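(* Let $p\ge2$ and assume that: (A) there is $K>0$ with $|g(t,x)|+|\sigma(t,x)|\le K(1+|x|)$ for all $x\in\mathbb{R}$, $t\in[0,T]$; (B) there is $L>0$ with $|g(t,x)-g(t,y)|+|\sigma(t,x)-\sigma(t,y)|\le L|x-y|$ for all $x,y\in\mathbb{R}$, $t\in[0,T]$. If moreover $g(t,x),\sigma(t,x)$ are twice differentiable in $x$ with these derivatives bounded by some constant $M>0$, then there is a constant $C$ independent of $\alpha$ such that for all $\alpha\ge1$ $$\sup_{t\in[0,T]}W_p^p\big(\mathrm{law}(X^\alpha_t),\mathrm{law}(X_t)\big)\le\frac{C}{\alpha^{p/2}}.$$ If instead, in addition to (A) and (B), $|\sigma(t,x)-\sigma(s,y)|\le L(|t-s|+|x-y|)$ for all $x,y\in\mathbb{R}$, $t,s\in[0,T]$, then there is a constant $C$ independent of $\alpha$ such that for all $\alpha\ge1$ $$\sup_{t\in[0,T]}W_p^p\big(\mathrm{law}(\tilde Y^\alpha_t),\mathrm{law}(\tilde Y_t)\big)\le\frac{C}{\alpha^{p/2}}.$$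
   Context: Fix $T>0$, constants $\kappa,\gamma>0$, points $x_0,y_0\in\mathbb{R}$, functions $g,\sigma:[0,T]\times\mathbb{R}\to\mathbb{R}$, and a standard one-dimensional Brownian motion $(W_t)_{t\in[0,T]}$ on a complete probability space with its natural filtration. For $\alpha>0$, $(X^\alpha,Y^\alpha)$ denotes the solution on $[0,T]$ of the mean-field system $$dX^\alpha_t=Y^\alpha_t\,dt,\qquad \tfrac1\alpha dY^\alpha_t=\big[-\kappa Y^\alpha_t-g(t,X^\alpha_t)-\gamma(Y^\alpha_t-\mathbb{E}[Y^\alpha_t])\big]dt+\sigma(t,X^\alpha_t)\,dW_t,$$ with $X^\alpha_0=x_0$, $Y^\alpha_0=y_0$. The process $X$ denotes the solution on $[0,T]$ of $$(\kappa+\gamma)\,dX_t=-\Big[g(t,X_t)+\frac{\gamma}{\kappa}\mathbb{E}[g(t,X_t)]\Big]dt+\sigma(t,X_t)\,dW_t,\qquad X_0=x_0.$$ Put $\tilde Y^\alpha_t:=\frac{1}{\sqrt\alpha}Y^\alpha_{t/\alpha}$ and $\tilde W_t:=\sqrt\alpha\,W_{t/\alpha}$ (again a Brownian motion), and let $\tilde Y$ solve $d\tilde Y_t=-(\kappa+\gamma)\tilde Y_t\,dt+\sigma(0,x_0)\,d\tilde W_t$, $\tilde Y_0=0$. The $p$-Wasserstein distance is $$W_p(\mu,\nu)=\Big(\inf\{\mathbb{E}[|U-V|^p]:U\sim\mu,\ V\sim\nu\}\Big)^{1/p}.$$ *)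

theory Defs
  imports "HOL-Probability.Probability"
begin

subsection \<open>Brownian motion\<close>

definition natural_filtration :: "'a measure \<Rightarrow> (real \<Rightarrow> 'a \<Rightarrow> real) \<Rightarrow> real \<Rightarrow> 'a measure" where
  "natural_filtration M W t =
     sigma (space M) (\<Union>u\<in>{0..t}. {W u -` A \<inter> space M | A. A \<in> sets borel})"

text \<open>The usual completion: every \<^term>\<open>M\<close>-null set is added at time zero.\<close>

definition augmented_filtration :: "'a measure \<Rightarrow> (real \<Rightarrow> 'a \<Rightarrow> real) \<Rightarrow> real \<Rightarrow> 'a measure" where
  "augmented_filtration M W t =
     sigma (space M) (sets (natural_filtration M W t) \<union> null_sets M)"

definition brownian_motion :: "'a measure \<Rightarrow> real \<Rightarrow> (real \<Rightarrow> 'a \<Rightarrow> real) \<Rightarrow> bool" where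
  "brownian_motion M T W \<longleftrightarrow>
     (\<forall>t\<in>{0..T}. W t \<in> borel_measurable M) \<and>
     (AE \<omega> in M. W 0 \<omega> = 0) \<and>
     (AE \<omega> in M. continuous_on {0..T} (\<lambda>t. W t \<omega>)) \<and>
     (\<forall>s t. 0 \<le> s \<and> s < t \<and> t \<le> T \<longrightarrow>
        distributed M lborel (\<lambda>\<omega>. W t \<omega> - W s \<omega>) (normal_density 0 (sqrt (t - s))) \<and>
        prob_space.indep_set M (sets (natural_filtration M W s))
          (sets (vimage_algebra (space M) (\<lambda>\<omega>. W t \<omega> - W s \<omega>) borel)))"


subsection \<open>The Ito integral\<close>

definition adapted :: "(real \<Rightarrow> 'a measure) \<Rightarrow> real \<Rightarrow> (real \<Rightarrow> 'a \<Rightarrow> real) \<Rightarrow> bool" where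
  "adapted F T Z \<longleftrightarrow> (\<forall>t\<in>{0..T}. Z t \<in> borel_measurable (F t))"

definition progressive :: "(real \<Rightarrow> 'a measure) \<Rightarrow> real \<Rightarrow> (real \<Rightarrow> 'a \<Rightarrow> real) \<Rightarrow> bool" where
  "progressive F T Z \<longleftrightarrow>
     (\<forall>t\<in>{0..T}. (\<lambda>(s, \<omega>). Z s \<omega>) \<in> borel_measurable (restrict_space borel {0..t} \<Otimes>\<^sub>M F t))"

text \<open>
  A simple process is the sum over \<open>i < n\<close> of \<open>\<xi> i\<close> times the indicator of
  \<open>(\<tau> i, \<tau> (i + 1)]\<close>, with deterministic times and bounded
  \<open>F (\<tau> i)\<close>-measurable coefficients.
\<close>

definition simple_data ::
  "'a measure \<Rightarrow> (real \<Rightarrow> 'a measure) \<Rightarrow> real \<Rightarrow> nat \<Rightarrow> (nat \<Rightarrow> real) \<Rightarrow> (nat \<Rightarrow> 'a \<Rightarrow> real) \<Rightarrow> bool" where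
  "simple_data M F T n \<tau> \<xi> \<longleftrightarrow>
     mono_on {..n} \<tau> \<and> \<tau> ` {..n} \<subseteq> {0..T} \<and>
     (\<forall>i<n. \<xi> i \<in> borel_measurable (F (\<tau> i)) \<and> (\<exists>c. \<forall>\<omega>\<in>space M. \<bar>\<xi> i \<omega>\<bar> \<le> c))"

definition simple_process ::
  "nat \<Rightarrow> (nat \<Rightarrow> real) \<Rightarrow> (nat \<Rightarrow> 'a \<Rightarrow> real) \<Rightarrow> real \<Rightarrow> 'a \<Rightarrow> real" where
  "simple_process n \<tau> \<xi> s \<omega> = (\<Sum>i<n. \<xi> i \<omega> * indicator {\<tau> i<..\<tau> (Suc i)} s)"

definition simple_integral ::
  "(real \<Rightarrow> 'a \<Rightarrow> real) \<Rightarrow> nat \<Rightarrow> (nat \<Rightarrow> real) \<Rightarrow> (nat \<Rightarrow> 'a \<Rightarrow> real) \<Rightarrow> real \<Rightarrow> 'a \<Rightarrow> real" where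
  "simple_integral W n \<tau> \<xi> t \<omega> =
     (\<Sum>i<n. \<xi> i \<omega> * (W (min (\<tau> (Suc i)) t) \<omega> - W (min (\<tau> i) t) \<omega>))"

definition null_in_probability :: "'a measure \<Rightarrow> (nat \<Rightarrow> 'a \<Rightarrow> ennreal) \<Rightarrow> bool" where
  "null_in_probability M Z \<longleftrightarrow>
     (\<forall>k. Z k \<in> borel_measurable M) \<and>
     (\<forall>\<epsilon>>0. (\<lambda>k. measure M {\<omega> \<in> space M. ennreal \<epsilon> < Z k \<omega>}) \<longlonglongrightarrow> 0)"

text \<open>
  \<open>J\<close> is (a version of) the process \<open>t \<mapsto> \<integral>\<^sub>0\<^sup>t H dW\<close>, \<open>t \<in> [0,T]\<close>, for a progressively
  measurable \<open>H\<close> with almost surely square integrable paths: the limit, uniformly on \<open>[0,T]\<close>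
  in probability, of the integrals of simple processes converging to \<open>H\<close> in \<open>L\<^sup>2([0,T])\<close>
  in probability.  No moment condition is imposed on \<open>H\<close>, and \<open>J\<close> is determined up to
  indistinguishability.
\<close>

definition ito_integral ::
  "'a measure \<Rightarrow> (real \<Rightarrow> 'a measure) \<Rightarrow> real \<Rightarrow> (real \<Rightarrow> 'a \<Rightarrow> real) \<Rightarrow>
   (real \<Rightarrow> 'a \<Rightarrow> real) \<Rightarrow> (real \<Rightarrow> 'a \<Rightarrow> real) \<Rightarrow> bool" where
  "ito_integral M F T W H J \<longleftrightarrow>
     progressive F T H \<and>
     (AE \<omega> in M. (\<integral>\<^sup>+s\<in>{0..T}. ennreal ((H s \<omega>)\<^sup>2) \<partial>lborel) < \<infinity>) \<and>
     adapted F T J \<and>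
     (AE \<omega> in M. continuous_on {0..T} (\<lambda>t. J t \<omega>)) \<and>
     (\<exists>n \<tau> \<xi>.
        (\<forall>k. simple_data M F T (n k) (\<tau> k) (\<xi> k)) \<and>
        null_in_probability M (\<lambda>k \<omega>. \<integral>\<^sup>+s\<in>{0..T}.
          ennreal ((simple_process (n k) (\<tau> k) (\<xi> k) s \<omega> - H s \<omega>)\<^sup>2) \<partial>lborel) \<and>
        null_in_probability M (\<lambda>k \<omega>. SUP t\<in>{0..T}.
          ennreal \<bar>simple_integral W (n k) (\<tau> k) (\<xi> k) t \<omega> - J t \<omega>\<bar>))"

text \<open>\<open>dZ\<^sub>t = b\<^sub>t dt + H\<^sub>t dW\<^sub>t\<close> on \<open>[0,T]\<close> with \<open>Z\<^sub>0 = z\<close>, in integral form.\<close>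

definition ito_process ::
  "'a measure \<Rightarrow> (real \<Rightarrow> 'a measure) \<Rightarrow> real \<Rightarrow> (real \<Rightarrow> 'a \<Rightarrow> real) \<Rightarrow> real \<Rightarrow>
   (real \<Rightarrow> 'a \<Rightarrow> real) \<Rightarrow> (real \<Rightarrow> 'a \<Rightarrow> real) \<Rightarrow> (real \<Rightarrow> 'a \<Rightarrow> real) \<Rightarrow> bool" where
  "ito_process M F T W z b H Z \<longleftrightarrow>
     adapted F T Z \<and>
     (AE \<omega> in M. continuous_on {0..T} (\<lambda>t. Z t \<omega>)) \<and>
     progressive F T b \<and>
     (AE \<omega> in M. set_integrable lborel {0..T} (\<lambda>s. b s \<omega>)) \<and>
     (\<exists>J. ito_integral M F T W H J \<and>
        (AE \<omega> in M. \<forall>t\<in>{0..T}. Z t \<omega> = z + (LINT s:{0..t}|lborel. b s \<omega>) + J t \<omega>))"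


subsection \<open>The equations\<close>

text \<open>
  Only the moments that occur in the equations are required to exist; higher moments of a
  solution are not part of the notion of solution.
\<close>

definition mean_field_solution ::
  "'a measure \<Rightarrow> real \<Rightarrow> (real \<Rightarrow> 'a \<Rightarrow> real) \<Rightarrow> real \<Rightarrow> real \<Rightarrow>
   (real \<Rightarrow> real \<Rightarrow> real) \<Rightarrow> (real \<Rightarrow> real \<Rightarrow> real) \<Rightarrow> real \<Rightarrow> real \<Rightarrow> real \<Rightarrow>
   (real \<Rightarrow> 'a \<Rightarrow> real) \<Rightarrow> (real \<Rightarrow> 'a \<Rightarrow> real) \<Rightarrow> bool" where
  "mean_field_solution M T W \<kappa> \<gamma> g \<sigma> x0 y0 \<alpha> X Y \<longleftrightarrow>
     (\<forall>t\<in>{0..T}. integrable M (Y t)) \<and>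
     ito_process M (augmented_filtration M W) T W x0 Y (\<lambda>t \<omega>. 0) X \<and>
     ito_process M (augmented_filtration M W) T W (1 / \<alpha> * y0)
       (\<lambda>t \<omega>. - \<kappa> * Y t \<omega> - g t (X t \<omega>) - \<gamma> * (Y t \<omega> - (\<integral>\<omega>'. Y t \<omega>' \<partial>M)))
       (\<lambda>t \<omega>. \<sigma> t (X t \<omega>))
       (\<lambda>t \<omega>. 1 / \<alpha> * Y t \<omega>)"

definition limit_solution ::
  "'a measure \<Rightarrow> real \<Rightarrow> (real \<Rightarrow> 'a \<Rightarrow> real) \<Rightarrow> real \<Rightarrow> real \<Rightarrow>
   (real \<Rightarrow> real \<Rightarrow> real) \<Rightarrow> (real \<Rightarrow> real \<Rightarrow> real) \<Rightarrow> real \<Rightarrow> (real \<Rightarrow> 'a \<Rightarrow> real) \<Rightarrow> bool" where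
  "limit_solution M T W \<kappa> \<gamma> g \<sigma> x0 X \<longleftrightarrow>
     (\<forall>t\<in>{0..T}. integrable M (\<lambda>\<omega>. g t (X t \<omega>))) \<and>
     ito_process M (augmented_filtration M W) T W ((\<kappa> + \<gamma>) * x0)
       (\<lambda>t \<omega>. - (g t (X t \<omega>) + \<gamma> / \<kappa> * (\<integral>\<omega>'. g t (X t \<omega>') \<partial>M)))
       (\<lambda>t \<omega>. \<sigma> t (X t \<omega>))
       (\<lambda>t \<omega>. (\<kappa> + \<gamma>) * X t \<omega>)"

definition scaled_velocity :: "real \<Rightarrow> (real \<Rightarrow> 'a \<Rightarrow> real) \<Rightarrow> real \<Rightarrow> 'a \<Rightarrow> real" where
  "scaled_velocity \<alpha> Y t \<omega> = 1 / sqrt \<alpha> * Y (t / \<alpha>) \<omega>"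

definition scaled_noise :: "real \<Rightarrow> (real \<Rightarrow> 'a \<Rightarrow> real) \<Rightarrow> real \<Rightarrow> 'a \<Rightarrow> real" where
  "scaled_noise \<alpha> W t \<omega> = sqrt \<alpha> * W (t / \<alpha>) \<omega>"

text \<open>The driving noise \<open>V\<close> is instantiated with \<^term>\<open>scaled_noise \<alpha> W\<close>.\<close>

definition velocity_limit_solution ::
  "'a measure \<Rightarrow> real \<Rightarrow> (real \<Rightarrow> 'a \<Rightarrow> real) \<Rightarrow> real \<Rightarrow> real \<Rightarrow>
   (real \<Rightarrow> real \<Rightarrow> real) \<Rightarrow> real \<Rightarrow> (real \<Rightarrow> 'a \<Rightarrow> real) \<Rightarrow> bool" where
  "velocity_limit_solution M T V \<kappa> \<gamma> \<sigma> x0 Y \<longleftrightarrow>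
     ito_process M (augmented_filtration M V) T V 0
       (\<lambda>t \<omega>. - (\<kappa> + \<gamma>) * Y t \<omega>) (\<lambda>t \<omega>. \<sigma> 0 x0) Y"


subsection \<open>Hypotheses on the coefficients\<close>

definition linear_growth ::
  "real \<Rightarrow> (real \<Rightarrow> real \<Rightarrow> real) \<Rightarrow> (real \<Rightarrow> real \<Rightarrow> real) \<Rightarrow> bool" where
  "linear_growth T g \<sigma> \<longleftrightarrow>
     (\<exists>K>0. \<forall>t\<in>{0..T}. \<forall>x. \<bar>g t x\<bar> + \<bar>\<sigma> t x\<bar> \<le> K * (1 + \<bar>x\<bar>))"

definition lipschitz_in_space ::
  "real \<Rightarrow> real \<Rightarrow> (real \<Rightarrow> real \<Rightarrow> real) \<Rightarrow> (real \<Rightarrow> real \<Rightarrow> real) \<Rightarrow> bool" where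
  "lipschitz_in_space T L g \<sigma> \<longleftrightarrow>
     (\<forall>t\<in>{0..T}. \<forall>x y. \<bar>g t x - g t y\<bar> + \<bar>\<sigma> t x - \<sigma> t y\<bar> \<le> L * \<bar>x - y\<bar>)"

definition bounded_space_derivatives :: "real \<Rightarrow> real \<Rightarrow> (real \<Rightarrow> real \<Rightarrow> real) \<Rightarrow> bool" where
  "bounded_space_derivatives T B f \<longleftrightarrow>
     (\<forall>t\<in>{0..T}. \<forall>x.
        f t differentiable at x \<and> deriv (f t) differentiable at x \<and>
        \<bar>deriv (f t) x\<bar> \<le> B \<and> \<bar>deriv (deriv (f t)) x\<bar> \<le> B)"

definition lipschitz_in_time_space :: "real \<Rightarrow> real \<Rightarrow> (real \<Rightarrow> real \<Rightarrow> real) \<Rightarrow> bool" where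
  "lipschitz_in_time_space T L \<sigma> \<longleftrightarrow>
     (\<forall>t\<in>{0..T}. \<forall>s\<in>{0..T}. \<forall>x y. \<bar>\<sigma> t x - \<sigma> s y\<bar> \<le> L * (\<bar>t - s\<bar> + \<bar>x - y\<bar>))"


subsection \<open>Wasserstein distance\<close>

text \<open>Real powers with a positive exponent, extended by \<open>\<infinity>\<close> to \<open>\<infinity>\<close>.\<close>

definition ennreal_powr :: "ennreal \<Rightarrow> real \<Rightarrow> ennreal" where
  "ennreal_powr c a = (if c = \<infinity> then \<infinity> else ennreal (enn2real c powr a))"

text \<open>
  A pair \<open>(U, V)\<close> with given marginals enters only through its joint law, so the infimum may
  be taken over probability measures on the plane.  It is taken in \<^typ>\<open>ennreal\<close>, so that
  infinite transport cost is not collapsed to zero.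
\<close>

definition couplings :: "real measure \<Rightarrow> real measure \<Rightarrow> (real \<times> real) measure set" where
  "couplings \<mu> \<nu> =
     {\<pi>. prob_space \<pi> \<and> sets \<pi> = sets (borel \<Otimes>\<^sub>M borel) \<and>
         distr \<pi> borel fst = \<mu> \<and> distr \<pi> borel snd = \<nu>}"

definition wasserstein :: "real \<Rightarrow> real measure \<Rightarrow> real measure \<Rightarrow> ennreal" where
  "wasserstein p \<mu> \<nu> =
     ennreal_powr (INF \<pi>\<in>couplings \<mu> \<nu>. \<integral>\<^sup>+(u, v). ennreal (\<bar>u - v\<bar> powr p) \<partial>\<pi>) (1 / p)"

definition law :: "'a measure \<Rightarrow> ('a \<Rightarrow> real) \<Rightarrow> real measure" where
  "law M Z = distr M borel Z"

end

(* The limit of small mass is a statement about Z = Y / alpha: with lambda = kappa + gamma, the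
   process N = Z + lambda (X - x0) has drift -g + gamma E[Y] and noise sigma dW, and Z solves
   Z = N - alpha lambda \<integral> Z.  Variation of constants turns a bound A + B (t - s) on the L^p norm of
   N_t - N_s into the bound |Z_0| + A + B / (alpha lambda) on Z_t.  Bounding the square root of t - s
   in the Ito moment inequality by an affine function of t - s gives |Z_t| = O(alpha^(-1/2)).  Taking
   expectations in the equation expresses the integral of E[Y] through E[g(X)] up to O(1 / alpha), so
   X^alpha satisfies the limit equation up to an error O(alpha^(-1/2)), and Gronwall concludes.  For
   the velocities, the difference on the fast time scale again solves z = n - lambda \<integral> z, where n is
   small because sigma(r, X_r) is close to sigma(0, x0) for r <= T / alpha.

   Gronwall is run with weights exp(c t): if |X_s| <= Q exp(c s) then both the drift and the noise
   contribute at most a constant times Q exp(c t) / sqrt c, which is absorbed for large c.  The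
   moment inequality for Ito integrals comes from simple integrals, one Gaussian step at a time:
   |S + xi dW|^2 <= |S|^2 + C |xi|^2 dt in L^p by a two-point inequality for symmetric increments. *)

theory Submission
  imports Defs
begin

subsection \<open>Bounds in \<open>L\<^sup>p\<close>\<close>

text \<open>The notions of integral and solution carry few moments: an Ito integral is a limit in
  probability of simple integrals, and a solution has only the first moments that its equation
  mentions. The moment inequality must therefore survive a limit in probability, for approximations
  about which nothing uniform is known in L^p. Clipping their coefficients gives dominated
  convergence of the L^p norms, and the part cut off is small in probability because its quadratic
  variation is. Finiteness of moments then comes from localization at a level. Gronwall uses it only
  to start, so it may depend on \<alpha>. The rate has one source: relaxation at speed
  \<alpha>(\<kappa> + \<gamma>) remembers the forcing for a time of order 1/\<alpha>, over which the
  noise moves by \<alpha>^(-1/2) and the drift by 1/\<alpha>. The mean velocity obeys a relaxation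
  equation without noise, so it stays bounded while the velocity itself is only bounded by order
  \<alpha>^(1/2). All processes live on one probability space and share one noise, so each pair
  compared is a coupling and an L^p estimate of the difference bounds the Wasserstein
  distance.\<close>

lemma powr_above_tangent:
  fixes x m p :: real
  assumes "p \<ge> 1" "x \<ge> 0" "m > 0"
  shows "m powr p + p * m powr (p - 1) * (x - m) \<le> x powr p"
proof (cases "x = 0")
  case True
  have "m powr p = m powr (p - 1) * m"
    using assms by (simp add: powr_mult_base mult.commute)
  then have "m powr p + p * m powr (p - 1) * (x - m) = (1 - p) * m powr p"
    using True by (simp add: algebra_simps)
  also have "\<dots> \<le> 0" using assms by (simp add: mult_nonpos_nonneg)
  finally show ?thesis by (simp add: order_trans)
next
  case False
  then have x: "x > 0" using assms by simp
  \<comment> \<open>The tangent criterion is applied on the open half line, where the power is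
    differentiable; zero was settled apart.\<close>
  have d: "((\<lambda>x. x powr p) has_real_derivative p * m powr (p - 1)) (at m within {0<..})"
    using assms by (auto intro!: derivative_eq_intros)
  have "x powr p - m powr p \<ge> p * m powr (p - 1) * (x - m)"
    by (rule convex_on_imp_above_tangent[OF powr_convex[OF assms(1)] _ _ _ d])
       (use assms x in \<open>auto simp: interior_open\<close>)
  then show ?thesis by simp
qed

text \<open>Jensen with the weights \<open>a / (a + b)\<close> and \<open>b / (a + b)\<close> at the
  points \<open>x\<close> and \<open>y\<close> of the proof. With \<open>a\<close> and
  \<open>b\<close> the norms of two variables, integrating it gives Minkowski's inequality with
  constant one.\<close>

lemma powr_add_le_weighted:
  fixes u v a b p :: real
  assumes "p \<ge> 1" "u \<ge> 0" "v \<ge> 0" "a > 0" "b > 0"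
  shows "(u + v) powr p \<le> (a + b) powr (p - 1) * (a powr (1 - p) * u powr p + b powr (1 - p) * v powr p)"
proof (cases "u + v = 0")
  case False
  define m where "m = u + v"
  have m: "m > 0" using False assms by (simp add: m_def)
  define x where "x = (a + b) * u / a"
  define y where "y = (a + b) * v / b"
  define \<theta> where "\<theta> = a / (a + b)"
  have \<theta>: "1 - \<theta> = b / (a + b)" using assms by (simp add: \<theta>_def field_simps)
  have mean: "\<theta> * x + (1 - \<theta>) * y = m"
    unfolding \<theta> using assms by (simp add: \<theta>_def x_def y_def m_def)
  have \<theta>01: "0 \<le> \<theta>" "0 \<le> 1 - \<theta>" using assms by (auto simp: \<theta> \<theta>_def)
  have "m powr p + p * m powr (p - 1) * (x - m) \<le> x powr p"
       "m powr p + p * m powr (p - 1) * (y - m) \<le> y powr p"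
    using assms m by (auto intro!: powr_above_tangent simp: x_def y_def)
  then have "\<theta> * (m powr p + p * m powr (p - 1) * (x - m)) + (1 - \<theta>) * (m powr p + p * m powr (p - 1) * (y - m))
      \<le> \<theta> * x powr p + (1 - \<theta>) * y powr p"
    using \<theta>01 by (intro add_mono mult_left_mono)
  also have "\<theta> * (m powr p + p * m powr (p - 1) * (x - m)) + (1 - \<theta>) * (m powr p + p * m powr (p - 1) * (y - m))
      = m powr p + p * m powr (p - 1) * (\<theta> * x + (1 - \<theta>) * y - m)"
    by (simp add: algebra_simps)
  finally have 1: "m powr p \<le> \<theta> * x powr p + (1 - \<theta>) * y powr p"
    unfolding mean by simp
  have ab: "(a + b) powr p = (a + b) * (a + b) powr (p - 1)"
    "a powr (1 - p) = a / a powr p" "b powr (1 - p) = b / b powr p"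
    using assms powr_mult_base[of "a + b" "p - 1"] by (simp_all add: powr_diff)
  have "\<theta> * x powr p = (a + b) powr (p - 1) * (a powr (1 - p) * u powr p)"
    using assms by (simp add: \<theta>_def x_def powr_mult powr_divide ab)
  moreover have "(1 - \<theta>) * y powr p = (a + b) powr (p - 1) * (b powr (1 - p) * v powr p)"
    unfolding \<theta> using assms by (simp add: y_def powr_mult powr_divide ab)
  ultimately show ?thesis using 1 by (simp add: m_def algebra_simps)
qed (use assms in auto)

text \<open>The norm is bounded through a measurable majorant because \<open>U\<close> need not be
  measurable: time integrals of \<open>g r (X r \<omega>)\<close> occur for which measurability in
  \<omega> is not at hand. The number \<open>a\<close> is any upper bound, so bounds can be weakened
  freely.\<close>

definition Lp_bound :: "'a measure \<Rightarrow> real \<Rightarrow> ('a \<Rightarrow> real) \<Rightarrow> real \<Rightarrow> bool" where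
  "Lp_bound M p U a \<longleftrightarrow> 0 \<le> a \<and>
     (\<exists>G\<in>borel_measurable M. (\<forall>\<omega>. 0 \<le> G \<omega>) \<and> (AE \<omega> in M. \<bar>U \<omega>\<bar> \<le> G \<omega>) \<and>
        (\<integral>\<^sup>+\<omega>. ennreal (G \<omega> powr p) \<partial>M) \<le> ennreal (a powr p))"

lemma Lp_bound_nonneg: "Lp_bound M p U a \<Longrightarrow> 0 \<le> a"
  by (simp add: Lp_bound_def)

lemma Lp_boundI:
  assumes "U \<in> borel_measurable M" "0 \<le> a"
    and "(\<integral>\<^sup>+\<omega>. ennreal (\<bar>U \<omega>\<bar> powr p) \<partial>M) \<le> ennreal (a powr p)"
  shows "Lp_bound M p U a"
  unfolding Lp_bound_def using assms by (auto intro!: bexI[of _ "\<lambda>\<omega>. \<bar>U \<omega>\<bar>"])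

lemma Lp_boundD:
  assumes "Lp_bound M p U a" "0 \<le> p"
  shows "(\<integral>\<^sup>+\<omega>. ennreal (\<bar>U \<omega>\<bar> powr p) \<partial>M) \<le> ennreal (a powr p)"
proof -
  obtain G where G: "\<forall>\<omega>. 0 \<le> G \<omega>" "AE \<omega> in M. \<bar>U \<omega>\<bar> \<le> G \<omega>"
    "(\<integral>\<^sup>+\<omega>. ennreal (G \<omega> powr p) \<partial>M) \<le> ennreal (a powr p)"
    using assms unfolding Lp_bound_def by blast
  have "(\<integral>\<^sup>+\<omega>. ennreal (\<bar>U \<omega>\<bar> powr p) \<partial>M) \<le> (\<integral>\<^sup>+\<omega>. ennreal (G \<omega> powr p) \<partial>M)"
    using G(2) by (intro nn_integral_mono_AE) (auto intro!: ennreal_leI powr_mono2 assms(2))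
  also note G(3)
  finally show ?thesis .
qed

lemma Lp_bound_mono:
  assumes "Lp_bound M p V b" "AE \<omega> in M. \<bar>U \<omega>\<bar> \<le> \<bar>V \<omega>\<bar>" "b \<le> a" "0 \<le> p"
  shows "Lp_bound M p U a"
proof -
  obtain G where G: "G \<in> borel_measurable M" "\<forall>\<omega>. 0 \<le> G \<omega>" "AE \<omega> in M. \<bar>V \<omega>\<bar> \<le> G \<omega>"
    "(\<integral>\<^sup>+\<omega>. ennreal (G \<omega> powr p) \<partial>M) \<le> ennreal (b powr p)" "0 \<le> b"
    using assms unfolding Lp_bound_def by blast
  have "ennreal (b powr p) \<le> ennreal (a powr p)"
    using assms G by (intro ennreal_leI powr_mono2) auto
  then have "(\<integral>\<^sup>+\<omega>. ennreal (G \<omega> powr p) \<partial>M) \<le> ennreal (a powr p)" using G(4) by order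
  moreover have "AE \<omega> in M. \<bar>U \<omega>\<bar> \<le> G \<omega>" using assms(2) G(3) by eventually_elim linarith
  ultimately show ?thesis unfolding Lp_bound_def using G assms by (auto intro!: bexI[of _ G])
qed

lemma Lp_bound_weaken: "Lp_bound M p U b \<Longrightarrow> b \<le> a \<Longrightarrow> 0 \<le> p \<Longrightarrow> Lp_bound M p U a"
  by (rule Lp_bound_mono) auto

lemma (in prob_space) Lp_bound_const:
  assumes "AE \<omega> in M. \<bar>U \<omega>\<bar> \<le> a" "0 \<le> a"
  shows "Lp_bound M p U a"
  unfolding Lp_bound_def using assms
  by (auto intro!: bexI[of _ "\<lambda>_. a"] simp: emeasure_space_1)

lemma Lp_bound_cmult:
  assumes "Lp_bound M p U a" "0 \<le> p"
  shows "Lp_bound M p (\<lambda>\<omega>. c * U \<omega>) (\<bar>c\<bar> * a)"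
proof -
  obtain G where G: "G \<in> borel_measurable M" "\<forall>\<omega>. 0 \<le> G \<omega>" "AE \<omega> in M. \<bar>U \<omega>\<bar> \<le> G \<omega>"
    "(\<integral>\<^sup>+\<omega>. ennreal (G \<omega> powr p) \<partial>M) \<le> ennreal (a powr p)" "0 \<le> a"
    using assms unfolding Lp_bound_def by blast
  have "(\<integral>\<^sup>+\<omega>. ennreal ((\<bar>c\<bar> * G \<omega>) powr p) \<partial>M) = (\<integral>\<^sup>+\<omega>. ennreal (\<bar>c\<bar> powr p) * ennreal (G \<omega> powr p) \<partial>M)"
    using G by (intro nn_integral_cong) (simp add: powr_mult ennreal_mult)
  also have "\<dots> = ennreal (\<bar>c\<bar> powr p) * (\<integral>\<^sup>+\<omega>. ennreal (G \<omega> powr p) \<partial>M)"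
    using G by (intro nn_integral_cmult) measurable
  also have "\<dots> \<le> ennreal (\<bar>c\<bar> powr p) * ennreal (a powr p)"
    using G by (intro mult_left_mono) auto
  also have "\<dots> = ennreal ((\<bar>c\<bar> * a) powr p)"
    using G by (simp add: powr_mult ennreal_mult)
  finally have "(\<integral>\<^sup>+\<omega>. ennreal ((\<bar>c\<bar> * G \<omega>) powr p) \<partial>M) \<le> ennreal ((\<bar>c\<bar> * a) powr p)" .
  moreover have "AE \<omega> in M. \<bar>c * U \<omega>\<bar> \<le> \<bar>c\<bar> * G \<omega>"
    using G(3) by eventually_elim (auto simp: abs_mult intro!: mult_left_mono)
  ultimately show ?thesis unfolding Lp_bound_def using G by (auto intro!: bexI[of _ "\<lambda>\<omega>. \<bar>c\<bar> * G \<omega>"])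
qed

text \<open>The pointwise infimum of the majorants for \<open>a + 1 / real (Suc n)\<close> is again
  a majorant. This allows norms to be raised slightly so that they are strictly positive, as weights
  with the exponent \<open>1 - p\<close> require.\<close>

lemma Lp_bound_closed:
  assumes "\<And>\<epsilon>. \<epsilon> > 0 \<Longrightarrow> Lp_bound M p U (a + \<epsilon>)" "0 \<le> a" "0 < p"
  shows "Lp_bound M p U a"
proof -
  have "\<forall>n::nat. \<exists>G\<in>borel_measurable M. (\<forall>\<omega>. 0 \<le> G \<omega>) \<and> (AE \<omega> in M. \<bar>U \<omega>\<bar> \<le> G \<omega>) \<and>
        (\<integral>\<^sup>+\<omega>. ennreal (G \<omega> powr p) \<partial>M) \<le> ennreal ((a + 1 / real (Suc n)) powr p)"
  proof
    fix n :: nat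
    have "Lp_bound M p U (a + 1 / real (Suc n))" by (intro assms) simp
    then show "\<exists>G\<in>borel_measurable M. (\<forall>\<omega>. 0 \<le> G \<omega>) \<and> (AE \<omega> in M. \<bar>U \<omega>\<bar> \<le> G \<omega>) \<and>
        (\<integral>\<^sup>+\<omega>. ennreal (G \<omega> powr p) \<partial>M) \<le> ennreal ((a + 1 / real (Suc n)) powr p)"
      unfolding Lp_bound_def by blast
  qed
  then have "\<exists>G. \<forall>n::nat. G n \<in> borel_measurable M \<and> (\<forall>\<omega>. 0 \<le> G n \<omega>) \<and> (AE \<omega> in M. \<bar>U \<omega>\<bar> \<le> G n \<omega>) \<and>
        (\<integral>\<^sup>+\<omega>. ennreal (G n \<omega> powr p) \<partial>M) \<le> ennreal ((a + 1 / real (Suc n)) powr p)"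
    unfolding Bex_def by (rule choice)
  then obtain G where G: "\<And>n. G n \<in> borel_measurable M" "\<And>n \<omega>. 0 \<le> G n \<omega>"
    "\<And>n. AE \<omega> in M. \<bar>U \<omega>\<bar> \<le> G n \<omega>"
    "\<And>n. (\<integral>\<^sup>+\<omega>. ennreal (G n \<omega> powr p) \<partial>M) \<le> ennreal ((a + 1 / real (Suc n)) powr p)"
    by blast
  define H where "H \<omega> = (INF n. G n \<omega>)" for \<omega>
  have bb: "bdd_below (range (\<lambda>n. G n \<omega>))" for \<omega> using G(2) by (intro bdd_belowI[of _ 0]) auto
  have Hm: "H \<in> borel_measurable M" unfolding H_def
    by (rule borel_measurable_cINF) (use G(1) bb in auto)
  have H0: "0 \<le> H \<omega>" for \<omega> unfolding H_def using G(2) by (intro cINF_greatest) auto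
  have HU: "AE \<omega> in M. \<bar>U \<omega>\<bar> \<le> H \<omega>"
  proof -
    have "AE \<omega> in M. \<forall>n. \<bar>U \<omega>\<bar> \<le> G n \<omega>" using G(3) by (simp add: AE_all_countable)
    then show ?thesis by eventually_elim (auto simp: H_def intro!: cINF_greatest)
  qed
  have le: "(\<integral>\<^sup>+\<omega>. ennreal (H \<omega> powr p) \<partial>M) \<le> ennreal ((a + 1 / real (Suc n)) powr p)" for n
  proof -
    have "(\<integral>\<^sup>+\<omega>. ennreal (H \<omega> powr p) \<partial>M) \<le> (\<integral>\<^sup>+\<omega>. ennreal (G n \<omega> powr p) \<partial>M)"
      using H0 assms bb by (intro nn_integral_mono ennreal_leI powr_mono2) (auto simp: H_def intro!: cINF_lower)
    then show ?thesis using G(4)[of n] by order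
  qed
  have "(\<lambda>n. (a + 1 / real (Suc n)) powr p) \<longlonglongrightarrow> (a + 0) powr p"
    using assms(2,3) by (intro tendsto_powr2 tendsto_add tendsto_const LIMSEQ_Suc[OF lim_1_over_n]) auto
  then have "(\<lambda>n. ennreal ((a + 1 / real (Suc n)) powr p)) \<longlonglongrightarrow> ennreal ((a + 0) powr p)"
    by (intro tendsto_ennrealI)
  then have "(\<integral>\<^sup>+\<omega>. ennreal (H \<omega> powr p) \<partial>M) \<le> ennreal ((a + 0) powr p)"
    by (rule LIMSEQ_le_const) (use le in auto)
  then show ?thesis unfolding Lp_bound_def using Hm H0 HU assms by auto
qed

lemma Lp_bound_add:
  assumes "Lp_bound M p U a" "Lp_bound M p V b" "1 \<le> p"
  shows "Lp_bound M p (\<lambda>\<omega>. U \<omega> + V \<omega>) (a + b)"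
proof -
  \<comment> \<open>Strictly positive norms serve as the weights of Jensen's inequality; the general
    case adds \<open>\<epsilon> / 2\<close> to each.\<close>
  have pos: "Lp_bound M p (\<lambda>\<omega>. U \<omega> + V \<omega>) (a + b)"
    if ab: "Lp_bound M p U a" "Lp_bound M p V b" "a > 0" "b > 0" for a b
  proof -
    obtain G where G: "G \<in> borel_measurable M" "\<forall>\<omega>. 0 \<le> G \<omega>" "AE \<omega> in M. \<bar>U \<omega>\<bar> \<le> G \<omega>"
      "(\<integral>\<^sup>+\<omega>. ennreal (G \<omega> powr p) \<partial>M) \<le> ennreal (a powr p)"
      using ab unfolding Lp_bound_def by blast
    obtain H where H: "H \<in> borel_measurable M" "\<forall>\<omega>. 0 \<le> H \<omega>" "AE \<omega> in M. \<bar>V \<omega>\<bar> \<le> H \<omega>"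
      "(\<integral>\<^sup>+\<omega>. ennreal (H \<omega> powr p) \<partial>M) \<le> ennreal (b powr p)"
      using ab unfolding Lp_bound_def by blast
    have [measurable]: "G \<in> borel_measurable M" "H \<in> borel_measurable M" by fact+
    let ?c = "(a + b) powr (p - 1)"
    have "(\<integral>\<^sup>+\<omega>. ennreal ((G \<omega> + H \<omega>) powr p) \<partial>M) \<le>
       (\<integral>\<^sup>+\<omega>. ennreal (?c * a powr (1 - p)) * ennreal (G \<omega> powr p) + ennreal (?c * b powr (1 - p)) * ennreal (H \<omega> powr p) \<partial>M)"
    proof (rule nn_integral_mono)
      fix \<omega>
      have "(G \<omega> + H \<omega>) powr p \<le> ?c * (a powr (1 - p) * G \<omega> powr p + b powr (1 - p) * H \<omega> powr p)"
        using ab assms G H by (intro powr_add_le_weighted) auto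
      then show "ennreal ((G \<omega> + H \<omega>) powr p) \<le> ennreal (?c * a powr (1 - p)) * ennreal (G \<omega> powr p) + ennreal (?c * b powr (1 - p)) * ennreal (H \<omega> powr p)"
        by (simp flip: ennreal_mult ennreal_plus add: ennreal_leI algebra_simps)
    qed
    also have "\<dots> = ennreal (?c * a powr (1 - p)) * (\<integral>\<^sup>+\<omega>. ennreal (G \<omega> powr p) \<partial>M) + ennreal (?c * b powr (1 - p)) * (\<integral>\<^sup>+\<omega>. ennreal (H \<omega> powr p) \<partial>M)"
      by (subst nn_integral_add) (auto simp: nn_integral_cmult)
    also have "\<dots> \<le> ennreal (?c * a powr (1 - p)) * ennreal (a powr p) + ennreal (?c * b powr (1 - p)) * ennreal (b powr p)"
      using G(4) H(4) by (intro add_mono mult_left_mono) auto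
    also have "\<dots> = ennreal (?c * (a powr (1 - p) * a powr p + b powr (1 - p) * b powr p))"
      by (subst ennreal_mult[symmetric], simp, simp)+ (subst ennreal_plus[symmetric], auto simp: algebra_simps)
    also have "?c * (a powr (1 - p) * a powr p + b powr (1 - p) * b powr p) = (a + b) powr p"
    proof -
      have "a powr (1 - p) * a powr p = a" "b powr (1 - p) * b powr p = b"
        using ab by (auto simp flip: powr_add)
      then show ?thesis using ab powr_mult_base[of "a + b" "p - 1"] by (simp add: mult.commute)
    qed
    finally have "(\<integral>\<^sup>+\<omega>. ennreal ((G \<omega> + H \<omega>) powr p) \<partial>M) \<le> ennreal ((a + b) powr p)" .
    moreover have "AE \<omega> in M. \<bar>U \<omega> + V \<omega>\<bar> \<le> G \<omega> + H \<omega>"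
      using G(3) H(3) by eventually_elim linarith
    ultimately show ?thesis unfolding Lp_bound_def using ab G H
      by (auto intro!: bexI[of _ "\<lambda>\<omega>. G \<omega> + H \<omega>"])
  qed
  have nn: "0 \<le> a" "0 \<le> b" using assms Lp_bound_nonneg by auto
  show ?thesis
  proof (rule Lp_bound_closed)
    fix \<epsilon> :: real assume \<epsilon>: "\<epsilon> > 0"
    have "Lp_bound M p (\<lambda>\<omega>. U \<omega> + V \<omega>) ((a + \<epsilon>/2) + (b + \<epsilon>/2))"
      using \<epsilon> assms nn by (intro pos) (auto elim!: Lp_bound_weaken)
    then show "Lp_bound M p (\<lambda>\<omega>. U \<omega> + V \<omega>) (a + b + \<epsilon>)" by (simp add: add_ac)
  qed (use nn assms in auto)
qed

lemma Lp_bound_zero: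
  assumes "Lp_bound M p U 0"
  shows "AE \<omega> in M. U \<omega> = 0"
proof -
  obtain G where G: "G \<in> borel_measurable M" "\<forall>\<omega>. 0 \<le> G \<omega>" "AE \<omega> in M. \<bar>U \<omega>\<bar> \<le> G \<omega>"
    "(\<integral>\<^sup>+\<omega>. ennreal (G \<omega> powr p) \<partial>M) \<le> ennreal (0 powr p)"
    using assms unfolding Lp_bound_def by blast
  then have "(\<integral>\<^sup>+\<omega>. ennreal (G \<omega> powr p) \<partial>M) = 0" by simp
  then have "AE \<omega> in M. ennreal (G \<omega> powr p) = 0"
    using G(1) by (subst (asm) nn_integral_0_iff_AE) auto
  then show ?thesis using G(3)
    by eventually_elim (auto simp: ennreal_eq_0_iff)
qed

lemma (in prob_space) Lp_bound_integral:
  assumes "Lp_bound M p U a" "1 \<le> p" and [measurable]: "U \<in> borel_measurable M"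
  shows "integrable M U" "(\<integral>\<omega>. \<bar>U \<omega>\<bar> \<partial>M) \<le> a"
proof -
  have *: "(\<integral>\<^sup>+\<omega>. ennreal \<bar>U \<omega>\<bar> \<partial>M) \<le> ennreal a" if b: "Lp_bound M p U a" "a > 0" for a
  proof -
    \<comment> \<open>The tangent of the p-th power at \<open>a\<close>, that is Young's inequality
      scaled so that integration returns exactly \<open>a\<close>.\<close>
    have "p * a powr (p - 1) * \<bar>U \<omega>\<bar> \<le> \<bar>U \<omega>\<bar> powr p + (p - 1) * a powr p" for \<omega>
    proof -
      have "a powr p = a * a powr (p - 1)" using that powr_mult_base[of a "p - 1"] by simp
      then show ?thesis using powr_above_tangent[of p "\<bar>U \<omega>\<bar>" a] assms that by (simp add: algebra_simps)
    qed
    then have "(\<integral>\<^sup>+\<omega>. ennreal (p * a powr (p - 1)) * ennreal \<bar>U \<omega>\<bar> \<partial>M)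
       \<le> (\<integral>\<^sup>+\<omega>. ennreal (\<bar>U \<omega>\<bar> powr p) + ennreal ((p - 1) * a powr p) \<partial>M)"
      using assms that
      by (intro nn_integral_mono) (auto simp flip: ennreal_mult ennreal_plus intro!: ennreal_leI)
    also have "\<dots> = (\<integral>\<^sup>+\<omega>. ennreal (\<bar>U \<omega>\<bar> powr p) \<partial>M) + ennreal ((p - 1) * a powr p)"
      by (subst nn_integral_add) (auto simp: emeasure_space_1)
    also have "\<dots> \<le> ennreal (a powr p) + ennreal ((p - 1) * a powr p)"
      using Lp_boundD[OF b(1)] assms by (intro add_mono) auto
    also have "\<dots> = ennreal (p * a powr (p - 1)) * ennreal a"
      using assms that powr_mult_base[of a "p - 1"]
      by (simp flip: ennreal_mult ennreal_plus add: algebra_simps)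
    finally have "ennreal (p * a powr (p - 1)) * (\<integral>\<^sup>+\<omega>. ennreal \<bar>U \<omega>\<bar> \<partial>M) \<le> ennreal (p * a powr (p - 1)) * ennreal a"
      by (simp add: nn_integral_cmult)
    then show ?thesis using that assms by (subst (asm) ennreal_mult_le_mult_iff) auto
  qed
  have a: "0 \<le> a" using assms Lp_bound_nonneg by auto
  have le: "(\<integral>\<^sup>+\<omega>. ennreal \<bar>U \<omega>\<bar> \<partial>M) \<le> ennreal a"
  proof (rule ennreal_le_epsilon)
    fix e :: real assume "e > 0"
    then have "(\<integral>\<^sup>+\<omega>. ennreal \<bar>U \<omega>\<bar> \<partial>M) \<le> ennreal (a + e)"
      using a assms by (intro *) (auto elim!: Lp_bound_weaken)
    then show "(\<integral>\<^sup>+\<omega>. ennreal \<bar>U \<omega>\<bar> \<partial>M) \<le> ennreal a + ennreal e" using a \<open>e > 0\<close> by simp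
  qed
  show 1: "integrable M U"
    using le by (intro integrableI_bounded) (auto simp: less_top[symmetric] top_unique)
  have "ennreal (\<integral>\<omega>. \<bar>U \<omega>\<bar> \<partial>M) = (\<integral>\<^sup>+\<omega>. ennreal \<bar>U \<omega>\<bar> \<partial>M)"
    using 1 by (intro nn_integral_eq_integral[symmetric]) auto
  then show "(\<integral>\<omega>. \<bar>U \<omega>\<bar> \<partial>M) \<le> a" using le a by (metis ennreal_le_iff)
qed

lemma (in prob_space) Lp_bound_expectation:
  assumes "Lp_bound M p U a" "1 \<le> p" "U \<in> borel_measurable M"
  shows "\<bar>\<integral>\<omega>. U \<omega> \<partial>M\<bar> \<le> a"
  using Lp_bound_integral[OF assms] integral_abs_bound[of M U] by linarith

text \<open>Fatou's lemma. It removes a localization whose events eventually contain almost every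
  point, provided that the bound is the same for all of them.\<close>

lemma Lp_bound_truncated_limit:
  assumes [measurable]: "U \<in> borel_measurable M" "\<And>n::nat. B n \<in> sets M"
    and "\<And>n. Lp_bound M p (\<lambda>\<omega>. U \<omega> * indicator (B n) \<omega>) a"
    and "AE \<omega> in M. eventually (\<lambda>n. \<omega> \<in> B n) sequentially" and "0 \<le> p"
  shows "Lp_bound M p U a"
proof (rule Lp_boundI)
  have "(\<integral>\<^sup>+\<omega>. ennreal (\<bar>U \<omega>\<bar> powr p) \<partial>M) \<le> (\<integral>\<^sup>+\<omega>. liminf (\<lambda>n. ennreal (\<bar>U \<omega> * indicator (B n) \<omega>\<bar> powr p)) \<partial>M)"
  proof (rule nn_integral_mono_AE)
    show "AE \<omega> in M. ennreal (\<bar>U \<omega>\<bar> powr p) \<le> liminf (\<lambda>n. ennreal (\<bar>U \<omega> * indicator (B n) \<omega>\<bar> powr p))"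
      using assms(4)
    proof eventually_elim
      case (elim \<omega>)
      show ?case by (rule Liminf_bounded, rule eventually_mono[OF elim]) auto
    qed
  qed
  also have "\<dots> \<le> liminf (\<lambda>n. \<integral>\<^sup>+\<omega>. ennreal (\<bar>U \<omega> * indicator (B n) \<omega>\<bar> powr p) \<partial>M)"
    by (rule nn_integral_liminf) measurable
  also have "\<dots> \<le> ennreal (a powr p)"
    using Lp_boundD[OF assms(3) assms(5)]
    by (intro Liminf_le[THEN order_trans] order_trans[OF Liminf_mono[of _ "\<lambda>_. ennreal (a powr p)"]])
       (auto simp: Liminf_const)
  finally show "(\<integral>\<^sup>+\<omega>. ennreal (\<bar>U \<omega>\<bar> powr p) \<partial>M) \<le> ennreal (a powr p)" .
  show "0 \<le> a" by (rule Lp_bound_nonneg[OF assms(3)])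
qed fact

lemma (in prob_space) Lp_bound_indicator:
  assumes "E \<in> sets M" "0 \<le> R" "0 < p"
  shows "Lp_bound M p (\<lambda>\<omega>. R * indicator E \<omega>) (R * prob E powr (1 / p))"
proof -
  have "Lp_bound M p (indicator E) (prob E powr (1 / p))"
  proof (rule Lp_boundI)
    have "(\<integral>\<^sup>+\<omega>. ennreal (\<bar>indicat_real E \<omega>\<bar> powr p) \<partial>M) = (\<integral>\<^sup>+\<omega>. indicator E \<omega> \<partial>M)"
      by (intro nn_integral_cong) (auto simp: indicator_def)
    also have "\<dots> = ennreal (prob E)" using assms by (simp add: emeasure_eq_measure)
    also have "prob E = (prob E powr (1 / p)) powr p" using assms by (simp add: powr_powr)
    finally show "(\<integral>\<^sup>+\<omega>. ennreal (\<bar>indicat_real E \<omega>\<bar> powr p) \<partial>M) \<le> ennreal ((prob E powr (1 / p)) powr p)" by simp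
  qed (use assms in auto)
  from Lp_bound_cmult[OF this, of R] assms show ?thesis by simp
qed

text \<open>Fatou's lemma in the form that fits convergence in probability. On the exceptional event
  \<open>E\<close> nothing is known about \<open>U\<close>, so \<open>U\<close> is first cut at a
  height \<open>R\<close>, where the event costs at most \<open>R * prob E powr (1 / p)\<close>; the
  height is released at the end.\<close>

lemma (in prob_space) Lp_bound_limit_in_prob:
  assumes U[measurable]: "U \<in> borel_measurable M" and "0 \<le> a" and p: "1 \<le> p"
    and approx: "\<And>\<epsilon>. \<epsilon> > 0 \<Longrightarrow> \<exists>I E. Lp_bound M p I (a + \<epsilon>) \<and> E \<in> sets M \<and> prob E \<le> \<epsilon> \<and>
           (AE \<omega> in M. \<omega> \<notin> E \<longrightarrow> \<bar>U \<omega> - I \<omega>\<bar> \<le> \<epsilon>)"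
  shows "Lp_bound M p U a"
proof -
  have trunc: "Lp_bound M p (\<lambda>\<omega>. min \<bar>U \<omega>\<bar> R) a" if R: "R \<ge> 0" for R
  proof (rule Lp_bound_closed)
    fix \<epsilon> :: real assume \<epsilon>: "\<epsilon> > 0"
    \<comment> \<open>\<open>\<delta>\<close> is chosen after \<open>R\<close>. The excess over
      \<open>a\<close> consists of \<open>\<delta>\<close> from the bound of \<open>I\<close>,
      \<open>\<delta>\<close> from the distance, and the cost of the exceptional event.\<close>
    have "((\<lambda>\<delta>. \<delta> + (\<delta> + R * \<delta> powr (1 / p))) \<longlongrightarrow> 0 + (0 + R * 0 powr (1 / p))) (at_right 0)"
      using p by (intro tendsto_intros tendsto_powr2) (auto intro: eventually_at_right_less simp: eventually_at_right_less less_imp_le eventually_at_filter)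
    then have "eventually (\<lambda>\<delta>. \<delta> + (\<delta> + R * \<delta> powr (1 / p)) < \<epsilon>) (at_right 0)"
      using \<epsilon> by (intro order_tendstoD(2)) auto
    moreover have "eventually (\<lambda>\<delta>::real. \<delta> > 0) (at_right 0)" by (simp add: eventually_at_right_less)
    ultimately have "eventually (\<lambda>\<delta>. \<delta> + (\<delta> + R * \<delta> powr (1 / p)) < \<epsilon> \<and> \<delta> > 0) (at_right 0)"
      by eventually_elim auto
    then obtain \<delta> where \<delta>: "\<delta> > 0" "\<delta> + (\<delta> + R * \<delta> powr (1 / p)) < \<epsilon>"
      using eventually_happens'[OF trivial_limit_at_right_real] by blast
    obtain I E where IE: "Lp_bound M p I (a + \<delta>)" "E \<in> sets M" "prob E \<le> \<delta>"
        "AE \<omega> in M. \<omega> \<notin> E \<longrightarrow> \<bar>U \<omega> - I \<omega>\<bar> \<le> \<delta>"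
      using approx[OF \<delta>(1)] by blast
    have "Lp_bound M p (\<lambda>\<omega>. R * indicator E \<omega>) (R * prob E powr (1 / p))"
      using IE R p by (intro Lp_bound_indicator) auto
    moreover have "Lp_bound M p (\<lambda>_. \<delta>) \<delta>" using \<delta> by (intro Lp_bound_const) auto
    moreover have "Lp_bound M p (\<lambda>\<omega>. \<bar>I \<omega>\<bar>) (a + \<delta>)"
      by (rule Lp_bound_mono[OF IE(1)]) (use p in auto)
    ultimately have *: "Lp_bound M p (\<lambda>\<omega>. \<bar>I \<omega>\<bar> + (\<delta> + R * indicator E \<omega>)) (a + \<delta> + (\<delta> + R * prob E powr (1 / p)))"
      using p by (intro Lp_bound_add)
    show "Lp_bound M p (\<lambda>\<omega>. min \<bar>U \<omega>\<bar> R) (a + \<epsilon>)"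
    proof (rule Lp_bound_mono[OF *])
      have "R * prob E powr (1 / p) \<le> R * \<delta> powr (1 / p)"
        using IE R p by (intro mult_left_mono powr_mono2) auto
      then show "a + \<delta> + (\<delta> + R * prob E powr (1 / p)) \<le> a + \<epsilon>" using \<delta> by linarith
      show "AE \<omega> in M. \<bar>min \<bar>U \<omega>\<bar> R\<bar> \<le> \<bar>\<bar>I \<omega>\<bar> + (\<delta> + R * indicator E \<omega>)\<bar>"
        using IE(4) by eventually_elim (use R \<delta> in \<open>auto simp: indicator_def\<close>)
    qed (use p in auto)
  qed (use assms in auto)
  show ?thesis
  proof (rule Lp_bound_truncated_limit[where B = "\<lambda>n. {\<omega>\<in>space M. \<bar>U \<omega>\<bar> \<le> real n}"])
    fix n :: nat
    show "Lp_bound M p (\<lambda>\<omega>. U \<omega> * indicator {\<omega>\<in>space M. \<bar>U \<omega>\<bar> \<le> real n} \<omega>) a"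
      by (rule Lp_bound_mono[OF trunc[of "real n"]]) (use p in \<open>auto simp: indicator_def\<close>)
  next
    show "AE \<omega> in M. eventually (\<lambda>n. \<omega> \<in> {\<omega>\<in>space M. \<bar>U \<omega>\<bar> \<le> real n}) sequentially"
    proof (rule AE_I2)
      fix \<omega> assume w: "\<omega> \<in> space M"
      obtain n where "\<bar>U \<omega>\<bar> \<le> real n" using real_arch_simple by blast
      then show "eventually (\<lambda>n. \<omega> \<in> {\<omega>\<in>space M. \<bar>U \<omega>\<bar> \<le> real n}) sequentially"
        using w by (intro eventually_sequentiallyI[of n]) auto
    qed
  qed (use p in auto)
qed

subsection \<open>Time integrals, Gronwall and relaxation\<close>

lemma set_nn_integral_eq_set_integral:
  fixes f :: "'a \<Rightarrow> real"
  assumes "set_integrable M A f" "\<And>x. x \<in> A \<Longrightarrow> 0 \<le> f x"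
  shows "(\<integral>\<^sup>+x\<in>A. ennreal (f x) \<partial>M) = ennreal (LINT x:A|M. f x)"
proof -
  have "(\<integral>\<^sup>+x\<in>A. ennreal (f x) \<partial>M) = (\<integral>\<^sup>+x. ennreal (indicator A x *\<^sub>R f x) \<partial>M)"
    by (intro nn_integral_cong) (auto simp: indicator_def)
  also have "\<dots> = ennreal (LINT x:A|M. f x)"
    unfolding set_lebesgue_integral_def using assms unfolding set_integrable_def
    by (intro nn_integral_eq_integral) (auto simp: indicator_def)
  finally show ?thesis .
qed

lemma set_lebesgue_integral_nonneg:
  fixes f :: "'a \<Rightarrow> real"
  assumes "\<And>x. x \<in> A \<Longrightarrow> 0 \<le> f x"
  shows "0 \<le> (LINT x:A|M. f x)"
  unfolding set_lebesgue_integral_def using assms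
  by (intro integral_nonneg_AE) (auto simp: indicator_def)

lemma floor_grid_tendsto:
  fixes x :: real
  shows "(\<lambda>n. real_of_int \<lfloor>x * real (Suc n)\<rfloor> / real (Suc n)) \<longlonglongrightarrow> x"
proof (rule tendsto_sandwich)
  show "(\<lambda>n. x - 1 / real (Suc n)) \<longlonglongrightarrow> x"
    using tendsto_diff[OF tendsto_const[of "x"] LIMSEQ_Suc[OF lim_1_over_n]] by simp
  show "(\<lambda>n. x) \<longlonglongrightarrow> x" by simp
  show "\<forall>\<^sub>F n in sequentially. x - 1 / real (Suc n) \<le> real_of_int \<lfloor>x * real (Suc n)\<rfloor> / real (Suc n)"
  proof (rule always_eventually, rule allI)
    fix n
    have "(x * real (Suc n) - 1) / real (Suc n) \<le> real_of_int \<lfloor>x * real (Suc n)\<rfloor> / real (Suc n)"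
      by (intro divide_right_mono) linarith+
    then show "x - 1 / real (Suc n) \<le> real_of_int \<lfloor>x * real (Suc n)\<rfloor> / real (Suc n)"
      by (simp add: diff_divide_distrib del: of_nat_Suc)
  qed
  show "\<forall>\<^sub>F n in sequentially. real_of_int \<lfloor>x * real (Suc n)\<rfloor> / real (Suc n) \<le> x"
  proof (rule always_eventually, rule allI)
    fix n
    have "real_of_int \<lfloor>x * real (Suc n)\<rfloor> \<le> x * real (Suc n)" by linarith
    then show "real_of_int \<lfloor>x * real (Suc n)\<rfloor> / real (Suc n) \<le> x"
      by (simp add: field_simps)
  qed
qed

text \<open>Sampling at the grid point below \<open>r\<close> leaves countably many measurable
  pieces, and continuity recovers the process in the limit.\<close>

lemma borel_measurable_continuous_process:
  fixes Q :: "real \<Rightarrow> 'a \<Rightarrow> real"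
  assumes meas: "\<And>r. Q r \<in> borel_measurable M"
    and cont: "\<And>\<omega>. \<omega> \<in> space M \<Longrightarrow> continuous_on UNIV (\<lambda>r. Q r \<omega>)"
  shows "(\<lambda>(r, \<omega>). Q r \<omega>) \<in> borel_measurable (borel \<Otimes>\<^sub>M M)"
proof (rule borel_measurable_LIMSEQ_real)
  fix n :: nat
  define F where "F = (\<lambda>r::real. \<lfloor>r * real (Suc n)\<rfloor>)"
  have [measurable]: "F \<in> measurable borel (count_space UNIV)" unfolding F_def by measurable
  have "(\<lambda>x. Q (real_of_int i / real (Suc n)) (snd x)) \<in> borel_measurable (borel \<Otimes>\<^sub>M M)" for i
    using meas[of "real_of_int i / real (Suc n)"] by measurable
  then have "(\<lambda>x. Q (real_of_int (F (fst x)) / real (Suc n)) (snd x)) \<in> borel_measurable (borel \<Otimes>\<^sub>M M)"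
    by (rule measurable_compose_countable) measurable
  then show "(\<lambda>x. Q (real_of_int \<lfloor>fst x * real (Suc n)\<rfloor> / real (Suc n)) (snd x)) \<in> borel_measurable (borel \<Otimes>\<^sub>M M)"
    by (simp add: F_def)
next
  fix x :: "real \<times> 'a" assume "x \<in> space (borel \<Otimes>\<^sub>M M)"
  then have x: "snd x \<in> space M" by (auto simp: space_pair_measure)
  note floor_grid_tendsto[of "fst x"]
  moreover have "isCont (\<lambda>r. Q r (snd x)) (fst x)"
    using cont[OF x] by (simp add: continuous_on_eq_continuous_at)
  ultimately show "(\<lambda>n. Q (real_of_int \<lfloor>fst x * real (Suc n)\<rfloor> / real (Suc n)) (snd x)) \<longlonglongrightarrow> (case x of (r, \<omega>) \<Rightarrow> Q r \<omega>)"
    unfolding case_prod_beta by (intro isCont_tendsto_compose[where g = "\<lambda>r. Q r (snd x)"])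
qed

text \<open>Jensen for the probability density \<open>q / I\<close> and the function
  \<open>I * f / q\<close>, whose mean is \<open>m\<close>. It is obtained by integrating the
  tangent of the p-th power at \<open>m\<close>.\<close>

lemma powr_integral_le_weighted:
  fixes f q :: "real \<Rightarrow> real"
  assumes "p \<ge> 1" "s < t" and f: "continuous_on {s..t} f" "\<And>r. r \<in> {s..t} \<Longrightarrow> 0 \<le> f r"
    and q: "continuous_on {s..t} q" "\<And>r. r \<in> {s..t} \<Longrightarrow> 0 < q r"
    and I: "I = (LINT r:{s..t}|lborel. q r)" "I > 0"
  shows "(LINT r:{s..t}|lborel. f r) powr p
    \<le> (LINT r:{s..t}|lborel. I powr (p - 1) * q r powr (1 - p) * f r powr p)"
proof -
  define m where "m = (LINT r:{s..t}|lborel. f r)"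
  have m0: "m \<ge> 0" unfolding m_def using f(2) by (intro set_lebesgue_integral_nonneg) auto
  show ?thesis
  proof (cases "m = 0")
    case True
    then show ?thesis unfolding m_def using assms by (auto intro!: set_lebesgue_integral_nonneg)
  next
    case False
    then have m: "m > 0" using m0 by simp
    let ?g = "\<lambda>r. (m powr p - p * m powr p) * (1 / I) * q r + p * m powr (p - 1) * f r"
    let ?h = "\<lambda>r. I powr (p - 1) * q r powr (1 - p) * f r powr p"
    have q0: "\<forall>r\<in>{s..t}. q r \<noteq> 0" using q(2) by force
    have cont: "continuous_on {s..t} ?g" "continuous_on {s..t} ?h"
    proof -
      show "continuous_on {s..t} ?g" using I(2) by (intro continuous_intros f q) simp
      have "continuous_on {s..t} (\<lambda>r. I powr (p - 1) * q r powr (1 - p))"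
        using q(1) q0 I by (intro continuous_intros) auto
      moreover have "continuous_on {s..t} (\<lambda>r. f r powr p)"
        by (rule continuous_on_powr'[OF f(1) continuous_on_const]) (use f assms in auto)
      ultimately show "continuous_on {s..t} ?h" by (rule continuous_on_mult)
    qed
    have le: "?g r \<le> ?h r" if r: "r \<in> {s..t}" for r
    proof -
      define x where "x = I * f r / q r"
      have "m powr p + p * m powr (p - 1) * (x - m) \<le> x powr p"
      proof (rule powr_above_tangent[OF assms(1) _ m])
        show "0 \<le> x" unfolding x_def using I(2) f(2)[OF r] q(2)[OF r] by (intro divide_nonneg_pos mult_nonneg_nonneg) auto
      qed
      then have "q r / I * (m powr p + p * m powr (p - 1) * (x - m)) \<le> q r / I * x powr p"
        using I q(2)[OF r] by (intro mult_left_mono) auto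
      also have "q r / I * x powr p = ?h r"
        using I q(2)[OF r] f(2)[OF r] by (simp add: x_def powr_divide powr_mult powr_diff)
      also have "m powr p = m * m powr (p - 1)" using powr_mult_base[of m "p - 1"] m by simp
      then have "q r / I * (m powr p + p * m powr (p - 1) * (x - m)) = ?g r"
        using I q(2)[OF r] by (simp add: x_def field_simps)
      finally show ?thesis .
    qed
    have "m powr p = (LINT r:{s..t}|lborel. ?g r)"
    proof -
      have "(LINT r:{s..t}|lborel. ?g r) = (m powr p - p * m powr p) * (1 / I) * I + p * m powr (p - 1) * m"
      proof (subst set_integral_add(2))
        show "set_integrable lborel {s..t} (\<lambda>r. (m powr p - p * m powr p) * (1 / I) * q r)"
             "set_integrable lborel {s..t} (\<lambda>r. p * m powr (p - 1) * f r)"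
          by (intro borel_integrable_atLeastAtMost' continuous_on_mult continuous_on_const f q)+
      qed (simp add: I(1)[symmetric] m_def)
      moreover have "m powr p = m * m powr (p - 1)" using powr_mult_base[of m "p - 1"] m by simp
      ultimately show ?thesis using I by (simp add: algebra_simps)
    qed
    also have "\<dots> \<le> (LINT r:{s..t}|lborel. ?h r)"
      using cont le by (intro set_integral_mono borel_integrable_atLeastAtMost') auto
    finally show ?thesis by (simp add: m_def)
  qed
qed

text \<open>Paths are continuous only almost surely and only on the interval. Setting the process to
  zero on a null set and clamping the time make it continuous everywhere, hence jointly measurable,
  as Fubini's theorem requires.\<close>

lemma continuous_modification:
  fixes Q :: "real \<Rightarrow> 'a \<Rightarrow> real"
  assumes st: "s \<le> t"
    and meas: "\<And>r. r \<in> {s..t} \<Longrightarrow> Q r \<in> borel_measurable M"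
    and cont: "AE \<omega> in M. continuous_on {s..t} (\<lambda>r. Q r \<omega>)"
  obtains Q' where "\<And>r. Q' r \<in> borel_measurable M"
    "\<And>\<omega>. \<omega> \<in> space M \<Longrightarrow> continuous_on UNIV (\<lambda>r. Q' r \<omega>)"
    "AE \<omega> in M. \<forall>r\<in>{s..t}. Q' r \<omega> = Q r \<omega>"
proof -
  obtain E where E: "{\<omega>\<in>space M. \<not> continuous_on {s..t} (\<lambda>r. Q r \<omega>)} \<subseteq> E" "E \<in> null_sets M"
    using cont by (auto simp: eventually_ae_filter)
  define Q' where "Q' r \<omega> = (if \<omega> \<in> E then 0 else Q (max s (min t r)) \<omega>)" for r \<omega>
  have clamp: "max s (min t r) \<in> {s..t}" for r using st by auto
  have Q'm: "Q' r \<in> borel_measurable M" for r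
    using meas[OF clamp[of r]] null_setsD2[OF E(2)] unfolding Q'_def
    by (auto intro!: measurable_If_set sets.Int_space_eq2[THEN subst])
  have Q'c: "continuous_on UNIV (\<lambda>r. Q' r \<omega>)" if "\<omega> \<in> space M" for \<omega>
  proof (cases "\<omega> \<in> E")
    case False
    then have c: "continuous_on {s..t} (\<lambda>r. Q r \<omega>)" using E that by auto
    have "continuous_on UNIV (\<lambda>r. Q (max s (min t r)) \<omega>)"
      by (rule continuous_on_compose2[OF c]) (use clamp in \<open>auto intro!: continuous_intros\<close>)
    then show ?thesis using False by (auto simp: Q'_def intro!: continuous_intros)
  qed (simp add: Q'_def)
  have "AE \<omega> in M. \<omega> \<notin> E" using E(2) by (rule AE_not_in)
  then have "AE \<omega> in M. \<forall>r\<in>{s..t}. Q' r \<omega> = Q r \<omega>" by eventually_elim (auto simp: Q'_def)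
  then show ?thesis using that Q'm Q'c by blast
qed

text \<open>Minkowski's integral inequality; the weight \<open>q\<close> of Jensen's inequality makes it sharp.\<close>

lemma (in prob_space) Lp_bound_time_integral:
  fixes Q :: "real \<Rightarrow> 'a \<Rightarrow> real"
  assumes st: "s \<le> t" and p: "p \<ge> 1"
    and meas: "\<And>r. r \<in> {s..t} \<Longrightarrow> Q r \<in> borel_measurable M"
    and cont: "AE \<omega> in M. continuous_on {s..t} (\<lambda>r. Q r \<omega>)"
    and bnd: "\<And>r. r \<in> {s..t} \<Longrightarrow> Lp_bound M p (Q r) (q r)"
    and q: "continuous_on {s..t} q"
  shows "Lp_bound M p (\<lambda>\<omega>. LINT r:{s..t}|lborel. \<bar>Q r \<omega>\<bar>) (LINT r:{s..t}|lborel. q r)"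
proof -
  obtain Q0 where Q0: "\<And>r. Q0 r \<in> borel_measurable M"
    "\<And>\<omega>. \<omega> \<in> space M \<Longrightarrow> continuous_on UNIV (\<lambda>r. Q0 r \<omega>)" "AE \<omega> in M. \<forall>r\<in>{s..t}. Q0 r \<omega> = Q r \<omega>"
    using continuous_modification[OF st meas cont] by blast
  define Q' where "Q' r \<omega> = \<bar>Q0 r \<omega>\<bar>" for r \<omega>
  have Q'm: "Q' r \<in> borel_measurable M" for r unfolding Q'_def using Q0(1) by measurable
  have Q'c: "continuous_on UNIV (\<lambda>r. Q' r \<omega>)" if "\<omega> \<in> space M" for \<omega>
    unfolding Q'_def using Q0(2)[OF that] by (intro continuous_intros)
  note joint = borel_measurable_continuous_process[OF Q'm Q'c, simplified]
  have Q'0: "0 \<le> Q' r \<omega>" for r \<omega> by (simp add: Q'_def)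
  have Q'b: "Lp_bound M p (Q' r) (q r)" if "r \<in> {s..t}" for r
    by (rule Lp_bound_mono[OF bnd[OF that]]) (use that p Q0(3) in \<open>auto simp: Q'_def elim!: eventually_mono\<close>)
  define G where "G \<omega> = (LINT r:{s..t}|lborel. Q' r \<omega>)" for \<omega>
  have joint2[measurable]: "(\<lambda>x. Q' (fst x) (snd x)) \<in> borel_measurable (lborel \<Otimes>\<^sub>M M)"
    using measurable_compose[OF _ joint, of "\<lambda>x. x" "lborel \<Otimes>\<^sub>M M"] by (simp add: case_prod_beta)
  have joint'[measurable]: "(\<lambda>x. Q' (snd x) (fst x)) \<in> borel_measurable (M \<Otimes>\<^sub>M lborel)"
    using measurable_compose[OF _ joint, of "\<lambda>x. (snd x, fst x)" "M \<Otimes>\<^sub>M lborel"] by simp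
  have "(\<lambda>(\<omega>, r). indicator {s..t} r *\<^sub>R Q' r \<omega>) \<in> borel_measurable (M \<Otimes>\<^sub>M lborel)"
    unfolding case_prod_beta by measurable
  then have Gm: "G \<in> borel_measurable M" unfolding G_def set_lebesgue_integral_def
    by (rule lborel.borel_measurable_lebesgue_integral)
  have G0: "0 \<le> G \<omega>" for \<omega> unfolding G_def by (intro set_lebesgue_integral_nonneg Q'0)
  have GQ: "AE \<omega> in M. \<bar>LINT r:{s..t}|lborel. \<bar>Q r \<omega>\<bar>\<bar> \<le> \<bar>G \<omega>\<bar>"
    using Q0(3)
  proof eventually_elim
    case (elim \<omega>)
    have "G \<omega> = (LINT r:{s..t}|lborel. \<bar>Q r \<omega>\<bar>)" unfolding G_def
      by (rule set_lebesgue_integral_cong) (use elim in \<open>auto simp: Q'_def\<close>)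
    then show ?case by simp
  qed
  \<comment> \<open>Pathwise Jensen with the weight \<open>q\<close>, then Tonelli. At time
    \<open>r\<close> the p-th moment is at most \<open>q r powr p\<close>, which turns the weight
    \<open>q r powr (1 - p)\<close> into \<open>q r\<close> and the total into
    \<open>I powr p\<close>.\<close>
  have pos: "Lp_bound M p G (LINT r:{s..t}|lborel. q r)"
    if st: "s < t" and bnd: "\<And>r. r \<in> {s..t} \<Longrightarrow> Lp_bound M p (Q' r) (q r)"
      and q: "continuous_on {s..t} q" and q0: "\<And>r. r \<in> {s..t} \<Longrightarrow> 0 < q r" for q
  proof -
    define I where "I = (LINT r:{s..t}|lborel. q r)"
    have qi: "set_integrable lborel {s..t} q" using q by (rule borel_integrable_atLeastAtMost')
    obtain r0 where r0: "r0 \<in> {s..t}" "\<And>r. r \<in> {s..t} \<Longrightarrow> q r0 \<le> q r"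
      using continuous_attains_inf[OF _ _ q] st by auto
    have "(LINT r:{s..t}|lborel. q r0) \<le> I" unfolding I_def
      using r0 qi by (intro set_integral_mono) (auto intro!: borel_integrable_atLeastAtMost' continuous_intros)
    moreover have "(LINT r:{s..t}|lborel. q r0) = (t - s) * q r0"
      using st by (subst set_integral_const) auto
    ultimately have I0: "I > 0" using st q0[OF r0(1)] mult_pos_pos[of "t - s" "q r0"] by linarith
    have qne: "\<forall>r\<in>{s..t}. q r \<noteq> 0" using q0 less_irrefl by metis
    let ?h = "\<lambda>r \<omega>. I powr (p - 1) * q r powr (1 - p) * Q' r \<omega> powr p"
    have wc: "continuous_on {s..t} (\<lambda>r. I powr (p - 1) * q r powr (1 - p))"
      using q qne by (intro continuous_intros) auto
    have wm[measurable]: "(\<lambda>r. indicator {s..t} r * (I powr (p - 1) * q r powr (1 - p))) \<in> borel_measurable lborel"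
      using borel_integrable_atLeastAtMost'[OF wc]
      unfolding set_integrable_def real_scaleR_def by (rule borel_measurable_integrable)
    have "(\<integral>\<^sup>+\<omega>. ennreal (G \<omega> powr p) \<partial>M) \<le> (\<integral>\<^sup>+\<omega>. (\<integral>\<^sup>+r. ennreal (indicator {s..t} r * (I powr (p - 1) * q r powr (1 - p)) * Q' r \<omega> powr p) \<partial>lborel) \<partial>M)"
    proof (rule nn_integral_mono)
      fix \<omega> assume w: "\<omega> \<in> space M"
      have c: "continuous_on {s..t} (\<lambda>r. Q' r \<omega>)" using Q'c[OF w] continuous_on_subset by blast
      have ch: "continuous_on {s..t} (\<lambda>r. ?h r \<omega>)"
      proof (rule continuous_on_mult[OF wc])
        show "continuous_on {s..t} (\<lambda>r. Q' r \<omega> powr p)"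
          by (rule continuous_on_powr'[OF c continuous_on_const]) (use Q'0 p in auto)
      qed
      have "G \<omega> powr p \<le> (LINT r:{s..t}|lborel. ?h r \<omega>)"
        unfolding G_def by (rule powr_integral_le_weighted[OF p st c Q'0 q q0 I_def I0])
      also have "ennreal \<dots> = (\<integral>\<^sup>+r\<in>{s..t}. ennreal (?h r \<omega>) \<partial>lborel)"
        using ch by (intro set_nn_integral_eq_set_integral[symmetric] borel_integrable_atLeastAtMost') auto
      also have "\<dots> = (\<integral>\<^sup>+r. ennreal (indicator {s..t} r * (I powr (p - 1) * q r powr (1 - p)) * Q' r \<omega> powr p) \<partial>lborel)"
        by (intro nn_integral_cong) (auto simp: indicator_def)
      finally show "ennreal (G \<omega> powr p) \<le> \<dots>" by (auto simp: ennreal_leI)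
    qed
    also have "\<dots> = (\<integral>\<^sup>+r. (\<integral>\<^sup>+\<omega>. ennreal (indicator {s..t} r * (I powr (p - 1) * q r powr (1 - p)) * Q' r \<omega> powr p) \<partial>M) \<partial>lborel)"
    proof -
      interpret pair_sigma_finite lborel M ..
      have "(\<lambda>x. indicator {s..t} (fst x) * (I powr (p - 1) * q (fst x) powr (1 - p))) \<in> borel_measurable (lborel \<Otimes>\<^sub>M M)"
        by (rule measurable_compose[OF measurable_fst wm])
      then have "(\<lambda>x. ennreal (indicator {s..t} (fst x) * (I powr (p - 1) * q (fst x) powr (1 - p)) * Q' (fst x) (snd x) powr p)) \<in> borel_measurable (lborel \<Otimes>\<^sub>M M)"
        by (rule measurable_compose[OF borel_measurable_times[OF _ powr_real_measurable[OF joint2 borel_measurable_const]] measurable_ennreal])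
      then have "case_prod (\<lambda>r \<omega>. ennreal (indicator {s..t} r * (I powr (p - 1) * q r powr (1 - p)) * Q' r \<omega> powr p)) \<in> borel_measurable (lborel \<Otimes>\<^sub>M M)"
        unfolding case_prod_beta .
      then show ?thesis by (rule Fubini')
    qed
    also have "\<dots> \<le> (\<integral>\<^sup>+r\<in>{s..t}. ennreal (I powr (p - 1) * q r) \<partial>lborel)"
    proof (rule nn_integral_mono)
      fix r :: real
      show "(\<integral>\<^sup>+\<omega>. ennreal (indicator {s..t} r * (I powr (p - 1) * q r powr (1 - p)) * Q' r \<omega> powr p) \<partial>M)
          \<le> ennreal (I powr (p - 1) * q r) * indicator {s..t} r"
      proof (cases "r \<in> {s..t}")
        case True
        have "(\<integral>\<^sup>+\<omega>. ennreal (indicator {s..t} r * (I powr (p - 1) * q r powr (1 - p)) * Q' r \<omega> powr p) \<partial>M)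
          = ennreal (I powr (p - 1) * q r powr (1 - p)) * (\<integral>\<^sup>+\<omega>. ennreal (\<bar>Q' r \<omega>\<bar> powr p) \<partial>M)"
          using True Q'0 Q'm[of r] by (subst nn_integral_cmult[symmetric]) (auto simp: ennreal_mult')
        also have "\<dots> \<le> ennreal (I powr (p - 1) * q r powr (1 - p)) * ennreal (q r powr p)"
          using Lp_boundD[OF bnd[OF True]] p by (intro mult_left_mono) auto
        also have "\<dots> = ennreal (I powr (p - 1) * q r)"
          using q0[OF True] by (auto simp flip: ennreal_mult' powr_add simp: mult.assoc)
        finally show ?thesis using True by simp
      qed simp
    qed
    also have "\<dots> = ennreal (LINT r:{s..t}|lborel. I powr (p - 1) * q r)"
      using q q0 by (intro set_nn_integral_eq_set_integral borel_integrable_atLeastAtMost') (auto intro!: continuous_intros simp: less_imp_le)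
    also have "(LINT r:{s..t}|lborel. I powr (p - 1) * q r) = I powr p"
      using powr_mult_base[of I "p - 1"] I0 by (simp add: I_def[symmetric] mult.commute)
    finally show ?thesis using Gm G0 I0 by (intro Lp_boundI) (auto simp: I_def)
  qed
  have "Lp_bound M p G (LINT r:{s..t}|lborel. q r)"
  proof (cases "s = t")
    case True
    have "(LINT r:{s..t}|lborel. f r) = 0" for f :: "real \<Rightarrow> real"
    proof -
      have "AE r in lborel. indicator {s..t} r *\<^sub>R f r = 0"
        using AE_lborel_singleton[of s] by eventually_elim (auto simp: True)
      then show ?thesis unfolding set_lebesgue_integral_def by (simp add: integral_eq_zero_AE)
    qed
    then have "(LINT r:{s..t}|lborel. q r) = 0" "G = (\<lambda>_. 0)" by (auto simp: G_def)
    then show ?thesis by (auto intro!: Lp_bound_const)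
  next
    case False
    then have lt: "s < t" using st by simp
    have q0: "0 \<le> q r" if "r \<in> {s..t}" for r using bnd[OF that] Lp_bound_nonneg by auto
    show ?thesis
    proof (rule Lp_bound_closed)
      fix \<epsilon> :: real assume \<epsilon>: "\<epsilon> > 0"
      \<comment> \<open>A constant summand makes the weight positive and raises its integral by
        exactly \<open>\<epsilon>\<close>.\<close>
      have "Lp_bound M p G (LINT r:{s..t}|lborel. q r + \<epsilon> / (t - s))"
        using lt \<epsilon> q0 p
        by (intro pos) (auto intro!: continuous_intros q add_nonneg_pos intro: Lp_bound_weaken[OF Q'b])
      also have "(LINT r:{s..t}|lborel. q r + \<epsilon> / (t - s)) = (LINT r:{s..t}|lborel. q r) + \<epsilon>"
        using lt by (subst set_integral_add(2)) (auto intro!: borel_integrable_atLeastAtMost' q continuous_intros simp: set_integral_const)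
      finally show "Lp_bound M p G ((LINT r:{s..t}|lborel. q r) + \<epsilon>)" .
    qed (use p q0 in \<open>auto intro!: set_lebesgue_integral_nonneg\<close>)
  qed
  then show ?thesis by (rule Lp_bound_mono[OF _ GQ]) (use p in auto)
qed

text \<open>The assumed step is iterated from the crude bound \<open>N\<close>. As
  \<open>B / sqrt c\<close> is at most one half, it sends the constant
  \<open>2 * A + N / 2 ^ n\<close> to the next one of this form, and \<open>N\<close> vanishes in
  the limit. All bounds are at fixed times, so no supremum over time appears inside an
  expectation.\<close>

lemma (in prob_space) Lp_gronwall:
  fixes X :: "real \<Rightarrow> 'a \<Rightarrow> real"
  assumes A: "0 \<le> A" and B: "0 \<le> B" and T: "0 \<le> T" and p: "1 \<le> p"
    and bounded: "\<And>t. t \<in> {0..T} \<Longrightarrow> Lp_bound M p (X t) N"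
    and step: "\<And>Q c t. 0 \<le> Q \<Longrightarrow> 1 \<le> c \<Longrightarrow> (\<And>s. s \<in> {0..T} \<Longrightarrow> Lp_bound M p (X s) (Q * exp (c * s))) \<Longrightarrow>
       t \<in> {0..T} \<Longrightarrow> Lp_bound M p (X t) (A + B * Q * exp (c * t) / sqrt c)"
    and t: "t \<in> {0..T}"
  shows "Lp_bound M p (X t) (2 * A * exp (max 1 (4 * B\<^sup>2) * T))"
proof -
  \<comment> \<open>The least exponent with \<open>1 \<le> c\<close> and
    \<open>2 * B \<le> sqrt c\<close>.\<close>
  define c where "c = max 1 (4 * B\<^sup>2)"
  have c: "1 \<le> c" by (simp add: c_def)
  have Bc: "B / sqrt c \<le> 1 / 2"
  proof -
    have "sqrt (4 * B\<^sup>2) \<le> sqrt c" unfolding c_def by simp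
    then have "2 * B \<le> sqrt c" using B by (simp add: real_sqrt_mult)
    then show ?thesis using c by (simp add: field_simps)
  qed
  have N: "0 \<le> N" using bounded[OF t] Lp_bound_nonneg by auto
  have iter: "\<forall>t\<in>{0..T}. Lp_bound M p (X t) ((2 * A + N / 2 ^ n) * exp (c * t))" for n
  proof (induction n)
    case 0
    show ?case
    proof
      fix t assume t: "t \<in> {0..T}"
      have "N \<le> (2 * A + N) * 1" using A N by simp
      also have "\<dots> \<le> (2 * A + N) * exp (c * t)" using A N t c by (intro mult_left_mono) auto
      finally show "Lp_bound M p (X t) ((2 * A + N / 2 ^ 0) * exp (c * t))"
        using p by (intro Lp_bound_weaken[OF bounded[OF t]]) auto
    qed
  next
    case (Suc n)
    show ?case
    proof
      fix t assume t: "t \<in> {0..T}"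
      let ?Q = "2 * A + N / 2 ^ n"
      have Q: "0 \<le> ?Q" using A N by simp
      have "A + B * ?Q * exp (c * t) / sqrt c = A * 1 + (B / sqrt c) * (?Q * exp (c * t))" by simp
      also have "\<dots> \<le> A * exp (c * t) + (1 / 2) * (?Q * exp (c * t))"
        using Bc Q A c t by (intro add_mono mult_left_mono mult_right_mono) auto
      also have "\<dots> = (2 * A + N / 2 ^ Suc n) * exp (c * t)" by (simp add: field_simps)
      finally have le: "A + B * ?Q * exp (c * t) / sqrt c \<le> (2 * A + N / 2 ^ Suc n) * exp (c * t)" .
      have "Lp_bound M p (X t) (A + B * ?Q * exp (c * t) / sqrt c)"
        using Suc.IH by (intro step[OF Q c _ t]) auto
      then show "Lp_bound M p (X t) ((2 * A + N / 2 ^ Suc n) * exp (c * t))"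
        using le p by (elim Lp_bound_weaken) auto
    qed
  qed
  show ?thesis
  proof (rule Lp_bound_closed)
    fix \<epsilon> :: real assume \<epsilon>: "\<epsilon> > 0"
    have "(\<lambda>n. N * exp (c * T) * (1 / 2) ^ n) \<longlonglongrightarrow> N * exp (c * T) * 0"
      by (intro tendsto_intros) auto
    then have "eventually (\<lambda>n. N * exp (c * T) * (1 / 2) ^ n < \<epsilon>) sequentially"
      using \<epsilon> by (intro order_tendstoD(2)) auto
    then obtain n where n: "N * exp (c * T) * (1 / 2) ^ n < \<epsilon>" by (auto simp: eventually_sequentially)
    have "(2 * A + N / 2 ^ n) * exp (c * t) \<le> (2 * A + N / 2 ^ n) * exp (c * T)"
      using A N t c by (intro mult_left_mono) auto
    also have "\<dots> = 2 * A * exp (c * T) + N * exp (c * T) * (1 / 2) ^ n"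
      unfolding power_one_over by (simp add: field_simps)
    finally have "(2 * A + N / 2 ^ n) * exp (c * t) \<le> 2 * A * exp (c * T) + \<epsilon>" using n by linarith
    moreover have "Lp_bound M p (X t) ((2 * A + N / 2 ^ n) * exp (c * t))" using iter[of n] t by blast
    ultimately have "Lp_bound M p (X t) (2 * A * exp (c * T) + \<epsilon>)" using p by (rule_tac Lp_bound_weaken) simp_all
    then show "Lp_bound M p (X t) (2 * A * exp (max 1 (4 * B\<^sup>2) * T) + \<epsilon>)" by (simp only: c_def)
  qed (use A p in auto)
qed

text \<open>The forcing enters through its increments up to the final time, and only the integral of
  \<open>z\<close> is differentiated, so \<open>N\<close> may be as rough as a Brownian
  path.\<close>

lemma variation_of_constants:
  fixes z N :: "real \<Rightarrow> real"
  assumes t: "0 \<le> t" and \<mu>: "0 \<le> \<mu>"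
    and z: "continuous_on {0..t} z"
    and eq: "\<And>s. s \<in> {0..t} \<Longrightarrow> z s = N s - \<mu> * (LINT r:{0..s}|lborel. z r)"
  shows "z t = exp (- \<mu> * t) * N t + (LINT s:{0..t}|lborel. \<mu> * exp (- \<mu> * (t - s)) * (N t - N s))"
    and "continuous_on {0..t} N"
proof -
  define w where "w s = integral {0..s} z" for s
  have LI: "(LINT r:{0..s}|lborel. z r) = w s" if "s \<in> {0..t}" for s
    unfolding w_def using that z
    by (intro set_borel_integral_eq_integral borel_integrable_atLeastAtMost' continuous_on_subset[OF z]) auto
  have dw: "(w has_real_derivative z s) (at s within {0..t})" if "s \<in> {0..t}" for s
    unfolding w_def using integral_has_real_derivative[OF z that] .
  have cw: "continuous_on {0..t} w" using dw by (rule DERIV_continuous_on)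
  have N: "N s = z s + \<mu> * w s" if "s \<in> {0..t}" for s using eq[OF that] LI[OF that] by simp
  have "continuous_on {0..t} (\<lambda>s. z s + \<mu> * w s)" by (intro continuous_intros z cw)
  then show cN: "continuous_on {0..t} N" by (rule continuous_on_eq) (simp add: N)
  \<comment> \<open>The forcing is frozen at \<open>t\<close>, so that the derivative of
    \<open>F\<close> contains \<open>N t - N s\<close>.\<close>
  define F where "F s = exp (- \<mu> * (t - s)) * (N t - \<mu> * w s)" for s
  have "((\<lambda>s. \<mu> * exp (- \<mu> * (t - s)) * (N t - N s)) has_integral F t - F 0) {0..t}"
  proof (rule fundamental_theorem_of_calculus[OF t])
    fix s assume s: "s \<in> {0..t}"
    have "(F has_real_derivative \<mu> * exp (- \<mu> * (t - s)) * (N t - \<mu> * w s) + exp (- \<mu> * (t - s)) * (- (\<mu> * z s))) (at s within {0..t})"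
      unfolding F_def by (rule derivative_eq_intros dw[OF s] refl | simp)+
    moreover have "\<mu> * exp (- \<mu> * (t - s)) * (N t - \<mu> * w s) + exp (- \<mu> * (t - s)) * (- (\<mu> * z s)) = \<mu> * exp (- \<mu> * (t - s)) * (N t - N s)"
      using N[OF s] by (simp add: algebra_simps)
    ultimately show "(F has_vector_derivative \<mu> * exp (- \<mu> * (t - s)) * (N t - N s)) (at s within {0..t})"
      by (simp add: has_real_derivative_iff_has_vector_derivative)
  qed
  moreover have "w 0 = 0" by (simp add: w_def)
  ultimately have "integral {0..t} (\<lambda>s. \<mu> * exp (- \<mu> * (t - s)) * (N t - N s)) = z t - exp (- \<mu> * t) * N t"
    using N[of t] t by (simp add: F_def integral_unique)
  moreover have "(LINT s:{0..t}|lborel. \<mu> * exp (- \<mu> * (t - s)) * (N t - N s)) = integral {0..t} (\<lambda>s. \<mu> * exp (- \<mu> * (t - s)) * (N t - N s))"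
    by (intro set_borel_integral_eq_integral borel_integrable_atLeastAtMost' continuous_intros cN)
  ultimately show "z t = exp (- \<mu> * t) * N t + (LINT s:{0..t}|lborel. \<mu> * exp (- \<mu> * (t - s)) * (N t - N s))"
    by simp
qed

text \<open>The boundary term at zero is kept exactly, because it cancels the growing part of the
  bound for \<open>exp (- \<mu> * t) * N t\<close> in the relaxation estimate.\<close>

lemma exp_kernel_integral:
  fixes A B t \<mu> :: real
  assumes "0 \<le> t" "0 < \<mu>"
  shows "(LINT s:{0..t}|lborel. \<mu> * exp (- \<mu> * (t - s)) * (A + B * (t - s))) = (A + B / \<mu>) - exp (- \<mu> * t) * (A + B * t + B / \<mu>)"
proof -
  define F where "F s = exp (- \<mu> * (t - s)) * (A + B * (t - s) + B / \<mu>)" for s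
  have "((\<lambda>s. \<mu> * exp (- \<mu> * (t - s)) * (A + B * (t - s))) has_integral F t - F 0) {0..t}"
  proof (rule fundamental_theorem_of_calculus[OF assms(1)])
    fix s
    have "(F has_real_derivative \<mu> * exp (- \<mu> * (t - s)) * (A + B * (t - s) + B / \<mu>) + exp (- \<mu> * (t - s)) * (- B)) (at s within {0..t})"
      unfolding F_def by (rule derivative_eq_intros refl | simp)+
    moreover have "\<mu> * exp (- \<mu> * (t - s)) * (A + B * (t - s) + B / \<mu>) + exp (- \<mu> * (t - s)) * (- B) = \<mu> * exp (- \<mu> * (t - s)) * (A + B * (t - s))"
      using assms by (simp add: field_simps)
    ultimately show "(F has_vector_derivative \<mu> * exp (- \<mu> * (t - s)) * (A + B * (t - s))) (at s within {0..t})"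
      by (simp add: has_real_derivative_iff_has_vector_derivative)
  qed
  moreover have "(LINT s:{0..t}|lborel. \<mu> * exp (- \<mu> * (t - s)) * (A + B * (t - s))) = integral {0..t} (\<lambda>s. \<mu> * exp (- \<mu> * (t - s)) * (A + B * (t - s)))"
    by (intro set_borel_integral_eq_integral borel_integrable_atLeastAtMost' continuous_intros)
  ultimately show ?thesis by (simp add: F_def integral_unique)
qed

text \<open>The kernel \<open>\<mu> * exp (- \<mu> * (t - s))\<close> has mass at most one and mean
  lag at most \<open>1 / \<mu>\<close>, so an affine bound on the increments is in effect evaluated
  at that lag, and the result does not depend on \<open>t\<close>.\<close>

lemma (in prob_space) Lp_bound_relaxation:
  fixes Z N :: "real \<Rightarrow> 'a \<Rightarrow> real"
  assumes t: "0 \<le> t" and \<mu>: "0 < \<mu>" and p: "1 \<le> p"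
    and meas: "\<And>s. s \<in> {0..t} \<Longrightarrow> N s \<in> borel_measurable M"
    and cont: "AE \<omega> in M. continuous_on {0..t} (\<lambda>s. Z s \<omega>)"
    and eq: "AE \<omega> in M. \<forall>s\<in>{0..t}. Z s \<omega> = N s \<omega> - \<mu> * (LINT r:{0..s}|lborel. Z r \<omega>)"
    and B: "0 \<le> B"
    and incr: "\<And>s. s \<in> {0..t} \<Longrightarrow> Lp_bound M p (\<lambda>\<omega>. N t \<omega> - N s \<omega>) (A + B * (t - s))"
    and init: "Lp_bound M p (N 0) z0"
  shows "Lp_bound M p (Z t) (z0 + A + B / \<mu>)"
proof -
  have AB: "0 \<le> A" "0 \<le> A + B * t"
    using incr[of t] incr[of 0] t Lp_bound_nonneg by force+
  have "Lp_bound M p (\<lambda>\<omega>. LINT s:{0..t}|lborel. \<bar>\<mu> * exp (- \<mu> * (t - s)) * (N t \<omega> - N s \<omega>)\<bar>)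
     (LINT s:{0..t}|lborel. \<mu> * exp (- \<mu> * (t - s)) * (A + B * (t - s)))"
  proof (rule Lp_bound_time_integral[OF t p])
    fix s assume s: "s \<in> {0..t}"
    show "(\<lambda>\<omega>. \<mu> * exp (- \<mu> * (t - s)) * (N t \<omega> - N s \<omega>)) \<in> borel_measurable M"
      using meas[OF s] meas[of t] t by auto
    show "Lp_bound M p (\<lambda>\<omega>. \<mu> * exp (- \<mu> * (t - s)) * (N t \<omega> - N s \<omega>)) (\<mu> * exp (- \<mu> * (t - s)) * (A + B * (t - s)))"
      using Lp_bound_cmult[OF incr[OF s], of "\<mu> * exp (- \<mu> * (t - s))"] p \<mu> by simp
  next
    show "AE \<omega> in M. continuous_on {0..t} (\<lambda>s. \<mu> * exp (- \<mu> * (t - s)) * (N t \<omega> - N s \<omega>))"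
      using cont eq
    proof eventually_elim
      case (elim \<omega>)
      have "continuous_on {0..t} (\<lambda>s. N s \<omega>)"
        by (rule variation_of_constants(2)[where z = "\<lambda>s. Z s \<omega>" and \<mu> = \<mu>]) (use elim t \<mu> in auto)
      then show ?case by (intro continuous_intros)
    qed
  qed (intro continuous_intros)
  moreover have "Lp_bound M p (\<lambda>\<omega>. (N t \<omega> - N 0 \<omega>) + N 0 \<omega>) (A + B * (t - 0) + z0)"
    by (rule Lp_bound_add[OF incr init p]) (use t in auto)
  then have "Lp_bound M p (\<lambda>\<omega>. exp (- \<mu> * t) * N t \<omega>) (exp (- \<mu> * t) * (A + B * t + z0))"
    using Lp_bound_cmult[of M p "N t" _ "exp (- \<mu> * t)"] p by simp
  then have "Lp_bound M p (\<lambda>\<omega>. \<bar>exp (- \<mu> * t) * N t \<omega>\<bar>) (exp (- \<mu> * t) * (A + B * t + z0))"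
    by (rule Lp_bound_mono) (use p in auto)
  ultimately have *: "Lp_bound M p (\<lambda>\<omega>. \<bar>exp (- \<mu> * t) * N t \<omega>\<bar> + (LINT s:{0..t}|lborel. \<bar>\<mu> * exp (- \<mu> * (t - s)) * (N t \<omega> - N s \<omega>)\<bar>))
     (exp (- \<mu> * t) * (A + B * t + z0) + ((A + B / \<mu>) - exp (- \<mu> * t) * (A + B * t + B / \<mu>)))"
    unfolding exp_kernel_integral[OF t \<mu>] using p by (intro Lp_bound_add)
  have e1: "exp (- \<mu> * t) \<le> 1" using t \<mu> by simp
  have z0: "0 \<le> z0" using init Lp_bound_nonneg by auto
  show ?thesis
  proof (rule Lp_bound_mono[OF *])
    show "AE \<omega> in M. \<bar>Z t \<omega>\<bar> \<le> \<bar>\<bar>exp (- \<mu> * t) * N t \<omega>\<bar> + (LINT s:{0..t}|lborel. \<bar>\<mu> * exp (- \<mu> * (t - s)) * (N t \<omega> - N s \<omega>)\<bar>)\<bar>"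
      using cont eq
    proof eventually_elim
      case (elim \<omega>)
      note voc = variation_of_constants[of t \<mu> "\<lambda>s. Z s \<omega>" "\<lambda>s. N s \<omega>", OF t _ elim(1)]
      have "continuous_on {0..t} (\<lambda>s. \<mu> * exp (- \<mu> * (t - s)) * (N t \<omega> - N s \<omega>))"
        using voc(2) elim(2) \<mu> by (intro continuous_intros) auto
      then have "\<bar>LINT s:{0..t}|lborel. \<mu> * exp (- \<mu> * (t - s)) * (N t \<omega> - N s \<omega>)\<bar>
         \<le> (LINT s:{0..t}|lborel. \<bar>\<mu> * exp (- \<mu> * (t - s)) * (N t \<omega> - N s \<omega>)\<bar>)"
        using set_integral_norm_bound[OF borel_integrable_atLeastAtMost'] by fastforce
      moreover have "Z t \<omega> = exp (- \<mu> * t) * N t \<omega> + (LINT s:{0..t}|lborel. \<mu> * exp (- \<mu> * (t - s)) * (N t \<omega> - N s \<omega>))"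
        using elim \<mu> by (intro voc(1)) auto
      ultimately show ?case by linarith
    qed
    have "exp (- \<mu> * t) * z0 \<le> 1 * z0" using e1 z0 by (intro mult_right_mono)
    moreover have "0 \<le> exp (- \<mu> * t) * (B / \<mu>)" using B \<mu> by simp
    ultimately show "exp (- \<mu> * t) * (A + B * t + z0) + ((A + B / \<mu>) - exp (- \<mu> * t) * (A + B * t + B / \<mu>)) \<le> z0 + A + B / \<mu>"
      by (simp add: algebra_simps)
  qed (use p in auto)
qed

subsection \<open>One Gaussian step\<close>

text \<open>After scaling to \<open>a = 1\<close>, the summand 5 serves the increments with
  \<open>1 / 2 \<le> \<bar>b\<bar>\<close> and the other summand the smaller ones.\<close>

definition two_point_const :: "real \<Rightarrow> real" where
  "two_point_const p = 5 + p\<^sup>2 * exp (p / 2)"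

text \<open>From \<open>exp y * (1 - exp (- y))\<^sup>2 = exp y - 2 + exp (- y)\<close> and
  \<open>1 - exp (- y) \<le> y\<close> for nonnegative \<open>y\<close>; evenness covers the other
  sign.\<close>

lemma cosh_le_quadratic:
  fixes x :: real
  shows "exp x + exp (- x) \<le> 2 + x\<^sup>2 * exp \<bar>x\<bar>"
proof -
  have *: "exp y + exp (- y) \<le> 2 + y\<^sup>2 * exp y" if y: "y \<ge> 0" for y :: real
  proof -
    have "1 - exp (- y) \<le> y" using exp_ge_add_one_self[of "- y"] by linarith
    moreover have "0 \<le> 1 - exp (- y)" using y by simp
    ultimately have "(1 - exp (- y))\<^sup>2 \<le> y\<^sup>2" by (rule power_mono)
    then have "exp y * (1 - exp (- y))\<^sup>2 \<le> exp y * y\<^sup>2" by (intro mult_left_mono) auto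
    moreover have "exp y * (1 - exp (- y))\<^sup>2 = exp y - 2 + exp (- y)"
      by (simp add: power2_eq_square algebra_simps flip: exp_add)
    ultimately show ?thesis by (simp add: algebra_simps)
  qed
  show ?thesis using *[of x] *[of "- x"] by (cases "x \<ge> 0") auto
qed

text \<open>This replaces Taylor expansion of the \<open>p\<close>-th power along symmetric increments.\<close>

lemma two_point_inequality:
  fixes a b p :: real
  assumes p: "p \<ge> 2"
  shows "\<bar>a + b\<bar> powr p + \<bar>a - b\<bar> powr p \<le> 2 * (a\<^sup>2 + two_point_const p * b\<^sup>2) powr (p / 2)"
proof -
  define K where "K = two_point_const p"
  have K: "5 \<le> K" "p\<^sup>2 * exp (p / 2) \<le> K" by (auto simp: K_def two_point_const_def)
  have sq: "(x\<^sup>2) powr (p / 2) = \<bar>x\<bar> powr p" for x :: real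
    by (metis powr_half_sqrt_powr real_sqrt_abs zero_le_power2 powr_powr powr_numeral abs_ge_zero power2_abs
         mult.commute times_divide_eq_right nonzero_mult_div_cancel_left zero_neq_numeral)
  \<comment> \<open>By homogeneity the case \<open>a = 1\<close> suffices, apart from
    \<open>a = 0\<close>.\<close>
  have unit: "\<bar>1 + b\<bar> powr p + \<bar>1 - b\<bar> powr p \<le> 2 * (1 + K * b\<^sup>2) powr (p / 2)" for b :: real
  proof (cases "\<bar>b\<bar> \<ge> 1 / 2")
    case True
    have "x\<^sup>2 \<le> 1 + K * b\<^sup>2" if "\<bar>x\<bar> \<le> 1 + \<bar>b\<bar>" for x
    proof -
      have "\<bar>x\<bar>\<^sup>2 \<le> (1 + \<bar>b\<bar>)\<^sup>2" using that by (intro power_mono) auto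
      also have "\<dots> = 1 + 2 * \<bar>b\<bar> + b\<^sup>2" by (simp add: power2_eq_square algebra_simps)
      \<comment> \<open>Here the lower bound on \<open>\<bar>b\<bar>\<close> turns the cross term
        into four squares; with the square already present this makes 5.\<close>
      also have "2 * \<bar>b\<bar> \<le> 4 * (\<bar>b\<bar> * \<bar>b\<bar>)" using True mult_right_mono[of "1/2" "\<bar>b\<bar>" "\<bar>b\<bar>"] by simp
      also have "1 + 4 * (\<bar>b\<bar> * \<bar>b\<bar>) + b\<^sup>2 = 1 + 5 * b\<^sup>2" by (simp add: power2_eq_square)
      also have "\<dots> \<le> 1 + K * b\<^sup>2" using K(1) by (simp add: mult_right_mono)
      finally show ?thesis by simp
    qed
    then have "\<bar>x\<bar> powr p \<le> (1 + K * b\<^sup>2) powr (p / 2)" if "\<bar>x\<bar> \<le> 1 + \<bar>b\<bar>" for x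
      using that p by (auto simp: sq[symmetric] intro!: powr_mono2)
    from this[of "1 + b"] this[of "1 - b"] show ?thesis
      using abs_triangle_ineq[of 1 b] abs_triangle_ineq4[of 1 b] by simp
  next
    case False
    then have b: "\<bar>b\<bar> \<le> 1 / 2" by simp
    \<comment> \<open>Exponentials turn the sum of the two powers into a hyperbolic cosine, in which
      the linear terms cancel.\<close>
    have e: "\<bar>1 + x\<bar> powr p \<le> exp (p * x)" if "\<bar>x\<bar> \<le> 1 / 2" for x
    proof -
      have x: "0 < 1 + x" using that by (simp add: abs_le_iff)
      then have "ln (1 + x) \<le> x" using ln_add_one_self_le_self2[of x] by linarith
      then have "p * ln (1 + x) \<le> p * x" using p by (intro mult_left_mono) auto
      then show ?thesis using x by (simp add: powr_def)
    qed
    have "\<bar>1 + b\<bar> powr p + \<bar>1 - b\<bar> powr p \<le> exp (p * b) + exp (- (p * b))"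
      using e[of b] e[of "- b"] b by simp
    also have "\<dots> \<le> 2 + (p * b)\<^sup>2 * exp \<bar>p * b\<bar>" by (rule cosh_le_quadratic)
    also have "\<dots> \<le> 2 + (p * b)\<^sup>2 * exp (p / 2)"
    proof -
      have "\<bar>p * b\<bar> \<le> p / 2" using b p mult_left_mono[of "\<bar>b\<bar>" "1/2" p] by (simp add: abs_mult)
      then show ?thesis by (intro add_left_mono mult_left_mono) auto
    qed
    also have "\<dots> = 2 + p\<^sup>2 * exp (p / 2) * b\<^sup>2" by (simp add: power_mult_distrib)
    also have "\<dots> \<le> 2 + K * b\<^sup>2" using K(2) by (simp add: mult_right_mono)
    also have "\<dots> \<le> 2 * (1 + K * b\<^sup>2)" using K(1) by simp
    also have "\<dots> \<le> 2 * (1 + K * b\<^sup>2) powr (p / 2)"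
    proof -
      have "(1 + K * b\<^sup>2) powr 1 \<le> (1 + K * b\<^sup>2) powr (p / 2)"
        using p K by (intro powr_mono) auto
      then show ?thesis using K by (simp add: abs_of_nonneg)
    qed
    finally show ?thesis .
  qed
  show ?thesis
  proof (cases "a = 0")
    case True
    have "\<bar>b\<bar> powr p = (b\<^sup>2) powr (p / 2)" by (simp add: sq)
    also have "\<dots> \<le> (K * b\<^sup>2) powr (p / 2)" using p K(1) mult_right_mono[of 1 K "b\<^sup>2"] by (intro powr_mono2) auto
    finally show ?thesis using True by (simp add: K_def)
  next
    case False
    have "\<bar>a + b\<bar> powr p + \<bar>a - b\<bar> powr p = \<bar>a\<bar> powr p * (\<bar>1 + b / a\<bar> powr p + \<bar>1 - b / a\<bar> powr p)"
    proof -
      have "a + b = a * (1 + b / a)" "a - b = a * (1 - b / a)" using False by (simp_all add: field_simps)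
      then have "\<bar>a + b\<bar> = \<bar>a\<bar> * \<bar>1 + b / a\<bar>" "\<bar>a - b\<bar> = \<bar>a\<bar> * \<bar>1 - b / a\<bar>" by (metis abs_mult)+
      then show ?thesis by (simp add: powr_mult distrib_left)
    qed
    also have "\<dots> \<le> \<bar>a\<bar> powr p * (2 * (1 + K * (b / a)\<^sup>2) powr (p / 2))"
      by (intro mult_left_mono unit) auto
    also have "\<bar>a\<bar> powr p = (a\<^sup>2) powr (p / 2)" by (simp add: sq)
    also have "(a\<^sup>2) powr (p / 2) * (2 * (1 + K * (b / a)\<^sup>2) powr (p / 2)) = 2 * (a\<^sup>2 + K * b\<^sup>2) powr (p / 2)"
    proof -
      have "a\<^sup>2 * (1 + K * (b / a)\<^sup>2) = a\<^sup>2 + K * b\<^sup>2" using False by (simp add: field_simps)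
      then show ?thesis using powr_mult[of "a\<^sup>2" "1 + K * (b / a)\<^sup>2" "p / 2"] K(1) by simp
    qed
    finally show ?thesis by (simp add: K_def)
  qed
qed

section \<open>Moments of Gaussian increments\<close>

definition normal_moment :: "real \<Rightarrow> real" where
  "normal_moment p = enn2real (\<integral>\<^sup>+x. ennreal (\<bar>x\<bar> powr p) * ennreal (std_normal_density x) \<partial>lborel) powr (1 / p)"

lemma normal_moment_nonneg: "0 \<le> normal_moment p"
  by (simp add: normal_moment_def)

text \<open>A real power is at most one plus an integer power, whose Gaussian moments are
  integrable. Finiteness also keeps the value of \<open>enn2real\<close> in
  \<open>normal_moment\<close> from being the default zero.\<close>

lemma normal_moment_finite:
  assumes "p \<ge> 0"
  shows "(\<integral>\<^sup>+x. ennreal (\<bar>x\<bar> powr p) * ennreal (std_normal_density x) \<partial>lborel) < \<infinity>"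
proof -
  obtain k where k: "p \<le> real k" using real_arch_simple by blast
  have "\<bar>x\<bar> powr p \<le> 1 + \<bar>x\<bar> ^ k" for x :: real
  proof (cases "\<bar>x\<bar> \<le> 1")
    case True
    then have "\<bar>x\<bar> powr p \<le> 1 powr p" using assms by (intro powr_mono2) auto
    then show ?thesis by (simp add: add_increasing2)
  next
    case False
    then have "\<bar>x\<bar> powr p \<le> \<bar>x\<bar> powr real k" using k by (intro powr_mono) auto
    also have "\<dots> = \<bar>x\<bar> ^ k" using False by (simp add: powr_realpow)
    finally show ?thesis by simp
  qed
  then have "\<bar>x\<bar> powr p * std_normal_density x \<le> std_normal_density x * \<bar>x\<bar> ^ 0 + std_normal_density x * \<bar>x\<bar> ^ k" for x :: real
    using mult_right_mono[of "\<bar>x\<bar> powr p" "1 + \<bar>x\<bar> ^ k" "std_normal_density x"] by (simp add: algebra_simps)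
  then have "(\<integral>\<^sup>+x. ennreal (\<bar>x\<bar> powr p) * ennreal (std_normal_density x) \<partial>lborel)
     \<le> (\<integral>\<^sup>+x. ennreal (std_normal_density x * \<bar>x\<bar> ^ 0 + std_normal_density x * \<bar>x\<bar> ^ k) \<partial>lborel)"
    by (intro nn_integral_mono) (simp only: ennreal_mult[symmetric] powr_ge_zero normal_density_nonneg ennreal_leI)
  also have "\<dots> < \<infinity>"
    using integrable_std_normal_moment_abs[of 0] integrable_std_normal_moment_abs[of k]
    by (subst nn_integral_eq_integral) (auto intro!: Bochner_Integration.integrable_add add_nonneg_nonneg)
  finally show ?thesis .
qed

lemma (in prob_space) Lp_bound_normal:
  assumes D: "distributed M lborel Z (normal_density 0 \<sigma>)" and \<sigma>: "0 < \<sigma>" and p: "0 < p"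
  shows "Lp_bound M p Z (\<sigma> * normal_moment p)"
proof -
  have D': "distributed M lborel (\<lambda>x. (Z x - 0) / \<sigma>) (\<lambda>x. ennreal (std_normal_density x))"
    using normal_standard_normal_convert[OF \<sigma>, of Z 0] D by blast
  have Zm: "Z \<in> borel_measurable M" using D by (auto simp: distributed_def)
  have "(\<integral>\<^sup>+\<omega>. ennreal (\<bar>Z \<omega> / \<sigma>\<bar> powr p) \<partial>M) = (\<integral>\<^sup>+x. ennreal (std_normal_density x) * ennreal (\<bar>x\<bar> powr p) \<partial>lborel)"
    using distributed_nn_integral[OF D', of "\<lambda>x. ennreal (\<bar>x\<bar> powr p)"] by simp
  also have "\<dots> = ennreal (normal_moment p powr p)"
    using normal_moment_finite[of p] p by (simp add: normal_moment_def powr_powr mult.commute less_top)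
  finally have "Lp_bound M p (\<lambda>\<omega>. Z \<omega> / \<sigma>) (normal_moment p)"
    using Zm by (intro Lp_boundI) (auto simp: normal_moment_nonneg)
  from Lp_bound_cmult[OF this, of \<sigma>] show ?thesis using \<sigma> p by simp
qed

text \<open>The constant of the moment inequality for squared norms, in the role of the
  Burkholder-Davis-Gundy constant.\<close>

definition ito_const :: "real \<Rightarrow> real" where
  "ito_const p = two_point_const p * (normal_moment p)\<^sup>2"

lemma ito_const_nonneg: "0 \<le> ito_const p"
  by (simp add: ito_const_def two_point_const_def)

lemma Lp_bound_square:
  assumes "Lp_bound M p U a" "U \<in> borel_measurable M" "p > 0"
  shows "Lp_bound M (p / 2) (\<lambda>\<omega>. (U \<omega>)\<^sup>2) (a\<^sup>2)"
proof (rule Lp_boundI)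
  have sq: "(x\<^sup>2) powr (p / 2) = \<bar>x\<bar> powr p" for x :: real
    by (cases "x = 0") (use powr_powr[of "\<bar>x\<bar>" 2 "p / 2"] in \<open>auto simp: powr_numeral\<close>)
  show "(\<integral>\<^sup>+\<omega>. ennreal (\<bar>(U \<omega>)\<^sup>2\<bar> powr (p / 2)) \<partial>M) \<le> ennreal ((a\<^sup>2) powr (p / 2))"
    using Lp_boundD[OF assms(1)] assms(3) Lp_bound_nonneg[OF assms(1)] by (simp add: sq)
qed (use assms in auto)

section \<open>Independent symmetric increments\<close>

context prob_space
begin

text \<open>\<open>indep_var\<close> forces both variables to have the same type, hence product laws are used instead.\<close>

lemma distr_pair_of_indep_set:
  assumes ind: "indep_set (sets \<G>) (sets (vimage_algebra (space M) Z borel))"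
    and \<G>: "subalgebra M \<G>"
    and Z[measurable]: "Z \<in> borel_measurable M"
    and X: "X \<in> measurable \<G> N"
  shows "distr M N X \<Otimes>\<^sub>M distr M (borel :: real measure) Z = distr M (N \<Otimes>\<^sub>M borel) (\<lambda>\<omega>. (X \<omega>, Z \<omega>))"
proof -
  have XM[measurable]: "X \<in> measurable M N" by (rule measurable_from_subalg[OF \<G> X])
  interpret A: prob_space "distr M N X" by (rule prob_space_distr) simp
  interpret B: prob_space "distr M borel Z" by (rule prob_space_distr) simp
  show ?thesis
  proof (rule pair_measure_eqI[symmetric, THEN sym])
    show "sigma_finite_measure (distr M N X)" "sigma_finite_measure (distr M borel Z)" ..
    show "sets (distr M N X \<Otimes>\<^sub>M distr M borel Z) = sets (distr M (N \<Otimes>\<^sub>M borel) (\<lambda>\<omega>. (X \<omega>, Z \<omega>)))"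
      by (simp cong: sets_pair_measure_cong)
    fix A B assume "A \<in> sets (distr M N X)" "B \<in> sets (distr M borel Z)"
    then have A[measurable]: "A \<in> sets N" and B[measurable]: "B \<in> sets borel" by auto
    have "X -` A \<inter> space M \<in> sets \<G>" using measurable_sets[OF X A] \<G> by (simp add: subalgebra_def)
    moreover have "Z -` B \<inter> space M \<in> sets (vimage_algebra (space M) Z borel)"
      by (rule in_vimage_algebra) fact
    ultimately have "prob ((X -` A \<inter> space M) \<inter> (Z -` B \<inter> space M)) = prob (X -` A \<inter> space M) * prob (Z -` B \<inter> space M)"
      by (rule indep_setD[OF ind])
    moreover have "(\<lambda>\<omega>. (X \<omega>, Z \<omega>)) -` (A \<times> B) \<inter> space M = (X -` A \<inter> space M) \<inter> (Z -` B \<inter> space M)" by auto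
    ultimately show "emeasure (distr M N X) A * emeasure (distr M borel Z) B = emeasure (distr M (N \<Otimes>\<^sub>M borel) (\<lambda>\<omega>. (X \<omega>, Z \<omega>))) (A \<times> B)"
      by (simp add: emeasure_distr emeasure_eq_measure ennreal_mult)
  qed
qed

text \<open>The reflected increment has the same normal law and is independent of the same
  sigma-algebra, so both pairs have the same product law.\<close>

lemma nn_integral_indep_symmetric:
  fixes X :: "'a \<Rightarrow> 'b" and Z :: "'a \<Rightarrow> real"
  assumes ind: "indep_set (sets \<G>) (sets (vimage_algebra (space M) Z borel))"
    and \<G>: "subalgebra M \<G>" and X: "X \<in> measurable \<G> N"
    and Z: "distributed M lborel Z (normal_density 0 \<sigma>)" "0 < \<sigma>"
    and f: "f \<in> borel_measurable (N \<Otimes>\<^sub>M borel)"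
  shows "(\<integral>\<^sup>+\<omega>. f (X \<omega>, Z \<omega>) \<partial>M) = (\<integral>\<^sup>+\<omega>. f (X \<omega>, - Z \<omega>) \<partial>M)"
proof -
  have rv[measurable]: "X \<in> measurable M N" "Z \<in> borel_measurable M"
    using measurable_from_subalg[OF \<G> X] Z(1) by (auto simp: distributed_def)
  have "distributed M lborel (\<lambda>x. 0 + (-1) * Z x) (normal_density (0 + (-1) * 0) (\<bar>-1\<bar> * \<sigma>))"
    using Z by (intro normal_density_affine) auto
  then have Z': "distributed M lborel (\<lambda>x. - Z x) (normal_density 0 \<sigma>)" by simp
  have same: "distr M borel Z = distr M borel (\<lambda>\<omega>. - Z \<omega>)"
    using distributed_distr_eq_density[OF Z(1)] distributed_distr_eq_density[OF Z']
    by (simp cong: distr_cong)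
  have neg: "sets (vimage_algebra (space M) (\<lambda>\<omega>. - Z \<omega>) borel) \<subseteq> sets (vimage_algebra (space M) Z borel)"
  proof -
    have "(\<lambda>\<omega>. - Z \<omega>) \<in> borel_measurable (vimage_algebra (space M) Z borel)"
      using measurable_vimage_algebra1[of Z "space M" "borel :: real measure"] by measurable
    from measurable_sets[OF this]
    have "{(\<lambda>\<omega>. - Z \<omega>) -` A \<inter> space M | A. A \<in> sets borel} \<subseteq> sets (vimage_algebra (space M) Z borel)"
      by auto
    from sets.sigma_sets_subset[OF this] show ?thesis
      by (simp add: sets_vimage_algebra[of _ "\<lambda>\<omega>. - Z \<omega>"])
  qed
  have ind': "indep_set (sets \<G>) (sets (vimage_algebra (space M) (\<lambda>\<omega>. - Z \<omega>) borel))"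
    using ind unfolding indep_set_def by (rule indep_sets_mono_sets) (use neg in \<open>auto split: bool.split\<close>)
  have "distr M (N \<Otimes>\<^sub>M borel) (\<lambda>\<omega>. (X \<omega>, Z \<omega>)) = distr M (N \<Otimes>\<^sub>M borel) (\<lambda>\<omega>. (X \<omega>, - Z \<omega>))"
    using distr_pair_of_indep_set[OF ind \<G> rv(2) X] distr_pair_of_indep_set[OF ind' \<G> _ X] same by simp
  then have "nn_integral (distr M (N \<Otimes>\<^sub>M borel) (\<lambda>\<omega>. (X \<omega>, Z \<omega>))) f = nn_integral (distr M (N \<Otimes>\<^sub>M borel) (\<lambda>\<omega>. (X \<omega>, - Z \<omega>))) f"
    by simp
  then show ?thesis using f by (simp add: nn_integral_distr)
qed

text \<open>Independence makes the p-th moments multiply, without the loss of exponent in Hoelder's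
  inequality.\<close>

lemma Lp_bound_indep_mult:
  fixes \<xi> Z :: "'a \<Rightarrow> real"
  assumes ind: "indep_set (sets \<G>) (sets (vimage_algebra (space M) Z borel))"
    and \<G>: "subalgebra M \<G>" and \<xi>: "\<xi> \<in> borel_measurable \<G>" and Z[measurable]: "Z \<in> borel_measurable M"
    and p: "0 \<le> p" and b: "Lp_bound M p \<xi> a" "Lp_bound M p Z b"
  shows "Lp_bound M p (\<lambda>\<omega>. \<xi> \<omega> * Z \<omega>) (a * b)"
proof -
  have rv[measurable]: "\<xi> \<in> borel_measurable M" by (rule measurable_from_subalg[OF \<G> \<xi>])
  interpret Q: prob_space "distr M borel Z" by (rule prob_space_distr) simp
  have "(\<integral>\<^sup>+\<omega>. ennreal (\<bar>\<xi> \<omega> * Z \<omega>\<bar> powr p) \<partial>M) =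
     (\<integral>\<^sup>+x. ennreal (\<bar>fst x * snd x\<bar> powr p) \<partial>distr M (borel \<Otimes>\<^sub>M borel) (\<lambda>\<omega>. (\<xi> \<omega>, Z \<omega>)))"
    by (subst nn_integral_distr) auto
  also have "\<dots> = (\<integral>\<^sup>+x. ennreal (\<bar>fst x * snd x\<bar> powr p) \<partial>(distr M borel \<xi> \<Otimes>\<^sub>M distr M borel Z))"
    using distr_pair_of_indep_set[OF ind \<G> Z \<xi>] by simp
  also have "\<dots> = (\<integral>\<^sup>+x. \<integral>\<^sup>+y. ennreal (\<bar>x * y\<bar> powr p) \<partial>distr M borel Z \<partial>distr M borel \<xi>)"
    by (subst Q.nn_integral_fst[symmetric]) auto
  also have "\<dots> = (\<integral>\<^sup>+x. ennreal (\<bar>x\<bar> powr p) * (\<integral>\<^sup>+y. ennreal (\<bar>y\<bar> powr p) \<partial>distr M borel Z) \<partial>distr M borel \<xi>)"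
    by (simp add: abs_mult powr_mult ennreal_mult nn_integral_cmult)
  also have "\<dots> = (\<integral>\<^sup>+\<omega>. ennreal (\<bar>\<xi> \<omega>\<bar> powr p) \<partial>M) * (\<integral>\<^sup>+\<omega>. ennreal (\<bar>Z \<omega>\<bar> powr p) \<partial>M)"
    by (subst nn_integral_multc) (auto simp: nn_integral_distr)
  also have "\<dots> \<le> ennreal (a powr p) * ennreal (b powr p)"
    by (intro mult_mono Lp_boundD b p) auto
  also have "\<dots> = ennreal ((a * b) powr p)"
    using b[THEN Lp_bound_nonneg] by (simp add: powr_mult ennreal_mult)
  finally show ?thesis using b[THEN Lp_bound_nonneg] by (intro Lp_boundI) auto
qed

text \<open>Reflecting \<open>Z\<close> does not change the p-th moment, which is thus the mean over
  both signs, and the two-point inequality applies pointwise. Minkowski in L^(p/2), available as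
  \<open>2 \<le> p\<close>, then adds squared norms. That squares add, and not norms, is what gives
  a sum of many steps the size of a square root of time.\<close>

lemma Lp_bound_normal_increment:
  assumes ind: "indep_set (sets \<G>) (sets (vimage_algebra (space M) Z borel))"
    and \<G>: "subalgebra M \<G>"
    and Z: "distributed M lborel Z (normal_density 0 \<sigma>)" "0 < \<sigma>"
    and S[measurable]: "S \<in> borel_measurable \<G>" and \<xi>[measurable]: "\<xi> \<in> borel_measurable \<G>"
    and p: "2 \<le> p" and b: "Lp_bound M p S a" "Lp_bound M p \<xi> b"
  shows "Lp_bound M p (\<lambda>\<omega>. S \<omega> + \<xi> \<omega> * Z \<omega>) (sqrt (a\<^sup>2 + ito_const p * (b\<^sup>2 * \<sigma>\<^sup>2)))"
proof -
  have Zm[measurable]: "Z \<in> borel_measurable M" using Z(1) by (auto simp: distributed_def)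
  have "(\<lambda>\<omega>. (S \<omega>, \<xi> \<omega>)) \<in> measurable \<G> (borel \<Otimes>\<^sub>M borel)" by measurable
  note sym = nn_integral_indep_symmetric[OF ind \<G> this Z]
  have Sm[measurable]: "S \<in> borel_measurable M" "\<xi> \<in> borel_measurable M"
    by (rule measurable_from_subalg[OF \<G>], fact)+
  let ?K = "two_point_const p"
  have K: "0 \<le> ?K" by (simp add: two_point_const_def)
  have "Lp_bound M p (\<lambda>\<omega>. \<xi> \<omega> * Z \<omega>) (b * (\<sigma> * normal_moment p))"
    using p by (intro Lp_bound_indep_mult[OF ind \<G> \<xi>] b Lp_bound_normal Z) auto
  then have "Lp_bound M (p / 2) (\<lambda>\<omega>. ?K * (\<xi> \<omega> * Z \<omega>)\<^sup>2) (\<bar>?K\<bar> * (b * (\<sigma> * normal_moment p))\<^sup>2)"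
    using p by (intro Lp_bound_cmult Lp_bound_square) auto
  moreover have "Lp_bound M (p / 2) (\<lambda>\<omega>. (S \<omega>)\<^sup>2) (a\<^sup>2)" using b p by (intro Lp_bound_square) auto
  ultimately have B: "Lp_bound M (p / 2) (\<lambda>\<omega>. (S \<omega>)\<^sup>2 + ?K * (\<xi> \<omega> * Z \<omega>)\<^sup>2) (a\<^sup>2 + \<bar>?K\<bar> * (b * (\<sigma> * normal_moment p))\<^sup>2)"
    using p by (intro Lp_bound_add) auto
  define R where "R = a\<^sup>2 + ito_const p * (b\<^sup>2 * \<sigma>\<^sup>2)"
  have R: "a\<^sup>2 + \<bar>?K\<bar> * (b * (\<sigma> * normal_moment p))\<^sup>2 = R"
    using K by (simp add: R_def ito_const_def power_mult_distrib)
  have R0: "0 \<le> R" using ito_const_nonneg[of p] by (simp add: R_def)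
  let ?I = "\<lambda>Z'. \<integral>\<^sup>+\<omega>. ennreal (\<bar>S \<omega> + \<xi> \<omega> * Z' \<omega>\<bar> powr p) \<partial>M"
  have "?I Z = ?I (\<lambda>\<omega>. - Z \<omega>)"
    using sym[of "\<lambda>x. ennreal (\<bar>fst (fst x) + snd (fst x) * snd x\<bar> powr p)"] by simp
  then have "2 * ?I Z = ?I Z + ?I (\<lambda>\<omega>. - Z \<omega>)" by (simp add: mult_2)
  also have "\<dots> = (\<integral>\<^sup>+\<omega>. ennreal (\<bar>S \<omega> + \<xi> \<omega> * Z \<omega>\<bar> powr p) + ennreal (\<bar>S \<omega> + \<xi> \<omega> * - Z \<omega>\<bar> powr p) \<partial>M)"
    by (rule nn_integral_add[symmetric]) measurable
  also have "\<dots> \<le> (\<integral>\<^sup>+\<omega>. 2 * ennreal (\<bar>(S \<omega>)\<^sup>2 + ?K * (\<xi> \<omega> * Z \<omega>)\<^sup>2\<bar> powr (p / 2)) \<partial>M)"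
  proof (rule nn_integral_mono)
    fix \<omega>
    have "\<bar>S \<omega> + \<xi> \<omega> * Z \<omega>\<bar> powr p + \<bar>S \<omega> + \<xi> \<omega> * - Z \<omega>\<bar> powr p \<le> 2 * (\<bar>(S \<omega>)\<^sup>2 + ?K * (\<xi> \<omega> * Z \<omega>)\<^sup>2\<bar> powr (p / 2))"
      using two_point_inequality[OF p, of "S \<omega>" "\<xi> \<omega> * Z \<omega>"] K by simp
    then show "ennreal (\<bar>S \<omega> + \<xi> \<omega> * Z \<omega>\<bar> powr p) + ennreal (\<bar>S \<omega> + \<xi> \<omega> * - Z \<omega>\<bar> powr p)
       \<le> 2 * ennreal (\<bar>(S \<omega>)\<^sup>2 + ?K * (\<xi> \<omega> * Z \<omega>)\<^sup>2\<bar> powr (p / 2))"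
      by (metis ennreal_leI ennreal_plus ennreal_mult ennreal_numeral powr_ge_zero zero_le_numeral)
  qed
  also have "\<dots> = 2 * (\<integral>\<^sup>+\<omega>. ennreal (\<bar>(S \<omega>)\<^sup>2 + ?K * (\<xi> \<omega> * Z \<omega>)\<^sup>2\<bar> powr (p / 2)) \<partial>M)"
    by (rule nn_integral_cmult) measurable
  also have "\<dots> \<le> 2 * ennreal (R powr (p / 2))"
    using Lp_boundD[OF B] p unfolding R by (intro mult_left_mono) auto
  finally have "?I Z \<le> ennreal (R powr (p / 2))"
    by (subst (asm) ennreal_mult_le_mult_iff) auto
  also have "R powr (p / 2) = sqrt R powr p" using R0 by (simp add: powr_half_sqrt[symmetric] powr_powr)
  finally show ?thesis using R0 unfolding R_def[symmetric] by (intro Lp_boundI) auto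
qed

end

subsection \<open>Simple integrals\<close>

text \<open>Written with increments of \<open>indicator {s..}\<close>, the process has the same
  shape as the integral, so that one refinement identity serves both.\<close>

lemma simple_process_eq_step:
  assumes "mono_on {..n} \<tau>"
  shows "simple_process n \<tau> \<xi> s \<omega> = (\<Sum>i<n. \<xi> i \<omega> * (indicator {s..} (\<tau> (Suc i)) - indicator {s..} (\<tau> i)))"
proof -
  have "indicator {\<tau> i<..\<tau> (Suc i)} s = (indicator {s..} (\<tau> (Suc i)) - indicator {s..} (\<tau> i) :: real)" if "i < n" for i
    using mono_onD[OF assms, of i "Suc i"] that by (auto simp: indicator_def)
  then show ?thesis unfolding simple_process_def by (intro sum.cong) auto
qed

text \<open>Each increment of \<open>f\<close> telescopes over the finer cells. The intervals are
  left-open, so the coefficient of a cell is read off at its right endpoint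
  \<open>d (Suc j)\<close>.\<close>

lemma sum_grid_refine:
  fixes f :: "real \<Rightarrow> real" and d :: "nat \<Rightarrow> real"
  assumes d: "\<And>j. j < m \<Longrightarrow> d j < d (Suc j)"
    and \<tau>: "mono_on {..n} \<tau>" "\<tau> ` {..n} \<subseteq> d ` {..m}"
  shows "(\<Sum>i<n. x i * (f (\<tau> (Suc i)) - f (\<tau> i))) =
    (\<Sum>j<m. (\<Sum>i<n. x i * indicator {\<tau> i<..\<tau> (Suc i)} (d (Suc j))) * (f (d (Suc j)) - f (d j)))"
proof -
  have lt: "d i < d j" if "i < j" "j \<le> m" for i j
    using that
  proof (induction j)
    case (Suc j)
    then show ?case using d[of j] by (cases "i = j") (auto simp: less_Suc_eq)
  qed simp
  then have less_iff: "d i < d j \<longleftrightarrow> i < j" if "i \<le> m" "j \<le> m" for i j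
  proof (cases "j < i")
    case True
    then show ?thesis using lt[OF True that(1)] by simp
  next
    case False
    then show ?thesis using lt[OF _ that(2)] by (cases "i = j") auto
  qed
  have single: "f (\<tau> (Suc i)) - f (\<tau> i) = (\<Sum>j<m. indicator {\<tau> i<..\<tau> (Suc i)} (d (Suc j)) * (f (d (Suc j)) - f (d j)))"
    if i: "i < n" for i
  proof -
    obtain a where a: "a \<le> m" "\<tau> i = d a" using \<tau>(2) i by (force simp: image_subset_iff)
    obtain b where b: "b \<le> m" "\<tau> (Suc i) = d b" using \<tau>(2) i by (force simp: image_subset_iff)
    have "\<tau> i \<le> \<tau> (Suc i)" using mono_onD[OF \<tau>(1), of i "Suc i"] i by simp
    then have ab: "a \<le> b" using less_iff[OF b(1) a(1)] a b by auto
    have "indicator {\<tau> i<..\<tau> (Suc i)} (d (Suc j)) = (indicator {a..<b} j :: real)" if "j < m" for j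
      using less_iff[OF a(1), of "Suc j"] less_iff[OF b(1), of "Suc j"] that a b
      by (auto simp: indicator_def not_less[symmetric])
    then have "(\<Sum>j<m. indicator {\<tau> i<..\<tau> (Suc i)} (d (Suc j)) * (f (d (Suc j)) - f (d j)))
       = (\<Sum>j<m. indicator {a..<b} j * (f (d (Suc j)) - f (d j)))"
      by (intro sum.cong) auto
    also have "\<dots> = (\<Sum>j=a..<b. f (d (Suc j)) - f (d j))"
      using b(1) by (intro sum.mono_neutral_cong_right) (auto simp: indicator_def)
    also have "\<dots> = f (d b) - f (d a)"
      using sum_Suc_diff'[OF ab, of "\<lambda>j. f (d j)"] by simp
    finally show ?thesis using a b by simp
  qed
  have "(\<Sum>i<n. x i * (f (\<tau> (Suc i)) - f (\<tau> i))) =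
     (\<Sum>i<n. \<Sum>j<m. x i * (indicator {\<tau> i<..\<tau> (Suc i)} (d (Suc j)) * (f (d (Suc j)) - f (d j))))"
    by (rule sum.cong[OF refl]) (simp only: single lessThan_iff sum_distrib_left)
  also have "\<dots> = (\<Sum>j<m. \<Sum>i<n. x i * (indicator {\<tau> i<..\<tau> (Suc i)} (d (Suc j)) * (f (d (Suc j)) - f (d j))))"
    by (rule sum.swap)
  finally show ?thesis by (simp only: sum_distrib_right mult.assoc)
qed

lemma finite_grid:
  fixes D :: "real set"
  assumes "finite D" "0 \<in> D" "T \<in> D" "D \<subseteq> {0..T}"
  obtains m d where "d ` {..m} = D" "\<And>j. j < m \<Longrightarrow> d j < d (Suc j)" "d 0 = 0" "d m = T"
proof -
  define xs where "xs = sorted_list_of_set D"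
  have set: "set xs = D" and ss: "sorted_wrt (<) xs" using assms by (auto simp: xs_def)
  have ne: "xs \<noteq> []" using set assms by auto
  define m where "m = length xs - 1"
  have len: "length xs = Suc m" using ne by (simp add: m_def)
  have img: "(!) xs ` {..m} = D"
    using set len by (auto simp: set_conv_nth image_iff less_Suc_eq_le)
  have nth: "xs ! i < xs ! j" if "i < j" "j \<le> m" for i j
    using ss that len by (auto simp: sorted_wrt_iff_nth_less)
  have "xs ! 0 = 0"
  proof -
    obtain j where j: "j \<le> m" "xs ! j = 0" using img assms(2) by (force simp: image_iff)
    have "xs ! 0 \<in> D" using img by auto
    then show ?thesis using nth[of 0 j] j assms(4) by (cases "j = 0") auto
  qed
  moreover have "xs ! m = T"
  proof -
    obtain j where j: "j \<le> m" "xs ! j = T" using img assms(3) by (force simp: image_iff)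
    have "xs ! m \<in> D" using img by auto
    then show ?thesis using nth[of j m] j assms(4) by (cases "j = m") auto
  qed
  ultimately show ?thesis using that[of "(!) xs" m] img nth by auto
qed

text \<open>Instantiated later with the augmented filtration of \<open>W\<close> and with that of
  the scaled noise.\<close>

locale bm_filtration = prob_space M for M :: "'a measure" +
  fixes F :: "real \<Rightarrow> 'a measure" and T :: real and W :: "real \<Rightarrow> 'a \<Rightarrow> real"
  assumes T: "0 < T"
    and F: "\<And>t. t \<in> {0..T} \<Longrightarrow> subalgebra M (F t)"
    and F_mono: "\<And>s t. 0 \<le> s \<Longrightarrow> s \<le> t \<Longrightarrow> t \<le> T \<Longrightarrow> sets (F s) \<subseteq> sets (F t)"
    and W_adapted: "\<And>t. t \<in> {0..T} \<Longrightarrow> W t \<in> borel_measurable (F t)"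
    and W_normal: "\<And>s t. 0 \<le> s \<Longrightarrow> s < t \<Longrightarrow> t \<le> T \<Longrightarrow>
       distributed M lborel (\<lambda>\<omega>. W t \<omega> - W s \<omega>) (normal_density 0 (sqrt (t - s)))"
    and W_indep: "\<And>s t. 0 \<le> s \<Longrightarrow> s < t \<Longrightarrow> t \<le> T \<Longrightarrow>
       indep_set (sets (F s)) (sets (vimage_algebra (space M) (\<lambda>\<omega>. W t \<omega> - W s \<omega>) borel))"
begin

lemma W_measurable: "t \<in> {0..T} \<Longrightarrow> W t \<in> borel_measurable M"
  using W_adapted F measurable_from_subalg by blast

lemma space_F: "t \<in> {0..T} \<Longrightarrow> space (F t) = space M"
  using F by (auto simp: subalgebra_def)

lemma F_measurable_mono:
  assumes "f \<in> measurable (F s) N" "0 \<le> s" "s \<le> t" "t \<le> T"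
  shows "f \<in> measurable (F t) N"
  by (rule measurable_from_subalg[OF _ assms(1)])
     (use F_mono[OF assms(2-4)] space_F[of s] space_F[of t] assms in \<open>auto simp: subalgebra_def\<close>)

lemma simple_dataD:
  assumes "simple_data M F T n \<tau> \<xi>"
  shows "i \<le> n \<Longrightarrow> \<tau> i \<in> {0..T}" "i \<le> j \<Longrightarrow> j \<le> n \<Longrightarrow> \<tau> i \<le> \<tau> j"
    "i < n \<Longrightarrow> \<xi> i \<in> borel_measurable (F (\<tau> i))" "i < n \<Longrightarrow> \<xi> i \<in> borel_measurable M"
    "mono_on {..n} \<tau>"
proof -
  note a = assms[unfolded simple_data_def]
  show 1: "i \<le> n \<Longrightarrow> \<tau> i \<in> {0..T}" using a by (simp add: image_subset_iff)
  show "i \<le> j \<Longrightarrow> j \<le> n \<Longrightarrow> \<tau> i \<le> \<tau> j" using a by (auto elim!: mono_onD)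
  show 2: "i < n \<Longrightarrow> \<xi> i \<in> borel_measurable (F (\<tau> i))" using a by simp
  show "i < n \<Longrightarrow> \<xi> i \<in> borel_measurable M"
    using measurable_from_subalg[OF F[OF 1] 2] by simp
  show "mono_on {..n} \<tau>" using a by simp
qed

text \<open>Clipping, localizing and subtracting simple processes are done cell by cell, which asks
  for a strictly increasing grid that contains all times involved.\<close>

lemma simple_data_refine:
  assumes sd: "simple_data M F T n \<tau> \<xi>"
    and d: "\<And>j. j < m \<Longrightarrow> d j < d (Suc j)" "\<tau> ` {..n} \<subseteq> d ` {..m}" "d ` {..m} \<subseteq> {0..T}"
  defines "\<eta> \<equiv> \<lambda>j \<omega>. simple_process n \<tau> \<xi> (d (Suc j)) \<omega>"
  shows "simple_data M F T m d \<eta>"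
    and "simple_process m d \<eta> s \<omega> = simple_process n \<tau> \<xi> s \<omega>"
    and "simple_integral W m d \<eta> t \<omega> = simple_integral W n \<tau> \<xi> t \<omega>"
proof -
  note \<tau> = simple_dataD[OF sd]
  have dmono: "mono_on {..m} d"
  proof (rule mono_onI)
    fix i j assume "i \<in> {..m}" "j \<in> {..m}" "i \<le> j"
    then have "j \<le> m" "i \<le> j" by auto
    then show "d i \<le> d j"
    proof (induction j)
      case (Suc j) then show ?case using d(1)[of j] by (cases "i = Suc j") auto
    qed simp
  qed
  have \<eta>: "\<eta> j \<omega> = (\<Sum>i<n. \<xi> i \<omega> * indicator {\<tau> i<..\<tau> (Suc i)} (d (Suc j)))" for j \<omega>
    by (simp add: \<eta>_def simple_process_def)
  show "simple_data M F T m d \<eta>"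
    unfolding simple_data_def
  proof (intro conjI allI impI)
    fix j assume j: "j < m"
    have dj: "d j \<in> {0..T}" "d (Suc j) \<in> {0..T}" using d(3) j by (auto simp: image_subset_iff)
    show "\<eta> j \<in> borel_measurable (F (d j))" unfolding \<eta>
    proof (rule borel_measurable_sum)
      fix i assume "i \<in> {..<n}"
      then have i: "i < n" by simp
      show "(\<lambda>\<omega>. \<xi> i \<omega> * indicator {\<tau> i<..\<tau> (Suc i)} (d (Suc j))) \<in> borel_measurable (F (d j))"
      \<comment> \<open>The coefficient is read off at the right endpoint of the cell but must be
        adapted at the left one. As \<open>\<tau> i\<close> is itself a grid point below
        \<open>d (Suc j)\<close>, it is at most \<open>d j\<close>.\<close>
      proof (cases "\<tau> i < d (Suc j)")
        case True
        obtain a where a: "a \<le> m" "\<tau> i = d a" using d(2) i by (force simp: image_subset_iff)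
        have "a \<le> j"
        proof (rule ccontr)
          assume "\<not> a \<le> j" then have "d (Suc j) \<le> d a" using dmono a j by (intro mono_onD[OF dmono]) auto
          then show False using True a by simp
        qed
        then have "\<tau> i \<le> d j" using a j by (auto intro!: mono_onD[OF dmono])
        then have "\<xi> i \<in> borel_measurable (F (d j))"
          using F_measurable_mono[OF \<tau>(3)[OF i], of "d j"] \<tau>(1)[of i] i dj by simp
        then show ?thesis by measurable
      qed simp
    qed
    have "\<forall>i. \<exists>c. i < n \<longrightarrow> (\<forall>\<omega>\<in>space M. \<bar>\<xi> i \<omega>\<bar> \<le> c)" using sd[unfolded simple_data_def] by blast
    from choice[OF this] obtain c where c: "\<And>i \<omega>. i < n \<Longrightarrow> \<omega> \<in> space M \<Longrightarrow> \<bar>\<xi> i \<omega>\<bar> \<le> c i" by blast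
    have "\<bar>\<eta> j \<omega>\<bar> \<le> (\<Sum>i<n. c i)" if "\<omega> \<in> space M" for \<omega>
      unfolding \<eta>
    proof (rule order_trans[OF sum_abs] , rule sum_mono)
      fix i assume "i \<in> {..<n}"
      then have "\<bar>\<xi> i \<omega>\<bar> \<le> c i" using c that by simp
      then show "\<bar>\<xi> i \<omega> * indicator {\<tau> i<..\<tau> (Suc i)} (d (Suc j))\<bar> \<le> c i"
        by (auto simp: indicator_def)
    qed
    then show "\<exists>c. \<forall>\<omega>\<in>space M. \<bar>\<eta> j \<omega>\<bar> \<le> c" by blast
  qed (use dmono d in auto)
  show "simple_process m d \<eta> s \<omega> = simple_process n \<tau> \<xi> s \<omega>"
    unfolding simple_process_eq_step[OF dmono] simple_process_eq_step[OF \<tau>(5)] \<eta>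
    by (rule sum_grid_refine[OF d(1) \<tau>(5) d(2), symmetric])
  show "simple_integral W m d \<eta> t \<omega> = simple_integral W n \<tau> \<xi> t \<omega>"
    unfolding simple_integral_def \<eta>
    by (rule sum_grid_refine[OF d(1) \<tau>(5) d(2), where f = "\<lambda>u. W (min u t) \<omega>", symmetric])
qed

text \<open>Induction on the number of steps. The partial sum is measurable at time
  \<open>\<tau> j\<close>, hence independent of the next increment, and its squared norm bound grows
  by one term.\<close>

lemma simple_sum_bound:
  assumes sd: "simple_data M F T n \<tau> \<xi>" and p: "2 \<le> p"
    and b: "\<And>i. i < n \<Longrightarrow> Lp_bound M p (\<xi> i) (b i)"
  shows "Lp_bound M p (\<lambda>\<omega>. \<Sum>i<n. \<xi> i \<omega> * (W (\<tau> (Suc i)) \<omega> - W (\<tau> i) \<omega>))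
     (sqrt (ito_const p * (\<Sum>i<n. (b i)\<^sup>2 * (\<tau> (Suc i) - \<tau> i))))"
proof -
  note \<tau> = simple_dataD[OF sd]
  have "j \<le> n \<Longrightarrow> (\<lambda>\<omega>. \<Sum>i<j. \<xi> i \<omega> * (W (\<tau> (Suc i)) \<omega> - W (\<tau> i) \<omega>)) \<in> borel_measurable (F (\<tau> j)) \<and>
    Lp_bound M p (\<lambda>\<omega>. \<Sum>i<j. \<xi> i \<omega> * (W (\<tau> (Suc i)) \<omega> - W (\<tau> i) \<omega>))
     (sqrt (ito_const p * (\<Sum>i<j. (b i)\<^sup>2 * (\<tau> (Suc i) - \<tau> i))))" for j
  proof (induction j)
    case 0
    then show ?case by (auto intro!: Lp_bound_const)
  next
    case (Suc j)
    let ?S = "\<lambda>\<omega>. \<Sum>i<j. \<xi> i \<omega> * (W (\<tau> (Suc i)) \<omega> - W (\<tau> i) \<omega>)"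
    let ?c = "\<Sum>i<j. (b i)\<^sup>2 * (\<tau> (Suc i) - \<tau> i)"
    have j: "j < n" using Suc by simp
    have IH: "?S \<in> borel_measurable (F (\<tau> j))" "Lp_bound M p ?S (sqrt (ito_const p * ?c))" using Suc by auto
    have \<tau>j: "0 \<le> \<tau> j" "\<tau> j \<le> \<tau> (Suc j)" "\<tau> (Suc j) \<le> T" using \<tau>(1)[of j] \<tau>(1)[of "Suc j"] \<tau>(2)[of j "Suc j"] j by auto
    have [measurable]: "?S \<in> borel_measurable (F (\<tau> (Suc j)))" "\<xi> j \<in> borel_measurable (F (\<tau> (Suc j)))"
        "W (\<tau> j) \<in> borel_measurable (F (\<tau> (Suc j)))" "W (\<tau> (Suc j)) \<in> borel_measurable (F (\<tau> (Suc j)))"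
      using F_measurable_mono[OF _ \<tau>j] IH(1) \<tau>(3)[OF j] W_adapted[of "\<tau> j"] W_adapted[of "\<tau> (Suc j)"] \<tau>j by auto
    have c0: "0 \<le> ?c" using \<tau>(2) j by (intro sum_nonneg mult_nonneg_nonneg) auto
    have "Lp_bound M p (\<lambda>\<omega>. ?S \<omega> + \<xi> j \<omega> * (W (\<tau> (Suc j)) \<omega> - W (\<tau> j) \<omega>)) (sqrt (ito_const p * (\<Sum>i<Suc j. (b i)\<^sup>2 * (\<tau> (Suc i) - \<tau> i))))"
    \<comment> \<open>A step of length zero has no normal density and adds nothing.\<close>
    proof (cases "\<tau> j = \<tau> (Suc j)")
      case True
      then show ?thesis using IH(2) by simp
    next
      case False
      then have lt: "\<tau> j < \<tau> (Suc j)" using \<tau>j by simp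
      have "Lp_bound M p (\<lambda>\<omega>. ?S \<omega> + \<xi> j \<omega> * (W (\<tau> (Suc j)) \<omega> - W (\<tau> j) \<omega>))
         (sqrt ((sqrt (ito_const p * ?c))\<^sup>2 + ito_const p * ((b j)\<^sup>2 * (sqrt (\<tau> (Suc j) - \<tau> j))\<^sup>2)))"
        using lt \<tau>j p IH \<tau>(3)[OF j] b[OF j]
        by (intro Lp_bound_normal_increment[OF W_indep[of "\<tau> j"] F W_normal[of "\<tau> j"]]) auto
      also have "(sqrt (ito_const p * ?c))\<^sup>2 + ito_const p * ((b j)\<^sup>2 * (sqrt (\<tau> (Suc j) - \<tau> j))\<^sup>2)
         = ito_const p * (\<Sum>i<Suc j. (b i)\<^sup>2 * (\<tau> (Suc i) - \<tau> i))"
        using c0 lt ito_const_nonneg[of p] by (simp add: algebra_simps)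
      finally show ?thesis .
    qed
    moreover have "(\<lambda>\<omega>. ?S \<omega> + \<xi> j \<omega> * (W (\<tau> (Suc j)) \<omega> - W (\<tau> j) \<omega>)) \<in> borel_measurable (F (\<tau> (Suc j)))"
      by measurable
    ultimately show ?case by simp
  qed
  from this[of n] show ?thesis by simp
qed

text \<open>The mean of each term vanishes by reflection: its positive and negative parts have equal
  integrals.\<close>

lemma simple_sum_expectation:
  assumes sd: "simple_data M F T n \<tau> \<xi>"
  shows "(\<integral>\<omega>. (\<Sum>i<n. \<xi> i \<omega> * (W (\<tau> (Suc i)) \<omega> - W (\<tau> i) \<omega>)) \<partial>M) = 0"
    and "integrable M (\<lambda>\<omega>. \<Sum>i<n. \<xi> i \<omega> * (W (\<tau> (Suc i)) \<omega> - W (\<tau> i) \<omega>))"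
proof -
  note \<tau> = simple_dataD[OF sd]
  have *: "integrable M (\<lambda>\<omega>. \<xi> i \<omega> * (W (\<tau> (Suc i)) \<omega> - W (\<tau> i) \<omega>)) \<and> (\<integral>\<omega>. \<xi> i \<omega> * (W (\<tau> (Suc i)) \<omega> - W (\<tau> i) \<omega>) \<partial>M) = 0" if i: "i < n" for i
  proof (cases "\<tau> i = \<tau> (Suc i)")
    case False
    have \<tau>i: "0 \<le> \<tau> i" "\<tau> i < \<tau> (Suc i)" "\<tau> (Suc i) \<le> T" using \<tau>(1)[of i] \<tau>(1)[of "Suc i"] \<tau>(2)[of i "Suc i"] i False by auto
    let ?Z = "\<lambda>\<omega>. W (\<tau> (Suc i)) \<omega> - W (\<tau> i) \<omega>"
    have [measurable]: "W (\<tau> (Suc i)) \<in> borel_measurable M" "W (\<tau> i) \<in> borel_measurable M" "\<xi> i \<in> borel_measurable M"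
      using \<tau>i \<tau>(4)[OF i] by (auto intro!: W_measurable)
    obtain c where c: "\<And>\<omega>. \<omega> \<in> space M \<Longrightarrow> \<bar>\<xi> i \<omega>\<bar> \<le> c" using sd[unfolded simple_data_def] i by blast
    have "Lp_bound M 1 (\<lambda>\<omega>. \<xi> i \<omega> * ?Z \<omega>) (max c 0 * (sqrt (\<tau> (Suc i) - \<tau> i) * normal_moment 1))"
      using \<tau>i c F[of "\<tau> i"] \<tau>(3)[OF i] by (intro Lp_bound_indep_mult[OF W_indep] Lp_bound_normal W_normal Lp_bound_const) (auto simp: le_max_iff_disj)
    then have int: "integrable M (\<lambda>\<omega>. \<xi> i \<omega> * ?Z \<omega>)" by (rule Lp_bound_integral) auto
    have "(\<integral>\<^sup>+\<omega>. ennreal (\<xi> i \<omega> * ?Z \<omega>) \<partial>M) = (\<integral>\<^sup>+\<omega>. ennreal (\<xi> i \<omega> * - ?Z \<omega>) \<partial>M)"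
      using nn_integral_indep_symmetric[OF W_indep[of "\<tau> i" "\<tau> (Suc i)"] F \<tau>(3)[OF i] W_normal[of "\<tau> i" "\<tau> (Suc i)"], of "\<lambda>x. ennreal (fst x * snd x)"] \<tau>i
      by simp
    then show ?thesis using int by (simp add: real_lebesgue_integral_def right_diff_distrib)
  qed simp
  show "integrable M (\<lambda>\<omega>. \<Sum>i<n. \<xi> i \<omega> * (W (\<tau> (Suc i)) \<omega> - W (\<tau> i) \<omega>))"
    using * by (intro Bochner_Integration.integrable_sum) auto
  show "(\<integral>\<omega>. (\<Sum>i<n. \<xi> i \<omega> * (W (\<tau> (Suc i)) \<omega> - W (\<tau> i) \<omega>)) \<partial>M) = 0"
    using * by (subst Bochner_Integration.integral_sum) auto
qed

end

lemma (in prob_space) Lp_bound_chebyshev: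
  assumes U[measurable]: "U \<in> borel_measurable M" and b: "Lp_bound M 2 U a" and "0 < \<epsilon>"
  shows "prob {\<omega>\<in>space M. \<epsilon> < \<bar>U \<omega>\<bar>} \<le> a\<^sup>2 / \<epsilon>\<^sup>2"
proof -
  have "ennreal (\<epsilon>\<^sup>2) * emeasure M {\<omega>\<in>space M. \<epsilon> < \<bar>U \<omega>\<bar>} = (\<integral>\<^sup>+\<omega>. ennreal (\<epsilon>\<^sup>2) * indicator {\<omega>\<in>space M. \<epsilon> < \<bar>U \<omega>\<bar>} \<omega> \<partial>M)"
    by (subst nn_integral_cmult_indicator) auto
  also have "\<dots> \<le> (\<integral>\<^sup>+\<omega>. ennreal (\<bar>U \<omega>\<bar> powr 2) \<partial>M)"
  proof (rule nn_integral_mono)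
    fix \<omega>
    have "\<epsilon>\<^sup>2 \<le> \<bar>U \<omega>\<bar> powr 2" if "\<epsilon> < \<bar>U \<omega>\<bar>"
      using that assms(3) power_mono[of \<epsilon> "\<bar>U \<omega>\<bar>" 2] by (simp add: powr_numeral)
    then show "ennreal (\<epsilon>\<^sup>2) * indicator {\<omega>\<in>space M. \<epsilon> < \<bar>U \<omega>\<bar>} \<omega> \<le> ennreal (\<bar>U \<omega>\<bar> powr 2)"
      by (auto simp: indicator_def intro!: ennreal_leI)
  qed
  also have "\<dots> \<le> ennreal (a\<^sup>2)" using Lp_boundD[OF b] Lp_bound_nonneg[OF b] by (simp add: powr_numeral)
  finally have "\<epsilon>\<^sup>2 * prob {\<omega>\<in>space M. \<epsilon> < \<bar>U \<omega>\<bar>} \<le> a\<^sup>2"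
    by (simp add: emeasure_eq_measure flip: ennreal_mult)
  then show ?thesis using assms(3) by (simp add: field_simps)
qed

context bm_filtration
begin

text \<open>Freezing the coefficients once the quadratic variation passes \<open>\<delta>\<close> does not change the sum on
  the event in question.\<close>

lemma simple_sum_small:
  assumes sd: "simple_data M F T n \<tau> \<xi>" and \<delta>: "0 \<le> \<delta>" and \<epsilon>: "0 < \<epsilon>"
  shows "prob {\<omega>\<in>space M. \<epsilon> < \<bar>\<Sum>i<n. \<xi> i \<omega> * (W (\<tau> (Suc i)) \<omega> - W (\<tau> i) \<omega>)\<bar> \<and>
     (\<Sum>i<n. (\<xi> i \<omega>)\<^sup>2 * (\<tau> (Suc i) - \<tau> i)) \<le> \<delta>} \<le> ito_const 2 * \<delta> / \<epsilon>\<^sup>2"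
proof -
  note \<tau> = simple_dataD[OF sd]
  define q where "q i \<omega> = (\<Sum>j<i. (\<xi> j \<omega>)\<^sup>2 * (\<tau> (Suc j) - \<tau> j))" for i \<omega>
  define \<xi>' where "\<xi>' i \<omega> = \<xi> i \<omega> * indicator {\<omega>\<in>space M. q (Suc i) \<omega> \<le> \<delta>} \<omega>" for i \<omega>
  have dt: "0 \<le> \<tau> (Suc i) - \<tau> i" if "i < n" for i using \<tau>(2)[of i "Suc i"] that by auto
  have qmono: "q i \<omega> \<le> q j \<omega>" if "i \<le> j" "j \<le> n" for i j \<omega>
    unfolding q_def using that dt by (intro sum_mono2) auto
  have sd': "simple_data M F T n \<tau> \<xi>'" unfolding simple_data_def
  proof (intro conjI allI impI)
    fix i assume i: "i < n"
    have "\<xi> j \<in> borel_measurable (F (\<tau> i))" if "j \<le> i" for j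
    proof (rule F_measurable_mono)
      show "\<xi> j \<in> borel_measurable (F (\<tau> j))" using \<tau>(3)[of j] i that by simp
      show "\<tau> j \<le> \<tau> i" using \<tau>(2)[of j i] i that by simp
      show "0 \<le> \<tau> j" "\<tau> i \<le> T" using \<tau>(1)[of j] \<tau>(1)[of i] i that by auto
    qed
    then have "q (Suc i) \<in> borel_measurable (F (\<tau> i))" unfolding q_def
      by (intro borel_measurable_sum borel_measurable_times borel_measurable_power borel_measurable_const) simp
    then have "{\<omega>\<in>space (F (\<tau> i)). q (Suc i) \<omega> \<le> \<delta>} \<in> sets (F (\<tau> i))" by measurable
    then show "\<xi>' i \<in> borel_measurable (F (\<tau> i))"
      unfolding \<xi>'_def using \<tau>(3)[OF i] space_F[OF \<tau>(1)[of i]] i by auto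
    obtain c where "\<And>\<omega>. \<omega> \<in> space M \<Longrightarrow> \<bar>\<xi> i \<omega>\<bar> \<le> c" using sd[unfolded simple_data_def] i by blast
    then show "\<exists>c. \<forall>\<omega>\<in>space M. \<bar>\<xi>' i \<omega>\<bar> \<le> c"
      by (intro exI[of _ "max c 0"]) (auto simp: \<xi>'_def indicator_def le_max_iff_disj)
  qed (use sd in \<open>auto simp: simple_data_def\<close>)
  note \<tau>' = simple_dataD[OF sd']
  have small: "(\<Sum>i<j. (\<xi>' i \<omega>)\<^sup>2 * (\<tau> (Suc i) - \<tau> i)) \<le> \<delta>" if "\<omega> \<in> space M" "j \<le> n" for \<omega> j
    using that(2)
  proof (induction j)
    case (Suc j)
    show ?case
    proof (cases "q (Suc j) \<omega> \<le> \<delta>")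
      case True
      have "(\<Sum>i<Suc j. (\<xi>' i \<omega>)\<^sup>2 * (\<tau> (Suc i) - \<tau> i)) \<le> q (Suc j) \<omega>"
        unfolding q_def using dt Suc by (intro sum_mono mult_right_mono) (auto simp: \<xi>'_def indicator_def)
      then show ?thesis using True by simp
    next
      case False
      then have "\<xi>' j \<omega> = 0" by (simp add: \<xi>'_def)
      then show ?thesis using Suc by simp
    qed
  qed (use \<delta> in simp)
  define v where "v i = (\<integral>\<omega>. (\<xi>' i \<omega>)\<^sup>2 \<partial>M)" for i
  have int: "integrable M (\<lambda>\<omega>. (\<xi>' i \<omega>)\<^sup>2)" if i: "i < n" for i
  proof -
    obtain c where c: "\<And>\<omega>. \<omega> \<in> space M \<Longrightarrow> \<bar>\<xi>' i \<omega>\<bar> \<le> c" using sd'[unfolded simple_data_def] i by blast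
    have "norm ((\<xi>' i \<omega>)\<^sup>2) \<le> c\<^sup>2" if "\<omega> \<in> space M" for \<omega>
      using power_mono[OF c[OF that], of 2] by simp
    then show ?thesis using \<tau>'(4)[OF i]
      by (intro integrable_const_bound[where B = "c\<^sup>2"]) auto
  qed
  have "Lp_bound M 2 (\<xi>' i) (sqrt (v i))" if i: "i < n" for i
  proof (rule Lp_boundI)
    show "(\<integral>\<^sup>+\<omega>. ennreal (\<bar>\<xi>' i \<omega>\<bar> powr 2) \<partial>M) \<le> ennreal (sqrt (v i) powr 2)"
      using int[OF i] by (simp add: powr_numeral v_def nn_integral_eq_integral)
  qed (use \<tau>'(4)[OF i] in \<open>auto simp: v_def\<close>)
  then have b: "Lp_bound M 2 (\<lambda>\<omega>. \<Sum>i<n. \<xi>' i \<omega> * (W (\<tau> (Suc i)) \<omega> - W (\<tau> i) \<omega>))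
     (sqrt (ito_const 2 * (\<Sum>i<n. (sqrt (v i))\<^sup>2 * (\<tau> (Suc i) - \<tau> i))))"
    by (intro simple_sum_bound sd') auto
  have "(\<Sum>i<n. (sqrt (v i))\<^sup>2 * (\<tau> (Suc i) - \<tau> i)) = (\<integral>\<omega>. (\<Sum>i<n. (\<xi>' i \<omega>)\<^sup>2 * (\<tau> (Suc i) - \<tau> i)) \<partial>M)"
    using int by (subst Bochner_Integration.integral_sum) (auto simp: v_def)
  also have "\<dots> \<le> (\<integral>\<omega>. \<delta> \<partial>M)"
    using int small by (intro integral_mono Bochner_Integration.integrable_sum integrable_mult_left) auto
  also have "\<dots> = \<delta>" by (simp add: prob_space)
  finally have le: "(\<Sum>i<n. (sqrt (v i))\<^sup>2 * (\<tau> (Suc i) - \<tau> i)) \<le> \<delta>" .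
  have b': "Lp_bound M 2 (\<lambda>\<omega>. \<Sum>i<n. \<xi>' i \<omega> * (W (\<tau> (Suc i)) \<omega> - W (\<tau> i) \<omega>)) (sqrt (ito_const 2 * \<delta>))"
    using le ito_const_nonneg[of 2] by (intro Lp_bound_weaken[OF b]) (auto intro!: mult_left_mono)
  have [measurable]: "W (\<tau> i) \<in> borel_measurable M" if "i \<le> n" for i using W_measurable \<tau>(1)[OF that] by simp
  have Um: "(\<lambda>\<omega>. \<Sum>i<n. \<xi>' i \<omega> * (W (\<tau> (Suc i)) \<omega> - W (\<tau> i) \<omega>)) \<in> borel_measurable M"
    using \<tau>'(4) by (intro borel_measurable_sum borel_measurable_times borel_measurable_diff) auto
  have "prob {\<omega>\<in>space M. \<epsilon> < \<bar>\<Sum>i<n. \<xi> i \<omega> * (W (\<tau> (Suc i)) \<omega> - W (\<tau> i) \<omega>)\<bar> \<and>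
     (\<Sum>i<n. (\<xi> i \<omega>)\<^sup>2 * (\<tau> (Suc i) - \<tau> i)) \<le> \<delta>}
     \<le> prob {\<omega>\<in>space M. \<epsilon> < \<bar>\<Sum>i<n. \<xi>' i \<omega> * (W (\<tau> (Suc i)) \<omega> - W (\<tau> i) \<omega>)\<bar>}"
  proof (rule finite_measure_mono)
    show "{\<omega>\<in>space M. \<epsilon> < \<bar>\<Sum>i<n. \<xi>' i \<omega> * (W (\<tau> (Suc i)) \<omega> - W (\<tau> i) \<omega>)\<bar>} \<in> sets M"
      using Um by measurable
    have "\<xi>' i \<omega> = \<xi> i \<omega>" if "\<omega> \<in> space M" "q n \<omega> \<le> \<delta>" "i < n" for i \<omega>
      using qmono[of "Suc i" n \<omega>] that by (simp add: \<xi>'_def)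
    then show "{\<omega>\<in>space M. \<epsilon> < \<bar>\<Sum>i<n. \<xi> i \<omega> * (W (\<tau> (Suc i)) \<omega> - W (\<tau> i) \<omega>)\<bar> \<and> (\<Sum>i<n. (\<xi> i \<omega>)\<^sup>2 * (\<tau> (Suc i) - \<tau> i)) \<le> \<delta>}
       \<subseteq> {\<omega>\<in>space M. \<epsilon> < \<bar>\<Sum>i<n. \<xi>' i \<omega> * (W (\<tau> (Suc i)) \<omega> - W (\<tau> i) \<omega>)\<bar>}"
      by (auto simp: q_def[symmetric])
  qed
  also have "\<dots> \<le> (sqrt (ito_const 2 * \<delta>))\<^sup>2 / \<epsilon>\<^sup>2" by (rule Lp_bound_chebyshev[OF Um b' \<epsilon>])
  also have "\<dots> = ito_const 2 * \<delta> / \<epsilon>\<^sup>2" using ito_const_nonneg[of 2] \<delta> by simp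
  finally show ?thesis .
qed

end

subsection \<open>Limits of simple integrals\<close>

lemma ennreal_twice_add:
  assumes "0 \<le> x" "0 \<le> y"
  shows "2 * ennreal x + 2 * ennreal y = ennreal (2 * x + 2 * y)"
  using assms by (simp add: ennreal_plus ennreal_mult)

lemma grid_cell:
  fixes d :: "nat \<Rightarrow> real"
  assumes "d 0 < u" "u \<le> d m"
  obtains j where "j < m" "d j < u" "u \<le> d (Suc j)"
proof -
  define k where "k = (LEAST k. u \<le> d k)"
  have k: "u \<le> d k" "k \<le> m" unfolding k_def using assms(2) by (auto intro: LeastI Least_le)
  have k0: "k \<noteq> 0"
  proof
    assume "k = 0" then show False using k(1) assms(1) by simp
  qed
  have "\<not> u \<le> d (k - 1)" using not_less_Least[of "k - 1" "\<lambda>k. u \<le> d k"] k0 by (simp add: k_def)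
  then show ?thesis using that[of "k - 1"] k k0 by auto
qed

lemma grid_sum_cell:
  fixes d :: "nat \<Rightarrow> real"
  assumes d: "\<And>j. j < m \<Longrightarrow> d j < d (Suc j)" and j: "j < m" "d j < u" "u \<le> d (Suc j)"
  shows "(\<Sum>i<m. x i * indicator {d i<..d (Suc i)} u) = (x j :: real)"
proof -
  have mono: "d a \<le> d b" if "a \<le> b" "b \<le> m" for a b
    using that
  proof (induction b)
    case (Suc b) then show ?case using d[of b] by (cases "a = Suc b") auto
  qed simp
  have "indicator {d i<..d (Suc i)} u = (if i = j then 1 else 0 :: real)" if "i < m" for i
  proof (cases i j rule: linorder_cases)
    case less
    then show ?thesis using mono[of "Suc i" j] j that by (auto simp: indicator_def)
  next
    case greater
    then show ?thesis using mono[of "Suc j" i] j that by (auto simp: indicator_def)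
  qed (use j in auto)
  then have "(\<Sum>i<m. x i * indicator {d i<..d (Suc i)} u) = (\<Sum>i<m. if i = j then x i else 0)"
    by (intro sum.cong) auto
  then show ?thesis using j by simp
qed

definition clip :: "real \<Rightarrow> real \<Rightarrow> real" where
  "clip N x = max (- N) (min N x)"

lemma borel_measurable_clip [measurable (raw)]:
  "f \<in> borel_measurable M \<Longrightarrow> (\<lambda>x. clip N (f x)) \<in> borel_measurable M"
  unfolding clip_def by (intro borel_measurable_max borel_measurable_min borel_measurable_const)

lemma abs_clip_le: "0 \<le> N \<Longrightarrow> \<bar>clip N x\<bar> \<le> N" "0 \<le> N \<Longrightarrow> \<bar>clip N x\<bar> \<le> \<bar>x\<bar>"
  by (auto simp: clip_def max_def min_def)

lemma clip_diff_le: "\<bar>clip N x - clip N y\<bar> \<le> \<bar>x - y\<bar>"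
  by (auto simp: clip_def max_def min_def)

text \<open>It carries a tail bound from the limit to the approximations: what clipping removes from
  \<open>x\<close> is small when \<open>x\<close> is near \<open>y\<close> and \<open>y\<close> has
  a small tail.\<close>

lemma clip_remainder_square:
  assumes "0 \<le> N"
  shows "(x - clip N x)\<^sup>2 \<le> 2 * (x - y)\<^sup>2 + 2 * (max 0 (\<bar>y\<bar> - N))\<^sup>2"
proof -
  have "\<bar>x - clip N x\<bar> \<le> \<bar>x - y\<bar> + max 0 (\<bar>y\<bar> - N)" using assms by (auto simp: clip_def max_def min_def)
  then have "\<bar>x - clip N x\<bar>\<^sup>2 \<le> (\<bar>x - y\<bar> + max 0 (\<bar>y\<bar> - N))\<^sup>2" by (intro power_mono) auto
  also have "\<dots> \<le> 2 * \<bar>x - y\<bar>\<^sup>2 + 2 * (max 0 (\<bar>y\<bar> - N))\<^sup>2"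
    using sum_squares_bound[of "\<bar>x - y\<bar>" "max 0 (\<bar>y\<bar> - N)"] by (simp add: power2_sum)
  finally show ?thesis by simp
qed

section \<open>Integrals as limits in probability at fixed times\<close>

context bm_filtration
begin

abbreviation "L \<equiv> restrict_space lborel {0..T}"

text \<open>A weakening of \<open>ito_integral\<close> that is easily seen to be stable under
  differences: convergence at each fixed time replaces uniform convergence, and joint measurability
  replaces progressive measurability. Integrands are compared over \<open>L\<close>, Lebesgue
  measure on the time interval.\<close>

definition ito_limit :: "(real \<Rightarrow> 'a \<Rightarrow> real) \<Rightarrow> (real \<Rightarrow> 'a \<Rightarrow> real) \<Rightarrow> bool" where
  "ito_limit H J \<longleftrightarrow>
     (\<lambda>x. H (fst x) (snd x)) \<in> borel_measurable (L \<Otimes>\<^sub>M M) \<and>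
     (\<forall>t\<in>{0..T}. J t \<in> borel_measurable M) \<and>
     (AE \<omega> in M. (\<integral>\<^sup>+s. ennreal ((H s \<omega>)\<^sup>2) \<partial>L) < \<infinity>) \<and>
     (\<exists>n \<tau> \<xi>. (\<forall>k. simple_data M F T (n k) (\<tau> k) (\<xi> k)) \<and>
        (\<forall>\<epsilon>>0. (\<lambda>k. prob {\<omega>\<in>space M. ennreal \<epsilon> < (\<integral>\<^sup>+s. ennreal ((simple_process (n k) (\<tau> k) (\<xi> k) s \<omega> - H s \<omega>)\<^sup>2) \<partial>L)}) \<longlonglongrightarrow> 0) \<and>
        (\<forall>t\<in>{0..T}. \<forall>\<epsilon>>0. (\<lambda>k. prob {\<omega>\<in>space M. \<epsilon> < \<bar>simple_integral W (n k) (\<tau> k) (\<xi> k) t \<omega> - J t \<omega>\<bar>}) \<longlonglongrightarrow> 0))"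

lemma finite_measure_L: "finite_measure L"
  using T by (intro finite_measure_restrict_space finite_measureI) (auto simp: emeasure_restrict_space)

lemma space_L [simp]: "space L = {0..T}"
  by (simp add: space_restrict_space)

lemma simple_process_measurable:
  assumes "simple_data M F T n \<tau> \<xi>"
  shows "(\<lambda>x. simple_process n \<tau> \<xi> (fst x) (snd x)) \<in> borel_measurable (L \<Otimes>\<^sub>M M)"
proof -
  have "(\<lambda>x. \<xi> i (snd x) * indicator {\<tau> i<..\<tau> (Suc i)} (fst x)) \<in> borel_measurable (L \<Otimes>\<^sub>M M)" if "i < n" for i
  proof -
    have "(\<lambda>x. \<xi> i (snd x)) \<in> borel_measurable (L \<Otimes>\<^sub>M M)"
      using simple_dataD(4)[OF assms that] by measurable
    moreover have "(\<lambda>x. indicator {\<tau> i<..\<tau> (Suc i)} (fst x) :: real) \<in> borel_measurable (L \<Otimes>\<^sub>M M)"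
      by (rule measurable_compose[OF measurable_fst], rule measurable_restrict_space1) simp
    ultimately show ?thesis by (rule borel_measurable_times)
  qed
  then show ?thesis unfolding simple_process_def by (intro borel_measurable_sum) auto
qed

text \<open>Convergence in probability of the distances says nothing about their expectations. After
  clipping the distances are bounded, hence they converge in mean over time and probability
  together, and a subsequence converges almost everywhere.\<close>

lemma clip_converges_subseq:
  fixes G :: "nat \<Rightarrow> real \<Rightarrow> 'a \<Rightarrow> real"
  assumes H[measurable]: "(\<lambda>x. H (fst x) (snd x)) \<in> borel_measurable (L \<Otimes>\<^sub>M M)"
    and G[measurable]: "\<And>k. (\<lambda>x. G k (fst x) (snd x)) \<in> borel_measurable (L \<Otimes>\<^sub>M M)"
    and conv: "\<And>\<epsilon>. \<epsilon> > 0 \<Longrightarrow> (\<lambda>k. prob {\<omega>\<in>space M. ennreal \<epsilon> < (\<integral>\<^sup>+s. ennreal ((G k s \<omega> - H s \<omega>)\<^sup>2) \<partial>L)}) \<longlonglongrightarrow> 0"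
    and N: "0 \<le> N"
  obtains r :: "nat \<Rightarrow> nat" where "strict_mono r"
    "AE s in L. AE \<omega> in M. (\<lambda>k. clip N (G (r k) s \<omega>)) \<longlonglongrightarrow> clip N (H s \<omega>)"
proof -
  interpret L: finite_measure L by (rule finite_measure_L)
  interpret LM: pair_sigma_finite L M ..
  interpret P: finite_measure "L \<Otimes>\<^sub>M M"
    by (rule finite_measure_pair_measure) unfold_locales
  define u where "u k x = (clip N (G k (fst x) (snd x)) - clip N (H (fst x) (snd x)))\<^sup>2" for k x
  have um[measurable]: "u k \<in> borel_measurable (L \<Otimes>\<^sub>M M)" for k unfolding u_def by measurable
  have u0: "0 \<le> u k x" for k x by (simp add: u_def)
  have uN: "u k x \<le> 4 * N\<^sup>2" for k x
  proof -
    have "\<bar>clip N (G k (fst x) (snd x)) - clip N (H (fst x) (snd x))\<bar> \<le> 2 * N"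
      using abs_clip_le(1)[OF N, of "G k (fst x) (snd x)"] abs_clip_le(1)[OF N, of "H (fst x) (snd x)"] by linarith
    from power_mono[OF this, of 2] show ?thesis by (simp add: u_def)
  qed
  have uint: "integrable (L \<Otimes>\<^sub>M M) (u k)" for k
    using u0 uN by (intro P.integrable_const_bound[where B = "4 * N\<^sup>2"]) auto
  define K where "K = 4 * N\<^sup>2 * T"
  have K: "0 \<le> K" using T by (simp add: K_def)
  define D where "D k \<omega> = (\<integral>\<^sup>+s. ennreal ((G k s \<omega> - H s \<omega>)\<^sup>2) \<partial>L)" for k \<omega>
  have Dm[measurable]: "D k \<in> borel_measurable M" for k
  proof -
    have "(\<lambda>x. ennreal ((G k (snd x) (fst x) - H (snd x) (fst x))\<^sup>2)) \<in> borel_measurable (M \<Otimes>\<^sub>M L)"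
      using measurable_compose[OF _ G[of k], of "\<lambda>x. (snd x, fst x)" "M \<Otimes>\<^sub>M L"] measurable_compose[OF _ H, of "\<lambda>x. (snd x, fst x)" "M \<Otimes>\<^sub>M L"]
      by simp
    then show ?thesis unfolding D_def by (intro L.borel_measurable_nn_integral) (simp add: case_prod_beta)
  qed
  \<comment> \<open>On the event that the distance exceeds \<open>\<epsilon>\<close> the trivial
    bound \<open>K\<close> is used; elsewhere clipping does not increase the distance.\<close>
  have le: "(\<integral>x. u k x \<partial>(L \<Otimes>\<^sub>M M)) \<le> \<epsilon> + K * prob {\<omega>\<in>space M. ennreal \<epsilon> < D k \<omega>}" if \<epsilon>: "\<epsilon> > 0" for \<epsilon> k
  proof -
    let ?A = "{\<omega>\<in>space M. ennreal \<epsilon> < D k \<omega>}"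
    have "ennreal (\<integral>x. u k x \<partial>(L \<Otimes>\<^sub>M M)) = (\<integral>\<^sup>+x. ennreal (u k x) \<partial>(L \<Otimes>\<^sub>M M))"
      using uint u0 by (intro nn_integral_eq_integral[symmetric]) auto
    also have "\<dots> = (\<integral>\<^sup>+\<omega>. \<integral>\<^sup>+s. ennreal (u k (s, \<omega>)) \<partial>L \<partial>M)"
      by (rule LM.nn_integral_snd[symmetric]) measurable
    also have "\<dots> \<le> (\<integral>\<^sup>+\<omega>. ennreal \<epsilon> + ennreal K * indicator ?A \<omega> \<partial>M)"
    proof (rule nn_integral_mono)
      fix \<omega> assume w: "\<omega> \<in> space M"
      show "(\<integral>\<^sup>+s. ennreal (u k (s, \<omega>)) \<partial>L) \<le> ennreal \<epsilon> + ennreal K * indicator ?A \<omega>"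
      proof (cases "\<omega> \<in> ?A")
        case True
        have "(\<integral>\<^sup>+s. ennreal (u k (s, \<omega>)) \<partial>L) \<le> (\<integral>\<^sup>+s. ennreal (4 * N\<^sup>2) \<partial>L)"
          using uN by (intro nn_integral_mono ennreal_leI)
        also have "\<dots> = ennreal K"
          using T by (simp add: K_def emeasure_restrict_space ennreal_mult)
        finally show ?thesis using True by (simp add: add_increasing)
      next
        case False
        have "(\<integral>\<^sup>+s. ennreal (u k (s, \<omega>)) \<partial>L) \<le> D k \<omega>" unfolding D_def
          using clip_diff_le by (intro nn_integral_mono ennreal_leI) (simp add: u_def abs_le_square_iff)
        then show ?thesis using False w by auto
      qed
    qed
    also have "\<dots> = ennreal \<epsilon> + ennreal K * ennreal (prob ?A)"
      by (subst nn_integral_add) (auto simp: nn_integral_cmult_indicator emeasure_eq_measure prob_space)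
    also have "\<dots> = ennreal (\<epsilon> + K * prob ?A)" using \<epsilon> K by (simp flip: ennreal_mult)
    finally show ?thesis using \<epsilon> K by (subst (asm) ennreal_le_iff) auto
  qed
  have "(\<lambda>k. \<integral>x. norm (u k x) \<partial>(L \<Otimes>\<^sub>M M)) \<longlonglongrightarrow> 0"
  proof (rule LIMSEQ_I)
    fix e :: real assume e: "0 < e"
    have "(\<lambda>k. e / 2 + K * prob {\<omega>\<in>space M. ennreal (e / 2) < D k \<omega>}) \<longlonglongrightarrow> e / 2 + K * 0"
      using conv[of "e / 2"] e unfolding D_def by (intro tendsto_intros) auto
    from order_tendstoD(2)[OF this, of e] e
    have "eventually (\<lambda>k. e / 2 + K * prob {\<omega>\<in>space M. ennreal (e / 2) < D k \<omega>} < e) sequentially"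
      by simp
    then obtain k0 where k0: "\<And>k. k \<ge> k0 \<Longrightarrow> e / 2 + K * prob {\<omega>\<in>space M. ennreal (e / 2) < D k \<omega>} < e"
      by (auto simp: eventually_sequentially)
    show "\<exists>no. \<forall>n\<ge>no. norm ((\<integral>x. norm (u n x) \<partial>(L \<Otimes>\<^sub>M M)) - 0) < e"
    proof (intro exI allI impI)
      fix k assume "k0 \<le> k"
      then have "(\<integral>x. u k x \<partial>(L \<Otimes>\<^sub>M M)) < e" using le[of "e/2" k] k0[of k] e by simp
      moreover have "0 \<le> (\<integral>x. u k x \<partial>(L \<Otimes>\<^sub>M M))" using u0 by (intro integral_nonneg_AE) auto
      ultimately show "norm ((\<integral>x. norm (u k x) \<partial>(L \<Otimes>\<^sub>M M)) - 0) < e" using u0 by simp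
    qed
  qed
  from tendsto_L1_AE_subseq[OF uint this] obtain r where r: "strict_mono r" "AE x in L \<Otimes>\<^sub>M M. (\<lambda>k. u (r k) x) \<longlonglongrightarrow> 0"
    by auto
  have "AE s in L. AE \<omega> in M. (\<lambda>k. u (r k) (s, \<omega>)) \<longlonglongrightarrow> 0" by (rule LM.AE_pair[OF r(2)])
  then have "AE s in L. AE \<omega> in M. (\<lambda>k. clip N (G (r k) s \<omega>)) \<longlonglongrightarrow> clip N (H s \<omega>)"
  proof (rule AE_mp, rule_tac AE_I2, rule_tac impI)
    fix s assume "AE \<omega> in M. (\<lambda>k. u (r k) (s, \<omega>)) \<longlonglongrightarrow> 0"
    then show "AE \<omega> in M. (\<lambda>k. clip N (G (r k) s \<omega>)) \<longlonglongrightarrow> clip N (H s \<omega>)"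
    proof eventually_elim
      case (elim \<omega>)
      have "(\<lambda>k. sqrt (u (r k) (s, \<omega>))) \<longlonglongrightarrow> sqrt 0" using elim by (rule tendsto_real_sqrt)
      then have "(\<lambda>k. \<bar>clip N (G (r k) s \<omega>) - clip N (H s \<omega>)\<bar>) \<longlonglongrightarrow> 0" by (simp add: u_def)
      then have "(\<lambda>k. clip N (G (r k) s \<omega>) - clip N (H s \<omega>)) \<longlonglongrightarrow> 0" by (rule tendsto_rabs_zero_cancel)
      then show ?case by (simp add: LIM_zero_iff)
    qed
  qed
  then show ?thesis using that r by blast
qed

text \<open>For almost every path the tail integral tends to zero by dominated convergence. The
  events decrease in \<open>N\<close>, so their probabilities tend to that of the intersection, a
  null set.\<close>

lemma tail_square_small:
  assumes H[measurable]: "(\<lambda>x. H (fst x) (snd x)) \<in> borel_measurable (L \<Otimes>\<^sub>M M)"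
    and fin: "AE \<omega> in M. (\<integral>\<^sup>+s. ennreal ((H s \<omega>)\<^sup>2) \<partial>L) < \<infinity>"
    and \<delta>: "0 < \<delta>" and \<epsilon>: "0 < \<epsilon>"
  obtains N :: nat where "{\<omega>\<in>space M. ennreal \<delta> < (\<integral>\<^sup>+s. ennreal ((max 0 (\<bar>H s \<omega>\<bar> - real N))\<^sup>2) \<partial>L)} \<in> sets M"
    "prob {\<omega>\<in>space M. ennreal \<delta> < (\<integral>\<^sup>+s. ennreal ((max 0 (\<bar>H s \<omega>\<bar> - real N))\<^sup>2) \<partial>L)} < \<epsilon>"
proof -
  interpret L: finite_measure L by (rule finite_measure_L)
  define R where "R N \<omega> = (\<integral>\<^sup>+s. ennreal ((max 0 (\<bar>H s \<omega>\<bar> - real N))\<^sup>2) \<partial>L)" for N :: nat and \<omega>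
  have H'[measurable]: "(\<lambda>x. H (snd x) (fst x)) \<in> borel_measurable (M \<Otimes>\<^sub>M L)"
    using measurable_compose[OF _ H, of "\<lambda>x. (snd x, fst x)" "M \<Otimes>\<^sub>M L"] by simp
  have Rm[measurable]: "R N \<in> borel_measurable M" for N
    unfolding R_def by (intro L.borel_measurable_nn_integral) (simp add: case_prod_beta)
  define A where "A N = {\<omega>\<in>space M. ennreal \<delta> < R N \<omega>}" for N
  have Am: "range A \<subseteq> sets M" unfolding A_def by auto
  have "R (Suc N) \<omega> \<le> R N \<omega>" for N \<omega>
    unfolding R_def by (intro nn_integral_mono ennreal_leI power_mono) auto
  then have "decseq A" unfolding A_def by (intro decseq_SucI) (auto intro: less_le_trans)
  then have "(\<lambda>N. prob (A N)) \<longlonglongrightarrow> prob (\<Inter>N. A N)" using Am by (intro finite_Lim_measure_decseq)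
  moreover have "prob (\<Inter>N. A N) = 0"
  proof -
    have "AE \<omega> in M. \<omega> \<notin> (\<Inter>N. A N)"
      using fin AE_space
    proof eventually_elim
      case (elim \<omega>)
      have Hs[measurable]: "(\<lambda>s. H s \<omega>) \<in> borel_measurable L"
        using measurable_compose[OF measurable_Pair1'[OF elim(2)] H'] by simp
      have "(\<lambda>N. R N \<omega>) \<longlonglongrightarrow> (\<integral>\<^sup>+s. 0 \<partial>L)" unfolding R_def
      proof (rule nn_integral_dominated_convergence[where w = "\<lambda>s. ennreal ((H s \<omega>)\<^sup>2)"])
        show "AE s in L. ennreal ((max 0 (\<bar>H s \<omega>\<bar> - real j))\<^sup>2) \<le> ennreal ((H s \<omega>)\<^sup>2)" for j
        proof (rule AE_I2, rule ennreal_leI)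
          fix s
          have "(max 0 (\<bar>H s \<omega>\<bar> - real j))\<^sup>2 \<le> \<bar>H s \<omega>\<bar>\<^sup>2" by (intro power_mono) auto
          then show "(max 0 (\<bar>H s \<omega>\<bar> - real j))\<^sup>2 \<le> (H s \<omega>)\<^sup>2" by simp
        qed
        show "AE s in L. (\<lambda>i. ennreal ((max 0 (\<bar>H s \<omega>\<bar> - real i))\<^sup>2)) \<longlonglongrightarrow> 0"
        proof (rule AE_I2)
          fix s
          obtain k where k: "\<bar>H s \<omega>\<bar> \<le> real k" using real_arch_simple by blast
          show "(\<lambda>i. ennreal ((max 0 (\<bar>H s \<omega>\<bar> - real i))\<^sup>2)) \<longlonglongrightarrow> 0"
          proof (rule tendsto_eventually, rule eventually_sequentiallyI[of k])
            fix i assume "k \<le> i"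
            then have "\<bar>H s \<omega>\<bar> \<le> real i" using k by (meson of_nat_mono order_trans)
            then show "ennreal ((max 0 (\<bar>H s \<omega>\<bar> - real i))\<^sup>2) = 0" by simp
          qed
        qed
      qed (use elim in auto)
      then have "eventually (\<lambda>N. R N \<omega> < ennreal \<delta>) sequentially"
        using \<delta> by (intro order_tendstoD(2)) auto
      then obtain N where "R N \<omega> < ennreal \<delta>" by (auto simp: eventually_sequentially)
      then show ?case by (auto simp: A_def intro!: exI[of _ N])
    qed
    moreover have "(\<Inter>N. A N) \<in> sets M" using Am by (intro sets.countable_INT) auto
    ultimately show ?thesis by (subst prob_eq_0) auto
  qed
  ultimately have "eventually (\<lambda>N. prob (A N) < \<epsilon>) sequentially"
    using \<epsilon> by (intro order_tendstoD(2)[of _ 0]) auto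
  then obtain N where "prob (A N) < \<epsilon>" by (auto simp: eventually_sequentially)
  then show ?thesis using that[of N] Am by (auto simp: A_def R_def)
qed

lemma integral_step:
  fixes d :: "nat \<Rightarrow> real"
  assumes d: "\<And>j. j < m \<Longrightarrow> d j < d (Suc j)" "d ` {..m} \<subseteq> {0..T}"
  shows "(\<integral>u. (\<Sum>j<m. x j * indicator {d j<..d (Suc j)} u) \<partial>L) = (\<Sum>j<m. x j * (d (Suc j) - d j))"
    "integrable L (\<lambda>u. \<Sum>j<m. x j * indicator {d j<..d (Suc j)} u)"
proof -
  have *: "integrable L (indicat_real {d j<..d (Suc j)}) \<and> (\<integral>u. indicat_real {d j<..d (Suc j)} u \<partial>L) = d (Suc j) - d j" if j: "j < m" for j
  proof -
    have "d j \<in> {0..T}" "d (Suc j) \<in> {0..T}" using d(2) j by (auto simp: image_subset_iff)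
    then have sub: "{d j<..d (Suc j)} \<subseteq> {0..T}" by auto
    then have s: "{d j<..d (Suc j)} \<in> sets L" by (auto simp: sets_restrict_space_iff)
    have "emeasure L {d j<..d (Suc j)} = ennreal (d (Suc j) - d j)"
      using sub d(1)[OF j] by (simp add: emeasure_restrict_space)
    then show ?thesis using s d(1)[OF j] by (simp add: measure_def integrable_real_indicator Int_absorb2[OF sub])
  qed
  show "integrable L (\<lambda>u. \<Sum>j<m. x j * indicator {d j<..d (Suc j)} u)"
    using * by (intro Bochner_Integration.integrable_sum integrable_mult_right) auto
  show "(\<integral>u. (\<Sum>j<m. x j * indicator {d j<..d (Suc j)} u) \<partial>L) = (\<Sum>j<m. x j * (d (Suc j) - d j))"
    using * by (subst Bochner_Integration.integral_sum) auto
qed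

end

section \<open>Approximation by simple sums with controlled norm\<close>

context bm_filtration
begin

text \<open>The events \<open>B r\<close> localize: on \<open>B t\<close> a simple integral up to time \<open>t\<close> does not see the factor
  \<open>indicator (B (d j))\<close> in its coefficients.\<close>

lemma ito_limit_approx:
  assumes lim: "ito_limit H J" and s: "0 \<le> s" and t: "s \<le> t" "t \<le> T" and p: "2 \<le> p"
    and B: "\<And>r. r \<in> {0..T} \<Longrightarrow> B r \<in> sets (F r)"
      "\<And>r r'. 0 \<le> r \<Longrightarrow> r \<le> r' \<Longrightarrow> r' \<le> T \<Longrightarrow> B r' \<subseteq> B r"
      "\<And>r \<omega>. 0 < r \<Longrightarrow> r \<le> T \<Longrightarrow> (\<And>u. 0 \<le> u \<Longrightarrow> u < r \<Longrightarrow> \<omega> \<in> B u) \<Longrightarrow> \<omega> \<in> B r"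
    and h: "continuous_on {s..t} h"
      "\<And>r. r \<in> {s..t} \<Longrightarrow> Lp_bound M p (\<lambda>\<omega>. H r \<omega> * indicator (B r) \<omega>) (h r)"
    and \<epsilon>: "0 < \<epsilon>"
  shows "\<exists>I E. I \<in> borel_measurable M \<and> Lp_bound M p I (sqrt (ito_const p * (LINT r:{s..t}|lborel. (h r)\<^sup>2)) + \<epsilon>) \<and>
     (\<integral>\<omega>. I \<omega> \<partial>M) = 0 \<and> E \<in> sets M \<and> prob E \<le> \<epsilon> \<and>
     (\<forall>\<omega>\<in>space M \<inter> B t - E. \<bar>J t \<omega> - J s \<omega> - I \<omega>\<bar> \<le> \<epsilon>)"
proof -
  interpret L: finite_measure L by (rule finite_measure_L)
  have st: "s \<in> {0..T}" "t \<in> {0..T}" using s t by auto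
  obtain n \<tau> \<xi> where Hm[measurable]: "(\<lambda>x. H (fst x) (snd x)) \<in> borel_measurable (L \<Otimes>\<^sub>M M)"
    and Jm: "\<And>t. t \<in> {0..T} \<Longrightarrow> J t \<in> borel_measurable M"
    and Hfin: "AE \<omega> in M. (\<integral>\<^sup>+s. ennreal ((H s \<omega>)\<^sup>2) \<partial>L) < \<infinity>"
    and sd: "\<And>k. simple_data M F T (n k) (\<tau> k) (\<xi> k)"
    and cH: "\<And>\<epsilon>. \<epsilon> > 0 \<Longrightarrow> (\<lambda>k. prob {\<omega>\<in>space M. ennreal \<epsilon> < (\<integral>\<^sup>+s. ennreal ((simple_process (n k) (\<tau> k) (\<xi> k) s \<omega> - H s \<omega>)\<^sup>2) \<partial>L)}) \<longlonglongrightarrow> 0"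
    and cJ: "\<And>t \<epsilon>. t \<in> {0..T} \<Longrightarrow> \<epsilon> > 0 \<Longrightarrow> (\<lambda>k. prob {\<omega>\<in>space M. \<epsilon> < \<bar>simple_integral W (n k) (\<tau> k) (\<xi> k) t \<omega> - J t \<omega>\<bar>}) \<longlonglongrightarrow> 0"
    using lim unfolding ito_limit_def by blast
  define G where "G k = simple_process (n k) (\<tau> k) (\<xi> k)" for k
  define SI where "SI k = simple_integral W (n k) (\<tau> k) (\<xi> k)" for k
  have Gm[measurable]: "(\<lambda>x. G k (fst x) (snd x)) \<in> borel_measurable (L \<Otimes>\<^sub>M M)" for k
    unfolding G_def by (rule simple_process_measurable[OF sd])
  \<comment> \<open>Adding one makes the divisor positive. The exceptional event will be a union of
    five, each of probability at most \<open>\<epsilon> / 5\<close>. The number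
    \<open>\<delta>\<close> is a quadratic variation for which the part cut off exceeds
    \<open>\<epsilon> / 2\<close> with at most that probability.\<close>
  define C where "C = ito_const 2 + 1"
  have C: "0 < C" "ito_const 2 \<le> C" using ito_const_nonneg[of 2] by (auto simp: C_def)
  define \<delta> where "\<delta> = (\<epsilon> / 2)\<^sup>2 * (\<epsilon> / 5) / C"
  have \<delta>: "0 < \<delta>" using C \<epsilon> by (simp add: \<delta>_def)
  obtain N :: nat where N: "{\<omega>\<in>space M. ennreal (\<delta> / 4) < (\<integral>\<^sup>+s. ennreal ((max 0 (\<bar>H s \<omega>\<bar> - real N))\<^sup>2) \<partial>L)} \<in> sets M"
    "prob {\<omega>\<in>space M. ennreal (\<delta> / 4) < (\<integral>\<^sup>+s. ennreal ((max 0 (\<bar>H s \<omega>\<bar> - real N))\<^sup>2) \<partial>L)} < \<epsilon> / 5"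
    using tail_square_small[OF Hm Hfin, of "\<delta> / 4" "\<epsilon> / 5"] \<delta> \<epsilon> by auto
  define c where "c = clip (real N)"
  have c: "\<bar>c x\<bar> \<le> real N" "\<bar>c x\<bar> \<le> \<bar>x\<bar>" for x by (auto simp: c_def abs_clip_le)
  have cm[measurable (raw)]: "f \<in> borel_measurable A \<Longrightarrow> (\<lambda>x. c (f x)) \<in> borel_measurable A" for f :: "'z \<Rightarrow> real" and A
    unfolding c_def by measurable
  obtain r :: "nat \<Rightarrow> nat" where r: "strict_mono r"
    "AE s in L. AE \<omega> in M. (\<lambda>k. c (G (r k) s \<omega>)) \<longlonglongrightarrow> c (H s \<omega>)"
    using clip_converges_subseq[of H G "real N", OF Hm Gm] cH unfolding c_def G_def by auto

  \<comment> \<open>The grid contains the times of the approximation, the end points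
    \<open>s\<close> and \<open>t\<close>, and a mesh of width \<open>T / real (Suc k)\<close>.
    Through the mesh the left end of the cell around a fixed time, where the localizing event is
    read off, converges to that time.\<close>
  define D where "D k = \<tau> k ` {..n k} \<union> {s, t, 0, T} \<union> (\<lambda>i. T * real i / real (Suc k)) ` {..Suc k}" for k
  have D: "finite (D k)" "0 \<in> D k" "T \<in> D k" "D k \<subseteq> {0..T}" for k
  proof -
    have "T * real i / real (Suc k) \<le> T" if "i \<le> Suc k" for i
      using that T by (simp add: field_simps del: of_nat_Suc)
    then show "D k \<subseteq> {0..T}" using simple_dataD(1)[OF sd] st T unfolding D_def by auto
  qed (auto simp: D_def)
  have "\<forall>k. \<exists>md. snd md ` {..fst md} = D k \<and> (\<forall>j<fst md. snd md j < snd md (Suc j)) \<and> snd md 0 = 0 \<and> snd md (fst md) = T"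
  proof
    fix k
    from finite_grid[OF D[of k]] obtain m d where "d ` {..m} = D k" "\<And>j. j < m \<Longrightarrow> d j < d (Suc j)" "d 0 = 0" "d m = T" by blast
    then show "\<exists>md. snd md ` {..fst md} = D k \<and> (\<forall>j<fst md. snd md j < snd md (Suc j)) \<and> snd md 0 = 0 \<and> snd md (fst md) = T"
      by (intro exI[of _ "(m, d)"]) auto
  qed
  from choice[OF this] obtain md where md: "\<And>k. snd (md k) ` {..fst (md k)} = D k"
     "\<And>k j. j < fst (md k) \<Longrightarrow> snd (md k) j < snd (md k) (Suc j)" "\<And>k. snd (md k) 0 = 0" "\<And>k. snd (md k) (fst (md k)) = T"
    by blast
  define m where "m k = fst (md k)" for k
  define d where "d k = snd (md k)" for k
  have dD: "d k ` {..m k} = D k" and dlt: "j < m k \<Longrightarrow> d k j < d k (Suc j)" and d0: "d k 0 = 0" and dT: "d k (m k) = T" for k j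
    using md by (auto simp: m_def d_def)
  have dmono: "d k a \<le> d k b" if "a \<le> b" "b \<le> m k" for a b k
    using that
  proof (induction b)
    case (Suc b) then show ?case using dlt[of b k] by (cases "a = Suc b") auto
  qed simp
  have dran: "d k ` {..m k} \<subseteq> {0..T}" for k using dD D(4) by simp
  have dj: "d k j \<in> {0..T}" if "j \<le> m k" for j k using dran[of k] that by (auto simp: image_subset_iff)
  have \<tau>sub: "\<tau> k ` {..n k} \<subseteq> d k ` {..m k}" for k unfolding dD D_def by auto
  have noIn: "d k (Suc j) \<le> u" if cell: "j < m k" "u \<in> D k" "d k j < u" for j k u
  proof -
    obtain i where i: "i \<le> m k" "u = d k i" using cell(2) dD[of k] by (auto simp: image_iff)
    then have "\<not> i \<le> j" using dmono[of i j k] cell by auto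
    then show ?thesis using dmono[of "Suc j" i k] i by simp
  qed
  define \<eta> where "\<eta> k j \<omega> = G k (d k (Suc j)) \<omega>" for k j \<omega>
  have \<eta>sd: "simple_data M F T (m k) (d k) (\<eta> k)"
    and \<eta>G: "simple_process (m k) (d k) (\<eta> k) u \<omega> = G k u \<omega>"
    and \<eta>SI: "simple_integral W (m k) (d k) (\<eta> k) u \<omega> = SI k u \<omega>" for k u \<omega>
    using simple_data_refine[OF sd[of k] dlt[of _ k] \<tau>sub dran] unfolding \<eta>_def G_def SI_def by auto
  \<comment> \<open>On \<open>B t\<close> the increment of the simple integral between
    \<open>s\<close> and \<open>t\<close> splits into the sum with the coefficients
    \<open>\<zeta>\<close>, whose norm is controlled, and the sum with the coefficients
    \<open>\<rho>\<close>, which is only small in probability.\<close>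
  define w where "w k j = (if s \<le> d k j \<and> d k j < t then 1 else 0 :: real)" for k j
  define \<zeta> where "\<zeta> k j \<omega> = c (\<eta> k j \<omega>) * indicator (B (d k j)) \<omega> * w k j" for k j \<omega>
  define \<rho> where "\<rho> k j \<omega> = (\<eta> k j \<omega> - c (\<eta> k j \<omega>)) * w k j" for k j \<omega>
  have wabs: "\<bar>w k j\<bar> \<le> 1" for k j by (simp add: w_def)
  have \<zeta>abs: "\<bar>\<zeta> k j \<omega>\<bar> \<le> real N" for k j \<omega>
  proof -
    have "\<bar>\<zeta> k j \<omega>\<bar> \<le> \<bar>c (\<eta> k j \<omega>)\<bar>" unfolding \<zeta>_def w_def by (auto simp: indicator_def)
    then show ?thesis using c(1)[of "\<eta> k j \<omega>"] by linarith
  qed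
  have BM: "B u \<in> sets M" if "u \<in> {0..T}" for u using B(1)[OF that] F[OF that] by (auto simp: subalgebra_def)
  have dmon: "mono_on {..m k} (d k)" for k using \<eta>sd[of k] by (simp add: simple_data_def)
  have \<zeta>sd: "simple_data M F T (m k) (d k) (\<zeta> k)" for k unfolding simple_data_def
  proof (intro conjI allI impI)
    fix j assume j: "j < m k"
    have [measurable]: "\<eta> k j \<in> borel_measurable (F (d k j))" using simple_dataD(3)[OF \<eta>sd j] .
    have [measurable]: "B (d k j) \<in> sets (F (d k j))" using B(1) dj[of j k] j by simp
    show "\<zeta> k j \<in> borel_measurable (F (d k j))" unfolding \<zeta>_def by measurable
    show "\<exists>c. \<forall>\<omega>\<in>space M. \<bar>\<zeta> k j \<omega>\<bar> \<le> c" using \<zeta>abs by blast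
  qed (use dmon dran in auto)
  have \<rho>sd: "simple_data M F T (m k) (d k) (\<rho> k)" for k unfolding simple_data_def
  proof (intro conjI allI impI)
    fix j assume j: "j < m k"
    have [measurable]: "\<eta> k j \<in> borel_measurable (F (d k j))" using simple_dataD(3)[OF \<eta>sd j] .
    show "\<rho> k j \<in> borel_measurable (F (d k j))" unfolding \<rho>_def by measurable
    obtain C where C: "\<And>\<omega>. \<omega> \<in> space M \<Longrightarrow> \<bar>\<eta> k j \<omega>\<bar> \<le> C" using \<eta>sd[of k, unfolded simple_data_def] j by blast
    have "\<bar>\<rho> k j \<omega>\<bar> \<le> C + real N" if "\<omega> \<in> space M" for \<omega>
    proof -
      have "\<bar>\<rho> k j \<omega>\<bar> \<le> \<bar>\<eta> k j \<omega> - c (\<eta> k j \<omega>)\<bar>" unfolding \<rho>_def w_def by auto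
      then show ?thesis using C[OF that] c(1)[of "\<eta> k j \<omega>"] by linarith
    qed
    then show "\<exists>c. \<forall>\<omega>\<in>space M. \<bar>\<rho> k j \<omega>\<bar> \<le> c" by blast
  qed (use dmon dran in auto)
  note \<zeta>M = simple_dataD(4)[OF \<zeta>sd]

  \<comment> \<open>\<open>\<beta> k j\<close> is the exact L^p norm of the clipped coefficient, so
    that its limit can be computed by dominated convergence.\<close>
  define \<mu> where "\<mu> k j = (\<integral>\<omega>. \<bar>\<zeta> k j \<omega>\<bar> powr p \<partial>M)" for k j
  define \<beta> where "\<beta> k j = \<mu> k j powr (1 / p)" for k j
  have \<zeta>p: "\<bar>\<zeta> k j \<omega>\<bar> powr p \<le> real N powr p" for k j \<omega> using \<zeta>abs p by (intro powr_mono2) auto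
  have \<mu>0: "0 \<le> \<mu> k j" for k j unfolding \<mu>_def by (intro integral_nonneg_AE) auto
  have \<zeta>int: "integrable M (\<lambda>\<omega>. \<bar>\<zeta> k j \<omega>\<bar> powr p)" if "j < m k" for k j
    using \<zeta>M[OF that] \<zeta>p by (intro integrable_const_bound[where B = "real N powr p"]) auto
  have \<mu>N: "\<mu> k j \<le> real N powr p" if "j < m k" for k j
    unfolding \<mu>_def using integral_mono[OF \<zeta>int[OF that], of "\<lambda>_. real N powr p"] \<zeta>p by (simp add: prob_space)
  have \<beta>: "Lp_bound M p (\<zeta> k j) (\<beta> k j)" if "j < m k" for k j
  proof (rule Lp_boundI)
    have "(\<integral>\<^sup>+\<omega>. ennreal (\<bar>\<zeta> k j \<omega>\<bar> powr p) \<partial>M) = ennreal (\<mu> k j)"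
      unfolding \<mu>_def using \<zeta>int[OF that] by (intro nn_integral_eq_integral) auto
    also have "\<mu> k j = \<beta> k j powr p" using p \<mu>0[of k j] by (simp add: \<beta>_def powr_powr)
    finally show "(\<integral>\<^sup>+\<omega>. ennreal (\<bar>\<zeta> k j \<omega>\<bar> powr p) \<partial>M) \<le> ennreal (\<beta> k j powr p)" by simp
  qed (use \<zeta>M[OF that] in \<open>auto simp: \<beta>_def\<close>)
  define I where "I k \<omega> = (\<Sum>j<m k. \<zeta> k j \<omega> * (W (d k (Suc j)) \<omega> - W (d k j) \<omega>))" for k \<omega>
  define Q where "Q k = (\<Sum>j<m k. (\<beta> k j)\<^sup>2 * (d k (Suc j) - d k j))" for k
  have I_bound: "Lp_bound M p (I k) (sqrt (ito_const p * Q k))" for k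
    unfolding I_def Q_def by (rule simple_sum_bound[OF \<zeta>sd p \<beta>])
  have WM: "W (d k j) \<in> borel_measurable M" if "j \<le> m k" for k j using W_measurable dj that by simp
  have I_meas: "I k \<in> borel_measurable M" for k
    unfolding I_def using \<zeta>M WM by (intro borel_measurable_sum borel_measurable_times borel_measurable_diff) auto
  have I_exp: "(\<integral>\<omega>. I k \<omega> \<partial>M) = 0" for k unfolding I_def by (rule simple_sum_expectation[OF \<zeta>sd])

  define h' where "h' u = indicator {s..t} u * (h u)\<^sup>2" for u
  have h0: "0 \<le> h u" if "u \<in> {s..t}" for u using h(2)[OF that] Lp_bound_nonneg by blast
  have h'int: "integrable L h'" and h'eq: "(\<integral>u. h' u \<partial>L) = (LINT r:{s..t}|lborel. (h r)\<^sup>2)"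
  proof -
    have "set_integrable lborel {s..t} (\<lambda>r. (h r)\<^sup>2)"
      by (intro borel_integrable_atLeastAtMost' continuous_intros h)
    then have i: "integrable lborel (\<lambda>r. indicator {s..t} r *\<^sub>R (h r)\<^sup>2)" unfolding set_integrable_def .
    have eq: "indicator {0..T} u *\<^sub>R h' u = indicator {s..t} u *\<^sub>R (h u)\<^sup>2" for u
      using s t by (auto simp: h'_def indicator_def)
    show "integrable L h'" using i by (subst integrable_restrict_space) (simp_all add: eq del: real_scaleR_def)
    show "(\<integral>u. h' u \<partial>L) = (LINT r:{s..t}|lborel. (h r)\<^sup>2)"
      unfolding set_lebesgue_integral_def by (subst integral_restrict_space) (simp_all add: eq del: real_scaleR_def)
  qed
  have h'0: "0 \<le> h' u" for u by (simp add: h'_def)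
  have Hsec: "(\<lambda>\<omega>. H u \<omega>) \<in> borel_measurable M" if "u \<in> {0..T}" for u
    using measurable_compose[OF measurable_Pair1'[of u L M] Hm] that by simp
  have cell: "\<exists>j<m k. d k j < u \<and> u \<le> d k (Suc j)" if "0 < u" "u \<le> T" for u k
    using grid_cell[of "d k" u "m k"] that d0[of k] dT[of k] by auto
  have \<eta>cell: "\<eta> k j \<omega> = G k u \<omega>" if "j < m k" "d k j < u" "u \<le> d k (Suc j)" for j k u \<omega>
    using grid_sum_cell[OF dlt that, of "\<lambda>j. \<eta> k j \<omega>"] \<eta>G[of k u \<omega>] by (simp add: simple_process_def)
  define \<phi> where "\<phi> k u = (\<Sum>j<m k. (\<beta> k j)\<^sup>2 * indicator {d k j<..d k (Suc j)} u)" for k u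
  have \<phi>int: "integrable L (\<phi> k)" "(\<integral>u. \<phi> k u \<partial>L) = Q k" for k
    unfolding \<phi>_def Q_def using integral_step[OF dlt dran, of k "\<lambda>j. (\<beta> k j)\<^sup>2"] by auto
  have \<phi>cell: "\<phi> k u = (\<beta> k j)\<^sup>2" if "j < m k" "d k j < u" "u \<le> d k (Suc j)" for j k u
    unfolding \<phi>_def by (rule grid_sum_cell[OF dlt that])
  have \<beta>N: "(\<beta> k j)\<^sup>2 \<le> (real N)\<^sup>2" if "j < m k" for j k
  proof -
    have "\<beta> k j \<le> (real N powr p) powr (1 / p)"
      unfolding \<beta>_def using \<mu>0 \<mu>N[OF that] p by (intro powr_mono2) auto
    also have "\<dots> = real N" using p by (simp add: powr_powr)
    finally show ?thesis by (intro power_mono) (auto simp: \<beta>_def)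
  qed
  have AE_pos: "AE u in L. 0 < u"
    using AE_lborel_singleton[of "0::real"] by (subst AE_restrict_space_iff) (auto elim!: eventually_mono)
  \<comment> \<open>Clipping may lose norm, so the limit of \<open>\<phi>\<close> is only known to
    lie below \<open>h'\<close>. The maximum with \<open>h'\<close> has the limit \<open>h'\<close>
    itself.\<close>
  have \<phi>lim: "AE u in L. (\<lambda>k. max (\<phi> (r k) u) (h' u)) \<longlonglongrightarrow> h' u"
    using r(2) AE_pos AE_space
  proof eventually_elim
    case (elim u)
    then have u: "0 < u" "u \<le> T" "u \<in> {0..T}" by auto
    have "\<forall>k. \<exists>j. j < m k \<and> d k j < u \<and> u \<le> d k (Suc j)" using cell[OF u(1,2)] by blast
    from choice[OF this] obtain jj where jj: "\<And>k. jj k < m k" "\<And>k. d k (jj k) < u" "\<And>k. u \<le> d k (Suc (jj k))"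
      by blast
    have \<phi>u: "\<phi> k u = (\<beta> k (jj k))\<^sup>2" for k by (rule \<phi>cell[OF jj])
    show ?case
    proof (cases "s < u \<and> u \<le> t")
      case False
      have "w k (jj k) = 0" for k
      proof (cases "u \<le> s")
        case True then show ?thesis using jj(2)[of k] by (auto simp: w_def)
      next
        case False
        then have "t < u" using \<open>\<not> (s < u \<and> u \<le> t)\<close> by auto
        moreover have "t \<in> D k" by (simp add: D_def)
        ultimately have "\<not> d k (jj k) < t" using noIn[OF jj(1)[of k], of t] jj(3)[of k] by auto
        then show ?thesis by (simp add: w_def)
      qed
      then have "\<mu> k (jj k) = 0" for k by (simp add: \<mu>_def \<zeta>_def)
      then have "\<phi> k u = 0" for k by (simp add: \<phi>u \<beta>_def)
      then show ?thesis using h'0[of u] by (simp add: max_absorb2)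
    next
      case True
      have w1: "w k (jj k) = 1" for k
      proof -
        have "s \<in> D k" by (simp add: D_def)
        then have "\<not> d k (jj k) < s" using noIn[OF jj(1)[of k], of s] jj(3)[of k] True by auto
        then show ?thesis using jj(2)[of k] True by (simp add: w_def)
      qed
      have \<zeta>u: "\<zeta> k (jj k) \<omega> = c (G k u \<omega>) * indicator (B (d k (jj k))) \<omega>" for k \<omega>
        using \<eta>cell[OF jj] by (simp add: \<zeta>_def w1)
      have mesh: "u - T / real (Suc k) \<le> d k (jj k)" for k
      proof -
        \<comment> \<open>The index of the last mesh point strictly below \<open>u\<close>: rounding
          up and subtracting one makes the inequality strict also when \<open>u\<close> is a mesh
          point.\<close>
        define i where "i = nat (\<lceil>u * real (Suc k) / T\<rceil> - 1)"
        have pos: "0 < u * real (Suc k) / T" using u T by simp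
        then have i: "real i = real_of_int \<lceil>u * real (Suc k) / T\<rceil> - 1" unfolding i_def
          by (simp del: of_nat_Suc)
        have i2: "real i < u * real (Suc k) / T" "u * real (Suc k) / T \<le> real i + 1" using i by linarith+
        have "u * real (Suc k) / T \<le> real (Suc k)" using u T by (simp add: field_simps del: of_nat_Suc)
        then have "i \<le> Suc k" using i2 by linarith
        then have iD: "T * real i / real (Suc k) \<in> D k" unfolding D_def by auto
        have lt: "T * real i / real (Suc k) < u" using i2(1) T by (simp add: field_simps del: of_nat_Suc)
        have "\<not> d k (jj k) < T * real i / real (Suc k)"
          using noIn[OF jj(1)[of k] iD] jj(3)[of k] lt by auto
        moreover have "u - T / real (Suc k) \<le> T * real i / real (Suc k)"
        proof -
          have "u * real (Suc k) \<le> T * (real i + 1)"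
            using i2(2) T by (simp add: pos_divide_le_eq mult.commute del: of_nat_Suc)
          then have "u \<le> T * (real i + 1) / real (Suc k)" by (simp add: pos_le_divide_eq del: of_nat_Suc)
          then show ?thesis by (simp add: distrib_left add_divide_distrib del: of_nat_Suc)
        qed
        ultimately show ?thesis by linarith
      qed
      have late: "eventually (\<lambda>k. v \<le> d (r k) (jj (r k))) sequentially" if "v < u" for v
      proof -
        have "(\<lambda>k. u - T * (1 / real (Suc k))) \<longlonglongrightarrow> u - T * 0"
          by (intro tendsto_intros LIMSEQ_Suc[OF lim_1_over_n])
        then have "eventually (\<lambda>k. v < u - T * (1 / real (Suc k))) sequentially"
          using that by (intro order_tendstoD(1)) auto
        then have "eventually (\<lambda>k. v < u - T * (1 / real (Suc (r k)))) sequentially"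
          by (rule eventually_subseq[OF r(1)])
        then show ?thesis
          by (rule eventually_mono) (use mesh in \<open>force intro: less_imp_le less_le_trans\<close>)
      qed
      \<comment> \<open>Inside \<open>B u\<close> monotonicity suffices. Outside, the third property
        of \<open>B\<close> yields an earlier time at which the point has already left.\<close>
      have indlim: "(\<lambda>k. indicator (B (d (r k) (jj (r k)))) \<omega> :: real) \<longlonglongrightarrow> indicator (B u) \<omega>" for \<omega>
      proof (cases "\<omega> \<in> B u")
        case True
        have "\<omega> \<in> B (d k (jj k))" for k
          using B(2)[of "d k (jj k)" u] jj(2)[of k] u dj[of "jj k" k] jj(1)[of k] True by auto
        then show ?thesis using True by simp
      next
        case False
        then obtain v where v: "0 \<le> v" "v < u" "\<omega> \<notin> B v" using B(3)[OF u(1,2)] by blast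
        show ?thesis
        proof (rule tendsto_eventually, rule eventually_mono[OF late[OF v(2)]])
          fix k assume "v \<le> d (r k) (jj (r k))"
          then have "\<omega> \<notin> B (d (r k) (jj (r k)))"
            using B(2)[of v "d (r k) (jj (r k))"] v dj[of "jj (r k)" "r k"] jj(1)[of "r k"] by auto
          then show "indicator (B (d (r k) (jj (r k)))) \<omega> = (indicator (B u) \<omega> :: real)" using False by simp
        qed
      qed
      define \<mu>' where "\<mu>' = (\<integral>\<omega>. \<bar>c (H u \<omega>) * indicator (B u) \<omega>\<bar> powr p \<partial>M)"
      have meas\<mu>: "(\<lambda>\<omega>. \<bar>c (H u \<omega>) * indicator (B u) \<omega>\<bar> powr p) \<in> borel_measurable M"
        using Hsec[OF u(3)] BM[OF u(3)] by measurable
      have "(\<lambda>k. \<mu> (r k) (jj (r k))) \<longlonglongrightarrow> \<mu>'"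
        unfolding \<mu>_def \<mu>'_def
      proof (rule integral_dominated_convergence[where w = "\<lambda>_. real N powr p"])
        show "AE \<omega> in M. (\<lambda>k. \<bar>\<zeta> (r k) (jj (r k)) \<omega>\<bar> powr p) \<longlonglongrightarrow> \<bar>c (H u \<omega>) * indicator (B u) \<omega>\<bar> powr p"
          using elim(1)
        proof eventually_elim
          case (elim \<omega>)
          then show ?case unfolding \<zeta>u using p
            by (intro tendsto_powr2 tendsto_rabs tendsto_mult indlim tendsto_const) auto
        qed
        show "(\<lambda>\<omega>. \<bar>\<zeta> (r k) (jj (r k)) \<omega>\<bar> powr p) \<in> borel_measurable M" for k
          using \<zeta>M[OF jj(1)] by measurable
      qed (use meas\<mu> \<zeta>p in auto)
      then have "(\<lambda>k. (\<mu> (r k) (jj (r k)) powr (1 / p))\<^sup>2) \<longlonglongrightarrow> (\<mu>' powr (1 / p))\<^sup>2"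
        using p \<mu>0 by (intro tendsto_power tendsto_powr2 tendsto_const) auto
      then have l1: "(\<lambda>k. \<phi> (r k) u) \<longlonglongrightarrow> (\<mu>' powr (1 / p))\<^sup>2" by (simp add: \<phi>u \<beta>_def)
      have ut: "u \<in> {s..t}" using True by auto
      have "ennreal \<mu>' = (\<integral>\<^sup>+\<omega>. ennreal (\<bar>c (H u \<omega>) * indicator (B u) \<omega>\<bar> powr p) \<partial>M)"
        unfolding \<mu>'_def
      proof (rule nn_integral_eq_integral[symmetric])
        have "norm (\<bar>c (H u \<omega>) * indicator (B u) \<omega>\<bar> powr p) \<le> real N powr p" for \<omega>
        proof -
          have "\<bar>c (H u \<omega>) * indicator (B u) \<omega>\<bar> \<le> real N" using c(1)[of "H u \<omega>"] by (auto simp: indicator_def)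
          then show ?thesis using p by (auto intro!: powr_mono2)
        qed
        then show "integrable M (\<lambda>\<omega>. \<bar>c (H u \<omega>) * indicator (B u) \<omega>\<bar> powr p)"
          using meas\<mu> by (intro integrable_const_bound[where B = "real N powr p"]) auto
      qed simp
      also have "\<dots> \<le> (\<integral>\<^sup>+\<omega>. ennreal (\<bar>H u \<omega> * indicator (B u) \<omega>\<bar> powr p) \<partial>M)"
      proof (intro nn_integral_mono ennreal_leI powr_mono2)
        fix \<omega> show "\<bar>c (H u \<omega>) * indicator (B u) \<omega>\<bar> \<le> \<bar>H u \<omega> * indicator (B u) \<omega>\<bar>"
          using c(2)[of "H u \<omega>"] by (auto simp: indicator_def)
      qed (use p in auto)
      also have "\<dots> \<le> ennreal (h u powr p)" using Lp_boundD[OF h(2)[OF ut]] p by simp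
      finally have "\<mu>' \<le> h u powr p" by simp
      moreover have "0 \<le> \<mu>'" unfolding \<mu>'_def by (intro integral_nonneg_AE) auto
      ultimately have "\<mu>' powr (1 / p) \<le> (h u powr p) powr (1 / p)" using p by (intro powr_mono2) auto
      also have "\<dots> = h u" using p h0[OF ut] by (simp add: powr_powr)
      finally have "(\<mu>' powr (1 / p))\<^sup>2 \<le> h' u" using ut by (simp add: h'_def power_mono)
      moreover have "(\<lambda>k. max (\<phi> (r k) u) (h' u)) \<longlonglongrightarrow> max ((\<mu>' powr (1 / p))\<^sup>2) (h' u)"
        by (intro tendsto_max l1 tendsto_const)
      ultimately show ?thesis by (simp add: max_absorb2)
    qed
  qed
  have Q_lim: "\<forall>\<^sub>F k in sequentially. Q (r k) < (LINT r:{s..t}|lborel. (h r)\<^sup>2) + e" if e: "0 < e" for e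
  proof -
    have \<phi>m: "\<phi> k \<in> borel_measurable L" for k using \<phi>int(1) by (rule borel_measurable_integrable)
    have "(\<lambda>k. \<integral>u. max (\<phi> (r k) u) (h' u) \<partial>L) \<longlonglongrightarrow> (\<integral>u. h' u \<partial>L)"
    proof (rule integral_dominated_convergence[where w = "\<lambda>u. (real N)\<^sup>2 + h' u"])
      show "integrable L (\<lambda>u. (real N)\<^sup>2 + h' u)" using h'int by auto
      show "AE u in L. norm (max (\<phi> (r k) u) (h' u)) \<le> (real N)\<^sup>2 + h' u" for k
        using AE_pos AE_space
      proof eventually_elim
        case (elim u)
        obtain j where j: "j < m (r k)" "d (r k) j < u" "u \<le> d (r k) (Suc j)" using cell[of u "r k"] elim by auto
        have "\<phi> (r k) u \<le> (real N)\<^sup>2" "0 \<le> \<phi> (r k) u" using \<phi>cell[OF j] \<beta>N[OF j(1)] by auto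
        then show ?case using h'0[of u] by auto
      qed
    qed (use \<phi>lim \<phi>m h'int in \<open>auto intro!: borel_measurable_max\<close>)
    from order_tendstoD(2)[OF this, of "(\<integral>u. h' u \<partial>L) + e"] e
    have "\<forall>\<^sub>F k in sequentially. (\<integral>u. max (\<phi> (r k) u) (h' u) \<partial>L) < (\<integral>u. h' u \<partial>L) + e" by simp
    then show ?thesis
    proof (rule eventually_mono)
      fix k assume *: "(\<integral>u. max (\<phi> (r k) u) (h' u) \<partial>L) < (\<integral>u. h' u \<partial>L) + e"
      have "Q (r k) \<le> (\<integral>u. max (\<phi> (r k) u) (h' u) \<partial>L)"
        unfolding \<phi>int(2)[symmetric] using \<phi>int(1) h'int by (intro integral_mono integrable_max) auto
      then show "Q (r k) < (LINT r:{s..t}|lborel. (h r)\<^sup>2) + e" using * h'eq by simp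
    qed
  qed

  \<comment> \<open>Chosen so that \<open>sqrt (ito_const p * e)\<close> is at most
    \<open>\<epsilon>\<close>; the summand one avoids division by zero.\<close>
  define e where "e = \<epsilon>\<^sup>2 / (ito_const p + 1)"
  have e: "0 < e" using \<epsilon> ito_const_nonneg[of p] by (simp add: e_def add_nonneg_pos)
  define E2 where "E2 k = {\<omega>\<in>space M. ennreal (\<delta> / 4) < (\<integral>\<^sup>+s. ennreal ((G k s \<omega> - H s \<omega>)\<^sup>2) \<partial>L)}" for k
  define E3 where "E3 k v = {\<omega>\<in>space M. \<epsilon> / 4 < \<bar>SI k v \<omega> - J v \<omega>\<bar>}" for k v
  have small: "eventually (\<lambda>k. prob (E2 k) < \<epsilon> / 5) sequentially" "eventually (\<lambda>k. prob (E3 k s) < \<epsilon> / 5) sequentially"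
     "eventually (\<lambda>k. prob (E3 k t) < \<epsilon> / 5) sequentially"
  proof -
    have "(\<lambda>k. prob (E2 k)) \<longlonglongrightarrow> 0" unfolding E2_def G_def by (rule cH) (use \<delta> in simp)
    from order_tendstoD(2)[OF this, of "\<epsilon> / 5"] \<epsilon> show "eventually (\<lambda>k. prob (E2 k) < \<epsilon> / 5) sequentially" by simp
    have "(\<lambda>k. prob (E3 k v)) \<longlonglongrightarrow> 0" if "v \<in> {0..T}" for v
      unfolding E3_def SI_def by (rule cJ) (use \<epsilon> that in auto)
    from order_tendstoD(2)[OF this[OF st(1)], of "\<epsilon> / 5"] order_tendstoD(2)[OF this[OF st(2)], of "\<epsilon> / 5"] \<epsilon>
    show "eventually (\<lambda>k. prob (E3 k s) < \<epsilon> / 5) sequentially" "eventually (\<lambda>k. prob (E3 k t) < \<epsilon> / 5) sequentially"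
      by simp_all
  qed
  have "eventually (\<lambda>k. Q (r k) < (LINT r:{s..t}|lborel. (h r)\<^sup>2) + e \<and> prob (E2 (r k)) < \<epsilon> / 5 \<and> prob (E3 (r k) s) < \<epsilon> / 5 \<and> prob (E3 (r k) t) < \<epsilon> / 5) sequentially"
    using Q_lim[OF e] small[THEN eventually_subseq[OF r(1)]] by eventually_elim auto
  then obtain K where K: "Q K < (LINT r:{s..t}|lborel. (h r)\<^sup>2) + e" "prob (E2 K) < \<epsilon> / 5" "prob (E3 K s) < \<epsilon> / 5" "prob (E3 K t) < \<epsilon> / 5"
    by (auto simp: eventually_sequentially)
  define E1 where "E1 = {\<omega>\<in>space M. ennreal (\<delta> / 4) < (\<integral>\<^sup>+s. ennreal ((max 0 (\<bar>H s \<omega>\<bar> - real N))\<^sup>2) \<partial>L)}"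
  \<comment> \<open>\<open>V\<close> is the quadratic variation of \<open>R\<close>, so
    \<open>simple_sum_small\<close> controls the event \<open>E5\<close>.\<close>
  define R where "R \<omega> = (\<Sum>j<m K. \<rho> K j \<omega> * (W (d K (Suc j)) \<omega> - W (d K j) \<omega>))" for \<omega>
  define V where "V \<omega> = (\<Sum>j<m K. (\<rho> K j \<omega>)\<^sup>2 * (d K (Suc j) - d K j))" for \<omega>
  define E5 where "E5 = {\<omega>\<in>space M. \<epsilon> / 2 < \<bar>R \<omega>\<bar> \<and> V \<omega> \<le> \<delta>}"
  define E where "E = E1 \<union> E2 K \<union> E3 K s \<union> E3 K t \<union> E5"
  have \<rho>M: "\<rho> K j \<in> borel_measurable M" if "j < m K" for j using simple_dataD(4)[OF \<rho>sd that] .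
  have Rm: "R \<in> borel_measurable M" unfolding R_def
    using \<rho>M WM by (intro borel_measurable_sum borel_measurable_times borel_measurable_diff) auto
  have Vm: "V \<in> borel_measurable M" unfolding V_def
    using \<rho>M by (intro borel_measurable_sum borel_measurable_times borel_measurable_power borel_measurable_const) auto
  have SIm: "SI K v \<in> borel_measurable M" if v: "v \<in> {0..T}" for v
  proof -
    have "min (\<tau> K i) v \<in> {0..T}" if "i \<le> n K" for i using simple_dataD(1)[OF sd that] v by auto
    then have "W (min (\<tau> K i) v) \<in> borel_measurable M" if "i \<le> n K" for i using W_measurable that by blast
    then show ?thesis unfolding SI_def simple_integral_def[abs_def] using simple_dataD(4)[OF sd]
      by (intro borel_measurable_sum borel_measurable_times borel_measurable_diff) auto
  qed
  have Hm'[measurable]: "(\<lambda>x. H (snd x) (fst x)) \<in> borel_measurable (M \<Otimes>\<^sub>M L)"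
    using measurable_compose[OF _ Hm, of "\<lambda>x. (snd x, fst x)" "M \<Otimes>\<^sub>M L"] by simp
  have Gm'[measurable]: "(\<lambda>x. G K (snd x) (fst x)) \<in> borel_measurable (M \<Otimes>\<^sub>M L)"
    using measurable_compose[OF _ Gm, of "\<lambda>x. (snd x, fst x)" "M \<Otimes>\<^sub>M L"] by simp
  have E2m: "E2 K \<in> sets M"
  proof -
    have "(\<lambda>\<omega>. \<integral>\<^sup>+s. ennreal ((G K s \<omega> - H s \<omega>)\<^sup>2) \<partial>L) \<in> borel_measurable M"
      by (intro L.borel_measurable_nn_integral) (simp add: case_prod_beta)
    then show ?thesis unfolding E2_def by measurable
  qed
  have E3m: "E3 K v \<in> sets M" if "v \<in> {0..T}" for v
  proof -
    have [measurable]: "SI K v \<in> borel_measurable M" "J v \<in> borel_measurable M" using SIm Jm that by auto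
    show ?thesis unfolding E3_def by measurable
  qed
  have E5m: "E5 \<in> sets M" unfolding E5_def using Rm Vm by measurable
  have Em: "E \<in> sets M" unfolding E_def using N(1) E2m E3m st E5m by (auto simp: E1_def)
  have p5: "prob E5 \<le> \<epsilon> / 5"
  proof -
    have "prob E5 \<le> ito_const 2 * \<delta> / (\<epsilon> / 2)\<^sup>2"
      unfolding E5_def R_def V_def using \<delta> \<epsilon> by (intro simple_sum_small \<rho>sd) auto
    also have "\<dots> \<le> C * \<delta> / (\<epsilon> / 2)\<^sup>2" using C \<delta> by (intro divide_right_mono mult_right_mono) auto
    also have "\<dots> = \<epsilon> / 5" using C \<epsilon> by (simp add: \<delta>_def)
    finally show ?thesis .
  qed
  have pE: "prob E \<le> \<epsilon>"
  proof -
    have "prob E \<le> prob E1 + prob (E2 K) + prob (E3 K s) + prob (E3 K t) + prob E5"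
      unfolding E_def using N(1) E2m E3m[OF st(1)] E3m[OF st(2)] E5m unfolding E1_def
      by (intro order_trans[OF measure_Un_le] add_mono order_refl sets.Un)
    then show ?thesis using N(2) K p5 unfolding E1_def by linarith
  qed
  have close: "\<bar>J t \<omega> - J s \<omega> - I K \<omega>\<bar> \<le> \<epsilon>" if \<omega>: "\<omega> \<in> space M \<inter> B t - E" for \<omega>
  proof -
    \<comment> \<open>At a grid point, stopping keeps each cell entirely or drops it.\<close>
    have stop: "W (min (d K (Suc j)) v) \<omega> - W (min (d K j) v) \<omega> = (if d K j < v then W (d K (Suc j)) \<omega> - W (d K j) \<omega> else 0)"
      if "j < m K" "v \<in> D K" for j v
      using noIn[OF that] dlt[of j K] that by (auto simp: min_absorb1 min_absorb2)
    have SIv: "SI K v \<omega> = (\<Sum>j<m K. \<eta> K j \<omega> * (if d K j < v then W (d K (Suc j)) \<omega> - W (d K j) \<omega> else 0))" if "v \<in> D K" for v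
      unfolding \<eta>SI[symmetric] simple_integral_def using stop that by (intro sum.cong) auto
    have "SI K t \<omega> - SI K s \<omega> - I K \<omega> = R \<omega>"
      unfolding R_def I_def SIv[of t, unfolded D_def, simplified] SIv[of s, unfolded D_def, simplified] sum_subtractf[symmetric]
    proof (rule sum.cong[OF refl])
      fix j assume "j \<in> {..<m K}"
      then have j: "j < m K" by simp
      have "indicator (B (d K j)) \<omega> * w K j = w K j"
        using B(2)[of "d K j" t] dj[of j K] j \<omega> st by (auto simp: w_def indicator_def)
      then have "\<zeta> K j \<omega> = c (\<eta> K j \<omega>) * w K j" by (auto simp: \<zeta>_def)
      then show "\<eta> K j \<omega> * (if d K j < t then W (d K (Suc j)) \<omega> - W (d K j) \<omega> else 0) -
         \<eta> K j \<omega> * (if d K j < s then W (d K (Suc j)) \<omega> - W (d K j) \<omega> else 0) - \<zeta> K j \<omega> * (W (d K (Suc j)) \<omega> - W (d K j) \<omega>)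
         = \<rho> K j \<omega> * (W (d K (Suc j)) \<omega> - W (d K j) \<omega>)"
        using t(1) by (auto simp: \<rho>_def w_def algebra_simps)
    qed
    \<comment> \<open>Off \<open>E1\<close> and \<open>E2 K\<close> the tail of \<open>H\<close> and
      the distance to \<open>H\<close> are at most \<open>\<delta> / 4\<close> each, and each counts
      twice in \<open>clip_remainder_square\<close>.\<close>
    moreover have "V \<omega> \<le> \<delta>"
    proof -
      have Hs[measurable]: "(\<lambda>s. H s \<omega>) \<in> borel_measurable L" "(\<lambda>s. G K s \<omega>) \<in> borel_measurable L"
        using measurable_compose[OF measurable_Pair1'[of \<omega> M L] Hm'] measurable_compose[OF measurable_Pair1'[of \<omega> M L] Gm'] \<omega> by auto
      have "ennreal (V \<omega>) = ennreal (\<integral>u. (\<Sum>j<m K. (\<rho> K j \<omega>)\<^sup>2 * indicator {d K j<..d K (Suc j)} u) \<partial>L)"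
        unfolding V_def by (subst integral_step(1)[OF dlt dran]) auto
      also have "\<dots> = (\<integral>\<^sup>+u. ennreal (\<Sum>j<m K. (\<rho> K j \<omega>)\<^sup>2 * indicator {d K j<..d K (Suc j)} u) \<partial>L)"
        by (intro nn_integral_eq_integral[symmetric] integral_step(2)[OF dlt dran]) (auto intro!: AE_I2 sum_nonneg)
      also have "\<dots> \<le> (\<integral>\<^sup>+u. 2 * ennreal ((G K u \<omega> - H u \<omega>)\<^sup>2) + 2 * ennreal ((max 0 (\<bar>H u \<omega>\<bar> - real N))\<^sup>2) \<partial>L)"
      proof (rule nn_integral_mono_AE)
        show "AE u in L. ennreal (\<Sum>j<m K. (\<rho> K j \<omega>)\<^sup>2 * indicator {d K j<..d K (Suc j)} u) \<le> 2 * ennreal ((G K u \<omega> - H u \<omega>)\<^sup>2) + 2 * ennreal ((max 0 (\<bar>H u \<omega>\<bar> - real N))\<^sup>2)"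
          using AE_pos AE_space
        proof eventually_elim
          case (elim u)
          obtain j where j: "j < m K" "d K j < u" "u \<le> d K (Suc j)" using cell[of u K] elim by auto
          have "(\<Sum>j<m K. (\<rho> K j \<omega>)\<^sup>2 * indicator {d K j<..d K (Suc j)} u) = (\<rho> K j \<omega>)\<^sup>2"
            by (rule grid_sum_cell[OF dlt j])
          also have "\<dots> \<le> (\<eta> K j \<omega> - c (\<eta> K j \<omega>))\<^sup>2" by (auto simp: \<rho>_def w_def)
          also have "\<dots> = (G K u \<omega> - c (G K u \<omega>))\<^sup>2" using \<eta>cell[OF j] by simp
          also have "\<dots> \<le> 2 * (G K u \<omega> - H u \<omega>)\<^sup>2 + 2 * (max 0 (\<bar>H u \<omega>\<bar> - real N))\<^sup>2"
            unfolding c_def by (rule clip_remainder_square) simp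
          finally have "ennreal (\<Sum>j<m K. (\<rho> K j \<omega>)\<^sup>2 * indicator {d K j<..d K (Suc j)} u) \<le> ennreal (2 * (G K u \<omega> - H u \<omega>)\<^sup>2 + 2 * (max 0 (\<bar>H u \<omega>\<bar> - real N))\<^sup>2)"
            by (rule ennreal_leI)
          also have "\<dots> = 2 * ennreal ((G K u \<omega> - H u \<omega>)\<^sup>2) + 2 * ennreal ((max 0 (\<bar>H u \<omega>\<bar> - real N))\<^sup>2)"
            by (simp add: ennreal_plus ennreal_mult)
          finally show ?case .
        qed
      qed
      also have "\<dots> = 2 * (\<integral>\<^sup>+u. ennreal ((G K u \<omega> - H u \<omega>)\<^sup>2) \<partial>L) + 2 * (\<integral>\<^sup>+u. ennreal ((max 0 (\<bar>H u \<omega>\<bar> - real N))\<^sup>2) \<partial>L)"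
        by (subst nn_integral_add) (auto simp: nn_integral_cmult)
      also have "\<dots> \<le> 2 * ennreal (\<delta> / 4) + 2 * ennreal (\<delta> / 4)"
        using \<omega> by (intro add_mono mult_left_mono) (auto simp: E_def E1_def E2_def not_less)
      also have "\<dots> = ennreal (2 * (\<delta> / 4) + 2 * (\<delta> / 4))" using \<delta> by (intro ennreal_twice_add) auto
      also have "2 * (\<delta> / 4) + 2 * (\<delta> / 4) = \<delta>" by simp
      finally show ?thesis using \<delta> by (simp add: ennreal_le_iff)
    qed
    then have "\<bar>R \<omega>\<bar> \<le> \<epsilon> / 2" using \<omega> by (auto simp: E_def E5_def not_less)
    moreover have "\<bar>SI K t \<omega> - J t \<omega>\<bar> \<le> \<epsilon> / 4" "\<bar>SI K s \<omega> - J s \<omega>\<bar> \<le> \<epsilon> / 4"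
      using \<omega> by (auto simp: E_def E3_def not_less)
    ultimately show ?thesis by linarith
  qed
  have "Lp_bound M p (I K) (sqrt (ito_const p * (LINT r:{s..t}|lborel. (h r)\<^sup>2)) + \<epsilon>)"
  proof (rule Lp_bound_weaken[OF I_bound])
    have h2: "0 \<le> (LINT r:{s..t}|lborel. (h r)\<^sup>2)" by (intro set_lebesgue_integral_nonneg) simp
    have "sqrt (ito_const p * Q K) \<le> sqrt (ito_const p * (LINT r:{s..t}|lborel. (h r)\<^sup>2) + ito_const p * e)"
      using mult_left_mono[OF less_imp_le[OF K(1)] ito_const_nonneg[of p]] by (simp add: distrib_left)
    also have "\<dots> \<le> sqrt (ito_const p * (LINT r:{s..t}|lborel. (h r)\<^sup>2)) + sqrt (ito_const p * e)"
      using h2 e ito_const_nonneg[of p] by (intro sqrt_add_le_add_sqrt) auto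
    also have "sqrt (ito_const p * e) \<le> sqrt (\<epsilon>\<^sup>2)"
      using ito_const_nonneg[of p] by (intro real_sqrt_le_mono) (simp add: e_def field_simps)
    also have "\<dots> = \<epsilon>" using \<epsilon> by simp
    finally show "sqrt (ito_const p * Q K) \<le> sqrt (ito_const p * (LINT r:{s..t}|lborel. (h r)\<^sup>2)) + \<epsilon>" by simp
  qed (use p in auto)
  then show ?thesis using I_meas I_exp Em pE close by blast
qed

end

subsection \<open>Moments of stochastic integrals\<close>

context bm_filtration
begin

text \<open>Moments are assumed of the localized integrand alone. The approximating sums carry the
  bound, and on \<open>B t\<close> they are near the increment outside a small event.\<close>

lemma Lp_bound_ito_local:
  assumes lim: "ito_limit H J" and s: "0 \<le> s" and t: "s \<le> t" "t \<le> T" and p: "2 \<le> p"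
    and B: "\<And>r. r \<in> {0..T} \<Longrightarrow> B r \<in> sets (F r)"
      "\<And>r r'. 0 \<le> r \<Longrightarrow> r \<le> r' \<Longrightarrow> r' \<le> T \<Longrightarrow> B r' \<subseteq> B r"
      "\<And>r \<omega>. 0 < r \<Longrightarrow> r \<le> T \<Longrightarrow> (\<And>u. 0 \<le> u \<Longrightarrow> u < r \<Longrightarrow> \<omega> \<in> B u) \<Longrightarrow> \<omega> \<in> B r"
    and h: "continuous_on {s..t} h"
      "\<And>r. r \<in> {s..t} \<Longrightarrow> Lp_bound M p (\<lambda>\<omega>. H r \<omega> * indicator (B r) \<omega>) (h r)"
  shows "Lp_bound M p (\<lambda>\<omega>. (J t \<omega> - J s \<omega>) * indicator (B t) \<omega>) (sqrt (ito_const p * (LINT r:{s..t}|lborel. (h r)\<^sup>2)))"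
proof (rule Lp_bound_limit_in_prob)
  have Bt: "B t \<in> sets M" using B(1)[of t] F[of t] s t by (auto simp: subalgebra_def)
  have [measurable]: "J t \<in> borel_measurable M" "J s \<in> borel_measurable M"
    using lim s t unfolding ito_limit_def by auto
  show "(\<lambda>\<omega>. (J t \<omega> - J s \<omega>) * indicator (B t) \<omega>) \<in> borel_measurable M" using Bt by measurable
  show "0 \<le> sqrt (ito_const p * (LINT r:{s..t}|lborel. (h r)\<^sup>2))"
    using ito_const_nonneg[of p] by (auto intro!: set_lebesgue_integral_nonneg mult_nonneg_nonneg)
  fix \<epsilon> :: real assume \<epsilon>: "0 < \<epsilon>"
  obtain I E where IE: "Lp_bound M p I (sqrt (ito_const p * (LINT r:{s..t}|lborel. (h r)\<^sup>2)) + \<epsilon>)"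
    "E \<in> sets M" "prob E \<le> \<epsilon>" "\<forall>\<omega>\<in>space M \<inter> B t - E. \<bar>J t \<omega> - J s \<omega> - I \<omega>\<bar> \<le> \<epsilon>"
    using ito_limit_approx[OF lim s t p B h \<epsilon>] by blast
  have "Lp_bound M p (\<lambda>\<omega>. I \<omega> * indicator (B t) \<omega>) (sqrt (ito_const p * (LINT r:{s..t}|lborel. (h r)\<^sup>2)) + \<epsilon>)"
    by (rule Lp_bound_mono[OF IE(1)]) (use p in \<open>auto simp: indicator_def\<close>)
  moreover have "AE \<omega> in M. \<omega> \<notin> E \<longrightarrow> \<bar>(J t \<omega> - J s \<omega>) * indicator (B t) \<omega> - I \<omega> * indicator (B t) \<omega>\<bar> \<le> \<epsilon>"
    using IE(4) \<epsilon> by (intro AE_I2) (auto simp: indicator_def)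
  ultimately show "\<exists>I E. Lp_bound M p I (sqrt (ito_const p * (LINT r:{s..t}|lborel. (h r)\<^sup>2)) + \<epsilon>) \<and> E \<in> sets M \<and> prob E \<le> \<epsilon> \<and>
       (AE \<omega> in M. \<omega> \<notin> E \<longrightarrow> \<bar>(J t \<omega> - J s \<omega>) * indicator (B t) \<omega> - I \<omega>\<bar> \<le> \<epsilon>)"
    using IE by blast
qed (use p in auto)

lemma Lp_bound_ito:
  assumes lim: "ito_limit H J" and s: "0 \<le> s" and t: "s \<le> t" "t \<le> T" and p: "2 \<le> p"
    and h: "continuous_on {s..t} h" "\<And>r. r \<in> {s..t} \<Longrightarrow> Lp_bound M p (H r) (h r)"
  shows "Lp_bound M p (\<lambda>\<omega>. J t \<omega> - J s \<omega>) (sqrt (ito_const p * (LINT r:{s..t}|lborel. (h r)\<^sup>2)))"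
proof -
  have "Lp_bound M p (\<lambda>\<omega>. (J t \<omega> - J s \<omega>) * indicator (space M) \<omega>) (sqrt (ito_const p * (LINT r:{s..t}|lborel. (h r)\<^sup>2)))"
  proof (rule Lp_bound_ito_local[OF lim s t p])
    show "space M \<in> sets (F r)" if "r \<in> {0..T}" for r using space_F[OF that] sets.top[of "F r"] by simp
    show "Lp_bound M p (\<lambda>\<omega>. H r \<omega> * indicator (space M) \<omega>) (h r)" if "r \<in> {s..t}" for r
      by (rule Lp_bound_mono[OF h(2)[OF that]]) (use p in \<open>auto simp: indicator_def\<close>)
    show "\<omega> \<in> space M" if "0 < r" "\<And>u. 0 \<le> u \<Longrightarrow> u < r \<Longrightarrow> \<omega> \<in> space M" for r :: real and \<omega>
      using that(2)[of 0] that(1) by simp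
  qed (use h in auto)
  then show ?thesis by (rule Lp_bound_mono) (use p in \<open>auto intro!: AE_I2\<close>)
qed

text \<open>The approximating sums have mean zero, and the bound in L^2 lets means pass to the limit
  in probability.\<close>

lemma ito_limit_expectation:
  assumes lim: "ito_limit H J" and s: "0 \<le> s" and t: "s \<le> t" "t \<le> T"
    and h: "continuous_on {s..t} h" "\<And>r. r \<in> {s..t} \<Longrightarrow> Lp_bound M 2 (H r) (h r)"
  shows "integrable M (\<lambda>\<omega>. J t \<omega> - J s \<omega>)" "(\<integral>\<omega>. J t \<omega> - J s \<omega> \<partial>M) = 0"
proof -
  define a where "a = sqrt (ito_const 2 * (LINT r:{s..t}|lborel. (h r)\<^sup>2))"
  define X where "X \<omega> = J t \<omega> - J s \<omega>" for \<omega>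
  have [measurable]: "J t \<in> borel_measurable M" "J s \<in> borel_measurable M"
    using lim s t unfolding ito_limit_def by auto
  have Xm[measurable]: "X \<in> borel_measurable M" unfolding X_def by measurable
  have X: "Lp_bound M 2 X a" unfolding X_def a_def by (rule Lp_bound_ito[OF lim s t _ h]) auto
  have Xi: "integrable M X" using Lp_bound_integral(1)[OF X] by simp
  have a0: "0 \<le> a" using X Lp_bound_nonneg by blast
  have le: "\<bar>\<integral>\<omega>. X \<omega> \<partial>M\<bar> \<le> \<epsilon> + sqrt \<epsilon> * (2 * a + \<epsilon>)\<^sup>2 + sqrt \<epsilon> / 4" if \<epsilon>: "0 < \<epsilon>" for \<epsilon>
  proof -
    have "\<exists>I E. I \<in> borel_measurable M \<and> Lp_bound M 2 I (a + \<epsilon>) \<and>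
     (\<integral>\<omega>. I \<omega> \<partial>M) = 0 \<and> E \<in> sets M \<and> prob E \<le> \<epsilon> \<and>
     (\<forall>\<omega>\<in>space M \<inter> space M - E. \<bar>J t \<omega> - J s \<omega> - I \<omega>\<bar> \<le> \<epsilon>)"
      unfolding a_def
    proof (rule ito_limit_approx[OF lim s t, where B = "\<lambda>_. space M"])
      show "space M \<in> sets (F r)" if "r \<in> {0..T}" for r using space_F[OF that] sets.top[of "F r"] by simp
      show "Lp_bound M 2 (\<lambda>\<omega>. H r \<omega> * indicator (space M) \<omega>) (h r)" if "r \<in> {s..t}" for r
        by (rule Lp_bound_mono[OF h(2)[OF that]]) (auto simp: indicator_def)
      show "\<omega> \<in> space M" if "0 < r" "\<And>u. 0 \<le> u \<Longrightarrow> u < r \<Longrightarrow> \<omega> \<in> space M" for r :: real and \<omega>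
        using that(2)[of 0] that(1) by simp
    qed (use h \<epsilon> in auto)
    then obtain I E where IE: "I \<in> borel_measurable M" "Lp_bound M 2 I (a + \<epsilon>)" "(\<integral>\<omega>. I \<omega> \<partial>M) = 0"
      "E \<in> sets M" "prob E \<le> \<epsilon>" "\<forall>\<omega>\<in>space M - E. \<bar>X \<omega> - I \<omega>\<bar> \<le> \<epsilon>"
      unfolding X_def by auto
    note [measurable] = IE(1) IE(4)
    have Ii: "integrable M I" using Lp_bound_integral(1)[OF IE(2)] by simp
    define D where "D \<omega> = X \<omega> + (-1) * I \<omega>" for \<omega>
    have Dm: "D \<in> borel_measurable M" unfolding D_def by measurable
    have "Lp_bound M 2 D (a + \<bar>-1\<bar> * (a + \<epsilon>))" unfolding D_def
      by (intro Lp_bound_add X Lp_bound_cmult IE) auto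
    then have "Lp_bound M (2 / 2) (\<lambda>\<omega>. (D \<omega>)\<^sup>2) ((2 * a + \<epsilon>)\<^sup>2)"
      using Lp_bound_square[OF _ Dm, of 2] by simp
    from Lp_bound_integral[OF this] have D2: "integrable M (\<lambda>\<omega>. (D \<omega>)\<^sup>2)" "(\<integral>\<omega>. (D \<omega>)\<^sup>2 \<partial>M) \<le> (2 * a + \<epsilon>)\<^sup>2"
      using Dm by auto
    \<comment> \<open>On \<open>E\<close> a square with weight \<open>sqrt \<epsilon>\<close> is
      completed. The constant \<open>1 / (4 * sqrt \<epsilon>)\<close> is integrated over an event
      of probability at most \<open>\<epsilon>\<close>, so every term vanishes with
      \<open>\<epsilon>\<close>.\<close>
    have pt: "\<bar>D \<omega>\<bar> \<le> \<epsilon> + sqrt \<epsilon> * (D \<omega>)\<^sup>2 + indicator E \<omega> / (4 * sqrt \<epsilon>)" if "\<omega> \<in> space M" for \<omega>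
    proof (cases "\<omega> \<in> E")
      case True
      have "0 \<le> sqrt \<epsilon> * (\<bar>D \<omega>\<bar> - 1 / (2 * sqrt \<epsilon>))\<^sup>2" using \<epsilon> by simp
      also have "\<dots> = sqrt \<epsilon> * (D \<omega>)\<^sup>2 - \<bar>D \<omega>\<bar> + 1 / (4 * sqrt \<epsilon>)"
        using \<epsilon> by (simp add: power2_eq_square field_simps)
      finally show ?thesis using True \<epsilon> by simp
    next
      case False
      then have "\<bar>D \<omega>\<bar> \<le> \<epsilon>" using IE(6) that by (simp add: D_def)
      then show ?thesis using False \<epsilon> by (simp add: add_increasing2)
    qed
    have "\<bar>\<integral>\<omega>. X \<omega> \<partial>M\<bar> = \<bar>\<integral>\<omega>. D \<omega> \<partial>M\<bar>" unfolding D_def using Xi Ii IE(3) by simp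
    also have "\<dots> \<le> (\<integral>\<omega>. \<bar>D \<omega>\<bar> \<partial>M)" by (rule integral_abs_bound)
    also have "\<dots> \<le> (\<integral>\<omega>. \<epsilon> + sqrt \<epsilon> * (D \<omega>)\<^sup>2 + indicator E \<omega> / (4 * sqrt \<epsilon>) \<partial>M)"
      using pt D2 Xi Ii IE(4) unfolding D_def
      by (intro integral_mono) (auto intro!: Bochner_Integration.integrable_add integrable_real_indicator simp: emeasure_eq_measure)
    also have "\<dots> = \<epsilon> + sqrt \<epsilon> * (\<integral>\<omega>. (D \<omega>)\<^sup>2 \<partial>M) + prob E / (4 * sqrt \<epsilon>)"
      using D2 IE(4) by (subst Bochner_Integration.integral_add) (auto simp: prob_space integrable_real_indicator emeasure_eq_measure)
    also have "\<dots> \<le> \<epsilon> + sqrt \<epsilon> * (2 * a + \<epsilon>)\<^sup>2 + \<epsilon> / (4 * sqrt \<epsilon>)"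
      using D2 IE(5) \<epsilon> by (intro add_mono mult_left_mono divide_right_mono) auto
    also have "\<epsilon> / (4 * sqrt \<epsilon>) = sqrt \<epsilon> / 4" using \<epsilon> by (simp add: real_div_sqrt field_simps)
    finally show ?thesis .
  qed
  have "((\<lambda>\<epsilon>. \<epsilon> + sqrt \<epsilon> * (2 * a + \<epsilon>)\<^sup>2 + sqrt \<epsilon> / 4) \<longlongrightarrow> 0 + sqrt 0 * (2 * a + 0)\<^sup>2 + sqrt 0 / 4) (at_right 0)"
    by (intro tendsto_intros) simp
  then have "\<bar>\<integral>\<omega>. X \<omega> \<partial>M\<bar> \<le> 0 + sqrt 0 * (2 * a + 0)\<^sup>2 + sqrt 0 / 4"
    by (rule tendsto_lowerbound) (auto intro: eventually_mono[OF eventually_at_right_less] le)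
  then show "(\<integral>\<omega>. J t \<omega> - J s \<omega> \<partial>M) = 0" by (simp add: X_def)
  show "integrable M (\<lambda>\<omega>. J t \<omega> - J s \<omega>)" using Xi by (simp add: X_def[abs_def])
qed

section \<open>Differences and special cases of limit integrals\<close>

lemma nn_integral_L_measurable:
  assumes "(\<lambda>x. f (fst x) (snd x)) \<in> borel_measurable (L \<Otimes>\<^sub>M M)"
  shows "(\<lambda>\<omega>. \<integral>\<^sup>+s. ennreal ((f s \<omega>)\<^sup>2) \<partial>L) \<in> borel_measurable M"
proof -
  interpret L: finite_measure L by (rule finite_measure_L)
  have [measurable]: "(\<lambda>x. f (snd x) (fst x)) \<in> borel_measurable (M \<Otimes>\<^sub>M L)"
    using measurable_compose[OF _ assms, of "\<lambda>x. (snd x, fst x)" "M \<Otimes>\<^sub>M L"] by simp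
  show ?thesis by (intro L.borel_measurable_nn_integral) (simp add: case_prod_beta)
qed

lemma simple_integral_measurable:
  assumes "simple_data M F T n \<tau> \<xi>" "v \<in> {0..T}"
  shows "simple_integral W n \<tau> \<xi> v \<in> borel_measurable M"
proof -
  have "min (\<tau> i) v \<in> {0..T}" if "i \<le> n" for i using simple_dataD(1)[OF assms(1) that] assms(2) by auto
  then have "W (min (\<tau> i) v) \<in> borel_measurable M" if "i \<le> n" for i using W_measurable that by blast
  then show ?thesis unfolding simple_integral_def[abs_def] using simple_dataD(4)[OF assms(1)]
    by (intro borel_measurable_sum borel_measurable_times borel_measurable_diff) auto
qed

text \<open>Both processes are rewritten on the union of their grids, where the coefficients can be
  subtracted.\<close>

lemma simple_data_diff:
  assumes sd: "simple_data M F T n1 \<tau>1 \<xi>1" "simple_data M F T n2 \<tau>2 \<xi>2"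
  obtains m d \<eta> where "simple_data M F T m d \<eta>"
    "\<And>u \<omega>. simple_process m d \<eta> u \<omega> = simple_process n1 \<tau>1 \<xi>1 u \<omega> - simple_process n2 \<tau>2 \<xi>2 u \<omega>"
    "\<And>u \<omega>. simple_integral W m d \<eta> u \<omega> = simple_integral W n1 \<tau>1 \<xi>1 u \<omega> - simple_integral W n2 \<tau>2 \<xi>2 u \<omega>"
proof -
  define D where "D = \<tau>1 ` {..n1} \<union> \<tau>2 ` {..n2} \<union> {0, T}"
  have "finite D" "0 \<in> D" "T \<in> D" "D \<subseteq> {0..T}"
    using simple_dataD(1)[OF sd(1)] simple_dataD(1)[OF sd(2)] T by (auto simp: D_def)
  from finite_grid[OF this] obtain m d where d: "d ` {..m} = D" "\<And>j. j < m \<Longrightarrow> d j < d (Suc j)"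
      "d 0 = 0" "d m = T" by blast
  have sub: "\<tau>1 ` {..n1} \<subseteq> d ` {..m}" "\<tau>2 ` {..n2} \<subseteq> d ` {..m}" "d ` {..m} \<subseteq> {0..T}"
    using d(1) \<open>D \<subseteq> {0..T}\<close> by (auto simp: D_def)
  define \<eta>1 where "\<eta>1 j = simple_process n1 \<tau>1 \<xi>1 (d (Suc j))" for j
  define \<eta>2 where "\<eta>2 j = simple_process n2 \<tau>2 \<xi>2 (d (Suc j))" for j
  note r1 = simple_data_refine[OF sd(1) d(2) sub(1,3), folded \<eta>1_def]
  note r2 = simple_data_refine[OF sd(2) d(2) sub(2,3), folded \<eta>2_def]
  have "simple_data M F T m d (\<lambda>j \<omega>. \<eta>1 j \<omega> - \<eta>2 j \<omega>)" unfolding simple_data_def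
  proof (intro conjI allI impI)
    fix j assume j: "j < m"
    show "(\<lambda>\<omega>. \<eta>1 j \<omega> - \<eta>2 j \<omega>) \<in> borel_measurable (F (d j))"
      using simple_dataD(3)[OF r1(1) j] simple_dataD(3)[OF r2(1) j] by measurable
    obtain c1 where c1: "\<forall>\<omega>\<in>space M. \<bar>\<eta>1 j \<omega>\<bar> \<le> c1" using r1(1)[unfolded simple_data_def] j by blast
    obtain c2 where c2: "\<forall>\<omega>\<in>space M. \<bar>\<eta>2 j \<omega>\<bar> \<le> c2" using r2(1)[unfolded simple_data_def] j by blast
    have "\<bar>\<eta>1 j \<omega> - \<eta>2 j \<omega>\<bar> \<le> c1 + c2" if "\<omega> \<in> space M" for \<omega>
      using bspec[OF c1 that] bspec[OF c2 that] by linarith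
    then show "\<exists>c. \<forall>\<omega>\<in>space M. \<bar>\<eta>1 j \<omega> - \<eta>2 j \<omega>\<bar> \<le> c" by blast
  qed (use r1(1) in \<open>auto simp: simple_data_def\<close>)
  then show ?thesis
  proof (rule that)
    fix u \<omega>
    have "simple_process m d (\<lambda>j \<omega>. \<eta>1 j \<omega> - \<eta>2 j \<omega>) u \<omega> = simple_process m d \<eta>1 u \<omega> - simple_process m d \<eta>2 u \<omega>"
      by (simp only: simple_process_def sum_subtractf left_diff_distrib)
    then show "simple_process m d (\<lambda>j \<omega>. \<eta>1 j \<omega> - \<eta>2 j \<omega>) u \<omega> = simple_process n1 \<tau>1 \<xi>1 u \<omega> - simple_process n2 \<tau>2 \<xi>2 u \<omega>"
      by (simp only: r1(2) r2(2))
    have "simple_integral W m d (\<lambda>j \<omega>. \<eta>1 j \<omega> - \<eta>2 j \<omega>) u \<omega> = simple_integral W m d \<eta>1 u \<omega> - simple_integral W m d \<eta>2 u \<omega>"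
      by (simp only: simple_integral_def sum_subtractf left_diff_distrib)
    then show "simple_integral W m d (\<lambda>j \<omega>. \<eta>1 j \<omega> - \<eta>2 j \<omega>) u \<omega> = simple_integral W n1 \<tau>1 \<xi>1 u \<omega> - simple_integral W n2 \<tau>2 \<xi>2 u \<omega>"
      by (simp only: r1(3) r2(3))
  qed
qed

lemma tendsto_prob_union:
  assumes "(\<lambda>k. prob (A k)) \<longlonglongrightarrow> 0" "(\<lambda>k. prob (B k)) \<longlonglongrightarrow> 0"
    and "\<And>k. A k \<in> sets M" "\<And>k. B k \<in> sets M" "\<And>k. C k \<subseteq> A k \<union> B k"
  shows "(\<lambda>k. prob (C k)) \<longlonglongrightarrow> 0"
proof (rule tendsto_sandwich[where f = "\<lambda>_. 0"])
  show "(\<lambda>k. prob (A k) + prob (B k)) \<longlonglongrightarrow> 0" using tendsto_add[OF assms(1,2)] by simp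
  show "\<forall>\<^sub>F k in sequentially. prob (C k) \<le> prob (A k) + prob (B k)"
  proof (rule always_eventually, rule allI)
    fix k
    have "prob (C k) \<le> prob (A k \<union> B k)" using assms by (intro finite_measure_mono) auto
    also have "\<dots> \<le> prob (A k) + prob (B k)" using assms by (intro measure_Un_le)
    finally show "prob (C k) \<le> prob (A k) + prob (B k)" .
  qed
qed auto

lemma nn_integral_square_diff_le:
  fixes f g :: "real \<Rightarrow> real"
  assumes [measurable]: "f \<in> borel_measurable A" "g \<in> borel_measurable A"
  shows "(\<integral>\<^sup>+s. ennreal ((f s - g s)\<^sup>2) \<partial>A) \<le> 2 * (\<integral>\<^sup>+s. ennreal ((f s)\<^sup>2) \<partial>A) + 2 * (\<integral>\<^sup>+s. ennreal ((g s)\<^sup>2) \<partial>A)"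
proof -
  have "(x - y)\<^sup>2 \<le> 2 * x\<^sup>2 + 2 * y\<^sup>2" for x y :: real
    using sum_squares_bound[of x "- y"] by (simp add: power2_diff)
  then have "(\<integral>\<^sup>+s. ennreal ((f s - g s)\<^sup>2) \<partial>A) \<le> (\<integral>\<^sup>+s. 2 * ennreal ((f s)\<^sup>2) + 2 * ennreal ((g s)\<^sup>2) \<partial>A)"
    by (intro nn_integral_mono) (simp only: ennreal_twice_add zero_le_power2 ennreal_leI)
  then show ?thesis by (simp add: nn_integral_add nn_integral_cmult)
qed

lemma section_measurable:
  assumes "(\<lambda>x. f (fst x) (snd x)) \<in> borel_measurable (L \<Otimes>\<^sub>M M)"
  shows "\<omega> \<in> space M \<Longrightarrow> (\<lambda>s. f s \<omega>) \<in> borel_measurable L"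
    "s \<in> {0..T} \<Longrightarrow> (\<lambda>\<omega>. f s \<omega>) \<in> borel_measurable M"
  using measurable_compose[OF measurable_Pair2'[of \<omega> M L] assms] measurable_compose[OF measurable_Pair1'[of s L M] assms]
  by simp_all

text \<open>Equations with the same noise are compared through this, and uniqueness of the integral
  follows from it.\<close>

lemma ito_limit_diff:
  assumes "ito_limit H1 J1" "ito_limit H2 J2"
  shows "ito_limit (\<lambda>s \<omega>. H1 s \<omega> - H2 s \<omega>) (\<lambda>t \<omega>. J1 t \<omega> - J2 t \<omega>)"
proof -
  obtain n1 \<tau>1 \<xi>1 where H1[measurable]: "(\<lambda>x. H1 (fst x) (snd x)) \<in> borel_measurable (L \<Otimes>\<^sub>M M)"
    and J1: "\<And>t. t \<in> {0..T} \<Longrightarrow> J1 t \<in> borel_measurable M"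
    and f1: "AE \<omega> in M. (\<integral>\<^sup>+s. ennreal ((H1 s \<omega>)\<^sup>2) \<partial>L) < \<infinity>"
    and s1: "\<And>k. simple_data M F T (n1 k) (\<tau>1 k) (\<xi>1 k)"
    and c1: "\<And>\<epsilon>. \<epsilon> > 0 \<Longrightarrow> (\<lambda>k. prob {\<omega>\<in>space M. ennreal \<epsilon> < (\<integral>\<^sup>+s. ennreal ((simple_process (n1 k) (\<tau>1 k) (\<xi>1 k) s \<omega> - H1 s \<omega>)\<^sup>2) \<partial>L)}) \<longlonglongrightarrow> 0"
    and d1: "\<And>t \<epsilon>. t \<in> {0..T} \<Longrightarrow> \<epsilon> > 0 \<Longrightarrow> (\<lambda>k. prob {\<omega>\<in>space M. \<epsilon> < \<bar>simple_integral W (n1 k) (\<tau>1 k) (\<xi>1 k) t \<omega> - J1 t \<omega>\<bar>}) \<longlonglongrightarrow> 0"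
    using assms(1) unfolding ito_limit_def by blast
  obtain n2 \<tau>2 \<xi>2 where H2[measurable]: "(\<lambda>x. H2 (fst x) (snd x)) \<in> borel_measurable (L \<Otimes>\<^sub>M M)"
    and J2: "\<And>t. t \<in> {0..T} \<Longrightarrow> J2 t \<in> borel_measurable M"
    and f2: "AE \<omega> in M. (\<integral>\<^sup>+s. ennreal ((H2 s \<omega>)\<^sup>2) \<partial>L) < \<infinity>"
    and s2: "\<And>k. simple_data M F T (n2 k) (\<tau>2 k) (\<xi>2 k)"
    and c2: "\<And>\<epsilon>. \<epsilon> > 0 \<Longrightarrow> (\<lambda>k. prob {\<omega>\<in>space M. ennreal \<epsilon> < (\<integral>\<^sup>+s. ennreal ((simple_process (n2 k) (\<tau>2 k) (\<xi>2 k) s \<omega> - H2 s \<omega>)\<^sup>2) \<partial>L)}) \<longlonglongrightarrow> 0"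
    and d2: "\<And>t \<epsilon>. t \<in> {0..T} \<Longrightarrow> \<epsilon> > 0 \<Longrightarrow> (\<lambda>k. prob {\<omega>\<in>space M. \<epsilon> < \<bar>simple_integral W (n2 k) (\<tau>2 k) (\<xi>2 k) t \<omega> - J2 t \<omega>\<bar>}) \<longlonglongrightarrow> 0"
    using assms(2) unfolding ito_limit_def by blast
  define G1 where "G1 k = simple_process (n1 k) (\<tau>1 k) (\<xi>1 k)" for k
  define G2 where "G2 k = simple_process (n2 k) (\<tau>2 k) (\<xi>2 k)" for k
  have [measurable]: "(\<lambda>x. G1 k (fst x) (snd x)) \<in> borel_measurable (L \<Otimes>\<^sub>M M)" "(\<lambda>x. G2 k (fst x) (snd x)) \<in> borel_measurable (L \<Otimes>\<^sub>M M)" for k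
    unfolding G1_def G2_def using simple_process_measurable s1 s2 by auto
  define P where "P k x \<longleftrightarrow> (case x of (m, d, \<eta>) \<Rightarrow> simple_data M F T m d \<eta> \<and>
    (\<forall>u \<omega>. simple_process m d \<eta> u \<omega> = G1 k u \<omega> - G2 k u \<omega>) \<and>
    (\<forall>u \<omega>. simple_integral W m d \<eta> u \<omega> = simple_integral W (n1 k) (\<tau>1 k) (\<xi>1 k) u \<omega> - simple_integral W (n2 k) (\<tau>2 k) (\<xi>2 k) u \<omega>))" for k x
  have "\<forall>k. \<exists>x. P k x"
  proof
    fix k
    from simple_data_diff[OF s1[of k] s2[of k]] obtain m d \<eta> where "simple_data M F T m d \<eta>"
      "\<And>u \<omega>. simple_process m d \<eta> u \<omega> = G1 k u \<omega> - G2 k u \<omega>"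
      "\<And>u \<omega>. simple_integral W m d \<eta> u \<omega> = simple_integral W (n1 k) (\<tau>1 k) (\<xi>1 k) u \<omega> - simple_integral W (n2 k) (\<tau>2 k) (\<xi>2 k) u \<omega>"
      unfolding G1_def G2_def by blast
    then have "P k (m, d, \<eta>)" by (simp add: P_def)
    then show "\<exists>x. P k x" by blast
  qed
  from choice[OF this] obtain x where x: "\<And>k. P k (x k)" by blast
  define n where "n k = fst (x k)" for k
  define \<tau> where "\<tau> k = fst (snd (x k))" for k
  define \<xi> where "\<xi> k = snd (snd (x k))" for k
  have sd: "simple_data M F T (n k) (\<tau> k) (\<xi> k)"
    and sp: "simple_process (n k) (\<tau> k) (\<xi> k) u \<omega> = G1 k u \<omega> - G2 k u \<omega>"
    and si: "simple_integral W (n k) (\<tau> k) (\<xi> k) u \<omega> = simple_integral W (n1 k) (\<tau>1 k) (\<xi>1 k) u \<omega> - simple_integral W (n2 k) (\<tau>2 k) (\<xi>2 k) u \<omega>" for k u \<omega>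
    using x[of k] unfolding P_def n_def \<tau>_def \<xi>_def by (auto split: prod.splits)
  show ?thesis unfolding ito_limit_def
  proof (intro conjI exI allI ballI impI)
    show "(\<lambda>x. H1 (fst x) (snd x) - H2 (fst x) (snd x)) \<in> borel_measurable (L \<Otimes>\<^sub>M M)" by measurable
    show "(\<lambda>\<omega>. J1 t \<omega> - J2 t \<omega>) \<in> borel_measurable M" if "t \<in> {0..T}" for t
      using J1[OF that] J2[OF that] by measurable
    show "AE \<omega> in M. (\<integral>\<^sup>+s. ennreal ((H1 s \<omega> - H2 s \<omega>)\<^sup>2) \<partial>L) < \<infinity>"
      using f1 f2 AE_space
    proof eventually_elim
      case (elim \<omega>)
      have "(\<integral>\<^sup>+s. ennreal ((H1 s \<omega> - H2 s \<omega>)\<^sup>2) \<partial>L) \<le> 2 * (\<integral>\<^sup>+s. ennreal ((H1 s \<omega>)\<^sup>2) \<partial>L) + 2 * (\<integral>\<^sup>+s. ennreal ((H2 s \<omega>)\<^sup>2) \<partial>L)"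
        by (intro nn_integral_square_diff_le section_measurable(1) H1 H2 elim)
      also have "\<dots> < \<infinity>" using elim by (simp add: ennreal_mult_eq_top_iff less_top[symmetric])
      finally show ?case .
    qed
    show "simple_data M F T (n k) (\<tau> k) (\<xi> k)" for k by (rule sd)
    fix \<epsilon> :: real assume \<epsilon>: "0 < \<epsilon>"
    let ?A = "\<lambda>k. {\<omega>\<in>space M. ennreal (\<epsilon> / 4) < (\<integral>\<^sup>+s. ennreal ((G1 k s \<omega> - H1 s \<omega>)\<^sup>2) \<partial>L)}"
    let ?B = "\<lambda>k. {\<omega>\<in>space M. ennreal (\<epsilon> / 4) < (\<integral>\<^sup>+s. ennreal ((G2 k s \<omega> - H2 s \<omega>)\<^sup>2) \<partial>L)}"
    show "(\<lambda>k. prob {\<omega>\<in>space M. ennreal \<epsilon> < (\<integral>\<^sup>+s. ennreal ((simple_process (n k) (\<tau> k) (\<xi> k) s \<omega> - (H1 s \<omega> - H2 s \<omega>))\<^sup>2) \<partial>L)}) \<longlonglongrightarrow> 0"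
    proof (rule tendsto_prob_union[where A = ?A and B = ?B])
      show "(\<lambda>k. prob (?A k)) \<longlonglongrightarrow> 0" unfolding G1_def by (rule c1) (use \<epsilon> in simp)
      show "(\<lambda>k. prob (?B k)) \<longlonglongrightarrow> 0" unfolding G2_def by (rule c2) (use \<epsilon> in simp)
      fix k
      have [measurable]: "(\<lambda>\<omega>. \<integral>\<^sup>+s. ennreal ((G1 k s \<omega> - H1 s \<omega>)\<^sup>2) \<partial>L) \<in> borel_measurable M"
         "(\<lambda>\<omega>. \<integral>\<^sup>+s. ennreal ((G2 k s \<omega> - H2 s \<omega>)\<^sup>2) \<partial>L) \<in> borel_measurable M"
        by (rule nn_integral_L_measurable, measurable)+
      show "?A k \<in> sets M" "?B k \<in> sets M" by measurable
      show "{\<omega>\<in>space M. ennreal \<epsilon> < (\<integral>\<^sup>+s. ennreal ((simple_process (n k) (\<tau> k) (\<xi> k) s \<omega> - (H1 s \<omega> - H2 s \<omega>))\<^sup>2) \<partial>L)} \<subseteq> ?A k \<union> ?B k"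
      proof (rule subsetI, rule ccontr)
        fix \<omega> assume \<omega>: "\<omega> \<in> {\<omega>\<in>space M. ennreal \<epsilon> < (\<integral>\<^sup>+s. ennreal ((simple_process (n k) (\<tau> k) (\<xi> k) s \<omega> - (H1 s \<omega> - H2 s \<omega>))\<^sup>2) \<partial>L)}"
          and n: "\<omega> \<notin> ?A k \<union> ?B k"
        have "(\<integral>\<^sup>+s. ennreal ((simple_process (n k) (\<tau> k) (\<xi> k) s \<omega> - (H1 s \<omega> - H2 s \<omega>))\<^sup>2) \<partial>L)
           = (\<integral>\<^sup>+s. ennreal (((G1 k s \<omega> - H1 s \<omega>) - (G2 k s \<omega> - H2 s \<omega>))\<^sup>2) \<partial>L)"
          by (simp add: sp algebra_simps)
        also have "\<dots> \<le> 2 * (\<integral>\<^sup>+s. ennreal ((G1 k s \<omega> - H1 s \<omega>)\<^sup>2) \<partial>L) + 2 * (\<integral>\<^sup>+s. ennreal ((G2 k s \<omega> - H2 s \<omega>)\<^sup>2) \<partial>L)"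
        proof (rule nn_integral_square_diff_le)
          have w: "\<omega> \<in> space M" using \<omega> by simp
          show "(\<lambda>s. G1 k s \<omega> - H1 s \<omega>) \<in> borel_measurable L"
            by (rule section_measurable(1)[where f = "\<lambda>s \<omega>. G1 k s \<omega> - H1 s \<omega>", OF _ w]) measurable
          show "(\<lambda>s. G2 k s \<omega> - H2 s \<omega>) \<in> borel_measurable L"
            by (rule section_measurable(1)[where f = "\<lambda>s \<omega>. G2 k s \<omega> - H2 s \<omega>", OF _ w]) measurable
        qed
        also have "\<dots> \<le> 2 * ennreal (\<epsilon> / 4) + 2 * ennreal (\<epsilon> / 4)"
          using n \<omega> by (intro add_mono mult_left_mono) (auto simp: not_less)
        also have "\<dots> = ennreal (2 * (\<epsilon> / 4) + 2 * (\<epsilon> / 4))" using \<epsilon> by (intro ennreal_twice_add) auto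
        also have "2 * (\<epsilon> / 4) + 2 * (\<epsilon> / 4) = \<epsilon>" by simp
        finally show False using \<omega> by (auto dest: leD)
      qed
    qed
  next
    fix t \<epsilon> :: real assume t: "t \<in> {0..T}" and \<epsilon>: "0 < \<epsilon>"
    let ?A = "\<lambda>k. {\<omega>\<in>space M. \<epsilon> / 2 < \<bar>simple_integral W (n1 k) (\<tau>1 k) (\<xi>1 k) t \<omega> - J1 t \<omega>\<bar>}"
    let ?B = "\<lambda>k. {\<omega>\<in>space M. \<epsilon> / 2 < \<bar>simple_integral W (n2 k) (\<tau>2 k) (\<xi>2 k) t \<omega> - J2 t \<omega>\<bar>}"
    show "(\<lambda>k. prob {\<omega>\<in>space M. \<epsilon> < \<bar>simple_integral W (n k) (\<tau> k) (\<xi> k) t \<omega> - (J1 t \<omega> - J2 t \<omega>)\<bar>}) \<longlonglongrightarrow> 0"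
    proof (rule tendsto_prob_union[where A = ?A and B = ?B])
      show "(\<lambda>k. prob (?A k)) \<longlonglongrightarrow> 0" by (rule d1[OF t]) (use \<epsilon> in simp)
      show "(\<lambda>k. prob (?B k)) \<longlonglongrightarrow> 0" by (rule d2[OF t]) (use \<epsilon> in simp)
      fix k
      note [measurable] = simple_integral_measurable[OF s1 t] simple_integral_measurable[OF s2 t] J1[OF t] J2[OF t]
      show "?A k \<in> sets M" "?B k \<in> sets M" by measurable
      show "{\<omega>\<in>space M. \<epsilon> < \<bar>simple_integral W (n k) (\<tau> k) (\<xi> k) t \<omega> - (J1 t \<omega> - J2 t \<omega>)\<bar>} \<subseteq> ?A k \<union> ?B k"
      proof
        fix \<omega> assume \<omega>: "\<omega> \<in> {\<omega>\<in>space M. \<epsilon> < \<bar>simple_integral W (n k) (\<tau> k) (\<xi> k) t \<omega> - (J1 t \<omega> - J2 t \<omega>)\<bar>}"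
        then have "\<epsilon> / 2 < \<bar>simple_integral W (n1 k) (\<tau>1 k) (\<xi>1 k) t \<omega> - J1 t \<omega>\<bar> \<or> \<epsilon> / 2 < \<bar>simple_integral W (n2 k) (\<tau>2 k) (\<xi>2 k) t \<omega> - J2 t \<omega>\<bar>"
          unfolding si mem_Collect_eq by linarith
        then show "\<omega> \<in> ?A k \<union> ?B k" using \<omega> by blast
      qed
    qed
  qed
qed

text \<open>Progressive measurability is used at the final time only, where \<open>F T\<close> is
  contained in \<open>M\<close>.\<close>

lemma progressive_joint:
  assumes "progressive F T H"
  shows "(\<lambda>x. H (fst x) (snd x)) \<in> borel_measurable (L \<Otimes>\<^sub>M M)"
proof -
  have TT: "T \<in> {0..T}" using T by simp
  have ident: "(\<lambda>x. x) \<in> measurable (L \<Otimes>\<^sub>M M) (restrict_space borel {0..T} \<Otimes>\<^sub>M F T)"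
  proof -
    have "fst \<in> measurable (L \<Otimes>\<^sub>M M) (restrict_space borel {0..T})"
      using measurable_fst[of L M] by (subst measurable_cong_sets[OF refl, of _ L]) (auto simp: sets_restrict_space)
    moreover have "snd \<in> measurable (L \<Otimes>\<^sub>M M) (F T)"
      by (rule measurable_compose[OF measurable_snd, of "\<lambda>x. x", simplified]) (rule measurable_from_subalg[OF F[OF TT] measurable_ident_sets[OF refl]])
    ultimately have "(\<lambda>x. (fst x, snd x)) \<in> measurable (L \<Otimes>\<^sub>M M) (restrict_space borel {0..T} \<Otimes>\<^sub>M F T)"
      by (rule measurable_Pair)
    then show ?thesis by simp
  qed
  have "(\<lambda>(s, \<omega>). H s \<omega>) \<in> borel_measurable (restrict_space borel {0..T} \<Otimes>\<^sub>M F T)"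
    using assms TT by (auto simp: progressive_def)
  from measurable_compose[OF ident this] show ?thesis by (simp add: case_prod_beta)
qed

lemma ito_limit_of_ito_integral:
  assumes "ito_integral M F T W H J"
  shows "ito_limit H J"
proof -
  have L: "(\<integral>\<^sup>+s\<in>{0..T}. f s \<partial>lborel) = (\<integral>\<^sup>+s. f s \<partial>L)" for f :: "real \<Rightarrow> ennreal"
    by (simp add: nn_integral_restrict_space)
  have TT: "T \<in> {0..T}" using T by simp
  obtain n \<tau> \<xi> where prog: "progressive F T H"
    and fin: "AE \<omega> in M. (\<integral>\<^sup>+s. ennreal ((H s \<omega>)\<^sup>2) \<partial>L) < \<infinity>"
    and J: "adapted F T J"
    and sd: "\<And>k. simple_data M F T (n k) (\<tau> k) (\<xi> k)"
    and cH: "null_in_probability M (\<lambda>k \<omega>. \<integral>\<^sup>+s. ennreal ((simple_process (n k) (\<tau> k) (\<xi> k) s \<omega> - H s \<omega>)\<^sup>2) \<partial>L)"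
    and cJ: "null_in_probability M (\<lambda>k \<omega>. SUP t\<in>{0..T}. ennreal \<bar>simple_integral W (n k) (\<tau> k) (\<xi> k) t \<omega> - J t \<omega>\<bar>)"
    using assms unfolding ito_integral_def L by blast
  have Jm: "J t \<in> borel_measurable M" if "t \<in> {0..T}" for t
  proof -
    have "J t \<in> borel_measurable (F t)" using J that by (simp add: adapted_def)
    from measurable_from_subalg[OF F[OF that] this] show ?thesis .
  qed
  show ?thesis unfolding ito_limit_def
  proof (intro conjI exI allI ballI impI)
    show "(\<lambda>x. H (fst x) (snd x)) \<in> borel_measurable (L \<Otimes>\<^sub>M M)" by (rule progressive_joint[OF prog])
    show "(\<lambda>k. prob {\<omega>\<in>space M. ennreal \<epsilon> < (\<integral>\<^sup>+s. ennreal ((simple_process (n k) (\<tau> k) (\<xi> k) s \<omega> - H s \<omega>)\<^sup>2) \<partial>L)}) \<longlonglongrightarrow> 0"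
      if "0 < \<epsilon>" for \<epsilon> :: real
      using cH that by (simp add: null_in_probability_def)
    fix t \<epsilon> :: real assume t: "t \<in> {0..T}" and \<epsilon>: "0 < \<epsilon>"
    let ?S = "\<lambda>k \<omega>. SUP t\<in>{0..T}. ennreal \<bar>simple_integral W (n k) (\<tau> k) (\<xi> k) t \<omega> - J t \<omega>\<bar>"
    have Sm: "?S k \<in> borel_measurable M" for k using cJ by (simp add: null_in_probability_def)
    show "(\<lambda>k. prob {\<omega>\<in>space M. \<epsilon> < \<bar>simple_integral W (n k) (\<tau> k) (\<xi> k) t \<omega> - J t \<omega>\<bar>}) \<longlonglongrightarrow> 0"
    proof (rule tendsto_sandwich[OF _ _ tendsto_const])
      show "(\<lambda>k. prob {\<omega>\<in>space M. ennreal \<epsilon> < ?S k \<omega>}) \<longlonglongrightarrow> 0"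
        using cJ \<epsilon> by (simp add: null_in_probability_def)
      show "\<forall>\<^sub>F k in sequentially. prob {\<omega>\<in>space M. \<epsilon> < \<bar>simple_integral W (n k) (\<tau> k) (\<xi> k) t \<omega> - J t \<omega>\<bar>} \<le> prob {\<omega>\<in>space M. ennreal \<epsilon> < ?S k \<omega>}"
      proof (rule always_eventually, rule allI, rule finite_measure_mono)
        fix k
        show "{\<omega>\<in>space M. \<epsilon> < \<bar>simple_integral W (n k) (\<tau> k) (\<xi> k) t \<omega> - J t \<omega>\<bar>} \<subseteq> {\<omega>\<in>space M. ennreal \<epsilon> < ?S k \<omega>}"
        proof (rule subsetI)
          fix \<omega> assume \<omega>: "\<omega> \<in> {\<omega>\<in>space M. \<epsilon> < \<bar>simple_integral W (n k) (\<tau> k) (\<xi> k) t \<omega> - J t \<omega>\<bar>}"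
          then have "ennreal \<epsilon> < ennreal \<bar>simple_integral W (n k) (\<tau> k) (\<xi> k) t \<omega> - J t \<omega>\<bar>"
            using \<epsilon> by (simp add: ennreal_less_iff)
          also have "\<dots> \<le> ?S k \<omega>" using t by (rule SUP_upper)
          finally show "\<omega> \<in> {\<omega>\<in>space M. ennreal \<epsilon> < ?S k \<omega>}" using \<omega> by simp
        qed
        show "{\<omega>\<in>space M. ennreal \<epsilon> < ?S k \<omega>} \<in> sets M" using Sm[of k] by measurable
      qed
    qed auto
  qed (use fin sd Jm in auto)
qed

text \<open>One interval from 0 to \<open>T\<close> represents the constant exactly, apart from time
  zero, which left-open intervals omit.\<close>

lemma ito_limit_const: "ito_limit (\<lambda>_ _. c) (\<lambda>t \<omega>. c * (W t \<omega> - W 0 \<omega>))"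
proof -
  define \<tau> where "\<tau> i = (if i = 0 then 0 else T)" for i :: nat
  define \<xi> where "\<xi> = (\<lambda>(_::nat) (_::'a). c)"
  have sd: "simple_data M F T 1 \<tau> \<xi>" unfolding simple_data_def
    using T by (auto simp: \<tau>_def \<xi>_def mono_on_def)
  have zero: "(\<integral>\<^sup>+s. ennreal ((simple_process 1 \<tau> \<xi> s \<omega> - c)\<^sup>2) \<partial>L) = 0" for \<omega>
  proof -
    have "AE s in L. 0 < s"
      using AE_lborel_singleton[of "0::real"] by (subst AE_restrict_space_iff) (auto elim!: eventually_mono)
    then have "AE s in L. ennreal ((simple_process 1 \<tau> \<xi> s \<omega> - c)\<^sup>2) = 0"
      using AE_space by eventually_elim (auto simp: simple_process_def \<tau>_def \<xi>_def)
    then show ?thesis by (subst nn_integral_cong_AE[of _ "\<lambda>_. 0"]) auto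
  qed
  show ?thesis unfolding ito_limit_def
  proof (intro conjI ballI exI[of _ "\<lambda>_. 1"] exI[of _ "\<lambda>_. \<tau>"] exI[of _ "\<lambda>_. \<xi>"] allI impI)
    show "(\<lambda>\<omega>. c * (W t \<omega> - W 0 \<omega>)) \<in> borel_measurable M" if "t \<in> {0..T}" for t
      using W_measurable[OF that] W_measurable[of 0] T by simp
    show "AE \<omega> in M. (\<integral>\<^sup>+s. ennreal (c\<^sup>2) \<partial>L) < \<infinity>"
      using T by (simp add: emeasure_restrict_space ennreal_mult_less_top)
    fix t \<epsilon> :: real assume "t \<in> {0..T}" "0 < \<epsilon>"
    then have "simple_integral W 1 \<tau> \<xi> t \<omega> - c * (W t \<omega> - W 0 \<omega>) = 0" for \<omega>
      by (simp add: simple_integral_def \<tau>_def \<xi>_def)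
    then show "(\<lambda>k. prob {\<omega>\<in>space M. \<epsilon> < \<bar>simple_integral W 1 \<tau> \<xi> t \<omega> - c * (W t \<omega> - W 0 \<omega>)\<bar>}) \<longlonglongrightarrow> 0"
      using \<open>0 < \<epsilon>\<close> by simp
  qed (use sd zero in auto)
qed

lemma ito_limit_zero: "ito_limit (\<lambda>_ _. 0) (\<lambda>_ _. 0)"
  using ito_limit_const[of 0] by simp

text \<open>All simple integrals vanish at time zero, and limits in probability are unique.\<close>

lemma ito_limit_at_zero:
  assumes "ito_limit H J"
  shows "AE \<omega> in M. J 0 \<omega> = 0"
proof -
  have T0: "0 \<in> {0..T}" using T by simp
  obtain n \<tau> \<xi> where sd: "\<And>k. simple_data M F T (n k) (\<tau> k) (\<xi> k)"
    and J: "J 0 \<in> borel_measurable M"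
    and cJ: "\<And>\<epsilon>. \<epsilon> > 0 \<Longrightarrow> (\<lambda>k. prob {\<omega>\<in>space M. \<epsilon> < \<bar>simple_integral W (n k) (\<tau> k) (\<xi> k) 0 \<omega> - J 0 \<omega>\<bar>}) \<longlonglongrightarrow> 0"
    using assms T0 unfolding ito_limit_def by blast
  have "simple_integral W (n k) (\<tau> k) (\<xi> k) 0 \<omega> = 0" for k \<omega>
    unfolding simple_integral_def using simple_dataD(1)[OF sd[of k]] by (intro sum.neutral) (auto simp: min_absorb2)
  then have "(\<lambda>k::nat. prob {\<omega>\<in>space M. \<epsilon> < \<bar>J 0 \<omega>\<bar>}) \<longlonglongrightarrow> 0" if "\<epsilon> > 0" for \<epsilon>
    using cJ[OF that] by simp
  then have 0: "prob {\<omega>\<in>space M. \<epsilon> < \<bar>J 0 \<omega>\<bar>} = 0" if "\<epsilon> > 0" for \<epsilon>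
    using that LIMSEQ_unique[OF tendsto_const] by blast
  have "AE \<omega> in M. \<not> 1 / real (Suc k) < \<bar>J 0 \<omega>\<bar>" for k
  proof -
    have "{\<omega>\<in>space M. 1 / real (Suc k) < \<bar>J 0 \<omega>\<bar>} \<in> sets M" using J by measurable
    from prob_eq_0[OF this] 0[of "1 / real (Suc k)"] show ?thesis by (auto elim!: AE_mp)
  qed
  then have "AE \<omega> in M. \<forall>k. \<not> 1 / real (Suc k) < \<bar>J 0 \<omega>\<bar>" by (simp add: AE_all_countable)
  then show ?thesis
  proof eventually_elim
    case (elim \<omega>)
    show ?case
    proof (rule ccontr)
      assume "J 0 \<omega> \<noteq> 0"
      then obtain k where "1 / real (Suc k) < \<bar>J 0 \<omega>\<bar>" using nat_approx_posE[of "\<bar>J 0 \<omega>\<bar>"] by auto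
      then show False using elim by blast
    qed
  qed
qed

end

subsection \<open>Brownian filtrations and couplings\<close>

lemma sets_natural_filtration:
  "sets (natural_filtration M W t) = sigma_sets (space M) (\<Union>u\<in>{0..t}. {W u -` A \<inter> space M | A. A \<in> sets borel})"
  unfolding natural_filtration_def by (rule sets_measure_of) auto

lemma sets_natural_filtration_le:
  assumes "\<And>u. u \<in> {0..t} \<Longrightarrow> W u \<in> borel_measurable M"
  shows "sets (natural_filtration M W t) \<subseteq> sets M"
  unfolding sets_natural_filtration using assms by (intro sets.sigma_sets_subset) (auto dest: measurable_sets)

lemma sets_augmented_filtration:
  assumes "\<And>u. u \<in> {0..t} \<Longrightarrow> W u \<in> borel_measurable M"
  shows "sets (augmented_filtration M W t) = sigma_sets (space M) (sets (natural_filtration M W t) \<union> null_sets M)"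
proof -
  have "sets (natural_filtration M W t) \<union> null_sets M \<subseteq> sets M"
    using sets_natural_filtration_le[of t W M] assms by auto
  then show ?thesis unfolding augmented_filtration_def
    using sets.sets_into_space by (intro sets_measure_of) blast
qed

text \<open>The sets that agree almost surely with an event of the natural filtration form a
  sigma-algebra containing the null sets. Independence of the increments thereby passes to the
  augmentation.\<close>

lemma (in prob_space) augmented_modification:
  assumes W: "\<And>u. u \<in> {0..t} \<Longrightarrow> W u \<in> borel_measurable M"
    and A: "A \<in> sets (augmented_filtration M W t)"
  shows "\<exists>A'\<in>sets (natural_filtration M W t). AE x in M. x \<in> A \<longleftrightarrow> x \<in> A'"
proof -
  have "A \<in> sigma_sets (space M) (sets (natural_filtration M W t) \<union> null_sets M)"
    using A sets_augmented_filtration[of t W M] W by simp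
  then show ?thesis
proof (induction rule: sigma_sets.induct)
  case (Basic a)
  then show ?case
  proof
    assume "a \<in> null_sets M"
    then have "AE x in M. x \<in> a \<longleftrightarrow> x \<in> {}" using AE_not_in by auto
    then show ?thesis by blast
  qed auto
next
  case (Compl a)
  then obtain A' where A': "A' \<in> sets (natural_filtration M W t)" "AE x in M. x \<in> a \<longleftrightarrow> x \<in> A'" by blast
  have "space M = space (natural_filtration M W t)" by (simp add: natural_filtration_def space_measure_of_conv)
  then have "space M - A' \<in> sets (natural_filtration M W t)" using A'(1) by auto
  moreover have "AE x in M. x \<in> space M - a \<longleftrightarrow> x \<in> space M - A'" using A'(2) by eventually_elim auto
  ultimately show ?case by blast
next
  case (Union a)
  then have "\<forall>i. \<exists>A'. A' \<in> sets (natural_filtration M W t) \<and> (AE x in M. x \<in> a i \<longleftrightarrow> x \<in> A')" by blast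
  from choice[OF this] obtain A' where A': "\<And>i. A' i \<in> sets (natural_filtration M W t)" "\<And>i. AE x in M. x \<in> a i \<longleftrightarrow> x \<in> A' i"
    by blast
  have "AE x in M. \<forall>i. x \<in> a i \<longleftrightarrow> x \<in> A' i" using A'(2) by (simp add: AE_all_countable)
  then have "AE x in M. x \<in> (\<Union>i. a i) \<longleftrightarrow> x \<in> (\<Union>i. A' i)" by eventually_elim auto
  moreover have "(\<Union>i. A' i) \<in> sets (natural_filtration M W t)" using A'(1) by auto
  ultimately show ?case by blast
qed auto
qed

lemma bm_filtration_augmented:
  assumes "prob_space M" and T: "0 < T" and bm: "brownian_motion M T W"
  shows "bm_filtration M (augmented_filtration M W) T W"
proof -
  interpret prob_space M by fact
  have W: "W u \<in> borel_measurable M" if "u \<in> {0..T}" for u using bm that by (simp add: brownian_motion_def)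
  have nat: "sets (natural_filtration M W t) \<subseteq> sets M" if "t \<in> {0..T}" for t
    using W that by (intro sets_natural_filtration_le) auto
  have aug: "sets (augmented_filtration M W t) = sigma_sets (space M) (sets (natural_filtration M W t) \<union> null_sets M)" if "t \<in> {0..T}" for t
    using W that by (intro sets_augmented_filtration) auto
  have sub: "subalgebra M (augmented_filtration M W t)" if t: "t \<in> {0..T}" for t
  proof -
    have "sets (augmented_filtration M W t) \<subseteq> sets M"
      unfolding aug[OF t] using nat[OF t] by (intro sets.sigma_sets_subset) auto
    moreover have "space (augmented_filtration M W t) = space M" by (simp add: augmented_filtration_def space_measure_of_conv)
    ultimately show ?thesis by (simp add: subalgebra_def)
  qed
  show ?thesis
  proof
    show "0 < T" by fact
    show "subalgebra M (augmented_filtration M W t)" if "t \<in> {0..T}" for t by (rule sub[OF that])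
    show "sets (augmented_filtration M W s) \<subseteq> sets (augmented_filtration M W t)" if st: "0 \<le> s" "s \<le> t" "t \<le> T" for s t
    proof -
      have "sets (natural_filtration M W s) \<subseteq> sets (natural_filtration M W t)"
        unfolding sets_natural_filtration using st by (intro sigma_sets_mono' UN_mono) auto
      then show ?thesis using aug[of s] aug[of t] st by (auto intro!: sigma_sets_mono')
    qed
    show "W t \<in> borel_measurable (augmented_filtration M W t)" if t: "t \<in> {0..T}" for t
    proof (rule measurableI)
      fix A :: "real set" assume "A \<in> sets borel"
      then have "W t -` A \<inter> space M \<in> sets (natural_filtration M W t)"
        unfolding sets_natural_filtration using t by (intro sigma_sets.Basic UN_I[of t]) auto
      then show "W t -` A \<inter> space (augmented_filtration M W t) \<in> sets (augmented_filtration M W t)"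
        unfolding aug[OF t] by (auto simp: augmented_filtration_def space_measure_of_conv intro!: sigma_sets.Basic)
    qed simp
    show "distributed M lborel (\<lambda>\<omega>. W t \<omega> - W s \<omega>) (normal_density 0 (sqrt (t - s)))" if "0 \<le> s" "s < t" "t \<le> T" for s t
      using bm that by (simp add: brownian_motion_def)
    fix s t :: real assume st: "0 \<le> s" "s < t" "t \<le> T"
    let ?V = "sets (vimage_algebra (space M) (\<lambda>\<omega>. W t \<omega> - W s \<omega>) borel)"
    have ind: "indep_set (sets (natural_filtration M W s)) ?V" using bm st by (simp add: brownian_motion_def)
    have sT: "s \<in> {0..T}" using st by simp
    show "indep_set (sets (augmented_filtration M W s)) ?V" unfolding indep_sets2_eq
    proof (intro conjI ballI)
      show "sets (augmented_filtration M W s) \<subseteq> events" using sub[OF sT] by (simp add: subalgebra_def)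
      show V: "?V \<subseteq> events" using ind unfolding indep_sets2_eq by simp
      fix a b assume a: "a \<in> sets (augmented_filtration M W s)" and b: "b \<in> ?V"
      obtain a' where a': "a' \<in> sets (natural_filtration M W s)" "AE x in M. x \<in> a \<longleftrightarrow> x \<in> a'"
        using augmented_modification[OF _ a] W st by force
      have m: "a \<in> events" "a' \<in> events" "b \<in> events" using a sub[OF sT] a' nat[OF sT] b V by (auto simp: subalgebra_def)
      have "prob (a \<inter> b) = prob (a' \<inter> b)" "prob a = prob a'"
        using a'(2) m by (auto intro!: measure_eq_AE elim!: eventually_mono)
      then show "prob (a \<inter> b) = prob a * prob b" using indep_setD[OF ind a'(1) b] by simp
    qed
  qed
qed

text \<open>Up to time \<open>T\<close> the scaled noise reads \<open>W\<close> only up to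
  \<open>T / \<alpha>\<close>, which \<open>1 \<le> \<alpha>\<close> keeps inside the
  interval.\<close>

lemma brownian_motion_scaled_noise:
  assumes "prob_space M" and T: "0 < T" and \<alpha>: "1 \<le> \<alpha>" and bm: "brownian_motion M T W"
  shows "brownian_motion M T (scaled_noise \<alpha> W)"
  unfolding brownian_motion_def
proof (intro conjI ballI allI impI)
  interpret prob_space M by fact
  have in_T: "t / \<alpha> \<in> {0..T}" if "t \<in> {0..T}" for t
  proof -
    have "t / \<alpha> \<le> t / 1" using that \<alpha> by (intro divide_left_mono) auto
    then show ?thesis using that \<alpha> by auto
  qed
  have W: "W u \<in> borel_measurable M" if "u \<in> {0..T}" for u using bm that by (simp add: brownian_motion_def)
  show "scaled_noise \<alpha> W t \<in> borel_measurable M" if "t \<in> {0..T}" for t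
    using W[OF in_T[OF that]] unfolding scaled_noise_def[abs_def] by measurable
  have "AE \<omega> in M. W 0 \<omega> = 0" using bm by (simp add: brownian_motion_def)
  then show "AE \<omega> in M. scaled_noise \<alpha> W 0 \<omega> = 0" by eventually_elim (simp add: scaled_noise_def)
  have "AE \<omega> in M. continuous_on {0..T} (\<lambda>t. W t \<omega>)" using bm by (simp add: brownian_motion_def)
  then show "AE \<omega> in M. continuous_on {0..T} (\<lambda>t. scaled_noise \<alpha> W t \<omega>)"
  proof eventually_elim
    case (elim \<omega>)
    have "continuous_on {0..T} (\<lambda>t. W (t / \<alpha>) \<omega>)"
    proof (rule continuous_on_compose2[OF elim])
      show "continuous_on {0..T} (\<lambda>t. t / \<alpha>)" using \<alpha> by (intro continuous_intros) auto
      show "(\<lambda>t. t / \<alpha>) ` {0..T} \<subseteq> {0..T}" using in_T by blast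
    qed
    then show ?case unfolding scaled_noise_def by (intro continuous_intros)
  qed
  fix s t :: real assume st: "0 \<le> s \<and> s < t \<and> t \<le> T"
  have st': "0 \<le> s / \<alpha>" "s / \<alpha> < t / \<alpha>" "t / \<alpha> \<le> T"
    using st \<alpha> in_T[of t] by (auto intro: divide_strict_right_mono)
  have D: "distributed M lborel (\<lambda>\<omega>. W (t / \<alpha>) \<omega> - W (s / \<alpha>) \<omega>) (normal_density 0 (sqrt (t / \<alpha> - s / \<alpha>)))"
    and I: "indep_set (sets (natural_filtration M W (s / \<alpha>))) (sets (vimage_algebra (space M) (\<lambda>\<omega>. W (t / \<alpha>) \<omega> - W (s / \<alpha>) \<omega>) borel))"
    using bm st' by (simp_all add: brownian_motion_def)
  have "distributed M lborel (\<lambda>\<omega>. 0 + sqrt \<alpha> * (W (t / \<alpha>) \<omega> - W (s / \<alpha>) \<omega>)) (normal_density (0 + sqrt \<alpha> * 0) (\<bar>sqrt \<alpha>\<bar> * sqrt (t / \<alpha> - s / \<alpha>)))"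
    using \<alpha> st' by (intro normal_density_affine[OF D]) auto
  moreover have "\<bar>sqrt \<alpha>\<bar> * sqrt (t / \<alpha> - s / \<alpha>) = sqrt (t - s)"
    using \<alpha> by (simp add: real_sqrt_mult[symmetric] right_diff_distrib)
  ultimately show "distributed M lborel (\<lambda>\<omega>. scaled_noise \<alpha> W t \<omega> - scaled_noise \<alpha> W s \<omega>) (\<lambda>x. ennreal (normal_density 0 (sqrt (t - s)) x))"
    by (simp add: scaled_noise_def right_diff_distrib)
  have 1: "sets (natural_filtration M (scaled_noise \<alpha> W) s) \<subseteq> sets (natural_filtration M W (s / \<alpha>))"
  proof -
    let ?N = "natural_filtration M W (s / \<alpha>)"
    have sp: "space ?N = space M" by (simp add: natural_filtration_def space_measure_of_conv)
    have "scaled_noise \<alpha> W u -` A \<inter> space M \<in> sets ?N" if u: "u \<in> {0..s}" and A: "A \<in> sets borel" for u A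
    proof -
      have "u / \<alpha> \<in> {0..s / \<alpha>}" using u \<alpha> by (auto intro: divide_right_mono)
      then have "W (u / \<alpha>) -` B \<inter> space M \<in> sets ?N" if "B \<in> sets borel" for B
        unfolding sets_natural_filtration using that by (intro sigma_sets.Basic UN_I[of "u / \<alpha>"]) auto
      then have "W (u / \<alpha>) \<in> borel_measurable ?N" by (intro measurableI) (auto simp: sp)
      then have "scaled_noise \<alpha> W u \<in> borel_measurable ?N" unfolding scaled_noise_def[abs_def] by measurable
      from measurable_sets[OF this A] show ?thesis by (simp add: sp)
    qed
    then have "(\<Union>u\<in>{0..s}. {scaled_noise \<alpha> W u -` A \<inter> space M |A. A \<in> sets borel}) \<subseteq> sets ?N" by auto
    from sets.sigma_sets_subset[OF this] show ?thesis by (simp only: sp sets_natural_filtration[of M "scaled_noise \<alpha> W"])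
  qed
  have 2: "sets (vimage_algebra (space M) (\<lambda>\<omega>. scaled_noise \<alpha> W t \<omega> - scaled_noise \<alpha> W s \<omega>) borel)
     \<subseteq> sets (vimage_algebra (space M) (\<lambda>\<omega>. W (t / \<alpha>) \<omega> - W (s / \<alpha>) \<omega>) borel)"
  proof -
    let ?D = "\<lambda>\<omega>. W (t / \<alpha>) \<omega> - W (s / \<alpha>) \<omega>"
    let ?A = "vimage_algebra (space M) ?D borel"
    have "(\<lambda>\<omega>. sqrt \<alpha> * ?D \<omega>) \<in> borel_measurable ?A"
      using measurable_vimage_algebra1[of ?D "space M" "borel :: real measure"] by measurable
    then have "(\<lambda>\<omega>. scaled_noise \<alpha> W t \<omega> - scaled_noise \<alpha> W s \<omega>) \<in> borel_measurable ?A"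
      by (simp add: scaled_noise_def right_diff_distrib)
    from measurable_sets[OF this]
    have "{(\<lambda>\<omega>. scaled_noise \<alpha> W t \<omega> - scaled_noise \<alpha> W s \<omega>) -` A \<inter> space M | A. A \<in> sets borel} \<subseteq> sets ?A"
      by auto
    from sets.sigma_sets_subset[OF this] show ?thesis
      by (simp add: sets_vimage_algebra[of _ "\<lambda>\<omega>. scaled_noise \<alpha> W t \<omega> - scaled_noise \<alpha> W s \<omega>"])
  qed
  show "indep_set (sets (natural_filtration M (scaled_noise \<alpha> W) s))
     (sets (vimage_algebra (space M) (\<lambda>\<omega>. scaled_noise \<alpha> W t \<omega> - scaled_noise \<alpha> W s \<omega>) borel))"
    using I unfolding indep_set_def by (rule indep_sets_mono_sets) (use 1 2 in \<open>auto split: bool.split\<close>)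
qed

text \<open>The joint law of \<open>U\<close> and \<open>V\<close> on the common probability space
  is one of the couplings.\<close>

lemma (in prob_space) wasserstein_le_Lp_bound:
  assumes [measurable]: "U \<in> borel_measurable M" "V \<in> borel_measurable M"
    and b: "Lp_bound M p (\<lambda>\<omega>. U \<omega> - V \<omega>) a" and p: "1 \<le> p"
  shows "ennreal_powr (wasserstein p (law M U) (law M V)) p \<le> ennreal (a powr p)"
proof -
  define \<pi> where "\<pi> = distr M (borel \<Otimes>\<^sub>M borel) (\<lambda>\<omega>. (U \<omega>, V \<omega>))"
  define c where "c = (INF \<pi>\<in>couplings (law M U) (law M V). \<integral>\<^sup>+(u, v). ennreal (\<bar>u - v\<bar> powr p) \<partial>\<pi>)"
  have "\<pi> \<in> couplings (law M U) (law M V)"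
    unfolding couplings_def law_def \<pi>_def by (auto intro!: prob_space_distr simp: distr_distr comp_def)
  then have "c \<le> (\<integral>\<^sup>+(u, v). ennreal (\<bar>u - v\<bar> powr p) \<partial>\<pi>)" unfolding c_def by (rule INF_lower)
  also have "\<dots> = (\<integral>\<^sup>+\<omega>. ennreal (\<bar>U \<omega> - V \<omega>\<bar> powr p) \<partial>M)"
    unfolding \<pi>_def by (subst nn_integral_distr) auto
  also have "\<dots> \<le> ennreal (a powr p)" using Lp_boundD[OF b] p by simp
  finally have le: "c \<le> ennreal (a powr p)" .
  \<comment> \<open>Finiteness lets the outer power undo the root inside
    \<open>wasserstein\<close>.\<close>
  then have fin: "c \<noteq> \<infinity>" by (auto simp: top_unique)
  have "ennreal_powr (wasserstein p (law M U) (law M V)) p = c"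
    unfolding wasserstein_def c_def[symmetric] ennreal_powr_def using fin p by (simp add: powr_powr less_top)
  then show ?thesis using le by simp
qed

subsection \<open>A priori bounds\<close>

text \<open>Agreement at countably many grid times needs one exceptional null set, and continuity
  extends it to all times.\<close>

lemma AE_eq_of_continuous:
  fixes f g :: "real \<Rightarrow> 'a \<Rightarrow> real"
  assumes cont: "AE \<omega> in M. continuous_on {0..T} (\<lambda>t. f t \<omega>)" "AE \<omega> in M. continuous_on {0..T} (\<lambda>t. g t \<omega>)"
    and eq: "\<And>t. t \<in> {0..T} \<Longrightarrow> AE \<omega> in M. f t \<omega> = g t \<omega>"
  shows "AE \<omega> in M. \<forall>t\<in>{0..T}. f t \<omega> = g t \<omega>"
proof -
  have "AE \<omega> in M. real_of_int i / real (Suc n) \<in> {0..T} \<longrightarrow> f (real_of_int i / real (Suc n)) \<omega> = g (real_of_int i / real (Suc n)) \<omega>" for i n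
    using eq[of "real_of_int i / real (Suc n)"] by (cases "real_of_int i / real (Suc n) \<in> {0..T}") auto
  then have "AE \<omega> in M. \<forall>i n. real_of_int i / real (Suc n) \<in> {0..T} \<longrightarrow> f (real_of_int i / real (Suc n)) \<omega> = g (real_of_int i / real (Suc n)) \<omega>"
    by (intro AE_all_countable[THEN iffD2] allI)
  then show ?thesis using cont
  proof eventually_elim
    case (elim \<omega>)
    show ?case
    proof
      fix t assume t: "t \<in> {0..T}"
      define x where "x n = real_of_int \<lfloor>t * real (Suc n)\<rfloor> / real (Suc n)" for n
      have x: "x \<longlonglongrightarrow> t" unfolding x_def by (rule floor_grid_tendsto)
      have xT: "x n \<in> {0..T}" for n
      proof -
        have "real_of_int \<lfloor>t * real (Suc n)\<rfloor> \<le> t * real (Suc n)" by linarith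
        then have "x n \<le> t" by (simp add: x_def pos_divide_le_eq del: of_nat_Suc)
        moreover have "0 \<le> x n" using t unfolding x_def by (intro divide_nonneg_nonneg) auto
        ultimately show ?thesis using t by auto
      qed
      have "(\<lambda>n. f (x n) \<omega>) \<longlonglongrightarrow> f t \<omega>"
        using continuous_on_tendsto_compose[OF elim(2) x t] xT by auto
      moreover have "(\<lambda>n. g (x n) \<omega>) \<longlonglongrightarrow> g t \<omega>"
        using continuous_on_tendsto_compose[OF elim(3) x t] xT by auto
      moreover have "f (x n) \<omega> = g (x n) \<omega>" for n
        using elim(1) xT[of n] unfolding x_def by blast
      ultimately show "f t \<omega> = g t \<omega>" using LIMSEQ_unique by simp
    qed
  qed
qed

lemma exp_integral:
  fixes c s :: real
  assumes "0 < c" "0 \<le> s"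
  shows "(LINT r:{0..s}|lborel. exp (c * r)) = (exp (c * s) - 1) / c"
proof -
  have "((\<lambda>r. exp (c * r)) has_integral exp (c * s) / c - exp (c * 0) / c) {0..s}"
  proof (rule fundamental_theorem_of_calculus[OF assms(2)])
    fix r
    have "((\<lambda>r. exp (c * r) / c) has_real_derivative exp (c * r)) (at r within {0..s})"
      using assms by (auto intro!: derivative_eq_intros)
    then show "((\<lambda>r. exp (c * r) / c) has_vector_derivative exp (c * r)) (at r within {0..s})"
      by (simp add: has_real_derivative_iff_has_vector_derivative)
  qed
  moreover have "(LINT r:{0..s}|lborel. exp (c * r)) = integral {0..s} (\<lambda>r. exp (c * r))"
    by (intro set_borel_integral_eq_integral borel_integrable_atLeastAtMost' continuous_intros)
  ultimately show ?thesis by (simp add: integral_unique diff_divide_distrib)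
qed

text \<open>Integration gains the factor \<open>1 / c\<close>. It is weakened to
  \<open>1 / sqrt c\<close>, the gain in the noise estimate, so that drift and noise enter Gronwall
  in the same form.\<close>

lemma affine_exp_integral_le:
  fixes c s T K Q :: real
  assumes "1 \<le> c" "0 \<le> s" "s \<le> T" "0 \<le> Q" "0 \<le> K"
  shows "(LINT r:{0..s}|lborel. K * (1 + Q * exp (c * r))) \<le> K * (T + Q * exp (c * s) / sqrt c)"
proof -
  have i: "set_integrable lborel {0..s} (\<lambda>r. 1 :: real)" "set_integrable lborel {0..s} (\<lambda>r. Q * exp (c * r))"
    by (intro borel_integrable_atLeastAtMost' continuous_intros)+
  have "(LINT r:{0..s}|lborel. 1 + Q * exp (c * r)) = s + Q * ((exp (c * s) - 1) / c)"
    using assms i by (simp add: set_integral_add(2) exp_integral set_integral_const)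
  also have "\<dots> \<le> T + Q * (exp (c * s) / sqrt c)"
  proof (intro add_mono mult_left_mono)
    have "sqrt c \<le> c" using assms(1) by (simp add: real_le_lsqrt power2_eq_square)
    then show "(exp (c * s) - 1) / c \<le> exp (c * s) / sqrt c"
      using assms(1) by (intro frac_le) auto
  qed (use assms in auto)
  finally have "K * (LINT r:{0..s}|lborel. 1 + Q * exp (c * r)) \<le> K * (T + Q * exp (c * s) / sqrt c)"
    using assms by (intro mult_left_mono) auto
  then show ?thesis by simp
qed

text \<open>This is the origin of \<open>sqrt c\<close> in \<open>Lp_gronwall\<close>: the norm is
  squared before it is integrated, so the gain \<open>1 / c\<close> stands under a root.\<close>

lemma affine_exp_square_integral_le:
  fixes c s T K Q D :: real
  assumes "1 \<le> c" "0 \<le> s" "s \<le> T" "0 \<le> Q" "0 \<le> K" "0 \<le> D"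
  shows "sqrt (D * (LINT r:{0..s}|lborel. (K * (1 + Q * exp (c * r)))\<^sup>2)) \<le> K * sqrt D * (sqrt (2 * T) + Q * exp (c * s) / sqrt c)"
proof -
  have "(LINT r:{0..s}|lborel. (K * (1 + Q * exp (c * r)))\<^sup>2) \<le> (LINT r:{0..s}|lborel. K\<^sup>2 * (2 + 2 * Q\<^sup>2 * exp (2 * c * r)))"
  proof (intro set_integral_mono borel_integrable_atLeastAtMost' continuous_intros)
    fix r
    have "exp (2 * c * r) = (exp (c * r))\<^sup>2" by (simp add: exp_double[symmetric] mult.assoc)
    then have "(1 + Q * exp (c * r))\<^sup>2 \<le> 2 + 2 * Q\<^sup>2 * exp (2 * c * r)"
      using sum_squares_bound[of 1 "Q * exp (c * r)"] by (simp add: power2_sum power_mult_distrib)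
    then show "(K * (1 + Q * exp (c * r)))\<^sup>2 \<le> K\<^sup>2 * (2 + 2 * Q\<^sup>2 * exp (2 * c * r))"
      by (simp add: power_mult_distrib mult_left_mono)
  qed
  also have "\<dots> = K\<^sup>2 * (2 * s + 2 * Q\<^sup>2 * ((exp (2 * c * s) - 1) / (2 * c)))"
  proof -
    have i: "set_integrable lborel {0..s} (\<lambda>r. 2 :: real)" "set_integrable lborel {0..s} (\<lambda>r. 2 * Q\<^sup>2 * exp (2 * c * r))"
      by (intro borel_integrable_atLeastAtMost' continuous_intros)+
    show ?thesis using assms i exp_integral[of "2 * c" s] by (simp add: set_integral_add(2) set_integral_const)
  qed
  also have "\<dots> \<le> K\<^sup>2 * (2 * T + Q\<^sup>2 * exp (2 * c * s) / c)"
  proof (intro mult_left_mono add_mono)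
    have "2 * Q\<^sup>2 * ((exp (2 * c * s) - 1) / (2 * c)) = Q\<^sup>2 * (exp (2 * c * s) - 1) / c" using assms by simp
    also have "\<dots> \<le> Q\<^sup>2 * exp (2 * c * s) / c" using assms by (intro divide_right_mono mult_left_mono) auto
    finally show "2 * Q\<^sup>2 * ((exp (2 * c * s) - 1) / (2 * c)) \<le> Q\<^sup>2 * exp (2 * c * s) / c" .
  qed (use assms in auto)
  finally have "sqrt (D * (LINT r:{0..s}|lborel. (K * (1 + Q * exp (c * r)))\<^sup>2)) \<le> sqrt (D * (K\<^sup>2 * (2 * T + Q\<^sup>2 * exp (2 * c * s) / c)))"
    using assms by (intro real_sqrt_le_mono mult_left_mono) auto
  also have "\<dots> = K * sqrt D * sqrt (2 * T + Q\<^sup>2 * exp (2 * c * s) / c)"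
    using assms by (simp add: real_sqrt_mult)
  also have "\<dots> \<le> K * sqrt D * (sqrt (2 * T) + sqrt (Q\<^sup>2 * exp (2 * c * s) / c))"
    using assms by (intro mult_left_mono sqrt_add_le_add_sqrt) auto
  also have "sqrt (Q\<^sup>2 * exp (2 * c * s) / c) = Q * exp (c * s) / sqrt c"
  proof -
    have "exp (2 * c * s) = (exp (c * s))\<^sup>2" by (simp add: exp_double[symmetric] mult.assoc)
    then show ?thesis using assms by (simp add: real_sqrt_mult real_sqrt_divide)
  qed
  finally show ?thesis .
qed

section \<open>Uniqueness of integrals and finiteness of moments\<close>

context bm_filtration
begin

text \<open>The difference is an integral of zero. This identifies integrals that are given by
  existence only, such as the vanishing noise of \<open>X\<close> in the mean-field system.\<close>

lemma ito_limit_unique: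
  assumes lim: "ito_limit H J1" "ito_limit H J2"
    and cont: "AE \<omega> in M. continuous_on {0..T} (\<lambda>t. J1 t \<omega>)" "AE \<omega> in M. continuous_on {0..T} (\<lambda>t. J2 t \<omega>)"
  shows "AE \<omega> in M. \<forall>t\<in>{0..T}. J1 t \<omega> = J2 t \<omega>"
proof (rule AE_eq_of_continuous[OF cont])
  fix t assume t: "t \<in> {0..T}"
  have "Lp_bound M 2 (\<lambda>\<omega>. (J1 t \<omega> - J2 t \<omega>) - (J1 0 \<omega> - J2 0 \<omega>)) (sqrt (ito_const 2 * (LINT r:{0..t}|lborel. 0\<^sup>2)))"
    using t by (intro Lp_bound_ito[OF ito_limit_diff[OF lim], where h = "\<lambda>_. 0"]) (auto intro!: Lp_bound_const)
  then have "AE \<omega> in M. (J1 t \<omega> - J2 t \<omega>) - (J1 0 \<omega> - J2 0 \<omega>) = 0"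
    by (intro Lp_bound_zero[of M 2]) (simp add: set_lebesgue_integral_def)
  then show "AE \<omega> in M. J1 t \<omega> = J2 t \<omega>"
    using ito_limit_at_zero[OF lim(1)] ito_limit_at_zero[OF lim(2)] by eventually_elim auto
qed

lemma ito_processE:
  assumes "ito_process M F T W z b H Z"
  obtains J where "ito_limit H J" "AE \<omega> in M. continuous_on {0..T} (\<lambda>t. J t \<omega>)"
    "AE \<omega> in M. set_integrable lborel {0..T} (\<lambda>s. b s \<omega>)"
    "AE \<omega> in M. \<forall>t\<in>{0..T}. Z t \<omega> = z + (LINT s:{0..t}|lborel. b s \<omega>) + J t \<omega>"
    "\<And>t. t \<in> {0..T} \<Longrightarrow> Z t \<in> borel_measurable (F t)" "AE \<omega> in M. continuous_on {0..T} (\<lambda>t. Z t \<omega>)"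
    "(\<lambda>x. b (fst x) (snd x)) \<in> borel_measurable (L \<Otimes>\<^sub>M M)"
proof -
  note a = assms[unfolded ito_process_def]
  obtain J where J: "ito_integral M F T W H J"
    "AE \<omega> in M. \<forall>t\<in>{0..T}. Z t \<omega> = z + (LINT s:{0..t}|lborel. b s \<omega>) + J t \<omega>"
    using a by blast
  have "AE \<omega> in M. continuous_on {0..T} (\<lambda>t. J t \<omega>)" using J(1) by (simp add: ito_integral_def)
  moreover have "AE \<omega> in M. set_integrable lborel {0..T} (\<lambda>s. b s \<omega>)" using a by blast
  moreover have "Z t \<in> borel_measurable (F t)" if "t \<in> {0..T}" for t
    using conjunct1[OF a] that by (simp add: adapted_def)
  moreover have "AE \<omega> in M. continuous_on {0..T} (\<lambda>t. Z t \<omega>)" using a by blast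
  moreover have "progressive F T b" using a by blast
  then have "(\<lambda>x. b (fst x) (snd x)) \<in> borel_measurable (L \<Otimes>\<^sub>M M)" by (rule progressive_joint)
  ultimately show ?thesis using that[of J] ito_limit_of_ito_integral[OF J(1)] J(2) by fast
qed

lemma ito_limit_measurable: "ito_limit H J \<Longrightarrow> t \<in> {0..T} \<Longrightarrow> J t \<in> borel_measurable M"
  by (simp add: ito_limit_def)

lemma F_measurable_M: "f \<in> borel_measurable (F t) \<Longrightarrow> t \<in> {0..T} \<Longrightarrow> f \<in> borel_measurable M"
  using measurable_from_subalg[OF F] by blast

text \<open>No moment of \<open>X\<close> is assumed to be finite: the estimate is first run for \<open>X\<close> frozen outside the
  event that \<open>X\<close> has stayed below a level, with constants that do not depend on the level.\<close>

lemma a_priori_bound: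
  assumes p: "2 \<le> p" and K: "0 \<le> K" and a: "0 \<le> a" and k: "0 \<le> k"
    and Xa: "\<And>t. t \<in> {0..T} \<Longrightarrow> X t \<in> borel_measurable (F t)"
    and Xc: "AE \<omega> in M. continuous_on {0..T} (\<lambda>t. X t \<omega>)"
    and X0: "AE \<omega> in M. X 0 \<omega> = x0"
    and J: "ito_limit H J" and Jc: "AE \<omega> in M. continuous_on {0..T} (\<lambda>t. J t \<omega>)"
    and H: "\<And>t \<omega>. t \<in> {0..T} \<Longrightarrow> \<bar>H t \<omega>\<bar> \<le> K * (1 + \<bar>X t \<omega>\<bar>)"
    and le: "AE \<omega> in M. \<forall>t\<in>{0..T}. \<bar>X t \<omega>\<bar> \<le> a + k * (LINT r:{0..t}|lborel. \<bar>X r \<omega>\<bar>) + k * \<bar>J t \<omega>\<bar> + k * (LINT r:{0..t}|lborel. \<bar>J r \<omega>\<bar>)"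
  shows "\<exists>C. \<forall>t\<in>{0..T}. Lp_bound M p (X t) C"
proof -
  have T0: "0 \<le> T" using T by simp
  have Xm: "X t \<in> borel_measurable M" if "t \<in> {0..T}" for t using F_measurable_M[OF Xa] that by blast
  have Jm: "J t \<in> borel_measurable M" if "t \<in> {0..T}" for t using ito_limit_measurable[OF J that] .
  \<comment> \<open>Rational times keep the event measurable at time \<open>r\<close>. The strict
    inequality \<open>q < r\<close> gives the left continuity that localizing events must
    have.\<close>
  define B where "B N r = {\<omega>\<in>space M. \<forall>q\<in>\<rat>. 0 \<le> q \<and> q < r \<longrightarrow> \<bar>X q \<omega>\<bar> \<le> N}" for N r
  have B1: "B N r \<in> sets (F r)" if r: "r \<in> {0..T}" for N r
  proof -
    have *: "{\<omega>\<in>space (F r). 0 \<le> q \<and> q < r \<longrightarrow> \<bar>X q \<omega>\<bar> \<le> N} \<in> sets (F r)" for q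
    proof (cases "0 \<le> q \<and> q < r")
      case True
      have "X q \<in> borel_measurable (F r)" using True r by (intro F_measurable_mono[OF Xa]) auto
      then show ?thesis using True by measurable
    next
      case False
      then have "{\<omega>\<in>space (F r). 0 \<le> q \<and> q < r \<longrightarrow> \<bar>X q \<omega>\<bar> \<le> N} = space (F r)" by blast
      then show ?thesis using sets.top[of "F r"] by (simp only:)
    qed
    have "B N r = (\<Inter>q\<in>\<rat>. {\<omega>\<in>space (F r). 0 \<le> q \<and> q < r \<longrightarrow> \<bar>X q \<omega>\<bar> \<le> N})"
      unfolding B_def space_F[OF r] using Rats_0 by blast
    also have "\<dots> \<in> sets (F r)"
    proof (rule sets.countable_INT'[OF countable_rat])
      show "\<rat> \<noteq> ({} :: real set)" using Rats_0 by blast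
    qed (use * in blast)
    finally show ?thesis .
  qed
  have BM: "B N r \<in> sets M" if "r \<in> {0..T}" for N r using B1[OF that] F[OF that] by (auto simp: subalgebra_def)
  have B2: "B N r' \<subseteq> B N r" if "r \<le> r'" for N r r' using that by (auto simp: B_def)
  have B3: "\<omega> \<in> B N r" if r: "0 < r" and Bu: "\<And>u. 0 \<le> u \<Longrightarrow> u < r \<Longrightarrow> \<omega> \<in> B N u" for N r \<omega>
  proof -
    have "\<omega> \<in> space M" using Bu[of 0] r by (simp add: B_def)
    moreover have "\<bar>X q \<omega>\<bar> \<le> N" if q: "q \<in> \<rat>" "0 \<le> q" "q < r" for q
    proof -
      obtain u where "q < u" "u < r" using dense q(3) by blast
      then show ?thesis using Bu[of u] q by (auto simp: B_def)
    qed
    ultimately show ?thesis by (auto simp: B_def)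
  qed
  \<comment> \<open>At time zero the event imposes nothing, so the initial value must lie below the
    level. Later times are limits of rationals from below.\<close>
  have bdd: "AE \<omega> in M. \<forall>t\<in>{0..T}. \<omega> \<in> B N t \<longrightarrow> \<bar>X t \<omega>\<bar> \<le> N" if N: "\<bar>x0\<bar> \<le> N" for N
    using Xc X0
  proof eventually_elim
    case (elim \<omega>)
    show ?case
    proof (intro ballI impI)
      fix t assume t: "t \<in> {0..T}" and w: "\<omega> \<in> B N t"
      show "\<bar>X t \<omega>\<bar> \<le> N"
      proof (cases "t = 0")
        case False
        then have t0: "0 < t" using t by simp
        have "\<exists>q\<in>\<rat>. t - t / real (Suc n) < q \<and> q < t" for n
          using t0 by (intro Rats_dense_in_real) simp
        then have "\<forall>n. \<exists>q. q \<in> \<rat> \<and> t - t / real (Suc n) < q \<and> q < t" by blast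
        from choice[OF this] obtain q where q: "\<And>n. q n \<in> \<rat>" "\<And>n. t - t / real (Suc n) < q n" "\<And>n. q n < t" by blast
        have q0: "0 \<le> q n" for n
        proof -
          have "t / real (Suc n) \<le> t / 1" using t0 by (intro divide_left_mono) auto
          then show ?thesis using q(2)[of n] by simp
        qed
        have "q \<longlonglongrightarrow> t"
        proof (rule tendsto_sandwich[where f = "\<lambda>n. t - t * (1 / real (Suc n))" and h = "\<lambda>_. t"])
          have "(\<lambda>n. t - t * (1 / real (Suc n))) \<longlonglongrightarrow> t - t * 0"
            by (intro tendsto_intros LIMSEQ_Suc[OF lim_1_over_n])
          then show "(\<lambda>n. t - t * (1 / real (Suc n))) \<longlonglongrightarrow> t" by simp
          show "\<forall>\<^sub>F n in sequentially. t - t * (1 / real (Suc n)) \<le> q n"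
            using q(2) by (intro always_eventually allI less_imp_le) simp
          show "\<forall>\<^sub>F n in sequentially. q n \<le> t" using q(3) by (intro always_eventually allI less_imp_le)
        qed simp
        moreover have "q n \<in> {0..T}" for n using q0[of n] q(3)[of n] t by simp
        ultimately have "(\<lambda>n. X (q n) \<omega>) \<longlonglongrightarrow> X t \<omega>"
          by (intro continuous_on_tendsto_compose[OF elim(1) _ t]) (auto simp del: atLeastAtMost_iff)
        then have "(\<lambda>n. \<bar>X (q n) \<omega>\<bar>) \<longlonglongrightarrow> \<bar>X t \<omega>\<bar>" by (rule tendsto_rabs)
        then show ?thesis
        proof (rule LIMSEQ_le_const2)
          show "\<exists>N'. \<forall>n\<ge>N'. \<bar>X (q n) \<omega>\<bar> \<le> N" using w q(1,3) q0 unfolding B_def by blast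
        qed
      qed (use elim N in auto)
    qed
  qed
  define D where "D = ito_const p"
  have D: "0 \<le> D" by (simp add: D_def ito_const_nonneg)
  \<comment> \<open>\<open>A\<close> and \<open>E\<close> collect the terms of the final estimate
    without and with the factor \<open>Q * exp (c * t) / sqrt c\<close>. The level \<open>N\<close>
    enters neither.\<close>
  define A where "A = a + k * T + k * (K * sqrt D * sqrt (2 * T)) * (1 + T)"
  define E where "E = k + k * (K * sqrt D) * (1 + T)"
  have AE0: "0 \<le> A" "0 \<le> E" using a k K D T by (auto simp: A_def E_def)
  define C where "C = 2 * A * exp (max 1 (4 * E\<^sup>2) * T)"
  have main: "Lp_bound M p (\<lambda>\<omega>. X t \<omega> * indicator (B N t) \<omega>) C" if N: "\<bar>x0\<bar> \<le> N" and t: "t \<in> {0..T}" for N t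
    unfolding C_def
  proof (rule Lp_gronwall[OF AE0 T0 _ _ _ t])
    fix t assume t: "t \<in> {0..T}"
    show "Lp_bound M p (\<lambda>\<omega>. X t \<omega> * indicator (B N t) \<omega>) N"
    proof (rule Lp_bound_const)
      show "AE \<omega> in M. \<bar>X t \<omega> * indicator (B N t) \<omega>\<bar> \<le> N"
        using bdd[OF N] by eventually_elim (use t N in \<open>auto simp: indicator_def\<close>)
    qed (use N in auto)
  next
    fix Q c t :: real assume Q: "0 \<le> Q" and c: "1 \<le> c" and t: "t \<in> {0..T}"
      and IH: "\<And>s. s \<in> {0..T} \<Longrightarrow> Lp_bound M p (\<lambda>\<omega>. X s \<omega> * indicator (B N s) \<omega>) (Q * exp (c * s))"
    have Hb: "Lp_bound M p (\<lambda>\<omega>. H s \<omega> * indicator (B N s) \<omega>) (K * (1 + Q * exp (c * s)))" if s: "s \<in> {0..T}" for s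
    proof -
      have "Lp_bound M p (\<lambda>\<omega>. K * (1 + \<bar>X s \<omega> * indicator (B N s) \<omega>\<bar>)) (\<bar>K\<bar> * (1 + Q * exp (c * s)))"
        by (intro Lp_bound_cmult Lp_bound_add Lp_bound_const Lp_bound_mono[OF IH[OF s]]) (use p in auto)
      then show ?thesis
      proof (rule Lp_bound_mono)
        show "AE \<omega> in M. \<bar>H s \<omega> * indicator (B N s) \<omega>\<bar> \<le> \<bar>K * (1 + \<bar>X s \<omega> * indicator (B N s) \<omega>\<bar>)\<bar>"
          using H[OF s] K by (intro AE_I2) (auto simp: indicator_def abs_mult)
      qed (use K p in auto)
    qed
    define j where "j s = K * sqrt D * (sqrt (2 * T) + Q * exp (c * s) / sqrt c)" for s
    have Jb: "Lp_bound M p (\<lambda>\<omega>. J s \<omega> * indicator (B N s) \<omega>) (j s)" if s: "s \<in> {0..T}" for s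
    proof -
      have "Lp_bound M p (\<lambda>\<omega>. (J s \<omega> - J 0 \<omega>) * indicator (B N s) \<omega>) (sqrt (ito_const p * (LINT r:{0..s}|lborel. (K * (1 + Q * exp (c * r)))\<^sup>2)))"
      proof (rule Lp_bound_ito_local[OF J _ _ _ p])
        show "continuous_on {0..s} (\<lambda>r. K * (1 + Q * exp (c * r)))" by (intro continuous_intros)
        show "Lp_bound M p (\<lambda>\<omega>. H r \<omega> * indicator (B N r) \<omega>) (K * (1 + Q * exp (c * r)))" if "r \<in> {0..s}" for r
          using Hb[of r] that s by simp
        show "\<omega> \<in> B N r" if "0 < r" "r \<le> T" "\<And>u. 0 \<le> u \<Longrightarrow> u < r \<Longrightarrow> \<omega> \<in> B N u" for r \<omega>
          using B3[OF that(1) that(3)] by blast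
      qed (use s B1 B2 in auto)
      then show ?thesis
      proof (rule Lp_bound_mono)
        show "AE \<omega> in M. \<bar>J s \<omega> * indicator (B N s) \<omega>\<bar> \<le> \<bar>(J s \<omega> - J 0 \<omega>) * indicator (B N s) \<omega>\<bar>"
          using ito_limit_at_zero[OF J] by eventually_elim simp
        show "sqrt (ito_const p * (LINT r:{0..s}|lborel. (K * (1 + Q * exp (c * r)))\<^sup>2)) \<le> j s"
          unfolding j_def D_def using s by (intro affine_exp_square_integral_le c Q K ito_const_nonneg) auto
      qed (use p in auto)
    qed
    have jmono: "j r \<le> j t" if "r \<in> {0..t}" for r
    proof -
      have "c * r \<le> c * t" using that c by (intro mult_left_mono) auto
      then show ?thesis unfolding j_def using K D Q c
        by (intro mult_left_mono add_left_mono divide_right_mono) auto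
    qed
    \<comment> \<open>\<open>B N t\<close> lies inside all earlier events, so under the time
      integrals its own indicator can be used. This one does not depend on \<open>r\<close> and
      keeps the integrands continuous.\<close>
    have sub: "r \<in> {0..T}" "B N t \<subseteq> B N r" if "r \<in> {0..t}" for r using that t B2 by auto
    have XI: "Lp_bound M p (\<lambda>\<omega>. LINT r:{0..t}|lborel. \<bar>X r \<omega> * indicator (B N t) \<omega>\<bar>) (LINT r:{0..t}|lborel. 1 * (1 + Q * exp (c * r)))"
    proof (rule Lp_bound_time_integral)
      show "(\<lambda>\<omega>. X r \<omega> * indicator (B N t) \<omega>) \<in> borel_measurable M" if "r \<in> {0..t}" for r
        using Xm[OF sub(1)[OF that]] BM[OF t] by measurable
      show "AE \<omega> in M. continuous_on {0..t} (\<lambda>r. X r \<omega> * indicator (B N t) \<omega>)"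
        using Xc by eventually_elim (use t in \<open>auto intro!: continuous_intros elim: continuous_on_subset\<close>)
      show "Lp_bound M p (\<lambda>\<omega>. X r \<omega> * indicator (B N t) \<omega>) (1 * (1 + Q * exp (c * r)))" if r: "r \<in> {0..t}" for r
        by (rule Lp_bound_mono[OF IH[OF sub(1)[OF r]]]) (use sub(2)[OF r] p in \<open>auto simp: indicator_def\<close>)
    qed (use t p in \<open>auto intro!: continuous_intros\<close>)
    have JI: "Lp_bound M p (\<lambda>\<omega>. LINT r:{0..t}|lborel. \<bar>J r \<omega> * indicator (B N t) \<omega>\<bar>) (LINT r:{0..t}|lborel. j t)"
    proof (rule Lp_bound_time_integral)
      show "(\<lambda>\<omega>. J r \<omega> * indicator (B N t) \<omega>) \<in> borel_measurable M" if "r \<in> {0..t}" for r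
        using Jm[OF sub(1)[OF that]] BM[OF t] by measurable
      show "AE \<omega> in M. continuous_on {0..t} (\<lambda>r. J r \<omega> * indicator (B N t) \<omega>)"
        using Jc by eventually_elim (use t in \<open>auto intro!: continuous_intros elim: continuous_on_subset\<close>)
      show "Lp_bound M p (\<lambda>\<omega>. J r \<omega> * indicator (B N t) \<omega>) (j t)" if r: "r \<in> {0..t}" for r
        by (rule Lp_bound_mono[OF Jb[OF sub(1)[OF r]]]) (use sub(2)[OF r] p jmono[OF r] in \<open>auto simp: indicator_def\<close>)
    qed (use t p in \<open>auto intro!: continuous_intros\<close>)
    have "Lp_bound M p (\<lambda>\<omega>. a + k * (LINT r:{0..t}|lborel. \<bar>X r \<omega> * indicator (B N t) \<omega>\<bar>) + k * \<bar>J t \<omega> * indicator (B N t) \<omega>\<bar> + k * (LINT r:{0..t}|lborel. \<bar>J r \<omega> * indicator (B N t) \<omega>\<bar>))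
       (a + \<bar>k\<bar> * (LINT r:{0..t}|lborel. 1 * (1 + Q * exp (c * r))) + \<bar>k\<bar> * j t + \<bar>k\<bar> * (LINT r:{0..t}|lborel. j t))"
      by (intro Lp_bound_add Lp_bound_cmult XI JI Lp_bound_const Lp_bound_mono[OF Jb[OF t]]) (use p a in auto)
    then show "Lp_bound M p (\<lambda>\<omega>. X t \<omega> * indicator (B N t) \<omega>) (A + E * Q * exp (c * t) / sqrt c)"
    proof (rule Lp_bound_mono)
      show "AE \<omega> in M. \<bar>X t \<omega> * indicator (B N t) \<omega>\<bar> \<le> \<bar>a + k * (LINT r:{0..t}|lborel. \<bar>X r \<omega> * indicator (B N t) \<omega>\<bar>) + k * \<bar>J t \<omega> * indicator (B N t) \<omega>\<bar> + k * (LINT r:{0..t}|lborel. \<bar>J r \<omega> * indicator (B N t) \<omega>\<bar>)\<bar>"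
        using le
      proof eventually_elim
        case (elim \<omega>)
        show ?case
        proof (cases "\<omega> \<in> B N t")
          case True
          then have "\<bar>X t \<omega>\<bar> \<le> a + k * (LINT r:{0..t}|lborel. \<bar>X r \<omega>\<bar>) + k * \<bar>J t \<omega>\<bar> + k * (LINT r:{0..t}|lborel. \<bar>J r \<omega>\<bar>)"
            using elim t by blast
          then show ?thesis using True by simp
        qed simp
      qed
      have 1: "(LINT r:{0..t}|lborel. 1 * (1 + Q * exp (c * r))) \<le> 1 * (T + Q * exp (c * t) / sqrt c)"
        using t by (intro affine_exp_integral_le c Q) auto
      have j0: "0 \<le> j t" unfolding j_def using K D T Q c by (intro mult_nonneg_nonneg add_nonneg_nonneg) auto
      have "(LINT r:{0..t}|lborel. j t) = t * j t" using t by (simp add: set_integral_const)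
      also have "\<dots> \<le> T * j t" using t j0 by (intro mult_right_mono) auto
      finally have 2: "(LINT r:{0..t}|lborel. j t) \<le> T * j t" .
      show "a + \<bar>k\<bar> * (LINT r:{0..t}|lborel. 1 * (1 + Q * exp (c * r))) + \<bar>k\<bar> * j t + \<bar>k\<bar> * (LINT r:{0..t}|lborel. j t) \<le> A + E * Q * exp (c * t) / sqrt c"
      proof -
        define x where "x = Q * exp (c * t) / sqrt c"
        have "a + k * (LINT r:{0..t}|lborel. 1 * (1 + Q * exp (c * r))) + k * j t + k * (LINT r:{0..t}|lborel. j t) \<le> a + k * (T + x) + k * j t + k * (T * j t)"
          using 1 2 k unfolding x_def by (intro add_mono mult_left_mono order_refl) auto
        also have "\<dots> = A + E * x"
        proof -
          have "j t = K * sqrt D * (sqrt (2 * T) + x)" by (simp add: j_def x_def)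
          then show ?thesis by (simp add: A_def E_def algebra_simps)
        qed
        finally show ?thesis using k by (simp add: x_def)
      qed
    qed (use p in auto)
  qed (use p in auto)
  have "\<forall>t\<in>{0..T}. Lp_bound M p (X t) C"
  proof
    fix t assume t: "t \<in> {0..T}"
    show "Lp_bound M p (X t) C"
    \<comment> \<open>A continuous path is bounded on the interval, so it belongs to the events for
      all large levels.\<close>
    proof (rule Lp_bound_truncated_limit[OF Xm[OF t], where B = "\<lambda>n. B (\<bar>x0\<bar> + real n) t"])
      show "B (\<bar>x0\<bar> + real n) t \<in> sets M" for n by (rule BM[OF t])
      show "Lp_bound M p (\<lambda>\<omega>. X t \<omega> * indicator (B (\<bar>x0\<bar> + real n) t) \<omega>) C" for n by (rule main[OF _ t]) simp
      show "AE \<omega> in M. \<forall>\<^sub>F n in sequentially. \<omega> \<in> B (\<bar>x0\<bar> + real n) t"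
        using Xc AE_space
      proof eventually_elim
        case (elim \<omega>)
        have "bounded ((\<lambda>t. X t \<omega>) ` {0..T})"
          by (intro compact_imp_bounded compact_continuous_image elim) auto
        then obtain b where b: "\<forall>u\<in>{0..T}. \<bar>X u \<omega>\<bar> \<le> b" unfolding bounded_iff by auto
        obtain n0 where n0: "b \<le> real n0" using real_arch_simple by blast
        show ?case
        proof (rule eventually_sequentiallyI)
          fix n assume "n0 \<le> n"
          then have "b \<le> \<bar>x0\<bar> + real n" using n0 by (meson abs_ge_zero add_increasing of_nat_mono order_trans)
          then have "\<bar>X q \<omega>\<bar> \<le> \<bar>x0\<bar> + real n" if "0 \<le> q" "q < t" for q
            using bspec[OF b, of q] that t by simp
          then show "\<omega> \<in> B (\<bar>x0\<bar> + real n) t" unfolding B_def using elim(2) by blast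
        qed
      qed
    qed (use p in auto)
  qed
  then show ?thesis by blast
qed

end

subsection \<open>The mean-field and the limit equation\<close>

context bm_filtration
begin

lemma set_integral_L:
  fixes f :: "real \<Rightarrow> real"
  assumes "t \<in> {0..T}"
  shows "(LINT s:{0..t}|lborel. f s) = (\<integral>s. indicator {0..t} s * f s \<partial>L)"
    "set_integrable lborel {0..T} f \<longleftrightarrow> integrable L f"
proof -
  have "indicator {0..T} s *\<^sub>R (indicator {0..t} s * f s) = indicator {0..t} s *\<^sub>R f s" for s
    using assms by (auto simp: indicator_def)
  then show "(LINT s:{0..t}|lborel. f s) = (\<integral>s. indicator {0..t} s * f s \<partial>L)"
    unfolding set_lebesgue_integral_def by (subst integral_restrict_space) (simp_all del: real_scaleR_def)
  show "set_integrable lborel {0..T} f \<longleftrightarrow> integrable L f"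
    unfolding set_integrable_def by (subst integrable_restrict_space) auto
qed

text \<open>Joint measurability over \<open>L \<Otimes>\<^sub>M M\<close> and a bound uniform in
  time give integrability on the product, hence Fubini.\<close>

lemma expectation_time_integral:
  assumes G[measurable]: "(\<lambda>x. G (fst x) (snd x)) \<in> borel_measurable (L \<Otimes>\<^sub>M M)"
    and b: "\<And>s. s \<in> {0..T} \<Longrightarrow> Lp_bound M p (G s) C" and p: "1 \<le> p"
  shows "set_integrable lborel {0..T} (\<lambda>s. \<integral>\<omega>. G s \<omega> \<partial>M)"
    and "t \<in> {0..T} \<Longrightarrow> integrable M (\<lambda>\<omega>. LINT s:{0..t}|lborel. G s \<omega>)"
    and "t \<in> {0..T} \<Longrightarrow> (\<integral>\<omega>. (LINT s:{0..t}|lborel. G s \<omega>) \<partial>M) = (LINT s:{0..t}|lborel. (\<integral>\<omega>. G s \<omega> \<partial>M))"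
proof -
  interpret L: finite_measure L by (rule finite_measure_L)
  interpret LM: pair_sigma_finite L M ..
  have sec: "G s \<in> borel_measurable M" if "s \<in> {0..T}" for s using section_measurable(2)[OF G that] .
  have int: "integrable (L \<Otimes>\<^sub>M M) (\<lambda>x. G (fst x) (snd x))"
  proof (rule LM.Fubini_integrable)
    show "AE s in L. integrable M (\<lambda>\<omega>. G (fst (s, \<omega>)) (snd (s, \<omega>)))"
      using Lp_bound_integral(1)[OF b p sec] by (intro AE_I2) auto
    have "(\<lambda>s. \<integral>\<omega>. \<bar>G s \<omega>\<bar> \<partial>M) \<in> borel_measurable L"
      by (rule borel_measurable_lebesgue_integral) (simp add: case_prod_beta)
    moreover have "AE s in L. norm (\<integral>\<omega>. \<bar>G s \<omega>\<bar> \<partial>M) \<le> C"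
      using Lp_bound_integral(2)[OF b p sec] by (intro AE_I2) (auto simp: integral_nonneg_AE)
    ultimately show "integrable L (\<lambda>s. \<integral>\<omega>. norm (G (fst (s, \<omega>)) (snd (s, \<omega>))) \<partial>M)"
      by (intro L.integrable_const_bound[where B = C]) auto
  qed measurable
  show "set_integrable lborel {0..T} (\<lambda>s. \<integral>\<omega>. G s \<omega> \<partial>M)"
    using LM.integrable_fst'[OF int] set_integral_L(2)[of T] T by simp
  assume t: "t \<in> {0..T}"
  have "(\<lambda>x. indicator {0..t} (fst x) :: real) \<in> borel_measurable (L \<Otimes>\<^sub>M M)"
    by (rule measurable_compose[OF measurable_fst], rule measurable_restrict_space1) simp
  then have "(\<lambda>x. indicator {0..t} (fst x) * G (fst x) (snd x)) \<in> borel_measurable (L \<Otimes>\<^sub>M M)"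
    using G by (rule borel_measurable_times)
  then have "integrable (L \<Otimes>\<^sub>M M) (\<lambda>x. indicator {0..t} (fst x) * G (fst x) (snd x))"
    by (rule Bochner_Integration.integrable_bound[OF int]) (rule AE_I2, simp add: indicator_def)
  then have int': "integrable (L \<Otimes>\<^sub>M M) (case_prod (\<lambda>s \<omega>. indicator {0..t} s * G s \<omega>))"
    unfolding case_prod_beta' .
  show "integrable M (\<lambda>\<omega>. LINT s:{0..t}|lborel. G s \<omega>)"
    using LM.integrable_snd[OF int'] by (simp add: set_integral_L(1)[OF t])
  show "(\<integral>\<omega>. (LINT s:{0..t}|lborel. G s \<omega>) \<partial>M) = (LINT s:{0..t}|lborel. (\<integral>\<omega>. G s \<omega> \<partial>M))"
    using LM.Fubini_integral[OF int'] by (simp add: set_integral_L(1)[OF t])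
qed

lemma joint_modification:
  fixes Q :: "real \<Rightarrow> 'a \<Rightarrow> real"
  assumes "\<And>t. t \<in> {0..T} \<Longrightarrow> Q t \<in> borel_measurable M"
    and "AE \<omega> in M. continuous_on {0..T} (\<lambda>t. Q t \<omega>)"
  obtains Q' where "(\<lambda>x. Q' (fst x) (snd x)) \<in> borel_measurable (L \<Otimes>\<^sub>M M)"
    "AE \<omega> in M. \<forall>t\<in>{0..T}. Q' t \<omega> = Q t \<omega>"
proof -
  obtain Q' where Q': "\<And>r. Q' r \<in> borel_measurable M"
    "\<And>\<omega>. \<omega> \<in> space M \<Longrightarrow> continuous_on UNIV (\<lambda>r. Q' r \<omega>)"
    "AE \<omega> in M. \<forall>r\<in>{0..T}. Q' r \<omega> = Q r \<omega>"
    using continuous_modification[of 0 T Q M] assms T by auto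
  have "(\<lambda>x. Q' (fst x) (snd x)) \<in> borel_measurable (borel \<Otimes>\<^sub>M M)"
    using borel_measurable_continuous_process[OF Q'(1,2)] by (simp add: case_prod_beta)
  moreover have "(\<lambda>x. (fst x, snd x)) \<in> measurable (L \<Otimes>\<^sub>M M) (borel \<Otimes>\<^sub>M M)"
    by (intro measurable_Pair measurable_compose[OF measurable_fst] measurable_snd measurable_restrict_space1) simp
  ultimately have "(\<lambda>x. Q' (fst x) (snd x)) \<in> borel_measurable (L \<Otimes>\<^sub>M M)"
    using measurable_compose[of "\<lambda>x. (fst x, snd x)" "L \<Otimes>\<^sub>M M" "borel \<Otimes>\<^sub>M M" "\<lambda>x. Q' (fst x) (snd x)" borel] by simp
  then show ?thesis using that Q'(3) by blast
qed

lemma AE_at: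
  assumes "AE \<omega> in M. \<forall>t\<in>{0..T}. P t \<omega>" "t \<in> {0..T}"
  shows "AE \<omega> in M. P t \<omega>"
  using assms(1) by eventually_elim (use assms(2) in blast)

lemma AE_obtain:
  assumes "AE \<omega> in M. P \<omega>"
  obtains \<omega> where "P \<omega>"
proof -
  have "\<exists>\<omega>. P \<omega>"
  proof (rule ccontr)
    assume "\<not> (\<exists>\<omega>. P \<omega>)"
    then have "AE \<omega> in M. False" using assms by simp
    then show False by simp
  qed
  then show ?thesis using that by blast
qed

end

lemma abs_drift_le: "\<bar>a - b - c + d + e\<bar> \<le> \<bar>a\<bar> + \<bar>b\<bar> + \<bar>c\<bar> + \<bar>d\<bar> + \<bar>e\<bar>" for a b c d e :: real
  by linarith

lemma abs_drift_le': "\<bar>a - b - c + d\<bar> \<le> \<bar>a\<bar> + \<bar>b\<bar> + \<bar>c\<bar> + \<bar>d\<bar>" for a b c d :: real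
  by linarith

lemma set_integral_at_point: "(LINT s:{t}|lborel. f s) = (0 :: real)" for t :: real
proof -
  have "AE s in lborel. indicator {t} s *\<^sub>R f s = 0"
    using AE_lborel_singleton[of t] by eventually_elim auto
  then show ?thesis unfolding set_lebesgue_integral_def by (simp add: integral_eq_zero_AE)
qed

lemma set_integral_subset_le:
  fixes f :: "'a \<Rightarrow> real"
  assumes "set_integrable M B f" "A \<in> sets M" "A \<subseteq> B" "\<And>x. x \<in> B \<Longrightarrow> 0 \<le> f x"
  shows "(LINT x:A|M. f x) \<le> (LINT x:B|M. f x)"
  unfolding set_lebesgue_integral_def
  by (rule integral_mono)
     (use assms set_integrable_subset[OF assms(1-3)] in \<open>auto simp: set_integrable_def indicator_def\<close>)

locale langevin = bm_filtration M F T W for M :: "'a measure" and F T W +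
  fixes \<kappa> \<gamma> K p :: real and g \<sigma> :: "real \<Rightarrow> real \<Rightarrow> real"
  assumes \<kappa>: "0 < \<kappa>" and \<gamma>: "0 < \<gamma>" and K: "0 \<le> K" and p: "2 \<le> p"
    and growth: "\<And>t x. t \<in> {0..T} \<Longrightarrow> \<bar>g t x\<bar> + \<bar>\<sigma> t x\<bar> \<le> K * (1 + \<bar>x\<bar>)"
begin

lemma g_growth: "t \<in> {0..T} \<Longrightarrow> \<bar>g t x\<bar> \<le> K * (1 + \<bar>x\<bar>)"
  and \<sigma>_growth: "t \<in> {0..T} \<Longrightarrow> \<bar>\<sigma> t x\<bar> \<le> K * (1 + \<bar>x\<bar>)"
  using growth[of t x] by linarith+

text \<open>\<open>mean_field_solution\<close> with the filtration taken from the locale instead of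
  fixed as the augmented one.\<close>

definition mean_field :: "real \<Rightarrow> real \<Rightarrow> real \<Rightarrow> (real \<Rightarrow> 'a \<Rightarrow> real) \<Rightarrow> (real \<Rightarrow> 'a \<Rightarrow> real) \<Rightarrow> bool" where
  "mean_field x0 y0 \<alpha> X Y \<longleftrightarrow>
     (\<forall>t\<in>{0..T}. integrable M (Y t)) \<and>
     ito_process M F T W x0 Y (\<lambda>t \<omega>. 0) X \<and>
     ito_process M F T W (1 / \<alpha> * y0)
       (\<lambda>t \<omega>. - \<kappa> * Y t \<omega> - g t (X t \<omega>) - \<gamma> * (Y t \<omega> - (\<integral>\<omega>'. Y t \<omega>' \<partial>M)))
       (\<lambda>t \<omega>. \<sigma> t (X t \<omega>))
       (\<lambda>t \<omega>. 1 / \<alpha> * Y t \<omega>)"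

text \<open>The coefficient \<open>g\<close> carries no measurability in time. Measurability and
  integrability of \<open>g t (X t \<omega>)\<close> are recovered by solving the drift for it,
  which is progressive and integrable by the notion of solution.\<close>

lemma mean_fieldE:
  assumes mf: "mean_field x0 y0 \<alpha> X Y" and \<alpha>: "0 < \<alpha>"
  obtains J g' where
    "ito_limit (\<lambda>t \<omega>. \<sigma> t (X t \<omega>)) J" "AE \<omega> in M. continuous_on {0..T} (\<lambda>t. J t \<omega>)"
    "\<And>t. t \<in> {0..T} \<Longrightarrow> X t \<in> borel_measurable (F t)" "AE \<omega> in M. continuous_on {0..T} (\<lambda>t. X t \<omega>)"
    "\<And>t. t \<in> {0..T} \<Longrightarrow> Y t \<in> borel_measurable M" "AE \<omega> in M. continuous_on {0..T} (\<lambda>t. Y t \<omega>)"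
    "AE \<omega> in M. \<forall>t\<in>{0..T}. X t \<omega> = x0 + (LINT s:{0..t}|lborel. Y s \<omega>)"
    "AE \<omega> in M. set_integrable lborel {0..T} (\<lambda>s. g s (X s \<omega>))"
    "set_integrable lborel {0..T} (\<lambda>s. \<integral>\<omega>. Y s \<omega> \<partial>M)"
    "AE \<omega> in M. \<forall>t\<in>{0..T}. Y t \<omega> / \<alpha> = y0 / \<alpha> - (\<kappa> + \<gamma>) * (X t \<omega> - x0) - (LINT s:{0..t}|lborel. g s (X s \<omega>))
        + \<gamma> * (LINT s:{0..t}|lborel. (\<integral>\<omega>. Y s \<omega> \<partial>M)) + J t \<omega>"
    "(\<lambda>x. g' (fst x) (snd x)) \<in> borel_measurable (L \<Otimes>\<^sub>M M)"
    "AE \<omega> in M. \<forall>t\<in>{0..T}. g' t \<omega> = g t (X t \<omega>)"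
    "\<And>t. t \<in> {0..T} \<Longrightarrow> (\<lambda>\<omega>. g t (X t \<omega>)) \<in> borel_measurable M"
proof -
  define m where "m s = (\<integral>\<omega>. Y s \<omega> \<partial>M)" for s
  define b where "b t \<omega> = - \<kappa> * Y t \<omega> - g t (X t \<omega>) - \<gamma> * (Y t \<omega> - m t)" for t \<omega>
  have mfX: "ito_process M F T W x0 Y (\<lambda>t \<omega>. 0) X"
    and mfY: "ito_process M F T W (1 / \<alpha> * y0) b (\<lambda>t \<omega>. \<sigma> t (X t \<omega>)) (\<lambda>t \<omega>. 1 / \<alpha> * Y t \<omega>)"
    using mf by (auto simp: mean_field_def b_def[abs_def] m_def)
  obtain J0 where X: "ito_limit (\<lambda>_ _. 0) J0" "AE \<omega> in M. continuous_on {0..T} (\<lambda>t. J0 t \<omega>)"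
    "AE \<omega> in M. set_integrable lborel {0..T} (\<lambda>s. Y s \<omega>)"
    "AE \<omega> in M. \<forall>t\<in>{0..T}. X t \<omega> = x0 + (LINT s:{0..t}|lborel. Y s \<omega>) + J0 t \<omega>"
    "\<And>t. t \<in> {0..T} \<Longrightarrow> X t \<in> borel_measurable (F t)" "AE \<omega> in M. continuous_on {0..T} (\<lambda>t. X t \<omega>)"
    "(\<lambda>x. Y (fst x) (snd x)) \<in> borel_measurable (L \<Otimes>\<^sub>M M)"
    by (rule ito_processE[OF mfX], rule that)
  obtain J where J: "ito_limit (\<lambda>t \<omega>. \<sigma> t (X t \<omega>)) J" "AE \<omega> in M. continuous_on {0..T} (\<lambda>t. J t \<omega>)"
    and bi: "AE \<omega> in M. set_integrable lborel {0..T} (\<lambda>s. b s \<omega>)"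
    and Yeq: "AE \<omega> in M. \<forall>t\<in>{0..T}. 1 / \<alpha> * Y t \<omega> = 1 / \<alpha> * y0 + (LINT s:{0..t}|lborel. b s \<omega>) + J t \<omega>"
    and Ya: "\<And>t. t \<in> {0..T} \<Longrightarrow> (\<lambda>\<omega>. 1 / \<alpha> * Y t \<omega>) \<in> borel_measurable (F t)"
    and Yc: "AE \<omega> in M. continuous_on {0..T} (\<lambda>t. 1 / \<alpha> * Y t \<omega>)"
    and bj: "(\<lambda>x. b (fst x) (snd x)) \<in> borel_measurable (L \<Otimes>\<^sub>M M)"
    by (rule ito_processE[OF mfY], rule that)
  have J0: "AE \<omega> in M. \<forall>t\<in>{0..T}. J0 t \<omega> = 0"
    by (rule ito_limit_unique[OF X(1) ito_limit_zero X(2)]) simp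
  have Ym: "Y t \<in> borel_measurable M" if "t \<in> {0..T}" for t
    using borel_measurable_times[OF borel_measurable_const[of \<alpha>] F_measurable_M[OF Ya[OF that] that]] \<alpha> by simp
  have Yc': "AE \<omega> in M. continuous_on {0..T} (\<lambda>t. Y t \<omega>)"
    using Yc
  proof eventually_elim
    case (elim \<omega>)
    from continuous_on_mult[OF continuous_on_const[of _ \<alpha>] elim] show ?case using \<alpha> by simp
  qed
  have Xeq: "AE \<omega> in M. \<forall>t\<in>{0..T}. X t \<omega> = x0 + (LINT s:{0..t}|lborel. Y s \<omega>)"
    using X(4) J0 by eventually_elim simp
  obtain Y' where Y': "(\<lambda>x. Y' (fst x) (snd x)) \<in> borel_measurable (L \<Otimes>\<^sub>M M)" "AE \<omega> in M. \<forall>t\<in>{0..T}. Y' t \<omega> = Y t \<omega>"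
    using joint_modification[of Y] Ym Yc' by blast
  note [measurable] = Y'(1) bj
  have mm: "m \<in> borel_measurable L"
  proof -
    have "(\<lambda>s. \<integral>\<omega>. Y' s \<omega> \<partial>M) \<in> borel_measurable L"
      by (rule borel_measurable_lebesgue_integral) (simp add: case_prod_beta)
    moreover have "(\<integral>\<omega>. Y' s \<omega> \<partial>M) = m s" if "s \<in> {0..T}" for s unfolding m_def
      using AE_at[OF Y'(2) that] Ym[OF that] section_measurable(2)[OF Y'(1) that] by (intro integral_cong_AE) auto
    ultimately show ?thesis using measurable_cong[of L "\<lambda>s. \<integral>\<omega>. Y' s \<omega> \<partial>M" m borel] by simp
  qed
  \<comment> \<open>A single good path suffices: along it \<open>\<gamma> * m s\<close> is the sum
    of the drift, a multiple of the velocity and \<open>g\<close>, all integrable or dominated, and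
    \<open>m\<close> does not depend on the path.\<close>
  have mi: "set_integrable lborel {0..T} m"
  proof -
    obtain \<omega> where w: "continuous_on {0..T} (\<lambda>t. X t \<omega>)" "continuous_on {0..T} (\<lambda>t. Y t \<omega>)" "set_integrable lborel {0..T} (\<lambda>s. b s \<omega>)"
      using AE_obtain[OF AE_conjI[OF X(6) AE_conjI[OF Yc' bi]]] by blast
    have "set_integrable lborel {0..T} (\<lambda>s. \<bar>b s \<omega>\<bar> + ((\<kappa> + \<gamma>) * \<bar>Y s \<omega>\<bar> + K * (1 + \<bar>X s \<omega>\<bar>)))"
      using w by (intro set_integral_add(1) set_integrable_abs) (auto intro!: borel_integrable_atLeastAtMost' continuous_intros)
    then have "integrable L (\<lambda>s. \<bar>b s \<omega>\<bar> + ((\<kappa> + \<gamma>) * \<bar>Y s \<omega>\<bar> + K * (1 + \<bar>X s \<omega>\<bar>)))"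
      using set_integral_L(2)[of T] T by simp
    then have "integrable L (\<lambda>s. \<gamma> * m s)"
    proof (rule Bochner_Integration.integrable_bound)
      show "(\<lambda>s. \<gamma> * m s) \<in> borel_measurable L" using mm by measurable
      show "AE s in L. norm (\<gamma> * m s) \<le> norm (\<bar>b s \<omega>\<bar> + ((\<kappa> + \<gamma>) * \<bar>Y s \<omega>\<bar> + K * (1 + \<bar>X s \<omega>\<bar>)))"
      proof (rule AE_I2)
        fix s assume "s \<in> space L"
        then have gs: "\<bar>g s (X s \<omega>)\<bar> \<le> K * (1 + \<bar>X s \<omega>\<bar>)" using g_growth by simp
        have "\<gamma> * m s = b s \<omega> + (\<kappa> + \<gamma>) * Y s \<omega> + g s (X s \<omega>)" by (simp add: b_def algebra_simps)
        also have "\<bar>\<dots>\<bar> \<le> \<bar>b s \<omega>\<bar> + \<bar>(\<kappa> + \<gamma>) * Y s \<omega>\<bar> + \<bar>g s (X s \<omega>)\<bar>" by linarith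
        also have "\<bar>(\<kappa> + \<gamma>) * Y s \<omega>\<bar> = (\<kappa> + \<gamma>) * \<bar>Y s \<omega>\<bar>" using \<kappa> \<gamma> by (simp add: abs_mult)
        finally show "norm (\<gamma> * m s) \<le> norm (\<bar>b s \<omega>\<bar> + ((\<kappa> + \<gamma>) * \<bar>Y s \<omega>\<bar> + K * (1 + \<bar>X s \<omega>\<bar>)))"
          using gs by simp
      qed
    qed
    then show ?thesis using \<gamma> set_integral_L(2)[of T m] T by simp
  qed
  have geq: "g s (X s \<omega>) = - b s \<omega> - (\<kappa> + \<gamma>) * Y s \<omega> + \<gamma> * m s" for s \<omega>
    by (simp add: b_def algebra_simps)
  have gi: "AE \<omega> in M. set_integrable lborel {0..T} (\<lambda>s. g s (X s \<omega>))"
    using bi Yc'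
  proof eventually_elim
    case (elim \<omega>)
    have "set_integrable lborel {0..T} (\<lambda>s. \<gamma> * m s - (b s \<omega> + (\<kappa> + \<gamma>) * Y s \<omega>))"
      using elim(1) mi borel_integrable_atLeastAtMost'[OF elim(2)]
      by (intro set_integral_add(1) set_integral_diff(1) set_integrable_mult_right)
    then show ?case by (simp add: geq algebra_simps)
  qed
  have Yeq': "AE \<omega> in M. \<forall>t\<in>{0..T}. Y t \<omega> / \<alpha> = y0 / \<alpha> - (\<kappa> + \<gamma>) * (X t \<omega> - x0) - (LINT s:{0..t}|lborel. g s (X s \<omega>))
        + \<gamma> * (LINT s:{0..t}|lborel. m s) + J t \<omega>"
    using Yeq Xeq gi Yc'
  proof eventually_elim
    case (elim \<omega>)
    show ?case
    proof
      fix t assume t: "t \<in> {0..T}"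
      have sub: "set_integrable lborel {0..t} f" if "set_integrable lborel {0..T} f" for f :: "real \<Rightarrow> real"
        by (rule set_integrable_subset[OF that]) (use t in auto)
      have i: "set_integrable lborel {0..t} (\<lambda>s. (\<kappa> + \<gamma>) * Y s \<omega>)" "set_integrable lborel {0..t} (\<lambda>s. g s (X s \<omega>))"
        "set_integrable lborel {0..t} (\<lambda>s. \<gamma> * m s)"
        by (intro set_integrable_mult_right sub borel_integrable_atLeastAtMost' elim(4)) (intro set_integrable_mult_right sub elim(3) mi)+
      have "(LINT s:{0..t}|lborel. b s \<omega>) = (LINT s:{0..t}|lborel. \<gamma> * m s - ((\<kappa> + \<gamma>) * Y s \<omega> + g s (X s \<omega>)))"
        by (simp add: b_def algebra_simps)
      also have "\<dots> = \<gamma> * (LINT s:{0..t}|lborel. m s) - ((\<kappa> + \<gamma>) * (LINT s:{0..t}|lborel. Y s \<omega>) + (LINT s:{0..t}|lborel. g s (X s \<omega>)))"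
        using i by (simp add: set_integral_add(2) set_integral_diff(2) set_integral_add(1))
      finally show "Y t \<omega> / \<alpha> = y0 / \<alpha> - (\<kappa> + \<gamma>) * (X t \<omega> - x0) - (LINT s:{0..t}|lborel. g s (X s \<omega>))
        + \<gamma> * (LINT s:{0..t}|lborel. m s) + J t \<omega>"
        using bspec[OF elim(1) t] bspec[OF elim(2) t] by simp
    qed
  qed
  \<comment> \<open>A jointly measurable version of \<open>g s (X s \<omega>)\<close>, made for
    Fubini's theorem.\<close>
  define g' where "g' s \<omega> = - b s \<omega> - (\<kappa> + \<gamma>) * Y' s \<omega> + \<gamma> * m s" for s \<omega>
  have [measurable]: "(\<lambda>x. m (fst x)) \<in> borel_measurable (L \<Otimes>\<^sub>M M)" using mm by measurable
  have g'1: "(\<lambda>x. g' (fst x) (snd x)) \<in> borel_measurable (L \<Otimes>\<^sub>M M)" unfolding g'_def by measurable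
  have g'2: "AE \<omega> in M. \<forall>t\<in>{0..T}. g' t \<omega> = g t (X t \<omega>)"
    using Y'(2) by eventually_elim (simp add: g'_def geq)
  have g3: "(\<lambda>\<omega>. g t (X t \<omega>)) \<in> borel_measurable M" if "t \<in> {0..T}" for t
    unfolding geq using Ym[OF that] section_measurable(2)[OF bj that] by measurable
  show ?thesis
    by (rule that[OF J X(5) X(6) Ym Yc' Xeq gi mi[unfolded m_def] Yeq'[unfolded m_def] g'1 g'2 g3])
qed

definition limit_equation :: "real \<Rightarrow> (real \<Rightarrow> 'a \<Rightarrow> real) \<Rightarrow> bool" where
  "limit_equation x0 X \<longleftrightarrow>
     (\<forall>t\<in>{0..T}. integrable M (\<lambda>\<omega>. g t (X t \<omega>))) \<and>
     ito_process M F T W ((\<kappa> + \<gamma>) * x0)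
       (\<lambda>t \<omega>. - (g t (X t \<omega>) + \<gamma> / \<kappa> * (\<integral>\<omega>'. g t (X t \<omega>') \<partial>M)))
       (\<lambda>t \<omega>. \<sigma> t (X t \<omega>))
       (\<lambda>t \<omega>. (\<kappa> + \<gamma>) * X t \<omega>)"

lemma limit_equationE:
  assumes lim: "limit_equation x0 X"
  obtains J where
    "ito_limit (\<lambda>t \<omega>. \<sigma> t (X t \<omega>)) J" "AE \<omega> in M. continuous_on {0..T} (\<lambda>t. J t \<omega>)"
    "\<And>t. t \<in> {0..T} \<Longrightarrow> X t \<in> borel_measurable (F t)" "AE \<omega> in M. continuous_on {0..T} (\<lambda>t. X t \<omega>)"
    "AE \<omega> in M. set_integrable lborel {0..T} (\<lambda>s. g s (X s \<omega>))"
    "set_integrable lborel {0..T} (\<lambda>s. \<integral>\<omega>. g s (X s \<omega>) \<partial>M)"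
    "AE \<omega> in M. \<forall>t\<in>{0..T}. (\<kappa> + \<gamma>) * X t \<omega> = (\<kappa> + \<gamma>) * x0 - (LINT s:{0..t}|lborel. g s (X s \<omega>))
        - \<gamma> / \<kappa> * (LINT s:{0..t}|lborel. (\<integral>\<omega>. g s (X s \<omega>) \<partial>M)) + J t \<omega>"
proof -
  define e where "e s = (\<integral>\<omega>. g s (X s \<omega>) \<partial>M)" for s
  define b where "b t \<omega> = - (g t (X t \<omega>) + \<gamma> / \<kappa> * e t)" for t \<omega>
  have ig: "\<And>t. t \<in> {0..T} \<Longrightarrow> integrable M (\<lambda>\<omega>. g t (X t \<omega>))"
    and ip: "ito_process M F T W ((\<kappa> + \<gamma>) * x0) b (\<lambda>t \<omega>. \<sigma> t (X t \<omega>)) (\<lambda>t \<omega>. (\<kappa> + \<gamma>) * X t \<omega>)"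
    using lim by (auto simp: limit_equation_def b_def[abs_def] e_def)
  obtain J where J: "ito_limit (\<lambda>t \<omega>. \<sigma> t (X t \<omega>)) J" "AE \<omega> in M. continuous_on {0..T} (\<lambda>t. J t \<omega>)"
    and bi: "AE \<omega> in M. set_integrable lborel {0..T} (\<lambda>s. b s \<omega>)"
    and Xeq: "AE \<omega> in M. \<forall>t\<in>{0..T}. (\<kappa> + \<gamma>) * X t \<omega> = (\<kappa> + \<gamma>) * x0 + (LINT s:{0..t}|lborel. b s \<omega>) + J t \<omega>"
    and Xa: "\<And>t. t \<in> {0..T} \<Longrightarrow> (\<lambda>\<omega>. (\<kappa> + \<gamma>) * X t \<omega>) \<in> borel_measurable (F t)"
    and Xc: "AE \<omega> in M. continuous_on {0..T} (\<lambda>t. (\<kappa> + \<gamma>) * X t \<omega>)"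
    and bj: "(\<lambda>x. b (fst x) (snd x)) \<in> borel_measurable (L \<Otimes>\<^sub>M M)"
    by (rule ito_processE[OF ip], rule that)
  have kg: "\<kappa> + \<gamma> \<noteq> 0" using \<kappa> \<gamma> by simp
  have Xa': "X t \<in> borel_measurable (F t)" if "t \<in> {0..T}" for t
    using borel_measurable_times[OF borel_measurable_const[of "1 / (\<kappa> + \<gamma>)"] Xa[OF that]] kg by simp
  have Xc': "AE \<omega> in M. continuous_on {0..T} (\<lambda>t. X t \<omega>)"
    using Xc
  proof eventually_elim
    case (elim \<omega>)
    from continuous_on_mult[OF continuous_on_const[of _ "1 / (\<kappa> + \<gamma>)"] elim] show ?case using kg by simp
  qed
  \<comment> \<open>The mean of the drift is \<open>- ((1 + \<gamma> / \<kappa>) * e s)\<close>, so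
    \<open>e\<close> inherits measurability in time from the drift.\<close>
  have em: "e \<in> borel_measurable L"
  proof -
    note [measurable] = bj
    have "(\<lambda>s. \<integral>\<omega>. b s \<omega> \<partial>M) \<in> borel_measurable L"
      by (rule borel_measurable_lebesgue_integral) (simp add: case_prod_beta)
    then have "(\<lambda>s. - (\<integral>\<omega>. b s \<omega> \<partial>M) / (1 + \<gamma> / \<kappa>)) \<in> borel_measurable L" by measurable
    moreover have "- (\<integral>\<omega>. b s \<omega> \<partial>M) / (1 + \<gamma> / \<kappa>) = e s" if "s \<in> {0..T}" for s
    proof -
      have "(\<integral>\<omega>. b s \<omega> \<partial>M) = - ((1 + \<gamma> / \<kappa>) * e s)"
        using ig[OF that] by (simp add: b_def e_def[symmetric] prob_space algebra_simps)
      moreover have "1 + \<gamma> / \<kappa> \<noteq> 0" using \<kappa> \<gamma> divide_pos_pos[of \<gamma> \<kappa>] by linarith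
      ultimately show ?thesis by simp
    qed
    ultimately show ?thesis by (rule measurable_cong[THEN iffD1, rotated]) simp
  qed
  have ei: "set_integrable lborel {0..T} e"
  proof -
    obtain \<omega> where w: "continuous_on {0..T} (\<lambda>t. X t \<omega>)" "set_integrable lborel {0..T} (\<lambda>s. b s \<omega>)"
      using AE_obtain[OF AE_conjI[OF Xc' bi]] by blast
    have "set_integrable lborel {0..T} (\<lambda>s. \<bar>b s \<omega>\<bar> + K * (1 + \<bar>X s \<omega>\<bar>))"
      by (intro set_integral_add(1) set_integrable_abs w(2) borel_integrable_atLeastAtMost' continuous_intros w(1))
    then have "integrable L (\<lambda>s. \<bar>b s \<omega>\<bar> + K * (1 + \<bar>X s \<omega>\<bar>))"
      using set_integral_L(2)[of T] T by simp
    then have "integrable L (\<lambda>s. \<gamma> / \<kappa> * e s)"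
    proof (rule Bochner_Integration.integrable_bound)
      show "(\<lambda>s. \<gamma> / \<kappa> * e s) \<in> borel_measurable L" using em by measurable
      show "AE s in L. norm (\<gamma> / \<kappa> * e s) \<le> norm (\<bar>b s \<omega>\<bar> + K * (1 + \<bar>X s \<omega>\<bar>))"
      proof (rule AE_I2)
        fix s assume "s \<in> space L"
        then have gs: "\<bar>g s (X s \<omega>)\<bar> \<le> K * (1 + \<bar>X s \<omega>\<bar>)" using g_growth by simp
        have "\<gamma> / \<kappa> * e s = - b s \<omega> - g s (X s \<omega>)" by (simp add: b_def)
        then show "norm (\<gamma> / \<kappa> * e s) \<le> norm (\<bar>b s \<omega>\<bar> + K * (1 + \<bar>X s \<omega>\<bar>))" using gs by simp
      qed
    qed
    from integrable_mult_right[OF this, of "\<kappa> / \<gamma>"]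
    have "integrable L (\<lambda>s. \<kappa> / \<gamma> * (\<gamma> / \<kappa> * e s))" .
    moreover have "(\<lambda>s. \<kappa> / \<gamma> * (\<gamma> / \<kappa> * e s)) = e" using \<gamma> \<kappa> by (simp add: fun_eq_iff)
    ultimately show ?thesis using set_integral_L(2)[of T e] T by simp
  qed
  have gi: "AE \<omega> in M. set_integrable lborel {0..T} (\<lambda>s. g s (X s \<omega>))"
    using bi
  proof eventually_elim
    case (elim \<omega>)
    have "set_integrable lborel {0..T} (\<lambda>s. (-1) * b s \<omega> - \<gamma> / \<kappa> * e s)"
      using elim ei by (intro set_integral_diff(1) set_integrable_mult_right)
    then show ?case by (simp add: b_def)
  qed
  have "AE \<omega> in M. \<forall>t\<in>{0..T}. (\<kappa> + \<gamma>) * X t \<omega> = (\<kappa> + \<gamma>) * x0 - (LINT s:{0..t}|lborel. g s (X s \<omega>))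
        - \<gamma> / \<kappa> * (LINT s:{0..t}|lborel. e s) + J t \<omega>"
    using Xeq gi
  proof eventually_elim
    case (elim \<omega>)
    show ?case
    proof
      fix t assume t: "t \<in> {0..T}"
      have sub: "set_integrable lborel {0..t} f" if "set_integrable lborel {0..T} f" for f :: "real \<Rightarrow> real"
        by (rule set_integrable_subset[OF that]) (use t in auto)
      have "(LINT s:{0..t}|lborel. b s \<omega>) = (LINT s:{0..t}|lborel. (-1) * (g s (X s \<omega>) + \<gamma> / \<kappa> * e s))"
        by (simp add: b_def)
      also have "\<dots> = (-1) * (LINT s:{0..t}|lborel. g s (X s \<omega>) + \<gamma> / \<kappa> * e s)" by (rule set_integral_mult_right)
      also have "(LINT s:{0..t}|lborel. g s (X s \<omega>) + \<gamma> / \<kappa> * e s) = (LINT s:{0..t}|lborel. g s (X s \<omega>)) + \<gamma> / \<kappa> * (LINT s:{0..t}|lborel. e s)"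
        using sub[OF elim(2)] sub[OF ei] by (subst set_integral_add(2)) auto
      finally show "(\<kappa> + \<gamma>) * X t \<omega> = (\<kappa> + \<gamma>) * x0 - (LINT s:{0..t}|lborel. g s (X s \<omega>))
        - \<gamma> / \<kappa> * (LINT s:{0..t}|lborel. e s) + J t \<omega>"
        using bspec[OF elim(1) t] by simp
    qed
  qed
  then show ?thesis using that[OF J Xa' Xc' gi ei[unfolded e_def]] by (simp add: e_def)
qed

lemma time_integral_growth_le:
  assumes t: "t \<in> {0..T}" and c: "continuous_on {0..T} x"
    and gi: "set_integrable lborel {0..T} (\<lambda>s. g s (x s))" and st: "0 \<le> s" "s \<le> t"
  shows "\<bar>LINT r:{s..t}|lborel. g r (x r)\<bar> \<le> (LINT r:{s..t}|lborel. K * (1 + \<bar>x r\<bar>))"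
proof -
  have gi': "set_integrable lborel {s..t} (\<lambda>r. g r (x r))"
    by (rule set_integrable_subset[OF gi]) (use t st in auto)
  have "\<bar>LINT r:{s..t}|lborel. g r (x r)\<bar> \<le> (LINT r:{s..t}|lborel. \<bar>g r (x r)\<bar>)"
    using set_integral_norm_bound[OF gi'] by simp
  also have "\<dots> \<le> (LINT r:{s..t}|lborel. K * (1 + \<bar>x r\<bar>))"
  proof (rule set_integral_mono)
    show "set_integrable lborel {s..t} (\<lambda>r. K * (1 + \<bar>x r\<bar>))"
      by (intro borel_integrable_atLeastAtMost' continuous_intros continuous_on_subset[OF c]) (use t st in auto)
  qed (use gi' set_integrable_abs g_growth t st in auto)
  finally show ?thesis .
qed

lemma set_integral_abs_continuous_mono:
  fixes x :: "real \<Rightarrow> real"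
  assumes c: "continuous_on {0..t} x" and "0 \<le> r" "r \<le> t"
  shows "(LINT u:{0..r}|lborel. \<bar>x u\<bar>) \<le> (LINT u:{0..t}|lborel. \<bar>x u\<bar>)"
proof -
  have "set_integrable lborel {0..t} (\<lambda>u. \<bar>x u\<bar>)" by (intro borel_integrable_atLeastAtMost' continuous_intros c)
  then show ?thesis using assms(2,3) by (intro set_integral_subset_le) auto
qed

text \<open>The velocity is bounded by \<alpha> times an expression in \<open>X\<close>, the noise
  and the constant \<open>m1\<close>; integrating this gives an inequality for \<open>X\<close>
  alone. The constants depend on \<alpha>, which is harmless as only finiteness is used
  later.\<close>

lemma mean_field_a_priori:
  assumes mf: "mean_field x0 y0 \<alpha> X Y" and \<alpha>: "0 < \<alpha>"
  shows "\<exists>C. \<forall>t\<in>{0..T}. Lp_bound M p (X t) C"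
proof -
  obtain J g' where J: "ito_limit (\<lambda>t \<omega>. \<sigma> t (X t \<omega>)) J" and Jc: "AE \<omega> in M. continuous_on {0..T} (\<lambda>t. J t \<omega>)"
    and Xa: "\<And>t. t \<in> {0..T} \<Longrightarrow> X t \<in> borel_measurable (F t)" and Xc: "AE \<omega> in M. continuous_on {0..T} (\<lambda>t. X t \<omega>)"
    and Ym: "\<And>t. t \<in> {0..T} \<Longrightarrow> Y t \<in> borel_measurable M" and Yc: "AE \<omega> in M. continuous_on {0..T} (\<lambda>t. Y t \<omega>)"
    and Xeq: "AE \<omega> in M. \<forall>t\<in>{0..T}. X t \<omega> = x0 + (LINT s:{0..t}|lborel. Y s \<omega>)"
    and gi: "AE \<omega> in M. set_integrable lborel {0..T} (\<lambda>s. g s (X s \<omega>))"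
    and mi: "set_integrable lborel {0..T} (\<lambda>s. \<integral>\<omega>. Y s \<omega> \<partial>M)"
    and Yeq: "AE \<omega> in M. \<forall>t\<in>{0..T}. Y t \<omega> / \<alpha> = y0 / \<alpha> - (\<kappa> + \<gamma>) * (X t \<omega> - x0) - (LINT s:{0..t}|lborel. g s (X s \<omega>))
        + \<gamma> * (LINT s:{0..t}|lborel. (\<integral>\<omega>. Y s \<omega> \<partial>M)) + J t \<omega>"
    and g': "(\<lambda>x. g' (fst x) (snd x)) \<in> borel_measurable (L \<Otimes>\<^sub>M M)" "AE \<omega> in M. \<forall>t\<in>{0..T}. g' t \<omega> = g t (X t \<omega>)"
      "\<And>t. t \<in> {0..T} \<Longrightarrow> (\<lambda>\<omega>. g t (X t \<omega>)) \<in> borel_measurable M"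
    by (rule mean_fieldE[OF mf \<alpha>], rule that)
  define m where "m s = (\<integral>\<omega>. Y s \<omega> \<partial>M)" for s
  define m1 where "m1 = (LINT s:{0..T}|lborel. \<bar>m s\<bar>)"
  have m1: "\<bar>LINT s:{0..t}|lborel. m s\<bar> \<le> m1" if t: "t \<in> {0..T}" for t
  proof -
    have i: "set_integrable lborel {0..t} m"
      by (rule set_integrable_subset[OF mi[folded m_def]]) (use t in auto)
    have "\<bar>LINT s:{0..t}|lborel. m s\<bar> \<le> (LINT s:{0..t}|lborel. \<bar>m s\<bar>)" using set_integral_norm_bound[OF i] by simp
    also have "\<dots> \<le> m1" unfolding m1_def
      by (rule set_integral_subset_le) (use set_integrable_abs[OF mi[folded m_def]] t in auto)
    finally show ?thesis .
  qed
  have m10: "0 \<le> m1" unfolding m1_def by (intro set_lebesgue_integral_nonneg) auto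
  define c0 where "c0 = \<bar>y0 / \<alpha>\<bar> + (\<kappa> + \<gamma>) * \<bar>x0\<bar> + K * T + \<gamma> * m1"
  have c0: "0 \<le> c0" using \<kappa> \<gamma> K T m10 by (simp add: c0_def)
  define k where "k = \<alpha> * (\<kappa> + \<gamma> + T * K + 1)"
  have k: "0 \<le> k" using \<alpha> \<kappa> \<gamma> K T by (simp add: k_def)
  have le: "AE \<omega> in M. \<forall>t\<in>{0..T}. \<bar>X t \<omega>\<bar> \<le> (\<bar>x0\<bar> + \<alpha> * (T * c0)) + k * (LINT r:{0..t}|lborel. \<bar>X r \<omega>\<bar>) + k * \<bar>J t \<omega>\<bar> + k * (LINT r:{0..t}|lborel. \<bar>J r \<omega>\<bar>)"
    using Xc Yc Jc gi Xeq Yeq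
  proof eventually_elim
    case (elim \<omega>)
    show ?case
    proof
      fix t assume t: "t \<in> {0..T}"
      define A where "A = (LINT r:{0..t}|lborel. \<bar>X r \<omega>\<bar>)"
      define B where "B = (LINT r:{0..t}|lborel. \<bar>J r \<omega>\<bar>)"
      have cX: "continuous_on {0..t} (\<lambda>r. X r \<omega>)" and cY: "continuous_on {0..t} (\<lambda>r. Y r \<omega>)" and cJ: "continuous_on {0..t} (\<lambda>r. J r \<omega>)"
        using t by (auto intro: continuous_on_subset[OF elim(1)] continuous_on_subset[OF elim(2)] continuous_on_subset[OF elim(3)])
      have A0: "0 \<le> A" "0 \<le> B" unfolding A_def B_def by (intro set_lebesgue_integral_nonneg abs_ge_zero)+
      have bound: "\<bar>Y r \<omega>\<bar> \<le> \<alpha> * (c0 + K * A) + (\<alpha> * (\<kappa> + \<gamma>) * \<bar>X r \<omega>\<bar> + \<alpha> * \<bar>J r \<omega>\<bar>)" if r: "r \<in> {0..t}" for r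
      proof -
        have rT: "r \<in> {0..T}" using r t by auto
        have ge: "\<bar>LINT s:{0..r}|lborel. g s (X s \<omega>)\<bar> \<le> K * T + K * A"
        proof -
          have "\<bar>LINT s:{0..r}|lborel. g s (X s \<omega>)\<bar> \<le> (LINT s:{0..r}|lborel. K * (1 + \<bar>X s \<omega>\<bar>))"
            using r by (intro time_integral_growth_le[OF rT elim(1) elim(4)]) auto
          also have "\<dots> = K * (r + (LINT s:{0..r}|lborel. \<bar>X s \<omega>\<bar>))"
          proof -
            have "set_integrable lborel {0..r} (\<lambda>s. 1 :: real)" "set_integrable lborel {0..r} (\<lambda>s. \<bar>X s \<omega>\<bar>)"
              using r by (auto intro!: borel_integrable_atLeastAtMost' continuous_intros continuous_on_subset[OF cX])
            then show ?thesis using r by (simp add: set_integral_add(2) set_integral_const)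
          qed
          also have "\<dots> \<le> K * (T + A)"
            unfolding A_def using r rT K set_integral_abs_continuous_mono[OF cX, of r] by (intro mult_left_mono add_mono) auto
          finally show ?thesis by (simp add: algebra_simps)
        qed
        have "\<bar>Y r \<omega> / \<alpha>\<bar> \<le> \<bar>y0 / \<alpha>\<bar> + (\<kappa> + \<gamma>) * (\<bar>X r \<omega>\<bar> + \<bar>x0\<bar>) + (K * T + K * A) + \<gamma> * m1 + \<bar>J r \<omega>\<bar>"
        proof -
          have "\<bar>(\<kappa> + \<gamma>) * (X r \<omega> - x0)\<bar> \<le> (\<kappa> + \<gamma>) * (\<bar>X r \<omega>\<bar> + \<bar>x0\<bar>)"
            using \<kappa> \<gamma> by (simp add: abs_mult mult_left_mono abs_triangle_ineq4)
          moreover have "\<bar>\<gamma> * (LINT s:{0..r}|lborel. m s)\<bar> \<le> \<gamma> * m1"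
            using \<gamma> m1[OF rT] by (simp add: abs_mult mult_left_mono)
          ultimately show ?thesis unfolding bspec[OF elim(6) rT] m_def[symmetric]
            using ge by (intro order_trans[OF abs_drift_le] add_mono order_refl)
        qed
        then have "\<alpha> * \<bar>Y r \<omega> / \<alpha>\<bar> \<le> \<alpha> * (\<bar>y0 / \<alpha>\<bar> + (\<kappa> + \<gamma>) * (\<bar>X r \<omega>\<bar> + \<bar>x0\<bar>) + (K * T + K * A) + \<gamma> * m1 + \<bar>J r \<omega>\<bar>)"
          using \<alpha> by (intro mult_left_mono) auto
        moreover have "\<alpha> * \<bar>Y r \<omega> / \<alpha>\<bar> = \<bar>Y r \<omega>\<bar>" using \<alpha> by (simp add: abs_divide)
        ultimately have "\<bar>Y r \<omega>\<bar> \<le> \<alpha> * (\<bar>y0 / \<alpha>\<bar> + (\<kappa> + \<gamma>) * (\<bar>X r \<omega>\<bar> + \<bar>x0\<bar>) + (K * T + K * A) + \<gamma> * m1 + \<bar>J r \<omega>\<bar>)" by simp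
        also have "\<dots> = \<alpha> * (c0 + K * A) + (\<alpha> * (\<kappa> + \<gamma>) * \<bar>X r \<omega>\<bar> + \<alpha> * \<bar>J r \<omega>\<bar>)"
          by (simp add: c0_def algebra_simps)
        finally show ?thesis .
      qed
      have i: "set_integrable lborel {0..t} (\<lambda>r. \<alpha> * (c0 + K * A))" "set_integrable lborel {0..t} (\<lambda>r. \<alpha> * (\<kappa> + \<gamma>) * \<bar>X r \<omega>\<bar>)"
         "set_integrable lborel {0..t} (\<lambda>r. \<alpha> * \<bar>J r \<omega>\<bar>)"
        by (intro borel_integrable_atLeastAtMost' continuous_intros cX cJ)+
      have "\<bar>LINT r:{0..t}|lborel. Y r \<omega>\<bar> \<le> (LINT r:{0..t}|lborel. \<bar>Y r \<omega>\<bar>)"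
        using set_integral_norm_bound[OF borel_integrable_atLeastAtMost'[OF cY]] by simp
      also have "\<dots> \<le> (LINT r:{0..t}|lborel. \<alpha> * (c0 + K * A) + (\<alpha> * (\<kappa> + \<gamma>) * \<bar>X r \<omega>\<bar> + \<alpha> * \<bar>J r \<omega>\<bar>))"
        by (intro set_integral_mono bound set_integral_add(1) i set_integrable_abs borel_integrable_atLeastAtMost'[OF cY])
      also have "\<dots> = t * (\<alpha> * (c0 + K * A)) + (\<alpha> * (\<kappa> + \<gamma>) * A + \<alpha> * B)"
        using i t by (simp add: set_integral_add set_integral_const A_def B_def)
      also have "\<dots> \<le> T * (\<alpha> * (c0 + K * A)) + (\<alpha> * (\<kappa> + \<gamma>) * A + \<alpha> * B)"
        using t \<alpha> c0 K A0 by (intro add_right_mono mult_right_mono) auto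
      also have "\<dots> \<le> \<alpha> * (T * c0) + k * A + k * \<bar>J t \<omega>\<bar> + k * B"
      proof -
        have "k * B = \<alpha> * B + \<alpha> * (\<kappa> + \<gamma> + T * K) * B" "k * A = T * (\<alpha> * (K * A)) + \<alpha> * (\<kappa> + \<gamma>) * A + \<alpha> * A"
          by (simp_all add: k_def algebra_simps)
        moreover have "0 \<le> \<alpha> * (\<kappa> + \<gamma> + T * K) * B" "0 \<le> \<alpha> * A" "0 \<le> k * \<bar>J t \<omega>\<bar>"
          using \<alpha> \<kappa> \<gamma> T K A0 k by auto
        ultimately show ?thesis by (simp add: algebra_simps)
      qed
      finally have "\<bar>LINT r:{0..t}|lborel. Y r \<omega>\<bar> \<le> \<alpha> * (T * c0) + k * A + k * \<bar>J t \<omega>\<bar> + k * B" .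
      then show "\<bar>X t \<omega>\<bar> \<le> (\<bar>x0\<bar> + \<alpha> * (T * c0)) + k * (LINT r:{0..t}|lborel. \<bar>X r \<omega>\<bar>) + k * \<bar>J t \<omega>\<bar> + k * (LINT r:{0..t}|lborel. \<bar>J r \<omega>\<bar>)"
        unfolding A_def[symmetric] B_def[symmetric] using bspec[OF elim(5) t] by linarith
    qed
  qed
  have X0: "AE \<omega> in M. X 0 \<omega> = x0"
  proof -
    have "AE \<omega> in M. X 0 \<omega> = x0 + (LINT s:{0..0}|lborel. Y s \<omega>)" by (rule AE_at[OF Xeq]) (use T in auto)
    then show ?thesis by (simp add: set_integral_at_point)
  qed
  show ?thesis
    by (rule a_priori_bound[OF p K _ k Xa Xc X0 J Jc _ le]) (use \<alpha> T c0 \<sigma>_growth in auto)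
qed

text \<open>The mean enters as a given integrable function of time and contributes only to the
  constant \<open>a\<close>, so the localized estimate for a single process applies.\<close>

lemma limit_a_priori:
  assumes lim: "limit_equation x0 X"
  shows "\<exists>C. \<forall>t\<in>{0..T}. Lp_bound M p (X t) C"
proof -
  obtain J where J: "ito_limit (\<lambda>t \<omega>. \<sigma> t (X t \<omega>)) J" and Jc: "AE \<omega> in M. continuous_on {0..T} (\<lambda>t. J t \<omega>)"
    and Xa: "\<And>t. t \<in> {0..T} \<Longrightarrow> X t \<in> borel_measurable (F t)" and Xc: "AE \<omega> in M. continuous_on {0..T} (\<lambda>t. X t \<omega>)"
    and gi: "AE \<omega> in M. set_integrable lborel {0..T} (\<lambda>s. g s (X s \<omega>))"
    and ei: "set_integrable lborel {0..T} (\<lambda>s. \<integral>\<omega>. g s (X s \<omega>) \<partial>M)"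
    and Xeq: "AE \<omega> in M. \<forall>t\<in>{0..T}. (\<kappa> + \<gamma>) * X t \<omega> = (\<kappa> + \<gamma>) * x0 - (LINT s:{0..t}|lborel. g s (X s \<omega>))
        - \<gamma> / \<kappa> * (LINT s:{0..t}|lborel. (\<integral>\<omega>. g s (X s \<omega>) \<partial>M)) + J t \<omega>"
    by (rule limit_equationE[OF lim], rule that)
  define e where "e s = (\<integral>\<omega>. g s (X s \<omega>) \<partial>M)" for s
  define m1 where "m1 = (LINT s:{0..T}|lborel. \<bar>e s\<bar>)"
  have m1: "\<bar>LINT s:{0..t}|lborel. e s\<bar> \<le> m1" if t: "t \<in> {0..T}" for t
  proof -
    have i: "set_integrable lborel {0..t} e"
      by (rule set_integrable_subset[OF ei[folded e_def]]) (use t in auto)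
    have "\<bar>LINT s:{0..t}|lborel. e s\<bar> \<le> (LINT s:{0..t}|lborel. \<bar>e s\<bar>)" using set_integral_norm_bound[OF i] by simp
    also have "\<dots> \<le> m1" unfolding m1_def
      by (rule set_integral_subset_le) (use set_integrable_abs[OF ei[folded e_def]] t in auto)
    finally show ?thesis .
  qed
  have m10: "0 \<le> m1" unfolding m1_def by (intro set_lebesgue_integral_nonneg) auto
  define a where "a = \<bar>x0\<bar> + (K * T + \<gamma> / \<kappa> * m1) / (\<kappa> + \<gamma>)"
  define k where "k = (K + 1) / (\<kappa> + \<gamma>)"
  have kg: "0 < \<kappa> + \<gamma>" using \<kappa> \<gamma> by simp
  have ak: "0 \<le> a" "0 \<le> k" using kg \<kappa> \<gamma> K T m10 by (auto simp: a_def k_def)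
  have le: "AE \<omega> in M. \<forall>t\<in>{0..T}. \<bar>X t \<omega>\<bar> \<le> a + k * (LINT r:{0..t}|lborel. \<bar>X r \<omega>\<bar>) + k * \<bar>J t \<omega>\<bar> + k * (LINT r:{0..t}|lborel. \<bar>J r \<omega>\<bar>)"
    using Xc Jc gi Xeq
  proof eventually_elim
    case (elim \<omega>)
    show ?case
    proof
      fix t assume t: "t \<in> {0..T}"
      define A where "A = (LINT r:{0..t}|lborel. \<bar>X r \<omega>\<bar>)"
      define B where "B = (LINT r:{0..t}|lborel. \<bar>J r \<omega>\<bar>)"
      have cX: "continuous_on {0..t} (\<lambda>r. X r \<omega>)"
        using t by (auto intro: continuous_on_subset[OF elim(1)])
      have A0: "0 \<le> A" "0 \<le> B" unfolding A_def B_def by (intro set_lebesgue_integral_nonneg abs_ge_zero)+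
      have ge: "\<bar>LINT s:{0..t}|lborel. g s (X s \<omega>)\<bar> \<le> K * T + K * A"
      proof -
        have "\<bar>LINT s:{0..t}|lborel. g s (X s \<omega>)\<bar> \<le> (LINT s:{0..t}|lborel. K * (1 + \<bar>X s \<omega>\<bar>))"
          using t by (intro time_integral_growth_le[OF t elim(1) elim(3)]) auto
        also have "\<dots> = K * (t + A)"
        proof -
          have "set_integrable lborel {0..t} (\<lambda>s. 1 :: real)" "set_integrable lborel {0..t} (\<lambda>s. \<bar>X s \<omega>\<bar>)"
            by (intro borel_integrable_atLeastAtMost' continuous_intros cX)+
          then show ?thesis using t by (simp add: set_integral_add(2) set_integral_const A_def)
        qed
        also have "\<dots> \<le> K * (T + A)" using t K by (intro mult_left_mono add_mono) auto
        finally show ?thesis by (simp add: algebra_simps)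
      qed
      have "(\<kappa> + \<gamma>) * \<bar>X t \<omega>\<bar> = \<bar>(\<kappa> + \<gamma>) * X t \<omega>\<bar>" using kg by (simp add: abs_mult)
      also have "\<dots> \<le> (\<kappa> + \<gamma>) * \<bar>x0\<bar> + (K * T + K * A) + \<gamma> / \<kappa> * m1 + \<bar>J t \<omega>\<bar>"
      proof -
        have "\<bar>\<gamma> / \<kappa> * (LINT s:{0..t}|lborel. e s)\<bar> \<le> \<gamma> / \<kappa> * m1"
          unfolding abs_mult using \<gamma> \<kappa> m1[OF t] by (intro mult_mono) auto
        moreover have "\<bar>(\<kappa> + \<gamma>) * x0\<bar> = (\<kappa> + \<gamma>) * \<bar>x0\<bar>" using kg by (simp add: abs_mult)
        ultimately show ?thesis unfolding bspec[OF elim(4) t] e_def[symmetric]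
          using ge by (intro order_trans[OF abs_drift_le'] add_mono) auto
      qed
      also have "\<dots> = (\<kappa> + \<gamma>) * (a + (K * A + \<bar>J t \<omega>\<bar>) / (\<kappa> + \<gamma>))"
      proof -
        have "(\<kappa> + \<gamma>) * (a + z / (\<kappa> + \<gamma>)) = (\<kappa> + \<gamma>) * \<bar>x0\<bar> + (K * T + \<gamma> / \<kappa> * m1) + z" for z
          using kg by (simp only: a_def distrib_left) simp
        then show ?thesis by simp
      qed
      finally have "\<bar>X t \<omega>\<bar> \<le> a + (K * A + \<bar>J t \<omega>\<bar>) / (\<kappa> + \<gamma>)" using kg by simp
      also have "\<dots> \<le> a + (((K + 1) * A + (K + 1) * \<bar>J t \<omega>\<bar>) / (\<kappa> + \<gamma>) + k * B)"
        using kg \<kappa> \<gamma> A0 K ak by (intro add_mono add_increasing2 divide_right_mono) (auto simp: algebra_simps)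
      also have "\<dots> = a + k * A + k * \<bar>J t \<omega>\<bar> + k * B"
        by (simp only: k_def add_divide_distrib[of "(K + 1) * A"] times_divide_eq_left add.assoc)
      finally show "\<bar>X t \<omega>\<bar> \<le> a + k * (LINT r:{0..t}|lborel. \<bar>X r \<omega>\<bar>) + k * \<bar>J t \<omega>\<bar> + k * (LINT r:{0..t}|lborel. \<bar>J r \<omega>\<bar>)"
        by (simp add: A_def B_def)
    qed
  qed
  have T0: "0 \<in> {0..T}" using T by simp
  have X0: "AE \<omega> in M. X 0 \<omega> = x0"
    using AE_at[OF Xeq T0] ito_limit_at_zero[OF J]
  proof eventually_elim
    case (elim \<omega>)
    then show ?case using kg by (simp add: set_integral_at_point)
  qed
  show ?thesis
    by (rule a_priori_bound[OF p K ak Xa Xc X0 J Jc _ le]) (use \<sigma>_growth in auto)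
qed

end

text \<open>The first-moment bound is applied to the q-th power, with exponent \<open>p / q\<close>.
  This makes the L^2 statement on expectations available under L^p bounds.\<close>

lemma (in prob_space) Lp_bound_exponent_mono:
  assumes b: "Lp_bound M p U a" and U[measurable]: "U \<in> borel_measurable M" and qp: "1 \<le> q" "q \<le> p"
  shows "Lp_bound M q U a"
proof -
  have a: "0 \<le> a" using b Lp_bound_nonneg by blast
  define V where "V \<omega> = \<bar>U \<omega>\<bar> powr q" for \<omega>
  have Vm: "V \<in> borel_measurable M" unfolding V_def by measurable
  have "Lp_bound M (p / q) V (a powr q)"
  proof (rule Lp_boundI[OF Vm])
    have "(\<integral>\<^sup>+\<omega>. ennreal (\<bar>V \<omega>\<bar> powr (p / q)) \<partial>M) = (\<integral>\<^sup>+\<omega>. ennreal (\<bar>U \<omega>\<bar> powr p) \<partial>M)"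
      using qp by (simp add: V_def powr_powr)
    also have "\<dots> \<le> ennreal (a powr p)" using Lp_boundD[OF b] qp by simp
    also have "a powr p = (a powr q) powr (p / q)" using qp by (simp add: powr_powr)
    finally show "(\<integral>\<^sup>+\<omega>. ennreal (\<bar>V \<omega>\<bar> powr (p / q)) \<partial>M) \<le> ennreal ((a powr q) powr (p / q))" .
  qed simp
  note I = Lp_bound_integral[OF this _ Vm]
  have "(\<integral>\<^sup>+\<omega>. ennreal (\<bar>U \<omega>\<bar> powr q) \<partial>M) = ennreal (\<integral>\<omega>. V \<omega> \<partial>M)"
    using I(1) qp by (subst nn_integral_eq_integral[symmetric]) (auto simp: V_def)
  also have "\<dots> \<le> ennreal (a powr q)" using I(2) qp by (intro ennreal_leI) (simp add: V_def)
  finally show ?thesis using a by (intro Lp_boundI U) auto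
qed

lemma set_integral_interval_diff:
  fixes f :: "real \<Rightarrow> real"
  assumes f: "set_integrable lborel {0..T} f" and st: "0 \<le> s" "s \<le> t" "t \<le> T"
  shows "(LINT r:{0..t}|lborel. f r) - (LINT r:{0..s}|lborel. f r) = (LINT r:{s..t}|lborel. f r)"
proof -
  have i: "set_integrable lborel {0..t} f" "set_integrable lborel {0..s} f" "set_integrable lborel {s..t} f"
    using st by (auto intro: set_integrable_subset[OF f])
  have "integral {0..s} f + integral {s..t} f = integral {0..t} f"
    by (rule Henstock_Kurzweil_Integration.integral_combine[OF st(1,2)]) (rule set_borel_integral_eq_integral(1)[OF i(1)])
  then show ?thesis using i[THEN set_borel_integral_eq_integral(2)] by simp
qed

lemma set_integral_interval_continuous:
  fixes f :: "real \<Rightarrow> real"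
  assumes "set_integrable lborel {0..T} f"
  shows "continuous_on {0..T} (\<lambda>t. LINT r:{0..t}|lborel. f r)"
proof (rule continuous_on_eq)
  show "continuous_on {0..T} (\<lambda>t. integral {0..t} f)"
    by (rule indefinite_integral_continuous_1) (rule set_borel_integral_eq_integral(1)[OF assms])
  fix t assume "t \<in> {0..T}"
  then have "set_integrable lborel {0..t} f" by (auto intro: set_integrable_subset[OF assms])
  then show "integral {0..t} f = (LINT r:{0..t}|lborel. f r)" by (simp add: set_borel_integral_eq_integral(2))
qed

text \<open>The tangent of the square root at \<open>1 / v\<close>. With \<open>v\<close> the
  relaxation speed, intercept and slope contribute the same amount after relaxation.\<close>

lemma sqrt_le_affine:
  fixes u v :: real
  assumes "0 \<le> u" "0 < v"
  shows "sqrt u \<le> 1 / (2 * sqrt v) + sqrt v / 2 * u"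
proof -
  have "0 \<le> (sqrt v * sqrt u - 1)\<^sup>2" by simp
  also have "\<dots> = v * u - 2 * sqrt v * sqrt u + 1"
    using assms by (simp add: power2_diff power_mult_distrib)
  finally have "2 * sqrt v * sqrt u \<le> v * u + 1" by simp
  then have "2 * sqrt v * sqrt u / (2 * sqrt v) \<le> (v * u + 1) / (2 * sqrt v)"
    using assms by (intro divide_right_mono) auto
  also have "(v * u + 1) / (2 * sqrt v) = 1 / (2 * sqrt v) + sqrt v / 2 * u"
  proof -
    define w where "w = sqrt v"
    have "v = w * w" "w > 0" using assms by (simp_all add: w_def)
    then show ?thesis unfolding w_def[symmetric] by (simp add: field_simps)
  qed
  finally show ?thesis using assms by simp
qed

section \<open>L^p bounds of drift and noise\<close>

context langevin
begin

lemma Lp_bound_growth: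
  assumes x: "Lp_bound M p U x" and V: "\<And>\<omega>. \<bar>V \<omega>\<bar> \<le> K * (1 + \<bar>U \<omega>\<bar>)"
  shows "Lp_bound M p V (K * (1 + x))"
proof -
  have "Lp_bound M p (\<lambda>\<omega>. K * (1 + \<bar>U \<omega>\<bar>)) (\<bar>K\<bar> * (1 + x))"
    by (intro Lp_bound_cmult Lp_bound_add Lp_bound_const Lp_bound_mono[OF x]) (use p in auto)
  then show ?thesis
    by (rule Lp_bound_mono) (use V K p in \<open>auto intro!: AE_I2 simp: abs_mult\<close>)
qed

text \<open>Minkowski's inequality is applied to \<open>K * (1 + \<bar>X r \<omega>\<bar>)\<close>,
  which is continuous in time; the integral of \<open>g\<close> is merely dominated by it.\<close>

lemma Lp_bound_drift:
  assumes Xm: "\<And>t. t \<in> {0..T} \<Longrightarrow> X t \<in> borel_measurable M"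
    and Xc: "AE \<omega> in M. continuous_on {0..T} (\<lambda>t. X t \<omega>)"
    and gi: "AE \<omega> in M. set_integrable lborel {0..T} (\<lambda>s. g s (X s \<omega>))"
    and x: "continuous_on {0..T} x" "\<And>r. r \<in> {0..T} \<Longrightarrow> Lp_bound M p (X r) (x r)"
    and st: "0 \<le> s" "s \<le> t" "t \<le> T"
  shows "Lp_bound M p (\<lambda>\<omega>. LINT r:{s..t}|lborel. g r (X r \<omega>)) (LINT r:{s..t}|lborel. K * (1 + x r))"
proof -
  have sub: "{s..t} \<subseteq> {0..T}" using st by auto
  have "Lp_bound M p (\<lambda>\<omega>. LINT r:{s..t}|lborel. \<bar>K * (1 + \<bar>X r \<omega>\<bar>)\<bar>) (LINT r:{s..t}|lborel. K * (1 + x r))"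
  proof (rule Lp_bound_time_integral[OF st(2)])
    fix r assume "r \<in> {s..t}"
    then have r: "r \<in> {0..T}" using sub by blast
    show "(\<lambda>\<omega>. K * (1 + \<bar>X r \<omega>\<bar>)) \<in> borel_measurable M" using Xm[OF r] by measurable
    show "Lp_bound M p (\<lambda>\<omega>. K * (1 + \<bar>X r \<omega>\<bar>)) (K * (1 + x r))"
      using K by (intro Lp_bound_growth[OF x(2)[OF r]]) (simp add: abs_mult)
  next
    show "AE \<omega> in M. continuous_on {s..t} (\<lambda>r. K * (1 + \<bar>X r \<omega>\<bar>))"
      using Xc by eventually_elim (intro continuous_intros continuous_on_subset[OF _ sub])
    show "continuous_on {s..t} (\<lambda>r. K * (1 + x r))" by (intro continuous_intros continuous_on_subset[OF x(1) sub])
  qed (use p in auto)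
  then show ?thesis
  proof (rule Lp_bound_mono)
    show "AE \<omega> in M. \<bar>LINT r:{s..t}|lborel. g r (X r \<omega>)\<bar> \<le> \<bar>LINT r:{s..t}|lborel. \<bar>K * (1 + \<bar>X r \<omega>\<bar>)\<bar>\<bar>"
      using Xc gi
    proof eventually_elim
      case (elim \<omega>)
      have "\<bar>LINT r:{s..t}|lborel. g r (X r \<omega>)\<bar> \<le> (LINT r:{s..t}|lborel. K * (1 + \<bar>X r \<omega>\<bar>))"
        by (rule time_integral_growth_le[OF _ elim]) (use st in auto)
      moreover have "\<bar>K * (1 + \<bar>X r \<omega>\<bar>)\<bar> = K * (1 + \<bar>X r \<omega>\<bar>)" for r using K by simp
      ultimately show ?case by (simp only:)
    qed
  qed (use p in auto)
qed

lemma Lp_bound_noise: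
  assumes J: "ito_limit (\<lambda>t \<omega>. \<sigma> t (X t \<omega>)) J"
    and x: "continuous_on {0..T} x" "\<And>r. r \<in> {0..T} \<Longrightarrow> Lp_bound M p (X r) (x r)"
    and st: "0 \<le> s" "s \<le> t" "t \<le> T"
  shows "Lp_bound M p (\<lambda>\<omega>. J t \<omega> - J s \<omega>) (sqrt (ito_const p * (LINT r:{s..t}|lborel. (K * (1 + x r))\<^sup>2)))"
proof (rule Lp_bound_ito[OF J st p])
  show "continuous_on {s..t} (\<lambda>r. K * (1 + x r))"
    by (intro continuous_intros continuous_on_subset[OF x(1)]) (use st in auto)
  fix r assume "r \<in> {s..t}"
  then have r: "r \<in> {0..T}" using st by auto
  show "Lp_bound M p (\<lambda>\<omega>. \<sigma> r (X r \<omega>)) (K * (1 + x r))"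
    by (rule Lp_bound_growth[OF x(2)[OF r]]) (rule \<sigma>_growth[OF r])
qed

end

text \<open>One solution for one \<alpha>. The constants of its bounds are defined in
  \<open>langevin\<close>, where \<alpha> is not in scope, which makes their independence of
  \<alpha> evident.\<close>

locale mean_field_process = langevin M F T W \<kappa> \<gamma> K p g \<sigma>
  for M :: "'a measure" and F T W \<kappa> \<gamma> K p and g \<sigma> :: "real \<Rightarrow> real \<Rightarrow> real" +
  fixes x0 y0 \<alpha> :: real and X Y J g' :: "real \<Rightarrow> 'a \<Rightarrow> real"
  assumes \<alpha>: "0 < \<alpha>"
    and J: "ito_limit (\<lambda>t \<omega>. \<sigma> t (X t \<omega>)) J" and Jc: "AE \<omega> in M. continuous_on {0..T} (\<lambda>t. J t \<omega>)"
    and Xa: "\<And>t. t \<in> {0..T} \<Longrightarrow> X t \<in> borel_measurable (F t)" and Xc: "AE \<omega> in M. continuous_on {0..T} (\<lambda>t. X t \<omega>)"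
    and Ym: "\<And>t. t \<in> {0..T} \<Longrightarrow> Y t \<in> borel_measurable M" and Yc: "AE \<omega> in M. continuous_on {0..T} (\<lambda>t. Y t \<omega>)"
    and Xeq: "AE \<omega> in M. \<forall>t\<in>{0..T}. X t \<omega> = x0 + (LINT s:{0..t}|lborel. Y s \<omega>)"
    and gi: "AE \<omega> in M. set_integrable lborel {0..T} (\<lambda>s. g s (X s \<omega>))"
    and mi: "set_integrable lborel {0..T} (\<lambda>s. \<integral>\<omega>. Y s \<omega> \<partial>M)"
    and Yeq: "AE \<omega> in M. \<forall>t\<in>{0..T}. Y t \<omega> / \<alpha> = y0 / \<alpha> - (\<kappa> + \<gamma>) * (X t \<omega> - x0) - (LINT s:{0..t}|lborel. g s (X s \<omega>))
        + \<gamma> * (LINT s:{0..t}|lborel. (\<integral>\<omega>. Y s \<omega> \<partial>M)) + J t \<omega>"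
    and g'j: "(\<lambda>x. g' (fst x) (snd x)) \<in> borel_measurable (L \<Otimes>\<^sub>M M)" and g'eq: "AE \<omega> in M. \<forall>t\<in>{0..T}. g' t \<omega> = g t (X t \<omega>)"
    and gm: "\<And>t. t \<in> {0..T} \<Longrightarrow> (\<lambda>\<omega>. g t (X t \<omega>)) \<in> borel_measurable M"
    and Yi: "\<And>t. t \<in> {0..T} \<Longrightarrow> integrable M (Y t)"
    and a_priori: "\<exists>C. \<forall>t\<in>{0..T}. Lp_bound M p (X t) C"
begin

definition m :: "real \<Rightarrow> real" where "m s = (\<integral>\<omega>. Y s \<omega> \<partial>M)"
definition e :: "real \<Rightarrow> real" where "e s = (\<integral>\<omega>. g s (X s \<omega>) \<partial>M)"
definition N :: "real \<Rightarrow> 'a \<Rightarrow> real" where "N t \<omega> = Y t \<omega> / \<alpha> + (\<kappa> + \<gamma>) * (X t \<omega> - x0)"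

lemma Xm: "t \<in> {0..T} \<Longrightarrow> X t \<in> borel_measurable M" using Xa F_measurable_M by blast
lemma Jm: "t \<in> {0..T} \<Longrightarrow> J t \<in> borel_measurable M" using J ito_limit_measurable by blast

lemma m_integrable: "set_integrable lborel {0..T} m" using mi by (simp add: m_def[abs_def])

lemma N_increment:
  assumes st: "0 \<le> s" "s \<le> t" "t \<le> T"
  shows "AE \<omega> in M. N t \<omega> - N s \<omega> = (- 1) * (LINT r:{s..t}|lborel. g r (X r \<omega>)) + \<gamma> * (LINT r:{s..t}|lborel. m r) + (J t \<omega> - J s \<omega>)"
  using Yeq gi
proof eventually_elim
  case (elim \<omega>)
  have sT: "s \<in> {0..T}" "t \<in> {0..T}" using st by auto
  have Nv: "N v \<omega> = y0 / \<alpha> - (LINT r:{0..v}|lborel. g r (X r \<omega>)) + \<gamma> * (LINT r:{0..v}|lborel. m r) + J v \<omega>" if "v \<in> {0..T}" for v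
    using bspec[OF elim(1) that] by (simp add: N_def m_def)
  show ?case unfolding Nv[OF sT(1)] Nv[OF sT(2)]
    set_integral_interval_diff[OF elim(2) st, symmetric] set_integral_interval_diff[OF m_integrable st, symmetric]
    by (simp add: algebra_simps)
qed

lemma N_increment_bound:
  assumes x: "continuous_on {0..T} x" "\<And>r. r \<in> {0..T} \<Longrightarrow> Lp_bound M p (X r) (x r)"
    and st: "0 \<le> s" "s \<le> t" "t \<le> T"
  shows "Lp_bound M p (\<lambda>\<omega>. N t \<omega> - N s \<omega>)
     ((LINT r:{s..t}|lborel. K * (1 + x r)) + \<gamma> * \<bar>LINT r:{s..t}|lborel. m r\<bar> + sqrt (ito_const p * (LINT r:{s..t}|lborel. (K * (1 + x r))\<^sup>2)))"
proof -
  have "Lp_bound M p (\<lambda>\<omega>. (- 1) * (LINT r:{s..t}|lborel. g r (X r \<omega>)) + \<gamma> * (LINT r:{s..t}|lborel. m r) + (J t \<omega> - J s \<omega>))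
     (\<bar>- 1\<bar> * (LINT r:{s..t}|lborel. K * (1 + x r)) + \<gamma> * \<bar>LINT r:{s..t}|lborel. m r\<bar> + sqrt (ito_const p * (LINT r:{s..t}|lborel. (K * (1 + x r))\<^sup>2)))"
    by (intro Lp_bound_add Lp_bound_cmult Lp_bound_drift[OF Xm Xc gi x st] Lp_bound_noise[OF J x st] Lp_bound_const)
       (use p \<gamma> in \<open>auto simp: abs_mult\<close>)
  then have "Lp_bound M p (\<lambda>\<omega>. N t \<omega> - N s \<omega>) (\<bar>- 1\<bar> * (LINT r:{s..t}|lborel. K * (1 + x r)) + \<gamma> * \<bar>LINT r:{s..t}|lborel. m r\<bar> + sqrt (ito_const p * (LINT r:{s..t}|lborel. (K * (1 + x r))\<^sup>2)))"
    by (rule Lp_bound_mono) (use N_increment[OF st] p in \<open>auto elim!: eventually_mono\<close>)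
  then show ?thesis by simp
qed

lemma N_measurable: "t \<in> {0..T} \<Longrightarrow> N t \<in> borel_measurable M"
  unfolding N_def[abs_def] using Xm Ym by measurable

lemma N_zero: "AE \<omega> in M. N 0 \<omega> = y0 / \<alpha>"
proof -
  have T0: "0 \<in> {0..T}" using T by simp
  show ?thesis using AE_at[OF Yeq T0] ito_limit_at_zero[OF J]
    by eventually_elim (simp add: N_def set_integral_at_point)
qed

text \<open>The displacement is \<alpha> times the integral of
  \<open>Y t \<omega> / \<alpha>\<close>, so this quotient solves the relaxation equation at speed
  \<open>\<alpha> * (\<kappa> + \<gamma>)\<close> with forcing \<open>N\<close>.\<close>

lemma velocity_bound:
  assumes t: "t \<in> {0..T}" and B: "0 \<le> B"
    and incr: "\<And>s. s \<in> {0..t} \<Longrightarrow> Lp_bound M p (\<lambda>\<omega>. N t \<omega> - N s \<omega>) (A + B * (t - s))"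
  shows "Lp_bound M p (\<lambda>\<omega>. Y t \<omega> / \<alpha>) (\<bar>y0\<bar> / \<alpha> + A + B / (\<alpha> * (\<kappa> + \<gamma>)))"
proof (rule Lp_bound_relaxation[where N = N and Z = "\<lambda>t \<omega>. Y t \<omega> / \<alpha>", OF _ _ _ _ _ _ B incr])
  show "0 \<le> t" using t by simp
  show "0 < \<alpha> * (\<kappa> + \<gamma>)" using \<alpha> \<kappa> \<gamma> by simp
  show "N s \<in> borel_measurable M" if "s \<in> {0..t}" for s using N_measurable that t by simp
  show "AE \<omega> in M. continuous_on {0..t} (\<lambda>s. Y s \<omega> / \<alpha>)"
    using Yc by eventually_elim (use t \<alpha> in \<open>auto intro!: continuous_intros elim: continuous_on_subset\<close>)
  show "AE \<omega> in M. \<forall>s\<in>{0..t}. Y s \<omega> / \<alpha> = N s \<omega> - \<alpha> * (\<kappa> + \<gamma>) * (LINT r:{0..s}|lborel. Y r \<omega> / \<alpha>)"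
    using Xeq
  proof eventually_elim
    case (elim \<omega>)
    show ?case
    proof
      fix s assume "s \<in> {0..t}"
      then have "X s \<omega> = x0 + (LINT r:{0..s}|lborel. Y r \<omega>)" using elim t by auto
      then show "Y s \<omega> / \<alpha> = N s \<omega> - \<alpha> * (\<kappa> + \<gamma>) * (LINT r:{0..s}|lborel. Y r \<omega> / \<alpha>)"
        using \<alpha> by (simp add: N_def)
    qed
  qed
  show "Lp_bound M p (N 0) (\<bar>y0\<bar> / \<alpha>)"
    by (rule Lp_bound_const) (use N_zero \<alpha> in \<open>auto elim!: eventually_mono\<close>)
qed (use p in auto)

text \<open>Relaxation with slope zero, so without any rate in \<alpha>; it serves to justify the
  expectations in \<open>mean_equation\<close>.\<close>

lemma Y_bounded: "\<exists>C. \<forall>t\<in>{0..T}. Lp_bound M p (Y t) C"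
proof -
  obtain C where C: "\<And>t. t \<in> {0..T} \<Longrightarrow> Lp_bound M p (X t) C" using a_priori by blast
  define G where "G = K * (1 + C)"
  have "0 \<in> {0..T}" using T by simp
  from Lp_bound_nonneg[OF C[OF this]] have G: "0 \<le> G" using K by (simp add: G_def)
  define A where "A = T * G + \<gamma> * (LINT r:{0..T}|lborel. \<bar>m r\<bar>) + sqrt (ito_const p * (T * G\<^sup>2))"
  have "Lp_bound M p (Y t) (\<bar>\<alpha>\<bar> * (\<bar>y0\<bar> / \<alpha> + A + 0 / (\<alpha> * (\<kappa> + \<gamma>))))" if t: "t \<in> {0..T}" for t
  proof -
    have "Lp_bound M p (\<lambda>\<omega>. Y t \<omega> / \<alpha>) (\<bar>y0\<bar> / \<alpha> + A + 0 / (\<alpha> * (\<kappa> + \<gamma>)))"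
    proof (rule velocity_bound[OF t])
      fix s assume s: "s \<in> {0..t}"
      have st: "0 \<le> s" "s \<le> t" "t \<le> T" using s t by auto
      show "Lp_bound M p (\<lambda>\<omega>. N t \<omega> - N s \<omega>) (A + 0 * (t - s))"
      proof (rule Lp_bound_weaken[OF N_increment_bound[where x = "\<lambda>_. C", OF _ C st]])
        have i: "set_integrable lborel {s..t} m" by (rule set_integrable_subset[OF m_integrable]) (use st in auto)
        have "\<bar>LINT r:{s..t}|lborel. m r\<bar> \<le> (LINT r:{s..t}|lborel. \<bar>m r\<bar>)" using set_integral_norm_bound[OF i] by simp
        also have "\<dots> \<le> (LINT r:{0..T}|lborel. \<bar>m r\<bar>)"
          by (rule set_integral_subset_le) (use set_integrable_abs[OF m_integrable] st in auto)
        finally have 1: "\<gamma> * \<bar>LINT r:{s..t}|lborel. m r\<bar> \<le> \<gamma> * (LINT r:{0..T}|lborel. \<bar>m r\<bar>)" using \<gamma> by simp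
        have 2: "(t - s) * G \<le> T * G" "(t - s) * G\<^sup>2 \<le> T * G\<^sup>2" using st G by (auto intro!: mult_right_mono)
        have 3: "sqrt (ito_const p * ((t - s) * G\<^sup>2)) \<le> sqrt (ito_const p * (T * G\<^sup>2))"
          using 2 ito_const_nonneg by (intro real_sqrt_le_mono mult_left_mono)
        have eqs: "(LINT r:{s..t}|lborel. K * (1 + C)) = (t - s) * G" "(LINT r:{s..t}|lborel. (K * (1 + C))\<^sup>2) = (t - s) * G\<^sup>2"
          using st by (simp_all add: set_integral_const G_def[symmetric])
        show "(LINT r:{s..t}|lborel. K * (1 + C)) + \<gamma> * \<bar>LINT r:{s..t}|lborel. m r\<bar> + sqrt (ito_const p * (LINT r:{s..t}|lborel. (K * (1 + C))\<^sup>2)) \<le> A + 0 * (t - s)"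
          unfolding eqs A_def using 1 2(1) 3 by linarith
      qed (use p in auto)
    qed simp
    from Lp_bound_cmult[OF this, of \<alpha>] show ?thesis using p \<alpha> by simp
  qed
  then show ?thesis by blast
qed

lemma e_bound:
  assumes "s \<in> {0..T}" "Lp_bound M p (X s) x"
  shows "\<bar>e s\<bar> \<le> K * (1 + x)"
  unfolding e_def using p gm[OF assms(1)]
  by (intro Lp_bound_expectation[OF Lp_bound_growth[OF assms(2) g_growth[OF assms(1)]]]) auto

text \<open>In expectation the noise disappears and the friction \<open>\<gamma>\<close> towards the
  mean cancels, leaving the damping \<open>\<kappa>\<close> alone.\<close>

lemma mean_equation:
  shows e_integrable: "set_integrable lborel {0..T} e"
    and "t \<in> {0..T} \<Longrightarrow> m t = y0 - \<alpha> * \<kappa> * (LINT s:{0..t}|lborel. m s) - \<alpha> * (LINT s:{0..t}|lborel. e s)"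
proof -
  obtain C where C: "\<And>t. t \<in> {0..T} \<Longrightarrow> Lp_bound M p (X t) C" using a_priori by blast
  obtain C' where C': "\<And>t. t \<in> {0..T} \<Longrightarrow> Lp_bound M p (Y t) C'" using Y_bounded by blast
  have p1: "1 \<le> p" using p by simp
  have gb: "Lp_bound M p (g' s) (K * (1 + C))" if s: "s \<in> {0..T}" for s
    using Lp_bound_growth[OF C[OF s] g_growth[OF s]]
    by (rule Lp_bound_mono) (use AE_at[OF g'eq s] p in \<open>auto elim!: eventually_mono\<close>)
  obtain Y' where Y': "(\<lambda>x. Y' (fst x) (snd x)) \<in> borel_measurable (L \<Otimes>\<^sub>M M)" "AE \<omega> in M. \<forall>t\<in>{0..T}. Y' t \<omega> = Y t \<omega>"
    using joint_modification[of Y] Ym Yc by blast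
  have Yb: "Lp_bound M p (Y' s) C'" if s: "s \<in> {0..T}" for s
    using C'[OF s] by (rule Lp_bound_mono) (use AE_at[OF Y'(2) s] p in \<open>auto elim!: eventually_mono\<close>)
  have Eg: "(\<integral>\<omega>. g' s \<omega> \<partial>M) = e s" if s: "s \<in> {0..T}" for s
    unfolding e_def using AE_at[OF g'eq s] section_measurable(2)[OF g'j s] gm[OF s] by (intro integral_cong_AE) auto
  have EY: "(\<integral>\<omega>. Y' s \<omega> \<partial>M) = m s" if s: "s \<in> {0..T}" for s
    unfolding m_def using AE_at[OF Y'(2) s] section_measurable(2)[OF Y'(1) s] Ym[OF s] by (intro integral_cong_AE) auto
  have Ig: "set_integrable lborel {0..T} (\<lambda>s. \<integral>\<omega>. g' s \<omega> \<partial>M)"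
    "t \<in> {0..T} \<Longrightarrow> integrable M (\<lambda>\<omega>. LINT s:{0..t}|lborel. g' s \<omega>)"
    "t \<in> {0..T} \<Longrightarrow> (\<integral>\<omega>. (LINT s:{0..t}|lborel. g' s \<omega>) \<partial>M) = (LINT s:{0..t}|lborel. (\<integral>\<omega>. g' s \<omega> \<partial>M))" for t
    using expectation_time_integral[OF g'j gb p1] by blast+
  have IY: "t \<in> {0..T} \<Longrightarrow> integrable M (\<lambda>\<omega>. LINT s:{0..t}|lborel. Y' s \<omega>)"
    "t \<in> {0..T} \<Longrightarrow> (\<integral>\<omega>. (LINT s:{0..t}|lborel. Y' s \<omega>) \<partial>M) = (LINT s:{0..t}|lborel. (\<integral>\<omega>. Y' s \<omega> \<partial>M))" for t
    using expectation_time_integral[OF Y'(1) Yb p1] by blast+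
  show "set_integrable lborel {0..T} e"
    using Ig(1) Eg by (subst set_integrable_cong[OF refl refl, of _ _ "\<lambda>s. \<integral>\<omega>. g' s \<omega> \<partial>M"]) auto
  assume t: "t \<in> {0..T}"
  have T0: "0 \<in> {0..T}" using T by simp
  have cong: "(LINT s:{0..t}|lborel. f s) = (LINT s:{0..t}|lborel. h s)" if "\<And>s. s \<in> {0..T} \<Longrightarrow> f s = h s" for f h :: "real \<Rightarrow> real"
    by (rule set_lebesgue_integral_cong) (use that t in auto)
  \<comment> \<open>The mean of the noise is computed from L^2 bounds, which
    \<open>2 \<le> p\<close> provides.\<close>
  have Jz: "integrable M (\<lambda>\<omega>. J t \<omega> - J 0 \<omega>)" "(\<integral>\<omega>. J t \<omega> - J 0 \<omega> \<partial>M) = 0"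
  proof -
    have "Lp_bound M 2 (\<lambda>\<omega>. \<sigma> r (X r \<omega>)) (K * (1 + C))" if "r \<in> {0..t}" for r
    proof -
      have r: "r \<in> {0..T}" using that t by auto
      have "(\<lambda>\<omega>. \<sigma> r (X r \<omega>)) \<in> borel_measurable M"
        using J by (intro section_measurable(2)[where f = "\<lambda>t \<omega>. \<sigma> t (X t \<omega>)", OF _ r]) (simp only: ito_limit_def)
      then show ?thesis
        by (rule Lp_bound_exponent_mono[OF Lp_bound_growth[OF C[OF r], where V = "\<lambda>\<omega>. \<sigma> r (X r \<omega>)", OF \<sigma>_growth[OF r]] _ _ p]) simp
    qed
    note I = ito_limit_expectation[OF J order_refl _ _ continuous_on_const this, of t]
    show "integrable M (\<lambda>\<omega>. J t \<omega> - J 0 \<omega>)" "(\<integral>\<omega>. J t \<omega> - J 0 \<omega> \<partial>M) = 0"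
      using I t by simp_all
  qed
  have Xi: "integrable M (X t)" using Lp_bound_integral(1)[OF C[OF t] p1 Xm[OF t]] .
  have EX: "(\<integral>\<omega>. X t \<omega> \<partial>M) = x0 + (LINT s:{0..t}|lborel. m s)"
  proof -
    have "AE \<omega> in M. X t \<omega> = x0 + (LINT s:{0..t}|lborel. Y' s \<omega>)"
      using AE_at[OF Xeq t] Y'(2)
    proof eventually_elim
      case (elim \<omega>)
      have "(LINT s:{0..t}|lborel. Y' s \<omega>) = (LINT s:{0..t}|lborel. Y s \<omega>)" by (rule cong) (use elim in auto)
      then show ?case using elim by simp
    qed
    then have "(\<integral>\<omega>. X t \<omega> \<partial>M) = (\<integral>\<omega>. x0 + (LINT s:{0..t}|lborel. Y' s \<omega>) \<partial>M)"
      using Xm[OF t] IY(1)[OF t] by (intro integral_cong_AE) auto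
    also have "\<dots> = x0 + (LINT s:{0..t}|lborel. (\<integral>\<omega>. Y' s \<omega> \<partial>M))"
      using IY[OF t] by (simp add: prob_space)
    also have "(LINT s:{0..t}|lborel. (\<integral>\<omega>. Y' s \<omega> \<partial>M)) = (LINT s:{0..t}|lborel. m s)" by (rule cong[OF EY])
    finally show ?thesis .
  qed
  have "AE \<omega> in M. Y t \<omega> / \<alpha> = (y0 / \<alpha> + \<gamma> * (LINT s:{0..t}|lborel. m s) + (\<kappa> + \<gamma>) * x0) - (\<kappa> + \<gamma>) * X t \<omega> - (LINT s:{0..t}|lborel. g' s \<omega>) + (J t \<omega> - J 0 \<omega>)"
    using AE_at[OF Yeq t] g'eq ito_limit_at_zero[OF J]
  proof eventually_elim
    case (elim \<omega>)
    have "(LINT s:{0..t}|lborel. g' s \<omega>) = (LINT s:{0..t}|lborel. g s (X s \<omega>))" by (rule cong) (use elim in auto)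
    then show ?case using elim by (simp add: m_def algebra_simps)
  qed
  then have "(\<integral>\<omega>. Y t \<omega> / \<alpha> \<partial>M) = (\<integral>\<omega>. (y0 / \<alpha> + \<gamma> * (LINT s:{0..t}|lborel. m s) + (\<kappa> + \<gamma>) * x0) - (\<kappa> + \<gamma>) * X t \<omega> - (LINT s:{0..t}|lborel. g' s \<omega>) + (J t \<omega> - J 0 \<omega>) \<partial>M)"
    using Ym[OF t] Xm[OF t] Jm[OF t] Jm[OF T0] Ig(2)[OF t] by (intro integral_cong_AE) auto
  also have "\<dots> = (y0 / \<alpha> + \<gamma> * (LINT s:{0..t}|lborel. m s) + (\<kappa> + \<gamma>) * x0) - (\<kappa> + \<gamma>) * (\<integral>\<omega>. X t \<omega> \<partial>M) - (LINT s:{0..t}|lborel. (\<integral>\<omega>. g' s \<omega> \<partial>M))"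
    using Xi Ig(2,3)[OF t] Jz by (simp add: prob_space)
  also have "(LINT s:{0..t}|lborel. (\<integral>\<omega>. g' s \<omega> \<partial>M)) = (LINT s:{0..t}|lborel. e s)" by (rule cong[OF Eg])
  finally have "m t / \<alpha> = y0 / \<alpha> - \<kappa> * (LINT s:{0..t}|lborel. m s) - (LINT s:{0..t}|lborel. e s)"
    using EX by (simp add: m_def algebra_simps)
  then have "\<alpha> * (m t / \<alpha>) = \<alpha> * (y0 / \<alpha> - \<kappa> * (LINT s:{0..t}|lborel. m s) - (LINT s:{0..t}|lborel. e s))" by simp
  then show "m t = y0 - \<alpha> * \<kappa> * (LINT s:{0..t}|lborel. m s) - \<alpha> * (LINT s:{0..t}|lborel. e s)"
    using \<alpha> by (simp add: right_diff_distrib)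
qed

text \<open>The relaxation lemma for constant random variables, at speed
  \<open>\<alpha> * \<kappa>\<close>. The factor \<alpha> in front of the forcing cancels against
  the speed in the slope but stays with the intercept.\<close>

lemma mean_velocity_bound:
  assumes t: "t \<in> {0..T}" and B: "0 \<le> B"
    and incr: "\<And>s. s \<in> {0..t} \<Longrightarrow> \<bar>LINT r:{s..t}|lborel. e r\<bar> \<le> A + B * (t - s)"
  shows "\<bar>m t\<bar> \<le> \<bar>y0\<bar> + \<alpha> * A + B / \<kappa>"
proof -
  have ak: "0 < \<alpha> * \<kappa>" using \<alpha> \<kappa> by simp
  define N' where "N' s = y0 - \<alpha> * (LINT r:{0..s}|lborel. e r)" for s
  have mc: "continuous_on {0..T} m"
  proof (rule continuous_on_eq)
    show "continuous_on {0..T} (\<lambda>t. y0 - \<alpha> * \<kappa> * (LINT s:{0..t}|lborel. m s) - \<alpha> * (LINT s:{0..t}|lborel. e s))"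
      by (intro continuous_intros set_integral_interval_continuous m_integrable e_integrable)
  qed (rule mean_equation(2)[symmetric])
  have "Lp_bound M p (\<lambda>_. m t) (\<bar>y0\<bar> + \<alpha> * A + \<alpha> * B / (\<alpha> * \<kappa>))"
  proof (rule Lp_bound_relaxation[where Z = "\<lambda>s _. m s" and N = "\<lambda>s _. N' s", OF _ ak])
    show "0 \<le> t" using t by simp
    show "AE \<omega> in M. continuous_on {0..t} (\<lambda>s. m s)" using continuous_on_subset[OF mc] t by auto
    show "AE \<omega> in M. \<forall>s\<in>{0..t}. m s = N' s - \<alpha> * \<kappa> * (LINT r:{0..s}|lborel. m r)"
      using mean_equation(2) t by (intro AE_I2) (auto simp: N'_def)
    show "Lp_bound M p (\<lambda>\<omega>. N' t - N' s) (\<alpha> * A + \<alpha> * B * (t - s))" if s: "s \<in> {0..t}" for s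
    proof (rule Lp_bound_const)
      have st: "0 \<le> s" "s \<le> t" "t \<le> T" using s t by auto
      have "N' t - N' s = - (\<alpha> * (LINT r:{s..t}|lborel. e r))"
        unfolding set_integral_interval_diff[OF e_integrable st, symmetric] by (simp add: N'_def algebra_simps)
      then have "\<bar>N' t - N' s\<bar> = \<alpha> * \<bar>LINT r:{s..t}|lborel. e r\<bar>" using \<alpha> by (simp add: abs_mult)
      also have "\<dots> \<le> \<alpha> * (A + B * (t - s))" using incr[OF s] \<alpha> by simp
      finally have *: "\<bar>N' t - N' s\<bar> \<le> \<alpha> * A + \<alpha> * B * (t - s)" by (simp add: algebra_simps)
      then show "AE \<omega> in M. \<bar>N' t - N' s\<bar> \<le> \<alpha> * A + \<alpha> * B * (t - s)" by simp
      show "0 \<le> \<alpha> * A + \<alpha> * B * (t - s)" using * by linarith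
    qed
    show "Lp_bound M p (\<lambda>_. N' 0) \<bar>y0\<bar>" by (rule Lp_bound_const) (auto simp: N'_def set_integral_at_point)
  qed (use p \<alpha> B in auto)
  from Lp_bound_expectation[OF this] show ?thesis using p \<alpha> by (simp add: prob_space)
qed

text \<open>It trades the mean velocity for \<open>e\<close>; the boundary term is of order
  \<open>1 / \<alpha>\<close> once \<open>m\<close> is bounded.\<close>

lemma mean_integral:
  assumes st: "0 \<le> s" "s \<le> t" "t \<le> T"
  shows "\<kappa> * (LINT r:{s..t}|lborel. m r) = (m s - m t) / \<alpha> - (LINT r:{s..t}|lborel. e r)"
proof -
  have "s \<in> {0..T}" "t \<in> {0..T}" using st by auto
  from mean_equation(2)[OF this(1)] mean_equation(2)[OF this(2)] \<alpha> show ?thesis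
    unfolding set_integral_interval_diff[OF m_integrable st, symmetric] set_integral_interval_diff[OF e_integrable st, symmetric]
    by (simp add: field_simps)
qed

end

subsection \<open>Bounds uniform in \<open>\<alpha>\<close>\<close>

lemma exp_square_integral_le:
  fixes c s K Q D :: real
  assumes "1 \<le> c" "0 \<le> s" "0 \<le> Q" "0 \<le> K" "0 \<le> D"
  shows "sqrt (D * (LINT r:{0..s}|lborel. (K * (Q * exp (c * r)))\<^sup>2)) \<le> K * sqrt D * (Q * exp (c * s) / sqrt c)"
proof -
  have e2: "exp (2 * c * r) = (exp (c * r))\<^sup>2" for r :: real by (simp add: exp_double[symmetric] mult.assoc)
  have "(LINT r:{0..s}|lborel. (K * (Q * exp (c * r)))\<^sup>2) = (K * Q)\<^sup>2 * (LINT r:{0..s}|lborel. exp (2 * c * r))"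
    by (simp add: exp_double power_mult_distrib mult.assoc)
  also have "\<dots> = (K * Q)\<^sup>2 * ((exp (2 * c * s) - 1) / (2 * c))" using assms exp_integral[of "2 * c" s] by simp
  also have "\<dots> \<le> (K * Q)\<^sup>2 * (exp (2 * c * s) / c)"
    using assms by (intro mult_left_mono frac_le) auto
  finally have "sqrt (D * (LINT r:{0..s}|lborel. (K * (Q * exp (c * r)))\<^sup>2)) \<le> sqrt (D * ((K * Q)\<^sup>2 * (exp (2 * c * s) / c)))"
    using assms by (intro real_sqrt_le_mono mult_left_mono) auto
  also have "\<dots> = K * sqrt D * (Q * exp (c * s) / sqrt c)"
    using assms by (simp add: e2 real_sqrt_mult real_sqrt_divide)
  finally show ?thesis .
qed

lemma exp_integral_le:
  fixes c s K Q :: real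
  assumes "1 \<le> c" "0 \<le> s" "0 \<le> Q" "0 \<le> K"
  shows "(LINT r:{0..s}|lborel. K * (Q * exp (c * r))) \<le> K * (Q * exp (c * s) / sqrt c)"
proof -
  have "sqrt c \<le> c" using assms(1) by (simp add: real_le_lsqrt power2_eq_square)
  then have "(exp (c * s) - 1) / c \<le> exp (c * s) / sqrt c"
    using assms(1) by (intro frac_le) auto
  then have "K * (Q * ((exp (c * s) - 1) / c)) \<le> K * (Q * (exp (c * s) / sqrt c))"
    using assms by (intro mult_left_mono) auto
  then show ?thesis using assms by (simp add: exp_integral)
qed

lemma set_integral_rescale:
  fixes f :: "real \<Rightarrow> real"
  assumes "0 < a"
  shows "(LINT u:{0..t}|lborel. f (u / a)) = a * (LINT r:{0..t / a}|lborel. f r)"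
proof -
  have "(\<integral>r. indicator {0..t / a} r *\<^sub>R f r \<partial>lborel) = \<bar>1 / a\<bar> *\<^sub>R (\<integral>u. indicator {0..t / a} (0 + 1 / a * u) *\<^sub>R f (0 + 1 / a * u) \<partial>lborel)"
    using assms by (intro lborel_integral_real_affine) auto
  also have "(\<lambda>u. indicator {0..t / a} (0 + 1 / a * u) *\<^sub>R f (0 + 1 / a * u)) = (\<lambda>u. indicator {0..t} u *\<^sub>R f (u / a))"
    using assms by (auto simp: indicator_def fun_eq_iff field_simps)
  finally show ?thesis using assms unfolding set_lebesgue_integral_def by simp
qed

lemma divide_le_self:
  fixes x a :: real
  assumes "0 \<le> x" "1 \<le> a"
  shows "x / a \<le> x"
  using divide_left_mono[OF assms(2,1)] assms(2) by simp

section \<open>Constants independent of \<alpha>\<close>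

context langevin
begin

text \<open>This constant and the next are the parts of the increment bound \<open>P\<close> in
  \<open>position_step\<close> without and with the factor
  \<open>Q * exp (c * t) / sqrt c\<close>.\<close>

definition step_const0 :: "real \<Rightarrow> real" where
  "step_const0 y0 = K * T + \<gamma> / \<kappa> * (2 * \<bar>y0\<bar> + 3 * (K * T)) + K * sqrt (ito_const p) * sqrt (2 * T)"

definition step_const1 :: real where
  "step_const1 = K + \<gamma> / \<kappa> * (3 * K) + K * sqrt (ito_const p)"

text \<open>The output of \<open>Lp_gronwall\<close> for the coefficients in
  \<open>position_step\<close>.\<close>

definition position_const :: "real \<Rightarrow> real \<Rightarrow> real" where
  "position_const x0 y0 = 2 * (\<bar>x0\<bar> + 2 * (\<bar>y0\<bar> + step_const0 y0) / (\<kappa> + \<gamma>)) * exp (max 1 (4 * (2 * step_const1 / (\<kappa> + \<gamma>))\<^sup>2) * T)"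

definition growth_const :: "real \<Rightarrow> real \<Rightarrow> real" where
  "growth_const x0 y0 = K * (1 + position_const x0 y0)"

definition mean_const :: "real \<Rightarrow> real \<Rightarrow> real" where
  "mean_const x0 y0 = \<bar>y0\<bar> + growth_const x0 y0 / \<kappa>"

text \<open>The summands belong to the initial velocity, to the noise over one relaxation time, and
  to the drift together with the mean field.\<close>

definition velocity_const :: "real \<Rightarrow> real \<Rightarrow> real" where
  "velocity_const x0 y0 = \<bar>y0\<bar> + sqrt (ito_const p) * growth_const x0 y0 / sqrt (\<kappa> + \<gamma>)
     + (growth_const x0 y0 + \<gamma> * mean_const x0 y0) / (\<kappa> + \<gamma>)"

lemma const_nonneg: "0 \<le> step_const0 y0" "0 \<le> step_const1" "0 \<le> position_const x0 y0" "0 \<le> growth_const x0 y0"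
  "0 \<le> mean_const x0 y0" "0 \<le> velocity_const x0 y0"
proof -
  show 0: "0 \<le> step_const0 y0" "0 \<le> step_const1"
    unfolding step_const0_def step_const1_def using K T \<kappa> \<gamma> ito_const_nonneg[of p] by auto
  show 1: "0 \<le> position_const x0 y0"
    unfolding position_const_def using 0 \<kappa> \<gamma> by auto
  show 2: "0 \<le> growth_const x0 y0" unfolding growth_const_def using 1 K by auto
  show 3: "0 \<le> mean_const x0 y0" unfolding mean_const_def using 2 \<kappa> by auto
  show "0 \<le> velocity_const x0 y0" unfolding velocity_const_def using 2 3 \<kappa> \<gamma> ito_const_nonneg[of p] by auto
qed

end

section \<open>Uniform bounds for position, mean and velocity\<close>

context mean_field_process
begin

text \<open>The danger is the mean velocity, which at this stage is bounded only by a multiple of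
  \<alpha>. By \<open>mean_integral\<close> its time integral involves it divided by \<alpha>, so
  every constant is free of \<alpha>. No rate is sought yet, hence relaxation with slope
  zero.\<close>

lemma position_step:
  assumes \<alpha>1: "1 \<le> \<alpha>" and Q: "0 \<le> Q" and c: "1 \<le> c" and t: "t \<in> {0..T}"
    and IH: "\<And>s. s \<in> {0..T} \<Longrightarrow> Lp_bound M p (X s) (Q * exp (c * s))"
  shows "Lp_bound M p (X t) ((\<bar>x0\<bar> + 2 * (\<bar>y0\<bar> + step_const0 y0) / (\<kappa> + \<gamma>)) + (2 * step_const1 / (\<kappa> + \<gamma>)) * Q * exp (c * t) / sqrt c)"
proof -
  define I where "I v = K * (T + Q * exp (c * v) / sqrt c)" for v
  have Imono: "I s \<le> I t" if "s \<le> t" for s t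
    unfolding I_def using that c Q K by (intro mult_left_mono add_left_mono divide_right_mono) auto
  have I0: "0 \<le> I v" for v unfolding I_def using K T Q c by auto
  have xc: "continuous_on A (\<lambda>r. K * (1 + Q * exp (c * r)))" for A by (intro continuous_intros)
  have growth_int: "(LINT r:{s..t}|lborel. K * (1 + Q * exp (c * r))) \<le> I t" if st: "0 \<le> s" "s \<le> t" "t \<le> T" for s t
  proof -
    have "(LINT r:{s..t}|lborel. K * (1 + Q * exp (c * r))) \<le> (LINT r:{0..t}|lborel. K * (1 + Q * exp (c * r)))"
      using st K Q by (intro set_integral_subset_le borel_integrable_atLeastAtMost' xc) auto
    also have "\<dots> \<le> I t" unfolding I_def using st by (intro affine_exp_integral_le c Q K) auto
    finally show ?thesis .
  qed
  have e_int: "\<bar>LINT r:{s..t}|lborel. e r\<bar> \<le> I t" if st: "0 \<le> s" "s \<le> t" "t \<le> T" for s t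
  proof -
    have i: "set_integrable lborel {s..t} e" by (rule set_integrable_subset[OF e_integrable]) (use st in auto)
    have "\<bar>LINT r:{s..t}|lborel. e r\<bar> \<le> (LINT r:{s..t}|lborel. \<bar>e r\<bar>)" using set_integral_norm_bound[OF i] by simp
    also have "\<dots> \<le> (LINT r:{s..t}|lborel. K * (1 + Q * exp (c * r)))"
      by (intro set_integral_mono set_integrable_abs i borel_integrable_atLeastAtMost' xc e_bound IH) (use st in auto)
    also have "\<dots> \<le> I t" by (rule growth_int[OF st])
    finally show ?thesis .
  qed
  have m_le: "\<bar>m t\<bar> \<le> \<bar>y0\<bar> + \<alpha> * I t" if t: "t \<in> {0..T}" for t
    using mean_velocity_bound[OF t order_refl, of "I t"] e_int t by simp
  \<comment> \<open>Two of the three copies of \<open>I t\<close> come from \<open>m s\<close> and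
    \<open>m t\<close> divided by \<alpha>, the third from the integral of \<open>e\<close>.\<close>
  have m_int: "\<bar>LINT r:{s..t}|lborel. m r\<bar> \<le> (2 * \<bar>y0\<bar> + 3 * I t) / \<kappa>" if st: "0 \<le> s" "s \<le> t" "t \<le> T" for s t
  proof -
    have "\<alpha> * I s \<le> \<alpha> * I t" using Imono[OF st(2)] \<alpha>1 by (intro mult_left_mono) auto
    then have "\<bar>m s\<bar> \<le> \<bar>y0\<bar> + \<alpha> * I t" using m_le[of s] st by simp
    moreover have "\<bar>m t\<bar> \<le> \<bar>y0\<bar> + \<alpha> * I t" using m_le[of t] st by auto
    ultimately have "\<bar>(m s - m t) / \<alpha>\<bar> \<le> (2 * \<bar>y0\<bar> + 2 * (\<alpha> * I t)) / \<alpha>"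
      unfolding abs_divide using \<alpha>1 by (intro frac_le) auto
    also have "\<dots> = 2 * \<bar>y0\<bar> / \<alpha> + 2 * I t" using \<alpha>1 by (simp add: add_divide_distrib)
    also have "\<dots> \<le> 2 * \<bar>y0\<bar> + 2 * I t" using \<alpha>1 by (intro add_right_mono divide_le_self) auto
    finally have "\<bar>\<kappa> * (LINT r:{s..t}|lborel. m r)\<bar> \<le> 2 * \<bar>y0\<bar> + 3 * I t"
      unfolding mean_integral[OF st] using e_int[OF st] by linarith
    then show ?thesis using \<kappa> by (simp add: abs_mult field_simps)
  qed
  define D where "D = ito_const p"
  define P where "P = I t + \<gamma> * ((2 * \<bar>y0\<bar> + 3 * I t) / \<kappa>) + K * sqrt D * (sqrt (2 * T) + Q * exp (c * t) / sqrt c)"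
  have incr: "Lp_bound M p (\<lambda>\<omega>. N t \<omega> - N s \<omega>) (P + 0 * (t - s))" if s: "s \<in> {0..t}" for s
  proof -
    have st: "0 \<le> s" "s \<le> t" "t \<le> T" using s t by auto
    have xcont: "continuous_on {0..T} (\<lambda>r. Q * exp (c * r))" by (intro continuous_intros)
    show ?thesis
    proof (rule Lp_bound_weaken[OF N_increment_bound[OF xcont IH st]])
      have "(LINT r:{s..t}|lborel. (K * (1 + Q * exp (c * r)))\<^sup>2) \<le> (LINT r:{0..t}|lborel. (K * (1 + Q * exp (c * r)))\<^sup>2)"
        using st by (intro set_integral_subset_le borel_integrable_atLeastAtMost' continuous_intros) auto
      then have "sqrt (ito_const p * (LINT r:{s..t}|lborel. (K * (1 + Q * exp (c * r)))\<^sup>2)) \<le> sqrt (ito_const p * (LINT r:{0..t}|lborel. (K * (1 + Q * exp (c * r)))\<^sup>2))"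
        using ito_const_nonneg by (intro real_sqrt_le_mono mult_left_mono)
      also have "\<dots> \<le> K * sqrt D * (sqrt (2 * T) + Q * exp (c * t) / sqrt c)"
        unfolding D_def using st by (intro affine_exp_square_integral_le c Q K ito_const_nonneg) auto
      finally have 1: "sqrt (ito_const p * (LINT r:{s..t}|lborel. (K * (1 + Q * exp (c * r)))\<^sup>2)) \<le> K * sqrt D * (sqrt (2 * T) + Q * exp (c * t) / sqrt c)" .
      have 2: "\<gamma> * \<bar>LINT r:{s..t}|lborel. m r\<bar> \<le> \<gamma> * ((2 * \<bar>y0\<bar> + 3 * I t) / \<kappa>)"
        using m_int[OF st] \<gamma> by (intro mult_left_mono) auto
      show "(LINT r:{s..t}|lborel. K * (1 + Q * exp (c * r))) + \<gamma> * \<bar>LINT r:{s..t}|lborel. m r\<bar> + sqrt (ito_const p * (LINT r:{s..t}|lborel. (K * (1 + Q * exp (c * r)))\<^sup>2)) \<le> P + 0 * (t - s)"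
        using growth_int[OF st] 1 2 unfolding P_def by linarith
    qed (use p in auto)
  qed
  have Z: "Lp_bound M p (\<lambda>\<omega>. Y t \<omega> / \<alpha>) (\<bar>y0\<bar> / \<alpha> + P + 0 / (\<alpha> * (\<kappa> + \<gamma>)))"
    by (rule velocity_bound[OF t order_refl incr])
  have "Lp_bound M p (N 0) (\<bar>y0\<bar> / \<alpha>)"
    by (rule Lp_bound_const) (use N_zero \<alpha> in \<open>auto elim!: eventually_mono\<close>)
  then have Nt: "Lp_bound M p (\<lambda>\<omega>. (N t \<omega> - N 0 \<omega>) + N 0 \<omega>) ((P + 0 * (t - 0)) + \<bar>y0\<bar> / \<alpha>)"
    using t p by (intro Lp_bound_add incr) auto
  define w where "w = \<kappa> + \<gamma>"
  have w: "0 < w" using \<kappa> \<gamma> by (simp add: w_def)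
  have *: "Lp_bound M p (\<lambda>\<omega>. x0 + (1 / w) * (((N t \<omega> - N 0 \<omega>) + N 0 \<omega>) + (- 1) * (Y t \<omega> / \<alpha>)))
      (\<bar>x0\<bar> + \<bar>1 / w\<bar> * (((P + 0 * (t - 0)) + \<bar>y0\<bar> / \<alpha>) + \<bar>- 1\<bar> * (\<bar>y0\<bar> / \<alpha> + P + 0 / (\<alpha> * (\<kappa> + \<gamma>)))))"
    by (intro Lp_bound_add Lp_bound_cmult Nt Z Lp_bound_const) (use p in auto)
  \<comment> \<open>The position is recovered from \<open>N\<close> and
    \<open>Y t \<omega> / \<alpha>\<close>, each bounded by
    \<open>\<bar>y0\<bar> / \<alpha> + P\<close>, whence the factor 2 in the result.\<close>
  have eq: "x0 + (1 / w) * (((N t \<omega> - N 0 \<omega>) + N 0 \<omega>) + (- 1) * (Y t \<omega> / \<alpha>)) = X t \<omega>" for \<omega>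
    using w by (simp add: N_def w_def[symmetric])
  have ya: "\<bar>y0\<bar> / \<alpha> \<le> \<bar>y0\<bar>" using \<alpha>1 by (intro divide_le_self) auto
  show ?thesis
  proof (rule Lp_bound_weaken[OF *[unfolded eq]])
    define x where "x = Q * exp (c * t) / sqrt c"
    have Pe: "P = step_const0 y0 + step_const1 * x"
      unfolding P_def I_def step_const0_def step_const1_def D_def x_def[symmetric] using \<kappa> by (simp add: field_simps)
    have "\<bar>x0\<bar> + \<bar>1 / w\<bar> * (((P + 0 * (t - 0)) + \<bar>y0\<bar> / \<alpha>) + \<bar>- 1\<bar> * (\<bar>y0\<bar> / \<alpha> + P + 0 / (\<alpha> * (\<kappa> + \<gamma>)))) = \<bar>x0\<bar> + 2 * (\<bar>y0\<bar> / \<alpha> + P) / w"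
      using w by (simp add: field_simps)
    also have "\<dots> \<le> \<bar>x0\<bar> + 2 * (\<bar>y0\<bar> + P) / w" using ya w by (simp add: divide_right_mono)
    also have "\<dots> = (\<bar>x0\<bar> + 2 * (\<bar>y0\<bar> + step_const0 y0) / w) + (2 * step_const1 / w) * x"
      unfolding Pe using w by (simp add: field_simps)
    finally show "\<bar>x0\<bar> + \<bar>1 / w\<bar> * (((P + 0 * (t - 0)) + \<bar>y0\<bar> / \<alpha>) + \<bar>- 1\<bar> * (\<bar>y0\<bar> / \<alpha> + P + 0 / (\<alpha> * (\<kappa> + \<gamma>))))
      \<le> (\<bar>x0\<bar> + 2 * (\<bar>y0\<bar> + step_const0 y0) / (\<kappa> + \<gamma>)) + (2 * step_const1 / (\<kappa> + \<gamma>)) * Q * exp (c * t) / sqrt c"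
      by (simp add: x_def w_def)
  qed (use p in auto)
qed

lemma position_uniform_bound:
  assumes \<alpha>1: "1 \<le> \<alpha>" and t: "t \<in> {0..T}"
  shows "Lp_bound M p (X t) (position_const x0 y0)"
proof -
  obtain C where C: "\<And>t. t \<in> {0..T} \<Longrightarrow> Lp_bound M p (X t) C" using a_priori by blast
  show ?thesis unfolding position_const_def
  proof (rule Lp_gronwall[OF _ _ _ _ C _ t])
    show "Lp_bound M p (X t) (\<bar>x0\<bar> + 2 * (\<bar>y0\<bar> + step_const0 y0) / (\<kappa> + \<gamma>) + 2 * step_const1 / (\<kappa> + \<gamma>) * Q * exp (c * t) / sqrt c)"
      if "0 \<le> Q" "1 \<le> c" "\<And>s. s \<in> {0..T} \<Longrightarrow> Lp_bound M p (X s) (Q * exp (c * s))" "t \<in> {0..T}" for Q c t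
      by (rule position_step[OF \<alpha>1 that(1,2,4,3)])
  qed (use T p \<kappa> \<gamma> const_nonneg in auto)
qed

lemma e_uniform_bound: "1 \<le> \<alpha> \<Longrightarrow> t \<in> {0..T} \<Longrightarrow> \<bar>e t\<bar> \<le> growth_const x0 y0"
  unfolding growth_const_def by (intro e_bound position_uniform_bound)

lemma integral_bounded:
  fixes f :: "real \<Rightarrow> real"
  assumes "set_integrable lborel {0..T} f" "\<And>r. r \<in> {0..T} \<Longrightarrow> \<bar>f r\<bar> \<le> b" "0 \<le> s" "s \<le> t" "t \<le> T"
  shows "\<bar>LINT r:{s..t}|lborel. f r\<bar> \<le> b * (t - s)"
proof -
  have i: "set_integrable lborel {s..t} f" by (rule set_integrable_subset[OF assms(1)]) (use assms in auto)
  have "\<bar>LINT r:{s..t}|lborel. f r\<bar> \<le> (LINT r:{s..t}|lborel. \<bar>f r\<bar>)" using set_integral_norm_bound[OF i] by simp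
  also have "\<dots> \<le> (LINT r:{s..t}|lborel. b)"
    by (intro set_integral_mono set_integrable_abs i borel_integrable_atLeastAtMost' continuous_intros) (use assms in auto)
  also have "\<dots> = b * (t - s)" using assms by (simp add: set_integral_const)
  finally show ?thesis .
qed

text \<open>With the position under control \<open>e\<close> is bounded, so its integrals are linear
  in the length of the interval and the term with \<alpha> in \<open>mean_velocity_bound\<close>
  drops out.\<close>

lemma m_uniform_bound:
  assumes \<alpha>1: "1 \<le> \<alpha>" and t: "t \<in> {0..T}"
  shows "\<bar>m t\<bar> \<le> mean_const x0 y0"
proof -
  have "\<bar>LINT r:{s..t}|lborel. e r\<bar> \<le> 0 + growth_const x0 y0 * (t - s)" if "s \<in> {0..t}" for s
    using integral_bounded[OF e_integrable e_uniform_bound[OF \<alpha>1], of s t] that t by simp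
  from mean_velocity_bound[OF t const_nonneg(4) this] show ?thesis by (simp add: mean_const_def)
qed

text \<open>The increments of \<open>N\<close> consist of a drift linear in the lag and a noise of
  the order of its square root, made affine by \<open>sqrt_le_affine\<close> at the relaxation
  speed. After relaxation the noise is of order \<open>1 / sqrt \<alpha>\<close>, the drift of order
  \<open>1 / \<alpha>\<close>.\<close>

lemma velocity_uniform_bound:
  assumes \<alpha>1: "1 \<le> \<alpha>" and t: "t \<in> {0..T}"
  shows "Lp_bound M p (\<lambda>\<omega>. Y t \<omega> / \<alpha>) (velocity_const x0 y0 / sqrt \<alpha>)"
proof -
  define G where "G = growth_const x0 y0"
  define m1 where "m1 = mean_const x0 y0"
  define D where "D = ito_const p"
  define v where "v = \<alpha> * (\<kappa> + \<gamma>)"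
  have v: "0 < v" using \<alpha> \<kappa> \<gamma> by (simp add: v_def)
  have nn: "0 \<le> G" "0 \<le> m1" "0 \<le> D" using const_nonneg ito_const_nonneg by (auto simp: G_def m1_def D_def)
  have "Lp_bound M p (\<lambda>\<omega>. Y t \<omega> / \<alpha>) (\<bar>y0\<bar> / \<alpha> + sqrt D * G / (2 * sqrt v) + (G + \<gamma> * m1 + sqrt D * G * sqrt v / 2) / (\<alpha> * (\<kappa> + \<gamma>)))"
  proof (rule velocity_bound[OF t])
    show "0 \<le> G + \<gamma> * m1 + sqrt D * G * sqrt v / 2" using nn \<gamma> v by auto
    fix s assume s: "s \<in> {0..t}"
    have st: "0 \<le> s" "s \<le> t" "t \<le> T" using s t by auto
    show "Lp_bound M p (\<lambda>\<omega>. N t \<omega> - N s \<omega>) (sqrt D * G / (2 * sqrt v) + (G + \<gamma> * m1 + sqrt D * G * sqrt v / 2) * (t - s))"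
    proof (rule Lp_bound_weaken[OF N_increment_bound[where x = "\<lambda>_. position_const x0 y0", OF continuous_on_const position_uniform_bound[OF \<alpha>1] st]])
      have eqs: "(LINT r:{s..t}|lborel. K * (1 + position_const x0 y0)) = G * (t - s)"
        "(LINT r:{s..t}|lborel. (K * (1 + position_const x0 y0))\<^sup>2) = G\<^sup>2 * (t - s)"
        using st by (simp_all add: set_integral_const G_def growth_const_def)
      have 1: "\<gamma> * \<bar>LINT r:{s..t}|lborel. m r\<bar> \<le> \<gamma> * (m1 * (t - s))"
        using integral_bounded[OF m_integrable m_uniform_bound[OF \<alpha>1] st] \<gamma> by (simp add: m1_def)
      have "sqrt (D * (G\<^sup>2 * (t - s))) = sqrt D * G * sqrt (t - s)" using nn by (simp add: real_sqrt_mult)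
      also have "\<dots> \<le> sqrt D * G * (1 / (2 * sqrt v) + sqrt v / 2 * (t - s))"
        using st v nn by (intro mult_left_mono sqrt_le_affine) auto
      finally have 2: "sqrt (D * (G\<^sup>2 * (t - s))) \<le> sqrt D * G * (1 / (2 * sqrt v) + sqrt v / 2 * (t - s))" .
      show "(LINT r:{s..t}|lborel. K * (1 + position_const x0 y0)) + \<gamma> * \<bar>LINT r:{s..t}|lborel. m r\<bar> + sqrt (ito_const p * (LINT r:{s..t}|lborel. (K * (1 + position_const x0 y0))\<^sup>2))
         \<le> sqrt D * G / (2 * sqrt v) + (G + \<gamma> * m1 + sqrt D * G * sqrt v / 2) * (t - s)"
      proof -
        have "G * (t - s) + \<gamma> * \<bar>LINT r:{s..t}|lborel. m r\<bar> + sqrt (D * (G\<^sup>2 * (t - s)))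
          \<le> G * (t - s) + \<gamma> * (m1 * (t - s)) + sqrt D * G * (1 / (2 * sqrt v) + sqrt v / 2 * (t - s))"
          using 1 2 by (intro add_mono order_refl)
        also have "\<dots> = sqrt D * G / (2 * sqrt v) + (G + \<gamma> * m1 + sqrt D * G * sqrt v / 2) * (t - s)"
          by (simp add: algebra_simps)
        finally show ?thesis unfolding eqs D_def .
      qed
    qed (use p in auto)
  qed
  then show ?thesis
  proof (rule Lp_bound_weaken)
    have a1: "1 \<le> sqrt \<alpha>" using \<alpha>1 by simp
    have inv: "x / \<alpha> \<le> x / sqrt \<alpha>" if "0 \<le> x" for x
    proof -
      have "sqrt \<alpha> \<le> \<alpha>" using \<alpha>1 by (simp add: real_le_lsqrt power2_eq_square)
      then show ?thesis using that a1 by (intro divide_left_mono) auto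
    qed
    \<comment> \<open>Intercept and slope of the tangent contribute equally, which removes the
      factor one half.\<close>
    have "sqrt D * G / (2 * sqrt v) + (G + \<gamma> * m1 + sqrt D * G * sqrt v / 2) / (\<alpha> * (\<kappa> + \<gamma>)) = sqrt D * G / sqrt v + (G + \<gamma> * m1) / v"
    proof -
      define u where "u = sqrt v"
      have "v = u * u" "0 < u" using v by (simp_all add: u_def)
      then show ?thesis unfolding v_def[symmetric] u_def[symmetric] by (simp add: field_simps)
    qed
    also have "\<dots> = sqrt D * G / sqrt (\<kappa> + \<gamma>) / sqrt \<alpha> + (G + \<gamma> * m1) / (\<kappa> + \<gamma>) / \<alpha>"
      by (simp add: v_def real_sqrt_mult mult.commute)
    also have "\<dots> \<le> sqrt D * G / sqrt (\<kappa> + \<gamma>) / sqrt \<alpha> + (G + \<gamma> * m1) / (\<kappa> + \<gamma>) / sqrt \<alpha>"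
      using nn \<kappa> \<gamma> by (intro add_left_mono inv) auto
    finally have 1: "sqrt D * G / (2 * sqrt v) + (G + \<gamma> * m1 + sqrt D * G * sqrt v / 2) / (\<alpha> * (\<kappa> + \<gamma>)) \<le> sqrt D * G / sqrt (\<kappa> + \<gamma>) / sqrt \<alpha> + (G + \<gamma> * m1) / (\<kappa> + \<gamma>) / sqrt \<alpha>" .
    have 2: "\<bar>y0\<bar> / \<alpha> \<le> \<bar>y0\<bar> / sqrt \<alpha>" by (rule inv) simp
    have "velocity_const x0 y0 / sqrt \<alpha> = \<bar>y0\<bar> / sqrt \<alpha> + sqrt D * G / sqrt (\<kappa> + \<gamma>) / sqrt \<alpha> + (G + \<gamma> * m1) / (\<kappa> + \<gamma>) / sqrt \<alpha>"
      by (simp add: velocity_const_def G_def m1_def D_def add_divide_distrib)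
    then show "\<bar>y0\<bar> / \<alpha> + sqrt D * G / (2 * sqrt v) + (G + \<gamma> * m1 + sqrt D * G * sqrt v / 2) / (\<alpha> * (\<kappa> + \<gamma>)) \<le> velocity_const x0 y0 / sqrt \<alpha>"
      using 1 2 by linarith
  qed (use p in auto)
qed

end

subsection \<open>Convergence rates\<close>

context langevin
begin

text \<open>Bounds the remainder \<open>R\<close> in \<open>position_error\<close> after
  \<open>1 / sqrt \<alpha>\<close> is taken out: initial velocity, velocity, and the boundary term
  left by the mean equation.\<close>

definition remainder_const :: "real \<Rightarrow> real \<Rightarrow> real" where
  "remainder_const x0 y0 = \<bar>y0\<bar> + velocity_const x0 y0 + \<gamma> / \<kappa> * (\<bar>y0\<bar> + mean_const x0 y0)"

text \<open>The three summands in the bracket belong to drift, mean and noise in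
  \<open>position_error\<close>.\<close>

definition error_step_const :: "real \<Rightarrow> real" where
  "error_step_const Lip = Lip * (1 + \<gamma> / \<kappa> + sqrt (ito_const p)) / (\<kappa> + \<gamma>)"

definition position_error_const :: "real \<Rightarrow> real \<Rightarrow> real \<Rightarrow> real" where
  "position_error_const Lip x0 y0 = 2 * (remainder_const x0 y0 / (\<kappa> + \<gamma>)) * exp (max 1 (4 * (error_step_const Lip)\<^sup>2) * T)"

end

section \<open>Error of the positions\<close>

context mean_field_process
begin

text \<open>Both noise terms are integrals against the same \<open>W\<close>, so their difference is
  the integral of a Lipschitz increment. The qualitative bounds of both processes only start
  Gronwall and leave no trace in the constant.\<close>

lemma position_error:
  assumes \<alpha>1: "1 \<le> \<alpha>" and lim: "limit_equation x0 X'"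
    and lip: "\<And>t x y. t \<in> {0..T} \<Longrightarrow> \<bar>g t x - g t y\<bar> + \<bar>\<sigma> t x - \<sigma> t y\<bar> \<le> Lip * \<bar>x - y\<bar>"
    and t: "t \<in> {0..T}"
  shows "Lp_bound M p (\<lambda>\<omega>. X t \<omega> - X' t \<omega>) (position_error_const Lip x0 y0 / sqrt \<alpha>)"
proof -
  obtain J' where J': "ito_limit (\<lambda>t \<omega>. \<sigma> t (X' t \<omega>)) J'" and Jc': "AE \<omega> in M. continuous_on {0..T} (\<lambda>t. J' t \<omega>)"
    and Xa': "\<And>t. t \<in> {0..T} \<Longrightarrow> X' t \<in> borel_measurable (F t)" and Xc': "AE \<omega> in M. continuous_on {0..T} (\<lambda>t. X' t \<omega>)"
    and gi': "AE \<omega> in M. set_integrable lborel {0..T} (\<lambda>s. g s (X' s \<omega>))"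
    and ei': "set_integrable lborel {0..T} (\<lambda>s. \<integral>\<omega>. g s (X' s \<omega>) \<partial>M)"
    and Xeq': "AE \<omega> in M. \<forall>t\<in>{0..T}. (\<kappa> + \<gamma>) * X' t \<omega> = (\<kappa> + \<gamma>) * x0 - (LINT s:{0..t}|lborel. g s (X' s \<omega>))
        - \<gamma> / \<kappa> * (LINT s:{0..t}|lborel. (\<integral>\<omega>. g s (X' s \<omega>) \<partial>M)) + J' t \<omega>"
    by (rule limit_equationE[OF lim], rule that)
  define e' where "e' s = (\<integral>\<omega>. g s (X' s \<omega>) \<partial>M)" for s
  have ig': "integrable M (\<lambda>\<omega>. g t (X' t \<omega>))" if "t \<in> {0..T}" for t
    using lim that by (simp add: limit_equation_def)
  have Xm': "X' t \<in> borel_measurable M" if "t \<in> {0..T}" for t using F_measurable_M[OF Xa'[OF that] that] .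
  obtain C where C: "\<And>t. t \<in> {0..T} \<Longrightarrow> Lp_bound M p (X t) C" using a_priori by blast
  obtain C' where C': "\<And>t. t \<in> {0..T} \<Longrightarrow> Lp_bound M p (X' t) C'" using limit_a_priori[OF lim] by blast
  have p1: "1 \<le> p" "0 \<le> p" using p by auto
  have ig: "integrable M (\<lambda>\<omega>. g t (X t \<omega>))" if "t \<in> {0..T}" for t
    by (rule Lp_bound_integral(1)[OF Lp_bound_growth[OF C[OF that] g_growth[OF that]] p1(1) gm[OF that]])
  have Lip: "0 \<le> Lip" using lip[of 0 0 1] T by simp
  have kg: "0 < \<kappa> + \<gamma>" using \<kappa> \<gamma> by simp
  define D where "D t \<omega> = X t \<omega> - X' t \<omega>" for t \<omega>
  \<comment> \<open>What is left over against the limit equation: terms with a factor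
    \<open>1 / \<alpha>\<close>, and the velocity \<open>Y t \<omega> / \<alpha>\<close>.\<close>
  define R where "R t \<omega> = (1 + \<gamma> / \<kappa>) * y0 / \<alpha> - \<gamma> / \<kappa> * m t / \<alpha> + (- 1) * (Y t \<omega> / \<alpha>)" for t \<omega>
  have Dm: "D t \<in> borel_measurable M" if "t \<in> {0..T}" for t
    unfolding D_def[abs_def] using Xm[OF that] Xm'[OF that] by measurable
  have Dc: "AE \<omega> in M. continuous_on {0..T} (\<lambda>t. D t \<omega>)"
    using Xc Xc' by eventually_elim (simp add: D_def continuous_on_diff)
  have Deq: "AE \<omega> in M. (\<kappa> + \<gamma>) * D t \<omega> = R t \<omega>
      + (- 1) * ((LINT s:{0..t}|lborel. g s (X s \<omega>)) - (LINT s:{0..t}|lborel. g s (X' s \<omega>)))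
      + ((- \<gamma> / \<kappa>) * ((LINT s:{0..t}|lborel. e s) - (LINT s:{0..t}|lborel. e' s))
      + ((J t \<omega> - J' t \<omega>) - (J 0 \<omega> - J' 0 \<omega>)))" if t: "t \<in> {0..T}" for t
    using AE_at[OF Yeq t] AE_at[OF Xeq' t] ito_limit_at_zero[OF J] ito_limit_at_zero[OF J']
  proof eventually_elim
    case (elim \<omega>)
    define Im where "Im = (LINT s:{0..t}|lborel. m s)"
    define Ie where "Ie = (LINT s:{0..t}|lborel. e s)"
    have mt: "m t = y0 - \<alpha> * \<kappa> * Im - \<alpha> * Ie" unfolding Im_def Ie_def by (rule mean_equation(2)[OF t])
    \<comment> \<open>The mean equation solved for the integral of \<open>m\<close>. This produces
      the nonlocal term of the limit equation with its factor
      \<open>\<gamma> / \<kappa>\<close>.\<close>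
    have "\<gamma> * Im = \<gamma> / \<kappa> * y0 / \<alpha> - \<gamma> / \<kappa> * m t / \<alpha> - \<gamma> / \<kappa> * Ie"
      unfolding mt using \<alpha> \<kappa> by (simp add: field_simps)
    then show ?case
      using elim unfolding D_def R_def Ie_def[symmetric] m_def[symmetric] e'_def[symmetric] Im_def[symmetric]
      by (simp add: algebra_simps add_divide_distrib)
  qed
  have a1: "1 \<le> sqrt \<alpha>" using \<alpha>1 by simp
  have inv: "x / \<alpha> \<le> x / sqrt \<alpha>" if "0 \<le> x" for x
  proof -
    have "sqrt \<alpha> \<le> \<alpha>" using \<alpha>1 by (simp add: real_le_lsqrt power2_eq_square)
    then show ?thesis using that a1 by (intro divide_left_mono) auto
  qed
  have Rb: "Lp_bound M p (R t) (remainder_const x0 y0 / sqrt \<alpha>)" if t: "t \<in> {0..T}" for t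
  proof -
    have "\<bar>(1 + \<gamma> / \<kappa>) * y0 / \<alpha> - \<gamma> / \<kappa> * m t / \<alpha>\<bar> \<le> (\<bar>y0\<bar> + \<gamma> / \<kappa> * (\<bar>y0\<bar> + mean_const x0 y0)) / sqrt \<alpha>"
    proof -
      have gk: "0 \<le> \<gamma> / \<kappa>" using \<gamma> \<kappa> by simp
      have "\<bar>(1 + \<gamma> / \<kappa>) * y0 / \<alpha> - \<gamma> / \<kappa> * m t / \<alpha>\<bar> = \<bar>y0 + \<gamma> / \<kappa> * (y0 - m t)\<bar> / \<alpha>"
      proof -
        have "(1 + \<gamma> / \<kappa>) * y0 / \<alpha> - \<gamma> / \<kappa> * m t / \<alpha> = (y0 + \<gamma> / \<kappa> * (y0 - m t)) / \<alpha>"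
          by (simp add: algebra_simps add_divide_distrib diff_divide_distrib)
        then show ?thesis using \<alpha> by (simp only: abs_divide abs_of_pos)
      qed
      also have "\<bar>y0 + \<gamma> / \<kappa> * (y0 - m t)\<bar> \<le> \<bar>y0\<bar> + \<bar>\<gamma> / \<kappa> * (y0 - m t)\<bar>" by (rule abs_triangle_ineq)
      also have "\<bar>\<gamma> / \<kappa> * (y0 - m t)\<bar> = \<gamma> / \<kappa> * \<bar>y0 - m t\<bar>" using gk by (simp only: abs_mult abs_of_nonneg)
      also have "\<gamma> / \<kappa> * \<bar>y0 - m t\<bar> \<le> \<gamma> / \<kappa> * (\<bar>y0\<bar> + mean_const x0 y0)"
        using m_uniform_bound[OF \<alpha>1 t] gk by (intro mult_left_mono) auto
      finally have "\<bar>(1 + \<gamma> / \<kappa>) * y0 / \<alpha> - \<gamma> / \<kappa> * m t / \<alpha>\<bar> \<le> (\<bar>y0\<bar> + \<gamma> / \<kappa> * (\<bar>y0\<bar> + mean_const x0 y0)) / \<alpha>"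
        using \<alpha> by (simp add: divide_right_mono)
      also have "\<dots> \<le> (\<bar>y0\<bar> + \<gamma> / \<kappa> * (\<bar>y0\<bar> + mean_const x0 y0)) / sqrt \<alpha>"
        by (intro inv add_nonneg_nonneg mult_nonneg_nonneg gk const_nonneg abs_ge_zero)
      finally show ?thesis .
    qed
    then have "Lp_bound M p (R t) ((\<bar>y0\<bar> + \<gamma> / \<kappa> * (\<bar>y0\<bar> + mean_const x0 y0)) / sqrt \<alpha> + \<bar>- 1\<bar> * (velocity_const x0 y0 / sqrt \<alpha>))"
      unfolding R_def
      by (intro Lp_bound_add Lp_bound_cmult velocity_uniform_bound[OF \<alpha>1 t] Lp_bound_const p1) (auto intro: order_trans[OF abs_ge_zero])
    then show ?thesis by (simp add: remainder_const_def add_divide_distrib ac_simps)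
  qed
  have step: "Lp_bound M p (D t) (remainder_const x0 y0 / sqrt \<alpha> / (\<kappa> + \<gamma>) + error_step_const Lip * Q * exp (c * t) / sqrt c)"
    if Q: "0 \<le> Q" and c: "1 \<le> c" and IH: "\<And>s. s \<in> {0..T} \<Longrightarrow> Lp_bound M p (D s) (Q * exp (c * s))" and t: "t \<in> {0..T}" for Q c t
  proof -
    define x where "x = Q * exp (c * t) / sqrt c"
    have t0: "0 \<le> t" "t \<le> T" and sub: "{0..t} \<subseteq> {0..T}" using t by auto
    have LD: "Lp_bound M p (\<lambda>\<omega>. Lip * D r \<omega>) (Lip * (Q * exp (c * r)))" if "r \<in> {0..T}" for r
      using Lp_bound_cmult[OF IH[OF that] p1(2), of Lip] Lip by simp
    have xc: "continuous_on A (\<lambda>r. Lip * (Q * exp (c * r)))" for A by (intro continuous_intros)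
    have lipg: "\<bar>g r (X r \<omega>) - g r (X' r \<omega>)\<bar> \<le> \<bar>Lip * D r \<omega>\<bar>" and lips: "\<bar>\<sigma> r (X r \<omega>) - \<sigma> r (X' r \<omega>)\<bar> \<le> \<bar>Lip * D r \<omega>\<bar>"
      if "r \<in> {0..T}" for r \<omega>
      using lip[OF that, of "X r \<omega>" "X' r \<omega>"] Lip by (auto simp: D_def abs_mult)
    have drift: "Lp_bound M p (\<lambda>\<omega>. (LINT s:{0..t}|lborel. g s (X s \<omega>)) - (LINT s:{0..t}|lborel. g s (X' s \<omega>))) (Lip * x)"
    proof (rule Lp_bound_mono)
      show "Lp_bound M p (\<lambda>\<omega>. LINT r:{0..t}|lborel. \<bar>Lip * D r \<omega>\<bar>) (LINT r:{0..t}|lborel. Lip * (Q * exp (c * r)))"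
      proof (rule Lp_bound_time_integral[OF t0(1) p1(1)])
        show "(\<lambda>\<omega>. Lip * D r \<omega>) \<in> borel_measurable M" if "r \<in> {0..t}" for r
          using Dm[of r] that sub by (intro borel_measurable_times) auto
        show "AE \<omega> in M. continuous_on {0..t} (\<lambda>r. Lip * D r \<omega>)"
          using Dc by eventually_elim (intro continuous_intros continuous_on_subset[OF _ sub])
      qed (use LD xc sub in auto)
      show "(LINT r:{0..t}|lborel. Lip * (Q * exp (c * r))) \<le> Lip * x"
        unfolding x_def by (rule exp_integral_le[OF c t0(1) Q Lip])
      show "AE \<omega> in M. \<bar>(LINT s:{0..t}|lborel. g s (X s \<omega>)) - (LINT s:{0..t}|lborel. g s (X' s \<omega>))\<bar> \<le> \<bar>LINT r:{0..t}|lborel. \<bar>Lip * D r \<omega>\<bar>\<bar>"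
        using gi gi' Dc
      proof eventually_elim
        case (elim \<omega>)
        have i: "set_integrable lborel {0..t} (\<lambda>s. g s (X s \<omega>))" "set_integrable lborel {0..t} (\<lambda>s. g s (X' s \<omega>))"
          using elim sub by (auto intro: set_integrable_subset)
        have "\<bar>LINT s:{0..t}|lborel. g s (X s \<omega>) - g s (X' s \<omega>)\<bar> \<le> (LINT s:{0..t}|lborel. \<bar>g s (X s \<omega>) - g s (X' s \<omega>)\<bar>)"
          using set_integral_norm_bound[OF set_integral_diff(1)[OF i]] by simp
        also have "\<dots> \<le> (LINT r:{0..t}|lborel. \<bar>Lip * D r \<omega>\<bar>)"
          using sub by (intro set_integral_mono set_integrable_abs set_integral_diff(1)[OF i] lipg borel_integrable_atLeastAtMost'
             continuous_intros continuous_on_subset[OF elim(3) sub]) auto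
        finally show ?case by (simp add: set_integral_diff(2)[OF i])
      qed
    qed (rule p1)
    \<comment> \<open>The means are deterministic and their difference is bounded by the L^p norm,
      so the nonlocal term behaves like the drift.\<close>
    have mean: "Lp_bound M p (\<lambda>\<omega>. (LINT s:{0..t}|lborel. e s) - (LINT s:{0..t}|lborel. e' s)) (Lip * x)"
    proof (rule Lp_bound_const)
      have i: "set_integrable lborel {0..t} e" "set_integrable lborel {0..t} e'"
        using e_integrable ei' sub by (auto intro: set_integrable_subset simp: e'_def[abs_def])
      have eb: "\<bar>e r - e' r\<bar> \<le> Lip * (Q * exp (c * r))" if r: "r \<in> {0..T}" for r
      proof -
        have "Lp_bound M p (\<lambda>\<omega>. g r (X r \<omega>) - g r (X' r \<omega>)) (Lip * (Q * exp (c * r)))"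
          by (rule Lp_bound_mono[OF LD[OF r]]) (use lipg[OF r] p1 in auto)
        from Lp_bound_expectation[OF this p1(1)] show ?thesis
          using ig[OF r] ig'[OF r] by (simp add: e_def e'_def)
      qed
      have "\<bar>LINT s:{0..t}|lborel. e s - e' s\<bar> \<le> (LINT s:{0..t}|lborel. \<bar>e s - e' s\<bar>)"
        using set_integral_norm_bound[OF set_integral_diff(1)[OF i]] by simp
      also have "\<dots> \<le> (LINT r:{0..t}|lborel. Lip * (Q * exp (c * r)))"
        using sub by (intro set_integral_mono set_integrable_abs set_integral_diff(1)[OF i] eb borel_integrable_atLeastAtMost' xc) auto
      also have "\<dots> \<le> Lip * x" unfolding x_def by (rule exp_integral_le[OF c t0(1) Q Lip])
      finally show "AE \<omega> in M. \<bar>(LINT s:{0..t}|lborel. e s) - (LINT s:{0..t}|lborel. e' s)\<bar> \<le> Lip * x"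
        by (simp add: set_integral_diff(2)[OF i])
      show "0 \<le> Lip * x" using Lip Q c by (simp add: x_def)
    qed
    have noise: "Lp_bound M p (\<lambda>\<omega>. (J t \<omega> - J' t \<omega>) - (J 0 \<omega> - J' 0 \<omega>)) (Lip * sqrt (ito_const p) * x)"
    proof (rule Lp_bound_weaken[OF Lp_bound_ito[OF ito_limit_diff[OF J J'] order_refl t0 p xc]])
      show "Lp_bound M p (\<lambda>\<omega>. \<sigma> r (X r \<omega>) - \<sigma> r (X' r \<omega>)) (Lip * (Q * exp (c * r)))" if "r \<in> {0..t}" for r
        by (rule Lp_bound_mono[OF LD]) (use lips p1 that sub in auto)
      show "sqrt (ito_const p * (LINT r:{0..t}|lborel. (Lip * (Q * exp (c * r)))\<^sup>2)) \<le> Lip * sqrt (ito_const p) * x"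
        unfolding x_def by (rule exp_square_integral_le[OF c t0(1) Q Lip ito_const_nonneg])
    qed (rule p1)
    have "Lp_bound M p (\<lambda>\<omega>. (1 / (\<kappa> + \<gamma>)) * (R t \<omega>
      + (- 1) * ((LINT s:{0..t}|lborel. g s (X s \<omega>)) - (LINT s:{0..t}|lborel. g s (X' s \<omega>)))
      + ((- \<gamma> / \<kappa>) * ((LINT s:{0..t}|lborel. e s) - (LINT s:{0..t}|lborel. e' s))
      + ((J t \<omega> - J' t \<omega>) - (J 0 \<omega> - J' 0 \<omega>)))))
      (\<bar>1 / (\<kappa> + \<gamma>)\<bar> * (remainder_const x0 y0 / sqrt \<alpha> + \<bar>- 1\<bar> * (Lip * x) + (\<bar>- \<gamma> / \<kappa>\<bar> * (Lip * x) + Lip * sqrt (ito_const p) * x)))"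
      by (intro Lp_bound_add Lp_bound_cmult Rb[OF t] drift mean noise p1)
    then show ?thesis
    proof (rule Lp_bound_mono)
      show "AE \<omega> in M. \<bar>D t \<omega>\<bar> \<le> \<bar>(1 / (\<kappa> + \<gamma>)) * (R t \<omega>
      + (- 1) * ((LINT s:{0..t}|lborel. g s (X s \<omega>)) - (LINT s:{0..t}|lborel. g s (X' s \<omega>)))
      + ((- \<gamma> / \<kappa>) * ((LINT s:{0..t}|lborel. e s) - (LINT s:{0..t}|lborel. e' s))
      + ((J t \<omega> - J' t \<omega>) - (J 0 \<omega> - J' 0 \<omega>))))\<bar>"
        using Deq[OF t]
      proof eventually_elim
        case (elim \<omega>)
        show ?case unfolding elim[symmetric] using kg by simp
      qed
      have "\<bar>1 / (\<kappa> + \<gamma>)\<bar> = 1 / (\<kappa> + \<gamma>)" "\<bar>- \<gamma> / \<kappa>\<bar> = \<gamma> / \<kappa>" using \<kappa> \<gamma> by auto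
      then show "\<bar>1 / (\<kappa> + \<gamma>)\<bar> * (remainder_const x0 y0 / sqrt \<alpha> + \<bar>- 1\<bar> * (Lip * x) + (\<bar>- \<gamma> / \<kappa>\<bar> * (Lip * x) + Lip * sqrt (ito_const p) * x))
        \<le> remainder_const x0 y0 / sqrt \<alpha> / (\<kappa> + \<gamma>) + error_step_const Lip * Q * exp (c * t) / sqrt c"
        by (simp only: error_step_const_def x_def) (simp add: algebra_simps add_divide_distrib)
    qed (rule p1)
  qed
  \<comment> \<open>The Gronwall bound is linear in its inhomogeneous term, so the factor
    \<open>1 / sqrt \<alpha>\<close> passes through.\<close>
  have "Lp_bound M p (D t) (2 * (remainder_const x0 y0 / sqrt \<alpha> / (\<kappa> + \<gamma>)) * exp (max 1 (4 * (error_step_const Lip)\<^sup>2) * T))"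
  proof (rule Lp_gronwall[OF _ _ _ _ _ step t])
    show "Lp_bound M p (D t) (C + \<bar>- 1\<bar> * C')" if "t \<in> {0..T}" for t
      using Lp_bound_add[OF C[OF that] Lp_bound_cmult[OF C'[OF that] p1(2), of "-1"] p1(1)] by (simp add: D_def[abs_def])
    show "0 \<le> remainder_const x0 y0 / sqrt \<alpha> / (\<kappa> + \<gamma>)"
      unfolding remainder_const_def using kg \<kappa> \<gamma> \<alpha> const_nonneg by auto
    show "0 \<le> error_step_const Lip" unfolding error_step_const_def using Lip \<kappa> \<gamma> ito_const_nonneg[of p] by auto
  qed (use T p in auto)
  then show ?thesis by (simp add: D_def[abs_def] position_error_const_def mult.commute mult.left_commute)
qed

end

section \<open>Velocities on the fast time scale\<close>

context langevin
begin

text \<open>Each summand is the size of one part of the rescaled forcing over the whole horizon,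
  with \<open>1 / sqrt \<alpha>\<close> taken out.\<close>

definition velocity_error_const :: "real \<Rightarrow> real \<Rightarrow> real \<Rightarrow> real" where
  "velocity_error_const Lip x0 y0 = \<bar>y0\<bar> + (growth_const x0 y0 * T + \<gamma> * (mean_const x0 y0 * T)
     + sqrt (ito_const p * T) * (Lip * T * (1 + velocity_const x0 y0)))"

lemma mean_field_processI:
  assumes mf: "mean_field x0 y0 \<alpha> X Y" and \<alpha>: "0 < \<alpha>"
  obtains J g' where "mean_field_process M F T W \<kappa> \<gamma> K p g \<sigma> x0 y0 \<alpha> X Y J g'"
proof -
  obtain J g' where facts:
    "ito_limit (\<lambda>t \<omega>. \<sigma> t (X t \<omega>)) J" "AE \<omega> in M. continuous_on {0..T} (\<lambda>t. J t \<omega>)"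
    "\<And>t. t \<in> {0..T} \<Longrightarrow> X t \<in> borel_measurable (F t)" "AE \<omega> in M. continuous_on {0..T} (\<lambda>t. X t \<omega>)"
    "\<And>t. t \<in> {0..T} \<Longrightarrow> Y t \<in> borel_measurable M" "AE \<omega> in M. continuous_on {0..T} (\<lambda>t. Y t \<omega>)"
    "AE \<omega> in M. \<forall>t\<in>{0..T}. X t \<omega> = x0 + (LINT s:{0..t}|lborel. Y s \<omega>)"
    "AE \<omega> in M. set_integrable lborel {0..T} (\<lambda>s. g s (X s \<omega>))"
    "set_integrable lborel {0..T} (\<lambda>s. \<integral>\<omega>. Y s \<omega> \<partial>M)"
    "AE \<omega> in M. \<forall>t\<in>{0..T}. Y t \<omega> / \<alpha> = y0 / \<alpha> - (\<kappa> + \<gamma>) * (X t \<omega> - x0) - (LINT s:{0..t}|lborel. g s (X s \<omega>))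
        + \<gamma> * (LINT s:{0..t}|lborel. (\<integral>\<omega>. Y s \<omega> \<partial>M)) + J t \<omega>"
    "(\<lambda>x. g' (fst x) (snd x)) \<in> borel_measurable (L \<Otimes>\<^sub>M M)"
    "AE \<omega> in M. \<forall>t\<in>{0..T}. g' t \<omega> = g t (X t \<omega>)"
    "\<And>t. t \<in> {0..T} \<Longrightarrow> (\<lambda>\<omega>. g t (X t \<omega>)) \<in> borel_measurable M"
    by (rule mean_fieldE[OF mf \<alpha>], rule that)
  have Yi: "\<And>t. t \<in> {0..T} \<Longrightarrow> integrable M (Y t)" using mf by (simp add: mean_field_def)
  have "mean_field_process_axioms M F T W \<kappa> \<gamma> p g \<sigma> x0 y0 \<alpha> X Y J g'"
    by (rule mean_field_process_axioms.intro[OF \<alpha> facts Yi mean_field_a_priori[OF mf \<alpha>]])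
  then show ?thesis by (intro that mean_field_process.intro langevin_axioms)
qed

end

context mean_field_process
begin

text \<open>The velocity is of order \<open>sqrt \<alpha>\<close>, but the fast time scale lasts
  only \<open>T / \<alpha>\<close>.\<close>

lemma displacement_bound:
  assumes \<alpha>1: "1 \<le> \<alpha>" and r: "r \<in> {0..T / \<alpha>}"
  shows "Lp_bound M p (\<lambda>\<omega>. X r \<omega> - x0) (velocity_const x0 y0 * T / sqrt \<alpha>)"
proof -
  define V where "V = velocity_const x0 y0"
  have V: "0 \<le> V" using const_nonneg by (simp add: V_def)
  have rT: "r \<in> {0..T}" using r divide_le_self[OF less_imp_le[OF T] \<alpha>1] by auto
  have sub: "{0..r} \<subseteq> {0..T}" using rT by auto
  have YV: "Lp_bound M p (Y u) (sqrt \<alpha> * V)" if "u \<in> {0..T}" for u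
  proof -
    have "\<bar>\<alpha>\<bar> * (V / sqrt \<alpha>) = sqrt \<alpha> * V" using \<alpha> real_div_sqrt[of \<alpha>] by (simp add: field_simps)
    then show ?thesis using Lp_bound_cmult[OF velocity_uniform_bound[OF \<alpha>1 that], of \<alpha>] \<alpha> p by (simp add: V_def)
  qed
  have "Lp_bound M p (\<lambda>\<omega>. LINT u:{0..r}|lborel. \<bar>Y u \<omega>\<bar>) (LINT u:{0..r}|lborel. sqrt \<alpha> * V)"
  proof (rule Lp_bound_time_integral)
    show "AE \<omega> in M. continuous_on {0..r} (\<lambda>r. Y r \<omega>)"
      using Yc by eventually_elim (rule continuous_on_subset[OF _ sub])
  qed (use r p Ym YV sub in \<open>auto intro: continuous_on_const\<close>)
  then show ?thesis
  proof (rule Lp_bound_mono)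
    show "AE \<omega> in M. \<bar>X r \<omega> - x0\<bar> \<le> \<bar>LINT u:{0..r}|lborel. \<bar>Y u \<omega>\<bar>\<bar>"
      using AE_at[OF Xeq rT] Yc
    proof eventually_elim
      case (elim \<omega>)
      have "set_integrable lborel {0..r} (\<lambda>u. Y u \<omega>)"
        by (rule borel_integrable_atLeastAtMost'[OF continuous_on_subset[OF elim(2) sub]])
      from set_integral_norm_bound[OF this] elim(1) show ?case by simp
    qed
    have "(LINT u:{0..r}|lborel. sqrt \<alpha> * V) = sqrt \<alpha> * V * r" using r by (simp add: set_integral_const)
    also have "\<dots> \<le> sqrt \<alpha> * V * (T / \<alpha>)" using r V \<alpha> by (intro mult_left_mono) auto
    also have "\<dots> = V * T / sqrt \<alpha>"
    proof -
      define q where "q = sqrt \<alpha>"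
      have q: "0 < q" "\<alpha> = q * q" using \<alpha> by (simp_all add: q_def)
      show ?thesis unfolding q_def[symmetric] unfolding q(2) using q(1) by simp
    qed
    finally show "(LINT u:{0..r}|lborel. sqrt \<alpha> * V) \<le> velocity_const x0 y0 * T / sqrt \<alpha>" by (simp add: V_def)
  qed (use p in auto)
qed

text \<open>On the fast time scale both the elapsed time and the displacement are at most of order
  \<open>1 / sqrt \<alpha>\<close>.\<close>

lemma diffusion_freezing_bound:
  assumes \<alpha>1: "1 \<le> \<alpha>"
    and lip: "\<And>t s x y. t \<in> {0..T} \<Longrightarrow> s \<in> {0..T} \<Longrightarrow> \<bar>\<sigma> t x - \<sigma> s y\<bar> \<le> Lip * (\<bar>t - s\<bar> + \<bar>x - y\<bar>)"
    and Lip: "0 \<le> Lip" and r: "r \<in> {0..T / \<alpha>}"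
  shows "Lp_bound M p (\<lambda>\<omega>. \<sigma> r (X r \<omega>) - \<sigma> 0 x0) (Lip * T * (1 + velocity_const x0 y0) / sqrt \<alpha>)"
proof -
  have rT: "r \<in> {0..T}" using r divide_le_self[OF less_imp_le[OF T] \<alpha>1] by auto
  have T0: "0 \<in> {0..T}" using T by simp
  have "T / \<alpha> \<le> T / sqrt \<alpha>"
  proof -
    have "sqrt \<alpha> \<le> \<alpha>" using \<alpha>1 by (simp add: real_le_lsqrt power2_eq_square)
    then show ?thesis using T \<alpha> by (intro divide_left_mono) auto
  qed
  then have rle: "\<bar>r\<bar> \<le> T / sqrt \<alpha>" using r by auto
  have "Lp_bound M p (\<lambda>\<omega>. Lip * (r + \<bar>X r \<omega> - x0\<bar>)) (\<bar>Lip\<bar> * (T / sqrt \<alpha> + velocity_const x0 y0 * T / sqrt \<alpha>))"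
    by (intro Lp_bound_cmult Lp_bound_add Lp_bound_const Lp_bound_mono[OF displacement_bound[OF \<alpha>1 r]])
       (use p rle T \<alpha> in auto)
  then show ?thesis
  proof (rule Lp_bound_mono)
    show "AE \<omega> in M. \<bar>\<sigma> r (X r \<omega>) - \<sigma> 0 x0\<bar> \<le> \<bar>Lip * (r + \<bar>X r \<omega> - x0\<bar>)\<bar>"
    proof (rule AE_I2)
      fix \<omega>
      have "0 \<le> Lip * (r + \<bar>X r \<omega> - x0\<bar>)" using Lip r by simp
      then show "\<bar>\<sigma> r (X r \<omega>) - \<sigma> 0 x0\<bar> \<le> \<bar>Lip * (r + \<bar>X r \<omega> - x0\<bar>)\<bar>"
        using lip[OF rT T0, of "X r \<omega>" x0] r by simp
    qed
    show "\<bar>Lip\<bar> * (T / sqrt \<alpha> + velocity_const x0 y0 * T / sqrt \<alpha>) \<le> Lip * T * (1 + velocity_const x0 y0) / sqrt \<alpha>"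
      using Lip by (simp add: algebra_simps add_divide_distrib)
  qed (use p in auto)
qed

text \<open>On the fast time scale the damping speed is \<open>\<kappa> + \<gamma>\<close>, so
  relaxation yields no gain and is used with slope zero; the smallness lies in the forcing. Its
  increments span a physical time of at most \<open>T / \<alpha>\<close>: drift and mean field
  contribute order \<open>sqrt \<alpha> * (T / \<alpha>)\<close>, and the noise is small because its
  coefficient is.\<close>

lemma velocity_error:
  assumes \<alpha>1: "1 \<le> \<alpha>"
    and lip: "\<And>t s x y. t \<in> {0..T} \<Longrightarrow> s \<in> {0..T} \<Longrightarrow> \<bar>\<sigma> t x - \<sigma> s y\<bar> \<le> Lip * (\<bar>t - s\<bar> + \<bar>x - y\<bar>)"
    and Lip: "0 \<le> Lip"
    and Zc: "AE \<omega> in M. continuous_on {0..T} (\<lambda>t. Z t \<omega>)"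
    and Zeq: "AE \<omega> in M. \<forall>t\<in>{0..T}. Z t \<omega> = - (\<kappa> + \<gamma>) * (LINT s:{0..t}|lborel. Z s \<omega>) + \<sigma> 0 x0 * (sqrt \<alpha> * (W (t / \<alpha>) \<omega> - W 0 \<omega>))"
    and t: "t \<in> {0..T}"
  shows "Lp_bound M p (\<lambda>\<omega>. scaled_velocity \<alpha> Y t \<omega> - Z t \<omega>) (velocity_error_const Lip x0 y0 / sqrt \<alpha>)"
proof -
  define q where "q = sqrt \<alpha>"
  have q: "0 < q" "\<alpha> = q * q" using \<alpha> by (simp_all add: q_def)
  have scale: "s / \<alpha> \<in> {0..T}" if "s \<in> {0..T}" for s
    using divide_le_self[OF _ \<alpha>1, of s] that \<alpha> by auto
  have T0: "0 \<in> {0..T}" using T by simp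
  define E where "E s \<omega> = scaled_velocity \<alpha> Y s \<omega> - Z s \<omega>" for s \<omega>
  define P where "P s \<omega> = q * (N (s / \<alpha>) \<omega> - \<sigma> 0 x0 * (W (s / \<alpha>) \<omega> - W 0 \<omega>))" for s \<omega>
  have Yscale: "AE \<omega> in M. continuous_on {0..T} (\<lambda>s. Y (s / \<alpha>) \<omega>)"
    using Yc
  proof eventually_elim
    case (elim \<omega>)
    show ?case
      by (rule continuous_on_compose2[OF elim]) (use scale[of T] T \<alpha> in \<open>auto intro!: continuous_intros\<close>)
  qed
  define A where "A = (growth_const x0 y0 * T + \<gamma> * (mean_const x0 y0 * T) + sqrt (ito_const p * T) * (Lip * T * (1 + velocity_const x0 y0))) / q"
  have "Lp_bound M p (E t) (\<bar>y0\<bar> / q + A + 0 / (\<kappa> + \<gamma>))"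
  proof (rule Lp_bound_relaxation[where Z = E and N = P])
    show "0 \<le> t" "0 < \<kappa> + \<gamma>" "1 \<le> p" "0 \<le> (0::real)" using t \<kappa> \<gamma> p by auto
    show "P s \<in> borel_measurable M" if "s \<in> {0..t}" for s
    proof -
      have "s / \<alpha> \<in> {0..T}" using scale[of s] that t by auto
      then show ?thesis unfolding P_def[abs_def]
        using N_measurable[of "s / \<alpha>"] W_measurable[of "s / \<alpha>"] W_measurable[OF T0] by measurable
    qed
    show "AE \<omega> in M. continuous_on {0..t} (\<lambda>s. E s \<omega>)"
      using Yscale Zc
    proof eventually_elim
      case (elim \<omega>)
      have "continuous_on {0..T} (\<lambda>s. E s \<omega>)"
        unfolding E_def scaled_velocity_def by (intro continuous_intros elim)
      then show ?case by (rule continuous_on_subset) (use t in auto)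
    qed
    show "AE \<omega> in M. \<forall>s\<in>{0..t}. E s \<omega> = P s \<omega> - (\<kappa> + \<gamma>) * (LINT r:{0..s}|lborel. E r \<omega>)"
      using Xeq Zeq Yscale Zc
    proof eventually_elim
      case (elim \<omega>)
      show ?case
      proof
        fix s assume "s \<in> {0..t}"
        then have s: "s \<in> {0..T}" and sub: "{0..s} \<subseteq> {0..T}" using t by auto
        have i: "set_integrable lborel {0..s} (\<lambda>r. 1 / sqrt \<alpha> * Y (r / \<alpha>) \<omega>)" "set_integrable lborel {0..s} (\<lambda>r. Z r \<omega>)"
          by (intro borel_integrable_atLeastAtMost' continuous_intros continuous_on_subset[OF elim(3) sub] continuous_on_subset[OF elim(4) sub])+
        define IY where "IY = (LINT r:{0..s / \<alpha>}|lborel. Y r \<omega>)"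
        define IZ where "IZ = (LINT r:{0..s}|lborel. Z r \<omega>)"
        have "(LINT r:{0..s}|lborel. E r \<omega>) = (LINT r:{0..s}|lborel. 1 / sqrt \<alpha> * Y (r / \<alpha>) \<omega>) - IZ"
          unfolding E_def scaled_velocity_def IZ_def by (rule set_integral_diff(2)[OF i])
        also have "(LINT r:{0..s}|lborel. 1 / sqrt \<alpha> * Y (r / \<alpha>) \<omega>) = 1 / sqrt \<alpha> * (\<alpha> * IY)"
          unfolding IY_def set_integral_rescale[OF \<alpha>, symmetric] by (rule set_integral_mult_right)
        also have "\<dots> = q * IY" unfolding q_def[symmetric] using q by simp
        finally have IE: "(LINT r:{0..s}|lborel. E r \<omega>) = q * IY - IZ" .
        have N: "N (s / \<alpha>) \<omega> = Y (s / \<alpha>) \<omega> / \<alpha> + (\<kappa> + \<gamma>) * IY"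
          using bspec[OF elim(1) scale[OF s]] by (simp add: N_def IY_def)
        have Z: "Z s \<omega> = - (\<kappa> + \<gamma>) * IZ + \<sigma> 0 x0 * (q * (W (s / \<alpha>) \<omega> - W 0 \<omega>))"
          using bspec[OF elim(2) s] by (simp add: IZ_def q_def)
        have "q * (Y (s / \<alpha>) \<omega> / \<alpha>) = 1 / q * Y (s / \<alpha>) \<omega>" using q by simp
        then show "E s \<omega> = P s \<omega> - (\<kappa> + \<gamma>) * (LINT r:{0..s}|lborel. E r \<omega>)"
          unfolding IE unfolding P_def N E_def scaled_velocity_def Z q_def[symmetric] by (simp add: algebra_simps)
      qed
    qed
    show "Lp_bound M p (\<lambda>\<omega>. P t \<omega> - P s \<omega>) (A + 0 * (t - s))" if s: "s \<in> {0..t}" for s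
    proof -
      define G where "G = growth_const x0 y0"
      define m1 where "m1 = mean_const x0 y0"
      define H where "H = Lip * T * (1 + velocity_const x0 y0) / q"
      have nn: "0 \<le> G" "0 \<le> m1" "0 \<le> H"
        unfolding G_def m1_def H_def using const_nonneg Lip T q by auto
      define s' where "s' = s / \<alpha>"
      define t' where "t' = t / \<alpha>"
      have st: "0 \<le> s'" "s' \<le> t'" "t' \<le> T"
        using s t scale[OF t] \<alpha> by (auto simp: s'_def t'_def divide_right_mono)
      have tT: "t' \<le> T / \<alpha>" using t \<alpha> by (simp add: t'_def divide_right_mono)
      then have dT: "t' - s' \<le> T / \<alpha>" using st by simp
      have drift: "Lp_bound M p (\<lambda>\<omega>. LINT r:{s'..t'}|lborel. g r (X r \<omega>)) (G * (T / \<alpha>))"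
      proof (rule Lp_bound_weaken[OF Lp_bound_drift[OF Xm Xc gi continuous_on_const position_uniform_bound[OF \<alpha>1] st]])
        have "(LINT r:{s'..t'}|lborel. K * (1 + position_const x0 y0)) = G * (t' - s')"
          using st by (simp add: set_integral_const G_def growth_const_def)
        then show "(LINT r:{s'..t'}|lborel. K * (1 + position_const x0 y0)) \<le> G * (T / \<alpha>)"
          using dT nn by (simp only: mult_left_mono)
      qed (use p in auto)
      have mean: "Lp_bound M p (\<lambda>\<omega>. LINT r:{s'..t'}|lborel. m r) (m1 * (T / \<alpha>))"
      proof (rule Lp_bound_const)
        have "\<bar>LINT r:{s'..t'}|lborel. m r\<bar> \<le> m1 * (t' - s')"
          using integral_bounded[OF m_integrable m_uniform_bound[OF \<alpha>1] st] by (simp add: m1_def)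
        also have "\<dots> \<le> m1 * (T / \<alpha>)" using dT nn by (intro mult_left_mono)
        finally show "AE \<omega> in M. \<bar>LINT r:{s'..t'}|lborel. m r\<bar> \<le> m1 * (T / \<alpha>)" by simp
        show "0 \<le> m1 * (T / \<alpha>)" using nn T \<alpha> by simp
      qed
      \<comment> \<open>The factor \<open>1 / q\<close> from the square root of the short time
        interval will cancel the prefactor \<open>q\<close> of \<open>P\<close>; the rate is
        supplied by the coefficient bound \<open>H\<close>.\<close>
      have noise: "Lp_bound M p (\<lambda>\<omega>. (J t' \<omega> - \<sigma> 0 x0 * (W t' \<omega> - W 0 \<omega>)) - (J s' \<omega> - \<sigma> 0 x0 * (W s' \<omega> - W 0 \<omega>))) (sqrt (ito_const p * T) * H / q)"
      proof (rule Lp_bound_weaken[OF Lp_bound_ito[OF ito_limit_diff[OF J ito_limit_const] st p continuous_on_const]])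
        show "Lp_bound M p (\<lambda>\<omega>. \<sigma> r (X r \<omega>) - \<sigma> 0 x0) H" if "r \<in> {s'..t'}" for r
          unfolding H_def q_def by (rule diffusion_freezing_bound[OF \<alpha>1 lip Lip]) (use that st tT in auto)
        have "ito_const p * (LINT r:{s'..t'}|lborel. H\<^sup>2) = ito_const p * (H\<^sup>2 * (t' - s'))"
          using st by (simp add: set_integral_const)
        also have "\<dots> \<le> ito_const p * (H\<^sup>2 * (T / \<alpha>))"
          using dT ito_const_nonneg by (intro mult_left_mono) auto
        finally have "sqrt (ito_const p * (LINT r:{s'..t'}|lborel. H\<^sup>2)) \<le> sqrt (ito_const p * (H\<^sup>2 * (T / \<alpha>)))"
          by (rule real_sqrt_le_mono)
        also have "ito_const p * (H\<^sup>2 * (T / \<alpha>)) = (ito_const p * T) * (H / q)\<^sup>2"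
          unfolding q(2) by (simp add: power2_eq_square)
        also have "sqrt ((ito_const p * T) * (H / q)\<^sup>2) = sqrt (ito_const p * T) * H / q"
          using nn q by (simp only: real_sqrt_mult real_sqrt_abs) simp
        finally show "sqrt (ito_const p * (LINT r:{s'..t'}|lborel. H\<^sup>2)) \<le> sqrt (ito_const p * T) * H / q" .
      qed (use p in auto)
      have "Lp_bound M p (\<lambda>\<omega>. q * (((- 1) * (LINT r:{s'..t'}|lborel. g r (X r \<omega>)) + \<gamma> * (LINT r:{s'..t'}|lborel. m r))
          + ((J t' \<omega> - \<sigma> 0 x0 * (W t' \<omega> - W 0 \<omega>)) - (J s' \<omega> - \<sigma> 0 x0 * (W s' \<omega> - W 0 \<omega>)))))
        (\<bar>q\<bar> * ((\<bar>- 1\<bar> * (G * (T / \<alpha>)) + \<bar>\<gamma>\<bar> * (m1 * (T / \<alpha>))) + sqrt (ito_const p * T) * H / q))"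
        by (intro Lp_bound_cmult Lp_bound_add drift mean noise) (use p in auto)
      then show ?thesis
      proof (rule Lp_bound_mono)
        show "AE \<omega> in M. \<bar>P t \<omega> - P s \<omega>\<bar> \<le> \<bar>q * (((- 1) * (LINT r:{s'..t'}|lborel. g r (X r \<omega>)) + \<gamma> * (LINT r:{s'..t'}|lborel. m r))
          + ((J t' \<omega> - \<sigma> 0 x0 * (W t' \<omega> - W 0 \<omega>)) - (J s' \<omega> - \<sigma> 0 x0 * (W s' \<omega> - W 0 \<omega>))))\<bar>"
          using N_increment[OF st]
        proof eventually_elim
          case (elim \<omega>)
          have "P t \<omega> - P s \<omega> = q * ((N t' \<omega> - N s' \<omega>) - \<sigma> 0 x0 * (W t' \<omega> - W s' \<omega>))"
            by (simp add: P_def s'_def t'_def algebra_simps)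
          then show ?case unfolding elim by (simp add: algebra_simps)
        qed
        have "q * (G * (T / \<alpha>)) = G * T / q" "q * (\<gamma> * (m1 * (T / \<alpha>))) = \<gamma> * (m1 * T) / q"
          unfolding q(2) using q(1) by simp_all
        moreover have "q * (sqrt (ito_const p * T) * H / q) = sqrt (ito_const p * T) * (Lip * T * (1 + velocity_const x0 y0)) / q"
          using q(1) by (simp add: H_def)
        moreover have "\<bar>q\<bar> * ((\<bar>- 1\<bar> * (G * (T / \<alpha>)) + \<bar>\<gamma>\<bar> * (m1 * (T / \<alpha>))) + sqrt (ito_const p * T) * H / q)
          = q * (G * (T / \<alpha>)) + q * (\<gamma> * (m1 * (T / \<alpha>))) + q * (sqrt (ito_const p * T) * H / q)"
          using q(1) \<gamma> by (simp only: distrib_left abs_of_pos abs_minus_cancel abs_one mult_1)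
        ultimately show "\<bar>q\<bar> * ((\<bar>- 1\<bar> * (G * (T / \<alpha>)) + \<bar>\<gamma>\<bar> * (m1 * (T / \<alpha>))) + sqrt (ito_const p * T) * H / q) \<le> A + 0 * (t - s)"
          by (simp add: A_def G_def m1_def add_divide_distrib)
      qed (use p in auto)
    qed
    \<comment> \<open>The two processes start at \<open>y0 / sqrt \<alpha>\<close> and at
      zero.\<close>
    show "Lp_bound M p (P 0) (\<bar>y0\<bar> / q)"
    proof (rule Lp_bound_const)
      show "AE \<omega> in M. \<bar>P 0 \<omega>\<bar> \<le> \<bar>y0\<bar> / q"
        using N_zero
      proof eventually_elim
        case (elim \<omega>)
        have "P 0 \<omega> = y0 / q" using elim q by (simp add: P_def)
        then show ?case using q by simp
      qed
    qed (use q in auto)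
  qed
  then show ?thesis
    by (simp add: E_def[abs_def] A_def velocity_error_const_def q_def add_divide_distrib)
qed

end

text \<open>The limit velocity is adapted to the filtration of the scaled noise, the mean-field
  system to that of \<open>W\<close>. As the diffusion coefficient is constant, the integral is a
  multiple of an increment of the noise, and in this explicit form the two processes can be compared
  path by path.\<close>

lemma velocity_limit_solutionD:
  assumes "prob_space M" and T: "0 < T" and \<alpha>: "1 \<le> \<alpha>" and bm: "brownian_motion M T W"
    and sol: "velocity_limit_solution M T (scaled_noise \<alpha> W) \<kappa> \<gamma> \<sigma> x0 Z"
  shows "AE \<omega> in M. continuous_on {0..T} (\<lambda>t. Z t \<omega>)"
    and "AE \<omega> in M. \<forall>t\<in>{0..T}. Z t \<omega> = - (\<kappa> + \<gamma>) * (LINT s:{0..t}|lborel. Z s \<omega>) + \<sigma> 0 x0 * (sqrt \<alpha> * (W (t / \<alpha>) \<omega> - W 0 \<omega>))"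
    and "\<And>t. t \<in> {0..T} \<Longrightarrow> Z t \<in> borel_measurable M"
proof -
  have bm': "brownian_motion M T (scaled_noise \<alpha> W)"
    by (rule brownian_motion_scaled_noise[OF assms(1) T \<alpha> bm])
  interpret V: bm_filtration M "augmented_filtration M (scaled_noise \<alpha> W)" T "scaled_noise \<alpha> W"
    by (rule bm_filtration_augmented[OF assms(1) T bm'])
  obtain J where J: "V.ito_limit (\<lambda>t \<omega>. \<sigma> 0 x0) J" "AE \<omega> in M. continuous_on {0..T} (\<lambda>t. J t \<omega>)"
    "AE \<omega> in M. set_integrable lborel {0..T} (\<lambda>s. - (\<kappa> + \<gamma>) * Z s \<omega>)"
    "AE \<omega> in M. \<forall>t\<in>{0..T}. Z t \<omega> = 0 + (LINT s:{0..t}|lborel. - (\<kappa> + \<gamma>) * Z s \<omega>) + J t \<omega>"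
    "\<And>t. t \<in> {0..T} \<Longrightarrow> Z t \<in> borel_measurable (augmented_filtration M (scaled_noise \<alpha> W) t)"
    "AE \<omega> in M. continuous_on {0..T} (\<lambda>t. Z t \<omega>)"
    "(\<lambda>x. - (\<kappa> + \<gamma>) * Z (fst x) (snd x)) \<in> borel_measurable (restrict_space lborel {0..T} \<Otimes>\<^sub>M M)"
    by (rule V.ito_processE[OF sol[unfolded velocity_limit_solution_def]], rule that)
  show "AE \<omega> in M. continuous_on {0..T} (\<lambda>t. Z t \<omega>)" by (rule J(6))
  show "\<And>t. t \<in> {0..T} \<Longrightarrow> Z t \<in> borel_measurable M" by (rule V.F_measurable_M[OF J(5)])
  have "AE \<omega> in M. continuous_on {0..T} (\<lambda>t. scaled_noise \<alpha> W t \<omega>)" using bm' by (simp add: brownian_motion_def)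
  then have "AE \<omega> in M. continuous_on {0..T} (\<lambda>t. \<sigma> 0 x0 * (scaled_noise \<alpha> W t \<omega> - scaled_noise \<alpha> W 0 \<omega>))"
    by eventually_elim (intro continuous_intros)
  from V.ito_limit_unique[OF J(1) V.ito_limit_const J(2) this] J(4)
  show "AE \<omega> in M. \<forall>t\<in>{0..T}. Z t \<omega> = - (\<kappa> + \<gamma>) * (LINT s:{0..t}|lborel. Z s \<omega>) + \<sigma> 0 x0 * (sqrt \<alpha> * (W (t / \<alpha>) \<omega> - W 0 \<omega>))"
  proof eventually_elim
    case (elim \<omega>)
    have "(LINT s:{0..t}|lborel. - (\<kappa> + \<gamma>) * Z s \<omega>) = - (\<kappa> + \<gamma>) * (LINT s:{0..t}|lborel. Z s \<omega>)" for t
      by (rule set_integral_mult_right)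
    then show ?case using elim by (simp add: scaled_noise_def right_diff_distrib)
  qed
qed

lemma powr_over_sqrt:
  fixes c \<alpha> p :: real
  assumes "0 \<le> c" "0 < \<alpha>"
  shows "(c / sqrt \<alpha>) powr p = c powr p / \<alpha> powr (p / 2)"
  using assms by (simp add: powr_divide powr_half_sqrt[symmetric] powr_powr)

theorem corollary1p1:
  fixes M :: "'a measure"
    and T \<kappa> \<gamma> x0 y0 p L :: real
    and g \<sigma> :: "real \<Rightarrow> real \<Rightarrow> real"
    and W X :: "real \<Rightarrow> 'a \<Rightarrow> real"
    and X\<alpha> Y\<alpha> Ytilde :: "real \<Rightarrow> real \<Rightarrow> 'a \<Rightarrow> real"
  assumes "prob_space M" and "complete_measure M"
    and "T > 0" and "\<kappa> > 0" and "\<gamma> > 0"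
    and "brownian_motion M T W"
    and "\<And>\<alpha>. \<alpha> > 0 \<Longrightarrow> mean_field_solution M T W \<kappa> \<gamma> g \<sigma> x0 y0 \<alpha> (X\<alpha> \<alpha>) (Y\<alpha> \<alpha>)"
    and "limit_solution M T W \<kappa> \<gamma> g \<sigma> x0 X"
    and "\<And>\<alpha>. \<alpha> \<ge> 1 \<Longrightarrow>
           velocity_limit_solution M T (scaled_noise \<alpha> W) \<kappa> \<gamma> \<sigma> x0 (Ytilde \<alpha>)"
    and "p \<ge> 2"
    and "linear_growth T g \<sigma>"
    and "L > 0" and "lipschitz_in_space T L g \<sigma>"
  shows
    "((\<exists>B>0. bounded_space_derivatives T B g \<and> bounded_space_derivatives T B \<sigma>) \<longrightarrow>
       (\<exists>C::real. \<forall>\<alpha>\<ge>1.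
          (SUP t\<in>{0..T}. ennreal_powr (wasserstein p (law M (X\<alpha> \<alpha> t)) (law M (X t))) p)
            \<le> ennreal (C / \<alpha> powr (p / 2)))) \<and>
     (lipschitz_in_time_space T L \<sigma> \<longrightarrow>
       (\<exists>C::real. \<forall>\<alpha>\<ge>1.
          (SUP t\<in>{0..T}. ennreal_powr
             (wasserstein p (law M (scaled_velocity \<alpha> (Y\<alpha> \<alpha>) t)) (law M (Ytilde \<alpha> t))) p)
            \<le> ennreal (C / \<alpha> powr (p / 2))))"
proof -
  obtain K where K: "0 < K" "\<And>t x. t \<in> {0..T} \<Longrightarrow> \<bar>g t x\<bar> + \<bar>\<sigma> t x\<bar> \<le> K * (1 + \<bar>x\<bar>)"
    using assms(11) unfolding linear_growth_def by blast
  \<comment> \<open>Interpreted before \<alpha> is fixed, so the constants with the prefix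
    \<open>S\<close> do not depend on it.\<close>
  interpret S: langevin M "augmented_filtration M W" T W \<kappa> \<gamma> K p g \<sigma>
    by (intro langevin.intro langevin_axioms.intro bm_filtration_augmented assms(1,3-6,10) K less_imp_le[OF K(1)])
  have mf: "S.mean_field x0 y0 \<alpha> (X\<alpha> \<alpha>) (Y\<alpha> \<alpha>)" if "0 < \<alpha>" for \<alpha>
    using assms(7)[OF that] unfolding mean_field_solution_def S.mean_field_def .
  have lim: "S.limit_equation x0 X"
    using assms(8) unfolding limit_solution_def S.limit_equation_def .
  have p1: "1 \<le> p" using assms(10) by simp
  have lip: "\<And>t x y. t \<in> {0..T} \<Longrightarrow> \<bar>g t x - g t y\<bar> + \<bar>\<sigma> t x - \<sigma> t y\<bar> \<le> L * \<bar>x - y\<bar>"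
    using assms(13) unfolding lipschitz_in_space_def by blast
  have Xm: "X t \<in> borel_measurable M" if "t \<in> {0..T}" for t
    by (rule S.limit_equationE[OF lim]) (use S.F_measurable_M that in blast)
  have position: "ennreal_powr (wasserstein p (law M (X\<alpha> \<alpha> t)) (law M (X t))) p
      \<le> ennreal (S.position_error_const L x0 y0 powr p / \<alpha> powr (p / 2))" if \<alpha>: "1 \<le> \<alpha>" and t: "t \<in> {0..T}" for \<alpha> t
  proof -
    have \<alpha>0: "0 < \<alpha>" using \<alpha> by simp
    obtain J g' where "mean_field_process M (augmented_filtration M W) T W \<kappa> \<gamma> K p g \<sigma> x0 y0 \<alpha> (X\<alpha> \<alpha>) (Y\<alpha> \<alpha>) J g'"
      by (rule S.mean_field_processI[OF mf[OF \<alpha>0] \<alpha>0])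
    then interpret P: mean_field_process M "augmented_filtration M W" T W \<kappa> \<gamma> K p g \<sigma> x0 y0 \<alpha> "X\<alpha> \<alpha>" "Y\<alpha> \<alpha>" J g' .
    note b = P.position_error[OF \<alpha> lim lip t]
    have "0 \<le> S.position_error_const L x0 y0"
      using Lp_bound_nonneg[OF b] \<alpha>0 by (simp add: zero_le_divide_iff)
    then show ?thesis
      using S.wasserstein_le_Lp_bound[OF P.Xm[OF t] Xm[OF t] b p1] \<alpha>0 by (simp add: powr_over_sqrt)
  qed
  have velocity: "ennreal_powr (wasserstein p (law M (scaled_velocity \<alpha> (Y\<alpha> \<alpha>) t)) (law M (Ytilde \<alpha> t))) p
      \<le> ennreal (S.velocity_error_const L x0 y0 powr p / \<alpha> powr (p / 2))"
    if lts: "lipschitz_in_time_space T L \<sigma>" and \<alpha>: "1 \<le> \<alpha>" and t: "t \<in> {0..T}" for \<alpha> t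
  proof -
    have \<alpha>0: "0 < \<alpha>" using \<alpha> by simp
    obtain J g' where "mean_field_process M (augmented_filtration M W) T W \<kappa> \<gamma> K p g \<sigma> x0 y0 \<alpha> (X\<alpha> \<alpha>) (Y\<alpha> \<alpha>) J g'"
      by (rule S.mean_field_processI[OF mf[OF \<alpha>0] \<alpha>0])
    then interpret P: mean_field_process M "augmented_filtration M W" T W \<kappa> \<gamma> K p g \<sigma> x0 y0 \<alpha> "X\<alpha> \<alpha>" "Y\<alpha> \<alpha>" J g' .
    have lip': "\<And>t s x y. t \<in> {0..T} \<Longrightarrow> s \<in> {0..T} \<Longrightarrow> \<bar>\<sigma> t x - \<sigma> s y\<bar> \<le> L * (\<bar>t - s\<bar> + \<bar>x - y\<bar>)"
      using lts unfolding lipschitz_in_time_space_def by blast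
    note Z = velocity_limit_solutionD[OF assms(1,3) \<alpha> assms(6) assms(9)[OF \<alpha>]]
    note b = P.velocity_error[OF \<alpha> lip' less_imp_le[OF assms(12)] Z(1,2) t]
    have "t / \<alpha> \<in> {0..T}" using divide_le_self[OF _ \<alpha>, of t] t \<alpha>0 by auto
    then have "scaled_velocity \<alpha> (Y\<alpha> \<alpha>) t \<in> borel_measurable M"
      unfolding scaled_velocity_def[abs_def] using P.Ym by measurable
    note w = S.wasserstein_le_Lp_bound[OF this Z(3)[OF t] b p1]
    have "0 \<le> S.velocity_error_const L x0 y0"
      using Lp_bound_nonneg[OF b] \<alpha>0 by (simp add: zero_le_divide_iff)
    then show ?thesis using w \<alpha>0 by (simp add: powr_over_sqrt)
  qed
  \<comment> \<open>The witnesses for \<open>C\<close> are the p-th powers of the two error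
    constants.\<close>
  show ?thesis
    using position velocity by (intro conjI impI exI allI SUP_least)
qed

end
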